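(* Let $G = KL$ be a finite solvable Frobenius group which is a $\mathbf{GC}^*$-group, with Frobenius kernel $K = G_\infty$ and complement $L$. Then either $K$ is an elementary abelian $q$-group for some prime $q$, or $K$ is a Suzuki $2$-group with $|K| = |K'|^2$, $L$ is cyclic and $|L| = |K'|-1$.
   Context: $G_\infty$ denotes the nilpotent residual of $G$, i.e. the last term of the lower central series of $G$. A non-abelian $2$-group $K$ is a Suzuki $2$-group if $K$ has more than one involution and there exists a solvable group of automorphisms of $K$ acting transitively on the set of involutions of $K$. Galois automorphisms act on characters by $\chi^\alpha(g)=\chi(g)^\alpha$; two irreducible characters of $G$ are Galois conjugate if one is the image of the other under some element of $\mathrm{Gal}(\mathbb{Q}_n|\mathbb{Q})$ with $|G|$ dividing $n$. A finite group is a $\mathbf{GC}^*$-group if any two of its non-linear irreducible characters of the same degree are Galois conjugate. *)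

theory Defs
  imports "HOL-Algebra.Algebra" "Jordan_Normal_Form.Matrix"
begin

fun lower_central :: "('a, 'b) monoid_scheme \<Rightarrow> nat \<Rightarrow> 'a set" where
  "lower_central G 0 = carrier G"
| "lower_central G (Suc i) = generate G
     {x \<otimes>\<^bsub>G\<^esub> y \<otimes>\<^bsub>G\<^esub> inv\<^bsub>G\<^esub> x \<otimes>\<^bsub>G\<^esub> inv\<^bsub>G\<^esub> y | x y. x \<in> lower_central G i \<and> y \<in> carrier G}"

text \<open>G_infinity: the last term of the lower central series (the intersection of all terms;
  for finite groups the series stabilises at this term).\<close>
definition nilpotent_residual :: "('a, 'b) monoid_scheme \<Rightarrow> 'a set" where
  "nilpotent_residual G = (\<Inter>i. lower_central G i)"

definition conjugate_set :: "('a, 'b) monoid_scheme \<Rightarrow> 'a \<Rightarrow> 'a set \<Rightarrow> 'a set" where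
  "conjugate_set G g H = {g \<otimes>\<^bsub>G\<^esub> h \<otimes>\<^bsub>G\<^esub> inv\<^bsub>G\<^esub> g | h. h \<in> H}"

definition frobenius_complement :: "('a, 'b) monoid_scheme \<Rightarrow> 'a set \<Rightarrow> bool" where
  "frobenius_complement G L \<longleftrightarrow>
     subgroup L G \<and> L \<noteq> {\<one>\<^bsub>G\<^esub>} \<and> L \<noteq> carrier G \<and>
     (\<forall>g \<in> carrier G - L. L \<inter> conjugate_set G g L = {\<one>\<^bsub>G\<^esub>})"

definition frobenius_kernel :: "('a, 'b) monoid_scheme \<Rightarrow> 'a set \<Rightarrow> 'a set" where
  "frobenius_kernel G L =
     (carrier G - (\<Union>g \<in> carrier G. conjugate_set G g L)) \<union> {\<one>\<^bsub>G\<^esub>}"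

definition elementary_abelian :: "('a, 'b) monoid_scheme \<Rightarrow> nat \<Rightarrow> bool" where
  "elementary_abelian H q \<longleftrightarrow> Factorial_Ring.prime q \<and> comm_group H \<and> finite (carrier H) \<and>
     (\<exists>k. card (carrier H) = q ^ k) \<and> (\<forall>x \<in> carrier H. x [^]\<^bsub>H\<^esub> q = \<one>\<^bsub>H\<^esub>)"

definition involutions :: "('a, 'b) monoid_scheme \<Rightarrow> 'a set" where
  "involutions H = {x \<in> carrier H. x \<noteq> \<one>\<^bsub>H\<^esub> \<and> x \<otimes>\<^bsub>H\<^esub> x = \<one>\<^bsub>H\<^esub>}"

definition suzuki_2_group :: "('a, 'b) monoid_scheme \<Rightarrow> bool" where
  "suzuki_2_group H \<longleftrightarrow> group H \<and> finite (carrier H) \<and> (\<exists>k. card (carrier H) = 2 ^ k) \<and>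
     \<not> comm_group H \<and> card (involutions H) > 1 \<and>
     (\<exists>A. subgroup A (AutoGroup H) \<and> solvable ((AutoGroup H)\<lparr>carrier := A\<rparr>) \<and>
          (\<forall>x \<in> involutions H. \<forall>y \<in> involutions H. \<exists>a \<in> A. a x = y))"

definition mat_trace :: "complex mat \<Rightarrow> complex" where
  "mat_trace A = (\<Sum>i<dim_row A. A $$ (i, i))"

definition representation :: "('a, 'b) monoid_scheme \<Rightarrow> nat \<Rightarrow> ('a \<Rightarrow> complex mat) \<Rightarrow> bool" where
  "representation G n \<rho> \<longleftrightarrow>
     (\<forall>g \<in> carrier G. \<rho> g \<in> carrier_mat n n) \<and> \<rho> \<one>\<^bsub>G\<^esub> = 1\<^sub>m n \<and>
     (\<forall>g \<in> carrier G. \<forall>h \<in> carrier G. \<rho> (g \<otimes>\<^bsub>G\<^esub> h) = \<rho> g * \<rho> h)"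

definition invariant_subspace :: "('a, 'b) monoid_scheme \<Rightarrow> nat \<Rightarrow> ('a \<Rightarrow> complex mat) \<Rightarrow> complex vec set \<Rightarrow> bool" where
  "invariant_subspace G n \<rho> W \<longleftrightarrow>
     W \<subseteq> carrier_vec n \<and> 0\<^sub>v n \<in> W \<and>
     (\<forall>v \<in> W. \<forall>w \<in> W. v + w \<in> W) \<and> (\<forall>c. \<forall>v \<in> W. c \<cdot>\<^sub>v v \<in> W) \<and>
     (\<forall>g \<in> carrier G. \<forall>v \<in> W. \<rho> g *\<^sub>v v \<in> W)"

definition irreducible_representation :: "('a, 'b) monoid_scheme \<Rightarrow> nat \<Rightarrow> ('a \<Rightarrow> complex mat) \<Rightarrow> bool" where
  "irreducible_representation G n \<rho> \<longleftrightarrow> n > 0 \<and> representation G n \<rho> \<and>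
     (\<forall>W. invariant_subspace G n \<rho> W \<longrightarrow> W = {0\<^sub>v n} \<or> W = carrier_vec n)"

definition irr_char :: "('a, 'b) monoid_scheme \<Rightarrow> ('a \<Rightarrow> complex) \<Rightarrow> bool" where
  "irr_char G \<chi> \<longleftrightarrow> (\<exists>n \<rho>. irreducible_representation G n \<rho> \<and>
     (\<forall>g. \<chi> g = (if g \<in> carrier G then mat_trace (\<rho> g) else 0)))"

definition subfield_complex :: "complex set \<Rightarrow> bool" where
  "subfield_complex F \<longleftrightarrow> 0 \<in> F \<and> 1 \<in> F \<and>
     (\<forall>x \<in> F. \<forall>y \<in> F. x + y \<in> F \<and> x - y \<in> F \<and> x * y \<in> F) \<and>
     (\<forall>x \<in> F. inverse x \<in> F)"

definition cyclotomic_field :: "nat \<Rightarrow> complex set" where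
  "cyclotomic_field n = \<Inter>{F. subfield_complex F \<and> cis (2 * pi / real n) \<in> F}"

text \<open>Elements of Gal(Q_n | Q): field automorphisms of Q_n (they automatically fix Q).\<close>
definition galois_aut :: "nat \<Rightarrow> (complex \<Rightarrow> complex) \<Rightarrow> bool" where
  "galois_aut n \<alpha> \<longleftrightarrow> bij_betw \<alpha> (cyclotomic_field n) (cyclotomic_field n) \<and>
     (\<forall>x \<in> cyclotomic_field n. \<forall>y \<in> cyclotomic_field n.
        \<alpha> (x + y) = \<alpha> x + \<alpha> y \<and> \<alpha> (x * y) = \<alpha> x * \<alpha> y)"

definition galois_conjugate :: "('a, 'b) monoid_scheme \<Rightarrow> ('a \<Rightarrow> complex) \<Rightarrow> ('a \<Rightarrow> complex) \<Rightarrow> bool" where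
  "galois_conjugate G \<chi> \<psi> \<longleftrightarrow> (\<exists>n \<alpha>. n > 0 \<and> card (carrier G) dvd n \<and> galois_aut n \<alpha> \<and>
     (\<forall>g \<in> carrier G. \<psi> g = \<alpha> (\<chi> g)))"

definition GC_star :: "('a, 'b) monoid_scheme \<Rightarrow> bool" where
  "GC_star G \<longleftrightarrow> (\<forall>\<chi> \<psi>. irr_char G \<chi> \<and> irr_char G \<psi> \<and> \<chi> \<one>\<^bsub>G\<^esub> \<noteq> 1 \<and>
      \<chi> \<one>\<^bsub>G\<^esub> = \<psi> \<one>\<^bsub>G\<^esub> \<longrightarrow> galois_conjugate G \<chi> \<psi>)"

end

theory Submission
  imports Defs "Jordan_Normal_Form.Determinant" "HOL-Number_Theory.Totient"
begin

text \<open>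
  All characters that occur are induced from linear characters \<open>\<psi>\<close> of explicit subgroups \<open>A\<close>, with
  irreducibility supplied by Mackey's criterion. If two such pairs have subgroups of the same order, the
  \<open>GC\<^sup>*\<close> condition makes the induced characters Galois conjugate, hence equal after replacing one linear
  character by a power of itself.

  Applied to \<open>K/K'\<close> this shows that \<open>K/K'\<close> is elementary abelian of exponent a prime \<open>q\<close>, and an averaging
  argument then makes \<open>K\<close> a \<open>q\<close>-group. Suppose \<open>K' \<noteq> 1\<close> and write \<open>K\<^sub>3 = [K', K]\<close>, \<open>K\<^sub>4 = [K\<^sub>3, K]\<close>. For a nontrivial
  linear character of \<open>K'/K\<^sub>3\<close>, counting its extensions to its radical in \<open>K\<close> against the available Galois
  conjugates bounds the radical, and the commutator pairing \<open>K/K' \<times> K/K' \<rightarrow> K'/K\<^sub>3\<close> has \<open>|K'/K\<^sub>3| = |K/K'|\<close>.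
  For odd \<open>q\<close> the \<open>q\<close>-th power map is a homomorphism \<open>K/K' \<rightarrow> K'/K\<^sub>3\<close> avoiding all images of the pairing, which a
  counting argument modulo \<open>q\<close> in the style of Chevalley and Warning excludes. So \<open>q = 2\<close> and \<open>L\<close> acts
  regularly on the nontrivial elements of both factors. If \<open>K\<^sub>3 \<noteq> 1\<close>, the pairing \<open>K/K' \<times> K'/K\<^sub>3 \<rightarrow> K\<^sub>3/K\<^sub>4\<close> and
  the squaring maps lead to the same contradiction. Hence \<open>K\<close> has class 2, its involutions are the nontrivial
  elements of \<open>K'\<close>, and \<open>L\<close> permutes them transitively. Finally \<open>L\<close> is nilpotent because \<open>K\<close> is the nilpotent
  residual, it has odd order, and it acts without fixed points, so it is cyclic.
\<close>

subsection \<open>Linear characters of abelian sections\<close>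

text \<open>One count serves twice. The extensions of a character \<nu> to its radical R all extend
  further to one common isotropic subgroup, so their induced characters have equal degree, and there
  are at most totient(e) of them if e bounds their orders. With e = q^2 this gives |R : K'| \<le> q.
  If \<nu> were trivial on x^q for some x in R outside K', then e = q would do and the index would
  drop to q - 1. So the bound on the radical also explains why q-th powers avoid commutators. The
  q-th power map is multiplicative modulo K_3 up to commutators raised to q(q-1)/2. These vanish for
  odd q but not for q = 2, so the first contradiction spares 2-groups, and for q = 2 the squaring
  map is exploited one step lower, from K'/K_3 to K_3/K_4. There the obstacle is that a character of
  K_3 extends to K' in a way that need not be K-invariant: the isotropic subgroups may differ in
  order, and GC* compares equal degrees only. The extensions are therefore sorted by the order of
  the isotropic subgroup and each class is bounded separately.\<close>

definition gcomm :: "('a, 'b) monoid_scheme \<Rightarrow> 'a \<Rightarrow> 'a \<Rightarrow> 'a" where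
  "gcomm G x y = x \<otimes>\<^bsub>G\<^esub> y \<otimes>\<^bsub>G\<^esub> inv\<^bsub>G\<^esub> x \<otimes>\<^bsub>G\<^esub> inv\<^bsub>G\<^esub> y"

definition gconj :: "('a, 'b) monoid_scheme \<Rightarrow> 'a \<Rightarrow> 'a \<Rightarrow> 'a" where
  "gconj G g x = g \<otimes>\<^bsub>G\<^esub> x \<otimes>\<^bsub>G\<^esub> inv\<^bsub>G\<^esub> g"

text \<open>Linear characters of the section \<open>N/D\<close>, extended by \<open>0\<close> outside \<open>N\<close>: with this convention
  the matrix entries and the trace of an induced representation need no case distinction.\<close>
definition lin :: "('a, 'b) monoid_scheme \<Rightarrow> 'a set \<Rightarrow> 'a set \<Rightarrow> ('a \<Rightarrow> complex) set" where
  "lin G N D = {\<psi>. (\<forall>x. x \<notin> N \<longrightarrow> \<psi> x = 0) \<and> (\<forall>x\<in>N. \<psi> x \<noteq> 0) \<and>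
     (\<forall>x\<in>N. \<forall>y\<in>N. \<psi> (x \<otimes>\<^bsub>G\<^esub> y) = \<psi> x * \<psi> y) \<and> (\<forall>d\<in>D. \<psi> d = 1)}"

definition abelian_section :: "('a, 'b) monoid_scheme \<Rightarrow> 'a set \<Rightarrow> 'a set \<Rightarrow> bool" where
  "abelian_section G N D \<longleftrightarrow> subgroup N G \<and> subgroup D G \<and> D \<subseteq> N \<and>
     (\<forall>x\<in>N. \<forall>y\<in>N. gcomm G x y \<in> D)"

context group
begin

section \<open>Identities for commutators and conjugates\<close>

lemma inv_cancel_left: "x \<in> carrier G \<Longrightarrow> y \<in> carrier G \<Longrightarrow> inv x \<otimes> (x \<otimes> y) = y"
  by (simp add: m_assoc[symmetric])

lemma cancel_inv_left: "x \<in> carrier G \<Longrightarrow> y \<in> carrier G \<Longrightarrow> x \<otimes> (inv x \<otimes> y) = y"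
  by (simp add: m_assoc[symmetric])

lemmas grp_simps = m_assoc inv_mult_group inv_cancel_left cancel_inv_left

lemma gcomm_closed [simp, intro]: "x \<in> carrier G \<Longrightarrow> y \<in> carrier G \<Longrightarrow> gcomm G x y \<in> carrier G"
  by (simp add: gcomm_def)

lemma gconj_closed [simp, intro]: "x \<in> carrier G \<Longrightarrow> y \<in> carrier G \<Longrightarrow> gconj G x y \<in> carrier G"
  by (simp add: gconj_def)

lemma gconj_gcomm: "x \<in> carrier G \<Longrightarrow> y \<in> carrier G \<Longrightarrow> gconj G x y = gcomm G x y \<otimes> y"
  by (simp add: gcomm_def gconj_def grp_simps)

lemma gconj_mult: "g \<in> carrier G \<Longrightarrow> x \<in> carrier G \<Longrightarrow> y \<in> carrier G \<Longrightarrow>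
    gconj G g (x \<otimes> y) = gconj G g x \<otimes> gconj G g y"
  by (simp add: gconj_def grp_simps)

lemma gconj_gconj: "g \<in> carrier G \<Longrightarrow> h \<in> carrier G \<Longrightarrow> x \<in> carrier G \<Longrightarrow>
    gconj G g (gconj G h x) = gconj G (g \<otimes> h) x"
  by (simp add: gconj_def grp_simps)

lemma gconj_one [simp]: "x \<in> carrier G \<Longrightarrow> gconj G \<one> x = x"
  by (simp add: gconj_def)

lemma gconj_one' [simp]: "x \<in> carrier G \<Longrightarrow> gconj G x \<one> = \<one>"
  by (simp add: gconj_def)

lemma gcomm_inv: "x \<in> carrier G \<Longrightarrow> y \<in> carrier G \<Longrightarrow> inv (gcomm G x y) = gcomm G y x"
  by (simp add: gcomm_def grp_simps)

lemma gcomm_mult_left: "x \<in> carrier G \<Longrightarrow> y \<in> carrier G \<Longrightarrow> w \<in> carrier G \<Longrightarrow>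
    gcomm G (x \<otimes> y) w = gconj G x (gcomm G y w) \<otimes> gcomm G x w"
  by (simp add: gcomm_def gconj_def grp_simps)

lemma gcomm_mult_right: "x \<in> carrier G \<Longrightarrow> y \<in> carrier G \<Longrightarrow> w \<in> carrier G \<Longrightarrow>
    gcomm G x (y \<otimes> w) = gcomm G x y \<otimes> gconj G y (gcomm G x w)"
  by (simp add: gcomm_def gconj_def grp_simps)

lemma gconj_gcomm_distrib: "g \<in> carrier G \<Longrightarrow> x \<in> carrier G \<Longrightarrow> y \<in> carrier G \<Longrightarrow>
    gconj G g (gcomm G x y) = gcomm G (gconj G g x) (gconj G g y)"
  by (simp add: gcomm_def gconj_def grp_simps)

lemma gcomm_self [simp]: "x \<in> carrier G \<Longrightarrow> gcomm G x x = \<one>"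
  by (simp add: gcomm_def grp_simps)

lemma gcomm_one_iff: "x \<in> carrier G \<Longrightarrow> y \<in> carrier G \<Longrightarrow> gcomm G x y = \<one> \<longleftrightarrow> x \<otimes> y = y \<otimes> x"
proof -
  assume x: "x \<in> carrier G" and y: "y \<in> carrier G"
  have "x \<otimes> y = gcomm G x y \<otimes> (y \<otimes> x)"
    using x y by (simp add: gcomm_def grp_simps)
  thus ?thesis using x y by (metis gcomm_closed l_one m_closed one_closed r_cancel)
qed

text \<open>In a finite group the inverse of an element is one of its powers, so closure under
  products suffices. Subgroups cut out by a condition are obtained this way below.\<close>

lemma finite_submonoid_imp_subgroup:
  assumes "finite (carrier G)" "S \<subseteq> carrier G" "\<one> \<in> S"
    and cl: "\<And>x y. x \<in> S \<Longrightarrow> y \<in> S \<Longrightarrow> x \<otimes> y \<in> S"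
  shows "subgroup S G"
proof
  fix x assume x: "x \<in> S"
  have pw: "x [^] (n::nat) \<in> S" for n
    by (induction n) (use assms x in auto)
  have xc: "x \<in> carrier G" using x assms by auto
  have "Coset.order G > 0" using assms(1) by (simp add: order_gt_0_iff_finite)
  then obtain n where n: "Coset.order G = Suc n" by (cases "Coset.order G") auto
  have "x [^] n \<otimes> x = \<one>" using pow_order_eq_1[OF xc] n by simp
  hence "inv x = x [^] n" using xc by (metis inv_equality nat_pow_closed)
  thus "inv x \<in> S" using pw by simp
qed (use assms in auto)

lemma subgroup_nat_pow: "subgroup N G \<Longrightarrow> x \<in> N \<Longrightarrow> x [^] (n::nat) \<in> N"
  by (induction n) (auto simp: subgroup.one_closed subgroup.m_closed)

section \<open>Extending and counting the linear characters of an abelian section\<close>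

lemma lin_mult: "\<psi> \<in> lin G N D \<Longrightarrow> x \<in> N \<Longrightarrow> y \<in> N \<Longrightarrow> \<psi> (x \<otimes> y) = \<psi> x * \<psi> y"
  by (simp add: lin_def)

lemma lin_nonzero: "\<psi> \<in> lin G N D \<Longrightarrow> x \<in> N \<Longrightarrow> \<psi> x \<noteq> 0"
  by (simp add: lin_def)

lemma lin_outside: "\<psi> \<in> lin G N D \<Longrightarrow> x \<notin> N \<Longrightarrow> \<psi> x = 0"
  by (simp add: lin_def)

lemma lin_trivial_on: "\<psi> \<in> lin G N D \<Longrightarrow> x \<in> D \<Longrightarrow> \<psi> x = 1"
  by (simp add: lin_def)

lemma lin_one: "subgroup N G \<Longrightarrow> \<psi> \<in> lin G N D \<Longrightarrow> \<psi> \<one> = 1"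
  by (metis lin_mult lin_nonzero l_one mult_cancel_right1 one_closed subgroup.one_closed)

lemma lin_inv:
  assumes "subgroup N G" "\<psi> \<in> lin G N D" "x \<in> N"
  shows "\<psi> (inv x) = inverse (\<psi> x)"
proof -
  have "\<psi> (inv x \<otimes> x) = \<psi> (inv x) * \<psi> x"
    using assms by (simp add: lin_mult subgroup.m_inv_closed)
  moreover have "inv x \<otimes> x = \<one>" using assms by (meson l_inv subgroup.mem_carrier)
  ultimately show ?thesis using lin_one[OF assms(1,2)]
    by (metis inverse_unique mult.commute)
qed

lemma lin_pow:
  assumes "subgroup N G" "\<psi> \<in> lin G N D" "x \<in> N"
  shows "\<psi> (x [^] (n::nat)) = \<psi> x ^ n"
proof (induction n)
  case 0 thus ?case using lin_one[OF assms(1,2)] by simp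
next
  case (Suc n)
  have "x [^] n \<in> N" using assms(1,3) by (simp add: subgroup_nat_pow)
  thus ?case using Suc assms by (simp add: lin_mult)
qed

lemma lin_mono: "\<psi> \<in> lin G N D \<Longrightarrow> D' \<subseteq> D \<Longrightarrow> \<psi> \<in> lin G N D'"
  by (auto simp: lin_def)

lemma lin_eqI: "\<psi> \<in> lin G N D \<Longrightarrow> \<phi> \<in> lin G N D' \<Longrightarrow> (\<And>x. x \<in> N \<Longrightarrow> \<psi> x = \<phi> x) \<Longrightarrow> \<psi> = \<phi>"
  by (rule ext) (metis lin_outside)

lemma lin_restrict:
  "\<psi> \<in> lin G N D \<Longrightarrow> subgroup H G \<Longrightarrow> H \<subseteq> N \<Longrightarrow> D' \<subseteq> D \<inter> H \<Longrightarrow> (\<lambda>x. if x \<in> H then \<psi> x else 0) \<in> lin G H D'"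
  by (auto simp: lin_def subgroup.m_closed subset_iff)

lemma lin_power:
  "\<psi> \<in> lin G N D \<Longrightarrow> j > 0 \<Longrightarrow> (\<lambda>x. \<psi> x ^ j) \<in> lin G N D"
  by (auto simp: lin_def power_mult_distrib)

lemma subgroup_pow_card:
  assumes "subgroup N G" "x \<in> N" shows "x [^] card N = \<one>"
proof -
  interpret N: group "G\<lparr>carrier := N\<rparr>" using assms(1) by (rule subgroup.subgroup_is_group) (rule is_group)
  show ?thesis using N.pow_order_eq_1[of x] assms(2) by (simp add: Coset.order_def nat_pow_consistent[symmetric])
qed

lemma lin_pow_card:
  assumes "subgroup N G" "\<psi> \<in> lin G N D" "x \<in> N"
  shows "\<psi> x ^ card N = 1"
  using lin_pow[OF assms, of "card N"] subgroup_pow_card[OF assms(1,3)] lin_one[OF assms(1,2)] by simp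

lemma finite_lin:
  assumes "subgroup N G" "finite N"
  shows "finite (lin G N D)"
proof -
  have "card N > 0" using assms by (metis card_gt_0_iff empty_iff subgroup.one_closed)
  hence "finite {z::complex. z ^ card N = 1}" using finite_roots_unity[of "card N"] by simp
  hence "finite {f. \<forall>x. (x \<in> N \<longrightarrow> f x \<in> {z::complex. z ^ card N = 1}) \<and> (x \<notin> N \<longrightarrow> f x = 0)}"
    using assms(2) by (intro finite_set_of_finite_funs)
  moreover have "lin G N D \<subseteq> {f. \<forall>x. (x \<in> N \<longrightarrow> f x \<in> {z::complex. z ^ card N = 1}) \<and> (x \<notin> N \<longrightarrow> f x = 0)}"
    using lin_pow_card[OF assms(1)] lin_outside by blast
  ultimately show ?thesis by (rule finite_subset[rotated])
qed

text \<open>\<open>H1\<close> is generated by \<open>H\<close> and \<open>x\<close>, and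
  \<open>m\<close> is the order of \<open>x\<close> modulo \<open>H\<close>. An extension of
  \<open>\<nu>\<close> to \<open>H1\<close> is determined by its value \<open>c\<close> at
  \<open>x\<close>, and \<open>c\<close> may be any of the \<open>m\<close> roots of
  \<open>c ^ m = \<nu> (x [^] m)\<close>. Reordering products costs commutators in \<open>D\<close>,
  on which \<open>\<nu>\<close> is trivial.\<close>

lemma lin_extend_step:
  assumes fin: "finite (carrier G)" and sec: "abelian_section G N D" and H: "subgroup H G" "D \<subseteq> H" "H \<subseteq> N"
    and lam: "\<nu> \<in> lin G H D" and x: "x \<in> N" "x \<notin> H"
  shows "\<exists>H1 m. subgroup H1 G \<and> H \<subset> H1 \<and> H1 \<subseteq> N \<and> m > 0 \<and>
     (\<forall>k::nat. x [^] k \<in> H \<longrightarrow> m dvd k) \<and> card H1 = m * card H \<and>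
     card {\<psi> \<in> lin G H1 D. \<forall>h\<in>H. \<psi> h = \<nu> h} = m"
proof -
  have N: "subgroup N G" and DN: "D \<subseteq> N" and cmD: "\<And>x y. x \<in> N \<Longrightarrow> y \<in> N \<Longrightarrow> gcomm G x y \<in> D"
    using sec by (auto simp: abelian_section_def)
  have NG: "N \<subseteq> carrier G" using N by (rule subgroup.subset)
  have xc: "x \<in> carrier G" using x NG by auto
  have HG: "H \<subseteq> carrier G" using H by (auto dest: subgroup.subset)
  have hc: "h \<in> carrier G" if "h \<in> H" for h using that HG by auto
  have finH: "finite H" using HG fin finite_subset by blast
  have xN: "x [^] (i::nat) \<in> N" for i using N x(1) by (simp add: subgroup_nat_pow)
  define m where "m = (LEAST m::nat. m > 0 \<and> x [^] m \<in> H)"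
  have "Coset.order G > 0" using fin by (simp add: order_gt_0_iff_finite)
  hence ex: "Coset.order G > 0 \<and> x [^] Coset.order G \<in> H" using pow_order_eq_1[OF xc] H(1) by (simp add: subgroup.one_closed)
  have m: "m > 0" "x [^] m \<in> H" using LeastI[where P="\<lambda>m. m > 0 \<and> x [^] m \<in> H", OF ex] by (auto simp: m_def)
  have xmk: "x [^] (m * k) \<in> H" for k
    using m(2) H(1) xc by (simp add: nat_pow_pow[symmetric] subgroup_nat_pow)
  have mdvd: "m dvd k" if k: "x [^] k \<in> H" for k
  proof (rule ccontr)
    assume nd: "\<not> m dvd k"
    have "x [^] k = x [^] (m * (k div m)) \<otimes> x [^] (k mod m)"
      using xc by (simp add: nat_pow_mult)
    hence "x [^] (k mod m) = inv (x [^] (m * (k div m))) \<otimes> x [^] k"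
      using xc by (simp add: inv_cancel_left)
    hence "x [^] (k mod m) \<in> H" using xmk k H(1) by (simp add: subgroup.m_closed subgroup.m_inv_closed)
    moreover have "k mod m > 0" using nd by (simp add: mod_greater_zero_iff_not_dvd)
    ultimately have "m \<le> k mod m" unfolding m_def by (intro Least_le) auto
    thus False using m(1) by (metis mod_less_divisor not_less)
  qed
  \<comment> \<open>Exponents below \<open>m\<close> make the representation unique;
    \<open>H1I\<close> admits arbitrary exponents afterwards.\<close>
  define H1 where "H1 = (\<lambda>(h,i). h \<otimes> x [^] i) ` (H \<times> {..<m})"
  have H1I: "h \<otimes> x [^] i \<in> H1" if "h \<in> H" for h and i :: nat
  proof -
    have "x [^] i = x [^] (m * (i div m)) \<otimes> x [^] (i mod m)" using xc by (simp add: nat_pow_mult)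
    hence "h \<otimes> x [^] i = (h \<otimes> x [^] (m * (i div m))) \<otimes> x [^] (i mod m)"
      using xc hc[OF that] by (simp add: m_assoc)
    moreover have "h \<otimes> x [^] (m * (i div m)) \<in> H" using that xmk H(1) by (simp add: subgroup.m_closed)
    moreover have "i mod m < m" using m(1) by simp
    ultimately show ?thesis unfolding H1_def by (intro image_eqI[of _ _ "(h \<otimes> x [^] (m * (i div m)), i mod m)"]) auto
  qed
  have H1E: "\<exists>h\<in>H. \<exists>i::nat. y = h \<otimes> x [^] i" if "y \<in> H1" for y using that by (auto simp: H1_def)
  have cj: "\<exists>h''\<in>H. (h \<otimes> x [^] i) \<otimes> (h' \<otimes> x [^] j) = h'' \<otimes> x [^] (i + j) \<and> \<nu> h'' = \<nu> h * \<nu> h'"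
    if h: "h \<in> H" "h' \<in> H" for h h' and i j :: nat
  proof -
    let ?d = "gcomm G (x [^] i) h'"
    have d: "?d \<in> D" using cmD xN h H(3) by auto
    have dH: "?d \<in> H" using d H by auto
    have "(h \<otimes> x [^] i) \<otimes> (h' \<otimes> x [^] j) = (h \<otimes> (?d \<otimes> h')) \<otimes> (x [^] i \<otimes> x [^] j)"
      using xc hc h by (simp add: gcomm_def grp_simps)
    moreover have "\<nu> (h \<otimes> (?d \<otimes> h')) = \<nu> h * \<nu> h'"
      using lam h dH d H by (simp add: lin_mult subgroup.m_closed lin_trivial_on)
    ultimately show ?thesis using xc h dH H by (metis nat_pow_mult subgroup.m_closed)
  qed
  have H1N: "H1 \<subseteq> N" using H(3) xN N by (auto simp: H1_def subgroup.m_closed)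
  have H1: "subgroup H1 G"
  proof (rule finite_submonoid_imp_subgroup[OF fin])
    show "H1 \<subseteq> carrier G" using H1N NG by auto
    show "\<one> \<in> H1" using H1I[of \<one> 0] H(1) by (simp add: subgroup.one_closed)
    fix a b assume "a \<in> H1" "b \<in> H1"
    then obtain h i h' j where "h \<in> H" "h' \<in> H" "a = h \<otimes> x [^] (i::nat)" "b = h' \<otimes> x [^] (j::nat)" using H1E by metis
    thus "a \<otimes> b \<in> H1" using cj H1I by metis
  qed
  have HH1: "H \<subseteq> H1" using H1I[of _ 0] hc by force
  have xH1: "x \<in> H1" using H1I[of \<one> 1] H(1) xc by (simp add: subgroup.one_closed)
  \<comment> \<open>Two representations of one element differ by a multiple of \<open>m\<close> in
    the exponent. This makes the value \<open>\<nu> h * c ^ i\<close> well defined.\<close>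
  have wd0: "\<exists>d. j = i + m * d \<and> h = h' \<otimes> x [^] (m * d)"
    if "h \<in> H" "h' \<in> H" "h \<otimes> x [^] i = h' \<otimes> x [^] j" "i \<le> j" for h h' and i j :: nat
  proof -
    have "h' \<otimes> x [^] j = (h' \<otimes> x [^] (j - i)) \<otimes> x [^] i"
      using that xc hc by (simp add: m_assoc nat_pow_mult)
    hence e: "h = h' \<otimes> x [^] (j - i)" using that xc hc by (metis m_closed nat_pow_closed r_cancel)
    hence "x [^] (j - i) = inv h' \<otimes> h" using that hc xc by (simp add: inv_cancel_left)
    hence "x [^] (j - i) \<in> H" using that H(1) by (simp add: subgroup.m_closed subgroup.m_inv_closed)
    hence "m dvd j - i" by (rule mdvd)
    then obtain d where "j - i = m * d" by (rule dvdE)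
    thus ?thesis using e that(4) by (metis le_add_diff_inverse)
  qed
  have inj: "inj_on (\<lambda>(h,i). h \<otimes> x [^] i) (H \<times> {..<m})"
  proof (rule inj_onI, clarsimp)
    fix h i h' j assume a: "h \<in> H" "i < m" "h' \<in> H" "j < m" "h \<otimes> x [^] i = h' \<otimes> x [^] j"
    have k: "i = j" if "i \<le> j" "j < m" "h \<in> H" "h' \<in> H" "h \<otimes> x [^] i = h' \<otimes> x [^] j" for i j h h'
    proof -
      from wd0[OF that(3-5,1)] obtain d where d: "j = i + m * d" by blast
      thus ?thesis using that(2) by (cases d) auto
    qed
    have "i = j" using k[of i j h h'] k[of j i h' h] a by (metis nle_le)
    thus "h = h' \<and> i = j" using a xc hc by (metis nat_pow_closed r_cancel)
  qed
  have cardH1: "card H1 = m * card H" unfolding H1_def card_image[OF inj] by (simp add: card_cartesian_product mult.commute)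
  define E where "E = {\<psi> \<in> lin G H1 D. \<forall>h\<in>H. \<psi> h = \<nu> h}"
  have "bij_betw (\<lambda>\<psi>. \<psi> x) E {c. c ^ m = \<nu> (x [^] m)}"
  proof (rule bij_betw_imageI)
    show "inj_on (\<lambda>\<psi>. \<psi> x) E"
    proof (rule inj_onI)
      fix \<psi> \<phi> assume a: "\<psi> \<in> E" "\<phi> \<in> E" "\<psi> x = \<phi> x"
      have v: "\<psi> (h \<otimes> x [^] i) = \<nu> h * \<psi> x ^ i" if "\<psi> \<in> E" "h \<in> H" for \<psi> h and i :: nat
      proof -
        have "x [^] i \<in> H1" using H1I[of \<one> i] H(1) xc by (simp add: subgroup.one_closed)
        thus ?thesis using that HH1 lin_mult[of \<psi> H1 D h "x [^] i"] lin_pow[OF H1, of \<psi> D x i] xH1 by (auto simp: E_def)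
      qed
      show "\<psi> = \<phi>"
      proof (rule lin_eqI)
        show "\<psi> \<in> lin G H1 D" "\<phi> \<in> lin G H1 D" using a by (auto simp: E_def)
        fix y assume "y \<in> H1"
        thus "\<psi> y = \<phi> y" using H1E v a by metis
      qed
    qed
    show "(\<lambda>\<psi>. \<psi> x) ` E = {c. c ^ m = \<nu> (x [^] m)}"
    proof (intro equalityI subsetI)
      fix c assume "c \<in> (\<lambda>\<psi>. \<psi> x) ` E"
      then obtain \<psi> where p: "\<psi> \<in> E" "c = \<psi> x" by auto
      thus "c \<in> {c. c ^ m = \<nu> (x [^] m)}"
        using m(2) lin_pow[OF H1 _ xH1, of \<psi> D m] by (simp add: E_def)
    next
      fix c assume "c \<in> {c. c ^ m = \<nu> (x [^] m)}"
      hence c: "c ^ m = \<nu> (x [^] m)" by simp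
      have c0: "c \<noteq> 0" using c m lin_nonzero[OF lam m(2)] by (metis power_eq_0_iff)
      have lmk: "\<nu> (x [^] (m * d)) = c ^ (m * d)" for d
        using lin_pow[OF H(1) lam m(2), of d] xc c by (simp add: nat_pow_pow power_mult)
      have wd1: "\<nu> h * c ^ i = \<nu> h' * c ^ j" if "h \<in> H" "h' \<in> H" "h \<otimes> x [^] i = h' \<otimes> x [^] j" "i \<le> j"
        for h h' and i j :: nat
      proof -
        from wd0[OF that] obtain d where d: "j = i + m * d" "h = h' \<otimes> x [^] (m * d)" by blast
        show ?thesis using d that lin_mult[OF lam, of h' "x [^] (m*d)"] xmk lmk by (simp add: power_add)
      qed
      have wd: "\<nu> h * c ^ i = \<nu> h' * c ^ j" if "h \<in> H" "h' \<in> H" "h \<otimes> x [^] i = h' \<otimes> x [^] j"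
        for h h' and i j :: nat
        using wd1[OF that] wd1[OF that(2,1) that(3)[symmetric]] by (metis nle_le)
      \<comment> \<open>Some representation is chosen; \<open>wd\<close> shows that the value does
        not depend on the choice.\<close>
      define \<psi> where "\<psi> y = (if y \<in> H1 then (let p = (SOME p. fst p \<in> H \<and> y = fst p \<otimes> x [^] (snd p::nat)) in \<nu> (fst p) * c ^ snd p) else 0)" for y
      have v: "\<psi> (h \<otimes> x [^] i) = \<nu> h * c ^ i" if h: "h \<in> H" for h and i :: nat
      proof -
        let ?P = "\<lambda>p. fst p \<in> H \<and> h \<otimes> x [^] i = fst p \<otimes> x [^] (snd p::nat)"
        have "?P (h,i)" using h by simp
        hence "?P (SOME p. ?P p)" by (rule someI)
        hence "\<nu> h * c ^ i = \<nu> (fst (SOME p. ?P p)) * c ^ snd (SOME p. ?P p)" using wd[OF h] by blast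
        thus ?thesis using H1I[OF h, of i] by (simp add: \<psi>_def Let_def)
      qed
      have vH: "\<psi> h = \<nu> h" if "h \<in> H" for h using v[OF that, of 0] hc[OF that] by simp
      have "\<psi> \<in> lin G H1 D"
        unfolding lin_def
      proof (intro CollectI conjI ballI allI impI)
        fix y assume "y \<notin> H1" thus "\<psi> y = 0" by (simp add: \<psi>_def)
      next
        fix y assume "y \<in> H1" thus "\<psi> y \<noteq> 0" using H1E v c0 lin_nonzero[OF lam] by (metis mult_eq_0_iff power_eq_0_iff)
      next
        fix a b assume "a \<in> H1" "b \<in> H1"
        then obtain h i h' j where ab: "h \<in> H" "h' \<in> H" "a = h \<otimes> x [^] (i::nat)" "b = h' \<otimes> x [^] (j::nat)" using H1E by metis
        then obtain h'' where h'': "h'' \<in> H" "a \<otimes> b = h'' \<otimes> x [^] (i + j)" "\<nu> h'' = \<nu> h * \<nu> h'" using cj by metis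
        show "\<psi> (a \<otimes> b) = \<psi> a * \<psi> b" using h'' ab v by (simp add: power_add)
      next
        fix d assume "d \<in> D" thus "\<psi> d = 1" using vH H(2) lin_trivial_on[OF lam] by auto
      qed
      hence "\<psi> \<in> E" using vH by (simp add: E_def)
      moreover have "\<psi> x = c" using v[of \<one> 1] H(1) xc lin_one[OF H(1) lam] by (simp add: subgroup.one_closed)
      ultimately show "c \<in> (\<lambda>\<psi>. \<psi> x) ` E" by auto
    qed
  qed
  hence "card E = card {c. c ^ m = \<nu> (x [^] m)}" by (rule bij_betw_same_card)
  also have "\<dots> = m" using card_nth_roots[OF lin_nonzero[OF lam m(2)] m(1)] .
  finally have "card E = m" .
  moreover have "H \<subset> H1" using HH1 xH1 x(2) by auto
  ultimately show ?thesis using H1 H1N m(1) mdvd cardH1 unfolding E_def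
    by (intro exI[of _ H1] exI[of _ m]) auto
qed

text \<open>Restriction to a larger subgroup \<open>H1\<close> sorts the extensions into
  \<open>m\<close> classes, one for each extension to \<open>H1\<close>, and each class is counted
  by the induction hypothesis. So a character of \<open>H\<close> trivial on \<open>D\<close> has
  exactly \<open>|N : H|\<close> extensions.\<close>

lemma card_lin_extensions:
  assumes fin: "finite (carrier G)" and sec: "abelian_section G N D"
  shows "subgroup H G \<Longrightarrow> D \<subseteq> H \<Longrightarrow> H \<subseteq> N \<Longrightarrow> \<nu> \<in> lin G H D \<Longrightarrow>
    card {\<psi> \<in> lin G N D. \<forall>h\<in>H. \<psi> h = \<nu> h} * card H = card N"
proof (induction "card N - card H" arbitrary: H \<nu> rule: less_induct)
  case less
  have N: "subgroup N G" using sec by (auto simp: abelian_section_def)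
  have NG: "N \<subseteq> carrier G" using N by (rule subgroup.subset)
  have finN: "finite N" using NG fin finite_subset by blast
  show ?case
  proof (cases "H = N")
    case True
    have "{\<psi> \<in> lin G N D. \<forall>h\<in>N. \<psi> h = \<nu> h} = {\<nu>}" using less.prems True by (auto intro: lin_eqI)
    thus ?thesis using True by simp
  next
    case False
    then obtain x where x: "x \<in> N" "x \<notin> H" using less.prems by auto
    obtain H1 m where H1: "subgroup H1 G" "H \<subset> H1" "H1 \<subseteq> N" "card H1 = m * card H"
      and cm: "card {\<psi> \<in> lin G H1 D. \<forall>h\<in>H. \<psi> h = \<nu> h} = m"
      using lin_extend_step[OF fin sec less.prems x] by blast
    define E where "E = {\<psi> \<in> lin G H1 D. \<forall>h\<in>H. \<psi> h = \<nu> h}"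
    have finH1: "finite H1" using H1 finN finite_subset by blast
    have H1p: "card H1 > 0" using finH1 H1 by (metis card_gt_0_iff empty_iff subgroup.one_closed)
    have lt: "card N - card H1 < card N - card H"
      using psubset_card_mono[OF finH1 H1(2)] card_mono[OF finN H1(3)] by linarith
    have DH1: "D \<subseteq> H1" using less.prems(2) H1(2) by auto
    have IH: "card {\<psi> \<in> lin G N D. \<forall>h\<in>H1. \<psi> h = \<phi> h} * card H1 = card N" if "\<phi> \<in> E" for \<phi>
      by (rule less.hyps[OF lt H1(1) DH1 H1(3)]) (use that in \<open>simp add: E_def\<close>)
    have each: "card {\<psi> \<in> lin G N D. \<forall>h\<in>H1. \<psi> h = \<phi> h} = card N div card H1" if "\<phi> \<in> E" for \<phi>
    proof -
      have "card {\<psi> \<in> lin G N D. \<forall>h\<in>H1. \<psi> h = \<phi> h} * card H1 = card N"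
        by (rule IH[OF that])
      thus ?thesis using div_mult_self_is_m[OF H1p, of "card {\<psi> \<in> lin G N D. \<forall>h\<in>H1. \<psi> h = \<phi> h}"] by (simp only:)
    qed
    have dv: "card N div card H1 * card H1 = card N"
    proof -
      have "card E \<noteq> 0" using cm H1(4) H1p by (simp add: E_def)
      hence "E \<noteq> {}" by force
      then obtain \<phi> where "\<phi> \<in> E" by blast
      hence "card {\<psi> \<in> lin G N D. \<forall>h\<in>H1. \<psi> h = \<phi> h} * card H1 = card N"
        by (rule IH)
      hence "card H1 dvd card N"
        using dvd_triv_right[of "card H1" "card {\<psi> \<in> lin G N D. \<forall>h\<in>H1. \<psi> h = \<phi> h}"] by (simp only:)
      thus ?thesis by simp
    qed
    have un: "{\<psi> \<in> lin G N D. \<forall>h\<in>H. \<psi> h = \<nu> h} = (\<Union>\<phi>\<in>E. {\<psi> \<in> lin G N D. \<forall>h\<in>H1. \<psi> h = \<phi> h})"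
    proof (intro equalityI subsetI)
      fix \<psi> assume p: "\<psi> \<in> {\<psi> \<in> lin G N D. \<forall>h\<in>H. \<psi> h = \<nu> h}"
      have "(\<lambda>x. if x \<in> H1 then \<psi> x else 0) \<in> lin G H1 D"
        using p lin_restrict[of \<psi> N D H1 D] H1 less.prems(2) by auto
      hence "(\<lambda>x. if x \<in> H1 then \<psi> x else 0) \<in> E" using p H1(2) by (auto simp: E_def)
      thus "\<psi> \<in> (\<Union>\<phi>\<in>E. {\<psi> \<in> lin G N D. \<forall>h\<in>H1. \<psi> h = \<phi> h})" using p by (intro UN_I) auto
    next
      fix \<psi> assume "\<psi> \<in> (\<Union>\<phi>\<in>E. {\<psi> \<in> lin G N D. \<forall>h\<in>H1. \<psi> h = \<phi> h})"
      thus "\<psi> \<in> {\<psi> \<in> lin G N D. \<forall>h\<in>H. \<psi> h = \<nu> h}" using H1(2) by (auto simp: E_def)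
    qed
    have finE: "finite E" using finite_lin[OF H1(1) finH1] by (simp add: E_def)
    have "card {\<psi> \<in> lin G N D. \<forall>h\<in>H. \<psi> h = \<nu> h} = (\<Sum>\<phi>\<in>E. card {\<psi> \<in> lin G N D. \<forall>h\<in>H1. \<psi> h = \<phi> h})"
      unfolding un
    proof (rule card_UN_disjoint)
      show "\<forall>\<phi>\<in>E. finite {\<psi> \<in> lin G N D. \<forall>h\<in>H1. \<psi> h = \<phi> h}" using finite_lin[OF N finN] by simp
      show "\<forall>\<phi>\<in>E. \<forall>\<phi>'\<in>E. \<phi> \<noteq> \<phi>' \<longrightarrow> {\<psi> \<in> lin G N D. \<forall>h\<in>H1. \<psi> h = \<phi> h} \<inter> {\<psi> \<in> lin G N D. \<forall>h\<in>H1. \<psi> h = \<phi>' h} = {}"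
      proof (intro ballI impI, rule ccontr)
        fix \<phi> \<phi>' assume a: "\<phi> \<in> E" "\<phi>' \<in> E" "\<phi> \<noteq> \<phi>'"
          "{\<psi> \<in> lin G N D. \<forall>h\<in>H1. \<psi> h = \<phi> h} \<inter> {\<psi> \<in> lin G N D. \<forall>h\<in>H1. \<psi> h = \<phi>' h} \<noteq> {}"
        hence "\<forall>h\<in>H1. \<phi> h = \<phi>' h" by fastforce
        moreover have "\<phi> \<in> lin G H1 D" "\<phi>' \<in> lin G H1 D" using a by (auto simp: E_def)
        ultimately show False using a(3) lin_eqI by blast
      qed
    qed (rule finE)
    also have "\<dots> = m * (card N div card H1)" using each cm by (simp add: E_def)
    finally have "card {\<psi> \<in> lin G N D. \<forall>h\<in>H. \<psi> h = \<nu> h} * card H = card N div card H1 * (m * card H)"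
      by simp
    thus ?thesis using dv H1(4) by (simp only:)
  qed
qed

lemma trivial_lin:
  "subgroup N G \<Longrightarrow> D \<subseteq> N \<Longrightarrow> (\<lambda>x. if x \<in> N then 1 else 0) \<in> lin G N D"
  by (auto simp: lin_def subgroup.m_closed)

lemma card_lin:
  assumes "finite (carrier G)" "abelian_section G N D"
  shows "card (lin G N D) * card D = card N"
proof -
  have D: "subgroup D G" "D \<subseteq> N" using assms(2) by (auto simp: abelian_section_def)
  have "{\<psi> \<in> lin G N D. \<forall>h\<in>D. \<psi> h = (if h \<in> D then 1 else 0)} = lin G N D"
    by (auto simp: lin_def)
  thus ?thesis using card_lin_extensions[OF assms D(1) _ D(2) trivial_lin[OF D(1)]] by simp
qed

lemma lin_extend:
  assumes "finite (carrier G)" "abelian_section G N D" "subgroup H G" "D \<subseteq> H" "H \<subseteq> N" "\<nu> \<in> lin G H D"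
  obtains \<psi> where "\<psi> \<in> lin G N D" "\<And>h. h \<in> H \<Longrightarrow> \<psi> h = \<nu> h"
proof -
  have "card N > 0" using assms
    by (metis abelian_section_def card_gt_0_iff empty_iff finite_subset subgroup.one_closed subgroup.subset)
  hence "card {\<psi> \<in> lin G N D. \<forall>h\<in>H. \<psi> h = \<nu> h} > 0"
    using card_lin_extensions[OF assms] by (intro gr0I) simp
  hence "{\<psi> \<in> lin G N D. \<forall>h\<in>H. \<psi> h = \<nu> h} \<noteq> {}" by fastforce
  thus ?thesis using that by blast
qed

text \<open>The common kernel \<open>T\<close> of the characters trivial on \<open>H\<close> admits
  the same characters as \<open>H\<close>; counting them gives \<open>|T| = |H|\<close>, so nothing
  outside \<open>H\<close> is killed by all of them.\<close>

lemma lin_separates: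
  assumes fin: "finite (carrier G)" and sec: "abelian_section G N D" and H: "subgroup H G" "D \<subseteq> H" "H \<subseteq> N"
    and x: "x \<in> N" "x \<notin> H"
  obtains \<psi> where "\<psi> \<in> lin G N H" "\<psi> x \<noteq> 1"
proof -
  have sec': "abelian_section G N H" using sec H by (auto simp: abelian_section_def)
  have "\<exists>\<psi>\<in>lin G N H. \<psi> x \<noteq> 1"
  proof (rule ccontr)
    assume c: "\<not> ?thesis"
    define T where "T = {y \<in> N. \<forall>\<psi>\<in>lin G N H. \<psi> y = 1}"
    have N: "subgroup N G" using sec by (auto simp: abelian_section_def)
    have NG: "N \<subseteq> carrier G" by (rule subgroup.subset[OF N])
    have T: "subgroup T G"
      by (rule finite_submonoid_imp_subgroup[OF fin])
        (use NG N in \<open>auto simp: T_def lin_mult lin_one subgroup.one_closed subgroup.m_closed\<close>)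
    have "H \<subseteq> T" using H(3) lin_trivial_on unfolding T_def by blast
    moreover have "x \<in> T" using c x unfolding T_def by blast
    ultimately have HT: "H \<subset> T" using x(2) by blast
    have finT: "finite T" using subgroup.subset[OF T] fin by (rule finite_subset)
    have TN: "T \<subseteq> N" by (auto simp: T_def)
    have sT: "abelian_section G N T" using sec' T HT TN unfolding abelian_section_def by blast
    have "lin G N T = lin G N H"
    proof
      show "lin G N T \<subseteq> lin G N H" using HT lin_mono by blast
      show "lin G N H \<subseteq> lin G N T" by (auto simp: lin_def T_def)
    qed
    hence "card (lin G N H) * card T = card N" "card (lin G N H) * card H = card N"
      using card_lin[OF fin sT] card_lin[OF fin sec'] by auto
    moreover have "card N > 0" using N fin NG by (metis card_gt_0_iff empty_iff finite_subset subgroup.one_closed)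
    ultimately have "card (lin G N H) * card T = card (lin G N H) * card H" "card (lin G N H) \<noteq> 0"
      by (auto intro!: gr0I)
    hence "card T = card H" by simp
    thus False using psubset_card_mono[OF finT HT] by simp
  qed
  thus ?thesis using that by blast
qed

end

subsection \<open>Induced representations and their Galois conjugates\<close>

text \<open>Mackey's irreducibility criterion for a linear character: for \<open>g\<close> outside
  \<open>A\<close>, the character and its conjugate by \<open>g\<close> differ somewhere on the part
  of \<open>A\<close> where both are defined.\<close>

definition mackey :: "('a, 'b) monoid_scheme \<Rightarrow> 'a set \<Rightarrow> ('a \<Rightarrow> complex) \<Rightarrow> bool" where
  "mackey G A \<psi> \<longleftrightarrow> subgroup A G \<and> \<psi> \<in> lin G A {} \<and>
     (\<forall>g\<in>carrier G - A. \<exists>h\<in>A. gconj G g h \<in> A \<and> \<psi> (gconj G g h) \<noteq> \<psi> h)"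

text \<open>The induced character multiplied by the order of its subgroup. Summing over the whole
  group avoids a transversal, and subgroups of equal order still give comparable functions.\<close>

definition induced :: "('a, 'b) monoid_scheme \<Rightarrow> ('a \<Rightarrow> complex) \<Rightarrow> 'a \<Rightarrow> complex" where
  "induced G \<psi> x = (\<Sum>g\<in>carrier G. \<psi> (gconj G g x))"

text \<open>The monomial matrices of the induced representation in terms of coset representatives
  \<open>t\<close>; the zero extension of \<open>\<psi>\<close> leaves a single nonzero entry in
  each row.\<close>

definition ind_rep :: "('a, 'b) monoid_scheme \<Rightarrow> ('a \<Rightarrow> complex) \<Rightarrow> (nat \<Rightarrow> 'a) \<Rightarrow> nat \<Rightarrow> 'a \<Rightarrow> complex mat" where
  "ind_rep G \<psi> t n g = mat n n (\<lambda>(i,j). \<psi> (t i \<otimes>\<^bsub>G\<^esub> g \<otimes>\<^bsub>G\<^esub> inv\<^bsub>G\<^esub> (t j)))"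

definition transversal :: "('a, 'b) monoid_scheme \<Rightarrow> 'a set \<Rightarrow> (nat \<Rightarrow> 'a) \<Rightarrow> nat \<Rightarrow> bool" where
  "transversal G A t n \<longleftrightarrow> n * card A = card (carrier G) \<and> (\<forall>i<n. t i \<in> carrier G) \<and>
     (\<forall>g\<in>carrier G. \<exists>!i. i < n \<and> g \<otimes>\<^bsub>G\<^esub> inv\<^bsub>G\<^esub> (t i) \<in> A)"

context group
begin

lemma transversal_exists:
  assumes fin: "finite (carrier G)" and A: "subgroup A G"
  obtains n t where "transversal G A t n"
proof -
  have finR: "finite (rcosets A)"
    using rcosets_subset_PowG[OF A] fin by (meson finite_Pow_iff finite_subset)
  obtain f where f: "bij_betw f {..<card (rcosets A)} (rcosets A)"
    using ex_bij_betw_nat_finite[OF finR] by (auto simp: atLeast0LessThan)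
  define t where "t i = (SOME x. x \<in> carrier G \<and> f i = A #> x)" for i
  have t: "t i \<in> carrier G \<and> f i = A #> t i" if "i < card (rcosets A)" for i
  proof -
    have "f i \<in> rcosets A" using f that by (auto simp: bij_betw_def)
    hence "\<exists>x. x \<in> carrier G \<and> f i = A #> x" by (auto simp: RCOSETS_def)
    thus ?thesis unfolding t_def by (rule someI_ex)
  qed
  have eqv: "g \<otimes> inv (t i) \<in> A \<longleftrightarrow> A #> g = f i" if g: "g \<in> carrier G" and i: "i < card (rcosets A)" for g i
  proof -
    have "g \<otimes> inv (t i) \<in> A \<longleftrightarrow> g \<in> A #> t i"
      using subgroup.rcos_module[OF A is_group] t[OF i] g by blast
    also have "\<dots> \<longleftrightarrow> A #> g = A #> t i"
      using repr_independence[OF _ _ A] t[OF i] g rcos_self[OF g A] by blast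
    finally show ?thesis using t[OF i] by simp
  qed
  have "transversal G A t (card (rcosets A))"
    unfolding transversal_def
  proof (intro conjI ballI allI impI)
    show "card (rcosets A) * card A = card (carrier G)"
      using lagrange[OF A] by (simp add: Coset.order_def mult.commute)
    fix i assume "i < card (rcosets A)" thus "t i \<in> carrier G" using t by simp
  next
    fix g assume g: "g \<in> carrier G"
    have "A #> g \<in> rcosets A" using g by (auto simp: RCOSETS_def)
    then obtain i where i: "i < card (rcosets A)" "f i = A #> g"
      using f by (metis bij_betw_iff_bijections lessThan_iff)
    show "\<exists>!i. i < card (rcosets A) \<and> g \<otimes> inv (t i) \<in> A"
    proof (rule ex1I[of _ i])
      show "i < card (rcosets A) \<and> g \<otimes> inv (t i) \<in> A" using i eqv[OF g] by simp
      fix k assume "k < card (rcosets A) \<and> g \<otimes> inv (t k) \<in> A"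
      hence "k < card (rcosets A)" "f k = f i" using i eqv[OF g] by auto
      thus "k = i" using f i by (auto simp: bij_betw_def inj_on_def)
    qed
  qed
  thus ?thesis by (rule that)
qed

text \<open>This holds for all \<open>y\<close> of the group because multiplication by
  \<open>A\<close> preserves the complement of \<open>A\<close>, where \<open>\<psi>\<close>
  vanishes.\<close>

lemma lin_mult_left:
  assumes "subgroup A G" "\<psi> \<in> lin G A D" "a \<in> A" "y \<in> carrier G"
  shows "\<psi> (a \<otimes> y) = \<psi> a * \<psi> y"
proof (cases "y \<in> A")
  case False
  have "a \<otimes> y \<notin> A"
  proof
    assume "a \<otimes> y \<in> A"
    hence "inv a \<otimes> (a \<otimes> y) \<in> A" using assms by (simp add: subgroup.m_closed subgroup.m_inv_closed)
    thus False using False assms by (simp add: inv_cancel_left subgroup.mem_carrier)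
  qed
  thus ?thesis using False assms by (simp add: lin_outside)
qed (use assms in \<open>simp add: lin_mult\<close>)

lemma lin_mult_right:
  assumes "subgroup A G" "\<psi> \<in> lin G A D" "a \<in> A" "y \<in> carrier G"
  shows "\<psi> (y \<otimes> a) = \<psi> y * \<psi> a"
proof (cases "y \<in> A")
  case False
  have "y \<otimes> a \<notin> A"
  proof
    assume "y \<otimes> a \<in> A"
    hence "(y \<otimes> a) \<otimes> inv a \<in> A" using assms by (simp add: subgroup.m_closed subgroup.m_inv_closed)
    thus False using False assms by (simp add: m_assoc subgroup.mem_carrier)
  qed
  thus ?thesis using False assms by (simp add: lin_outside)
qed (use assms in \<open>simp add: lin_mult\<close>)

lemma lin_gconj:
  assumes "subgroup A G" "\<psi> \<in> lin G A D" "a \<in> A" "y \<in> carrier G"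
  shows "\<psi> (gconj G a y) = \<psi> y"
proof -
  have a: "a \<in> carrier G" using assms by (simp add: subgroup.mem_carrier)
  have "\<psi> (gconj G a y) = \<psi> a * \<psi> y * \<psi> (inv a)"
    unfolding gconj_def using assms a by (simp add: lin_mult_left lin_mult_right subgroup.m_inv_closed)
  thus ?thesis using lin_inv[OF assms(1-3)] lin_nonzero[OF assms(2,3)] by simp
qed

lemma transversal_diff:
  assumes tr: "transversal G A t n" and A: "subgroup A G" and "i < n" "j < n"
  shows "t i \<otimes> inv (t j) \<in> A \<longleftrightarrow> i = j"
proof -
  have ti: "t i \<in> carrier G" using assms by (simp add: transversal_def)
  have "\<exists>!k. k < n \<and> t i \<otimes> inv (t k) \<in> A" using tr ti by (simp add: transversal_def)
  moreover have "t i \<otimes> inv (t i) \<in> A" using ti A by (simp add: subgroup.one_closed)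
  ultimately show ?thesis using assms by blast
qed

text \<open>In the sum over \<open>k\<close> only the coset containing
  \<open>t i \<otimes> g\<close> contributes, and there the two values multiply to the required
  one.\<close>

lemma ind_rep_mult:
  assumes A: "subgroup A G" and psi: "\<psi> \<in> lin G A D" and tr: "transversal G A t n"
    and g: "g \<in> carrier G" and h: "h \<in> carrier G"
  shows "ind_rep G \<psi> t n (g \<otimes> h) = ind_rep G \<psi> t n g * ind_rep G \<psi> t n h"
proof (rule eq_matI)
  fix i j assume "i < dim_row (ind_rep G \<psi> t n g * ind_rep G \<psi> t n h)"
    "j < dim_col (ind_rep G \<psi> t n g * ind_rep G \<psi> t n h)"
  hence ij: "i < n" "j < n" by (auto simp: ind_rep_def)
  have tc: "t k \<in> carrier G" if "k < n" for k using tr that by (simp add: transversal_def)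
  have "t i \<otimes> g \<in> carrier G" using tc ij g by simp
  then obtain k0 where k0: "k0 < n" "t i \<otimes> g \<otimes> inv (t k0) \<in> A"
    and uniq: "\<And>k. k < n \<Longrightarrow> t i \<otimes> g \<otimes> inv (t k) \<in> A \<Longrightarrow> k = k0"
    using tr unfolding transversal_def by blast
  have "(ind_rep G \<psi> t n g * ind_rep G \<psi> t n h) $$ (i, j) =
      (\<Sum>k<n. \<psi> (t i \<otimes> g \<otimes> inv (t k)) * \<psi> (t k \<otimes> h \<otimes> inv (t j)))"
    using ij by (simp add: ind_rep_def scalar_prod_def atLeast0LessThan)
  also have "\<dots> = (\<Sum>k\<in>{k0}. \<psi> (t i \<otimes> g \<otimes> inv (t k)) * \<psi> (t k \<otimes> h \<otimes> inv (t j)))"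
  proof (rule sum.mono_neutral_right)
    show "\<forall>k\<in>{..<n} - {k0}. \<psi> (t i \<otimes> g \<otimes> inv (t k)) * \<psi> (t k \<otimes> h \<otimes> inv (t j)) = 0"
      using uniq lin_outside[OF psi] by auto
  qed (use k0 in auto)
  also have "\<dots> = \<psi> ((t i \<otimes> g \<otimes> inv (t k0)) \<otimes> (t k0 \<otimes> h \<otimes> inv (t j)))"
    using lin_mult_left[OF A psi k0(2)] tc k0 ij h by simp
  also have "(t i \<otimes> g \<otimes> inv (t k0)) \<otimes> (t k0 \<otimes> h \<otimes> inv (t j)) = t i \<otimes> (g \<otimes> h) \<otimes> inv (t j)"
    using tc k0 ij h g by (simp add: grp_simps)
  finally show "ind_rep G \<psi> t n (g \<otimes> h) $$ (i, j) = (ind_rep G \<psi> t n g * ind_rep G \<psi> t n h) $$ (i, j)"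
    using ij by (simp add: ind_rep_def)
qed (auto simp: ind_rep_def)

text \<open>The argument of an entry is a conjugate of \<open>c\<close> times
  \<open>t i \<otimes> inv (t j)\<close>, and the latter lies in \<open>A\<close> only on the
  diagonal.\<close>

lemma ind_rep_scalar:
  assumes A: "subgroup A G" and psi: "\<psi> \<in> lin G A D" and tr: "transversal G A t n"
    and c: "c \<in> A" and inv: "\<And>g. g \<in> carrier G \<Longrightarrow> gconj G g c \<in> A \<and> \<psi> (gconj G g c) = \<psi> c"
  shows "ind_rep G \<psi> t n c = \<psi> c \<cdot>\<^sub>m 1\<^sub>m n"
proof (rule eq_matI)
  fix i j assume "i < dim_row (\<psi> c \<cdot>\<^sub>m 1\<^sub>m n)" "j < dim_col (\<psi> c \<cdot>\<^sub>m (1\<^sub>m n :: complex mat))"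
  hence ij: "i < n" "j < n" by auto
  have tc: "t k \<in> carrier G" if "k < n" for k using tr that by (simp add: transversal_def)
  have cc: "c \<in> carrier G" using c A by (simp add: subgroup.mem_carrier)
  have "t i \<otimes> c \<otimes> inv (t j) = gconj G (t i) c \<otimes> (t i \<otimes> inv (t j))"
    using tc ij cc by (simp add: gconj_def grp_simps)
  hence "\<psi> (t i \<otimes> c \<otimes> inv (t j)) = \<psi> c * \<psi> (t i \<otimes> inv (t j))"
    using inv[OF tc[OF ij(1)]] lin_mult_left[OF A psi] tc ij by simp
  also have "\<psi> (t i \<otimes> inv (t j)) = (if i = j then 1 else 0)"
    using transversal_diff[OF tr A ij] lin_outside[OF psi] lin_one[OF A psi] tc ij by simp
  finally show "ind_rep G \<psi> t n c $$ (i, j) = (\<psi> c \<cdot>\<^sub>m 1\<^sub>m n) $$ (i, j)"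
    using ij by (simp add: ind_rep_def)
qed (auto simp: ind_rep_def)

lemma ind_rep_one:
  assumes A: "subgroup A G" and psi: "\<psi> \<in> lin G A D" and tr: "transversal G A t n"
  shows "ind_rep G \<psi> t n \<one> = 1\<^sub>m n"
  using ind_rep_scalar[OF A psi tr, of \<one>] A lin_one[OF A psi]
  by (auto simp: subgroup.one_closed intro!: eq_matI)

lemma representation_ind_rep:
  assumes A: "subgroup A G" and psi: "\<psi> \<in> lin G A D" and tr: "transversal G A t n"
  shows "representation G n (ind_rep G \<psi> t n)"
  unfolding representation_def
  using ind_rep_mult[OF assms] ind_rep_one[OF assms] by (simp add: ind_rep_def)

text \<open>Group elements are written uniquely as \<open>a \<otimes> t i\<close>; conjugation by
  \<open>a\<close> does not change \<open>\<psi>\<close>, so each coset contributes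
  \<open>card A\<close> equal terms.\<close>

lemma induced_eq_trace:
  assumes fin: "finite (carrier G)" and A: "subgroup A G" and psi: "\<psi> \<in> lin G A D" and tr: "transversal G A t n"
    and x: "x \<in> carrier G"
  shows "induced G \<psi> x = of_nat (card A) * (\<Sum>i<n. \<psi> (gconj G (t i) x))"
proof -
  have tc: "t k \<in> carrier G" if "k < n" for k using tr that by (simp add: transversal_def)
  have AG: "a \<in> carrier G" if "a \<in> A" for a using A that by (simp add: subgroup.mem_carrier)
  have "bij_betw (\<lambda>(a,i). a \<otimes> t i) (A \<times> {..<n}) (carrier G)"
  proof (rule bij_betw_imageI)
    show "inj_on (\<lambda>(a,i). a \<otimes> t i) (A \<times> {..<n})"
    proof (rule inj_onI, clarsimp)
      fix a i b j assume a: "a \<in> A" "i < n" "b \<in> A" "j < n" "a \<otimes> t i = b \<otimes> t j"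
      have "t i \<otimes> inv (t j) = inv a \<otimes> (a \<otimes> t i) \<otimes> inv (t j)"
        using a(1,2,4) tc AG by (simp add: inv_cancel_left)
      also have "\<dots> = inv a \<otimes> b" unfolding a(5) using a(1-4) tc AG by (simp add: grp_simps)
      finally have "t i \<otimes> inv (t j) \<in> A" using a A by (simp add: subgroup.m_closed subgroup.m_inv_closed)
      hence "i = j" using transversal_diff[OF tr A] a by blast
      thus "a = b \<and> i = j" using a tc AG by simp
    qed
    show "(\<lambda>(a,i). a \<otimes> t i) ` (A \<times> {..<n}) = carrier G"
    proof (intro equalityI subsetI)
      fix g assume g: "g \<in> carrier G"
      then obtain i where i: "i < n" "g \<otimes> inv (t i) \<in> A" using tr unfolding transversal_def by blast
      have "g = (g \<otimes> inv (t i)) \<otimes> t i" using g tc i by (simp add: grp_simps)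
      thus "g \<in> (\<lambda>(a,i). a \<otimes> t i) ` (A \<times> {..<n})" using i by (intro image_eqI[of _ _ "(g \<otimes> inv (t i), i)"]) auto
    qed (use tc AG in auto)
  qed
  hence "induced G \<psi> x = (\<Sum>(a,i)\<in>A \<times> {..<n}. \<psi> (gconj G (a \<otimes> t i) x))"
    unfolding induced_def using sum.reindex_bij_betw[of _ _ _ "\<lambda>g. \<psi> (gconj G g x)"]
    by (fastforce simp: case_prod_beta)
  also have "\<dots> = (\<Sum>(a,i)\<in>A \<times> {..<n}. \<psi> (gconj G (t i) x))"
  proof (rule sum.cong[OF refl], clarsimp)
    fix a i assume "a \<in> A" "i < n"
    thus "\<psi> (gconj G (a \<otimes> t i) x) = \<psi> (gconj G (t i) x)"
      using lin_gconj[OF A psi] tc AG x by (simp add: gconj_gconj[symmetric])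
  qed
  also have "\<dots> = of_nat (card A) * (\<Sum>i<n. \<psi> (gconj G (t i) x))"
    by (simp add: sum.cartesian_product[symmetric])
  finally show ?thesis .
qed

text \<open>Replacing \<open>a\<close> by \<open>a \<otimes> h\<close> multiplies the sum by
  \<open>\<psi> (gconj G (inv v) h) / \<psi> h\<close>. For \<open>v\<close> outside
  \<open>A\<close> Mackey's criterion supplies \<open>h\<close> making this factor different from 1,
  so the sum vanishes.\<close>

lemma mackey_orthogonality:
  assumes fin: "finite (carrier G)" and M: "mackey G A \<psi>" and u: "u \<in> carrier G" and v: "v \<in> carrier G"
  shows "(\<Sum>a\<in>A. \<psi> (inv a) * \<psi> (u \<otimes> a \<otimes> v)) = (if u \<in> A \<and> v \<in> A then of_nat (card A) * \<psi> u * \<psi> v else 0)"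
proof -
  have A: "subgroup A G" and psi: "\<psi> \<in> lin G A {}" using M by (auto simp: mackey_def)
  have AG: "a \<in> carrier G" if "a \<in> A" for a using A that by (simp add: subgroup.mem_carrier)
  show ?thesis
  proof (cases "v \<in> A")
    case v': True
    have "\<psi> (inv a) * \<psi> (u \<otimes> a \<otimes> v) = \<psi> u * \<psi> v" if "a \<in> A" for a
      using lin_mult_right[OF A psi v', of "u \<otimes> a"] lin_mult_right[OF A psi that u] u AG that
        lin_inv[OF A psi that] lin_nonzero[OF psi that] by simp
    thus ?thesis using v' lin_outside[OF psi, of u] by simp
  next
    case False
    have "inv v \<in> carrier G - A" using False v A
      by (metis Diff_iff inv_closed inv_inv subgroup.m_inv_closed)
    then obtain h where h: "h \<in> A" "gconj G (inv v) h \<in> A" "\<psi> (gconj G (inv v) h) \<noteq> \<psi> h"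
      using M unfolding mackey_def by blast
    define S where "S = (\<Sum>a\<in>A. \<psi> (inv a) * \<psi> (u \<otimes> a \<otimes> v))"
    have hc: "h \<in> carrier G" using AG h by simp
    have bij: "bij_betw (\<lambda>a. a \<otimes> h) A A"
    proof (rule bij_betwI[where g="\<lambda>a. a \<otimes> inv h"])
      show "(\<lambda>a. a \<otimes> h) \<in> A \<rightarrow> A" "(\<lambda>a. a \<otimes> inv h) \<in> A \<rightarrow> A"
        using h A by (auto simp: subgroup.m_closed subgroup.m_inv_closed)
    qed (use AG hc in \<open>auto simp: m_assoc\<close>)
    have "S = (\<Sum>a\<in>A. \<psi> (inv (a \<otimes> h)) * \<psi> (u \<otimes> (a \<otimes> h) \<otimes> v))"
      unfolding S_def by (rule sum.reindex_bij_betw[OF bij, symmetric])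
    also have "\<dots> = (\<Sum>a\<in>A. inverse (\<psi> h) * \<psi> (gconj G (inv v) h) * (\<psi> (inv a) * \<psi> (u \<otimes> a \<otimes> v)))"
    proof (rule sum.cong[OF refl])
      fix a assume a: "a \<in> A"
      have "u \<otimes> (a \<otimes> h) \<otimes> v = (u \<otimes> a \<otimes> v) \<otimes> gconj G (inv v) h"
        using u v hc AG[OF a] by (simp add: gconj_def grp_simps)
      hence "\<psi> (u \<otimes> (a \<otimes> h) \<otimes> v) = \<psi> (u \<otimes> a \<otimes> v) * \<psi> (gconj G (inv v) h)"
        using lin_mult_right[OF A psi h(2)] u v AG[OF a] by simp
      moreover have "\<psi> (inv (a \<otimes> h)) = inverse (\<psi> h) * \<psi> (inv a)"
        using a h A AG hc lin_inv[OF A psi] lin_mult[OF psi] by (simp add: subgroup.m_closed)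
      ultimately show "\<psi> (inv (a \<otimes> h)) * \<psi> (u \<otimes> (a \<otimes> h) \<otimes> v) =
          inverse (\<psi> h) * \<psi> (gconj G (inv v) h) * (\<psi> (inv a) * \<psi> (u \<otimes> a \<otimes> v))" by simp
    qed
    also have "\<dots> = inverse (\<psi> h) * \<psi> (gconj G (inv v) h) * S" by (simp add: S_def sum_distrib_left)
    finally have "\<psi> h * S = \<psi> (gconj G (inv v) h) * S" using lin_nonzero[OF psi h(1)] by (simp add: field_simps)
    hence "S = 0" using h(3) by simp
    thus ?thesis using False by (simp add: S_def)
  qed
qed

text \<open>Schur orthogonality for the matrix entries, reduced to a sum over \<open>A\<close> by a
  substitution. It exhibits multiples of all matrix units as combinations of the induced matrices,
  and irreducibility follows.\<close>

lemma ind_rep_matrix_units: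
  assumes fin: "finite (carrier G)" and M: "mackey G A \<psi>" and tr: "transversal G A t n"
    and ij: "i < n" "j < n" "k < n" "l < n"
  shows "(\<Sum>g\<in>carrier G. \<psi> (inv (t k \<otimes> g \<otimes> inv (t l))) * \<psi> (t i \<otimes> g \<otimes> inv (t j))) =
    (if i = k \<and> j = l then of_nat (card A) else 0)"
proof -
  have A: "subgroup A G" and psi: "\<psi> \<in> lin G A {}" using M by (auto simp: mackey_def)
  have tc: "t k \<in> carrier G" if "k < n" for k using tr that by (simp add: transversal_def)
  let ?u = "t i \<otimes> inv (t k)" and ?v = "t l \<otimes> inv (t j)"
  have bij: "bij_betw (\<lambda>g. t k \<otimes> g \<otimes> inv (t l)) (carrier G) (carrier G)"
    by (rule bij_betwI[where g="\<lambda>y. inv (t k) \<otimes> y \<otimes> t l"]) (use tc ij in \<open>auto simp: grp_simps\<close>)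
  have "(\<Sum>g\<in>carrier G. \<psi> (inv (t k \<otimes> g \<otimes> inv (t l))) * \<psi> (t i \<otimes> g \<otimes> inv (t j))) =
     (\<Sum>g\<in>carrier G. (\<lambda>y. \<psi> (inv y) * \<psi> (?u \<otimes> y \<otimes> ?v)) (t k \<otimes> g \<otimes> inv (t l)))"
    by (rule sum.cong) (use tc ij in \<open>auto simp: grp_simps\<close>)
  also have "\<dots> = (\<Sum>y\<in>carrier G. \<psi> (inv y) * \<psi> (?u \<otimes> y \<otimes> ?v))"
    by (rule sum.reindex_bij_betw[OF bij])
  also have "\<dots> = (\<Sum>y\<in>A. \<psi> (inv y) * \<psi> (?u \<otimes> y \<otimes> ?v))"
  proof (rule sum.mono_neutral_right[OF fin subgroup.subset[OF A]], rule ballI)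
    fix y assume y: "y \<in> carrier G - A"
    hence "inv y \<notin> A" using A by (metis Diff_iff inv_inv subgroup.m_inv_closed)
    thus "\<psi> (inv y) * \<psi> (?u \<otimes> y \<otimes> ?v) = 0" using lin_outside[OF psi] by simp
  qed
  also have "\<dots> = (if ?u \<in> A \<and> ?v \<in> A then of_nat (card A) * \<psi> ?u * \<psi> ?v else 0)"
    by (rule mackey_orthogonality[OF fin M]) (use tc ij in auto)
  also have "\<dots> = (if i = k \<and> j = l then of_nat (card A) else 0)"
    using transversal_diff[OF tr A ij(1,3)] transversal_diff[OF tr A ij(4,2)] tc ij lin_one[OF A psi]
    by auto
  finally show ?thesis .
qed

lemma irreducible_ind_rep:
  assumes fin: "finite (carrier G)" and M: "mackey G A \<psi>" and tr: "transversal G A t n"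
  shows "irreducible_representation G n (ind_rep G \<psi> t n)"
  unfolding irreducible_representation_def
proof (intro conjI allI impI)
  have A: "subgroup A G" and psi: "\<psi> \<in> lin G A {}" using M by (auto simp: mackey_def)
  have finA: "finite A" using A fin finite_subset subgroup.subset by blast
  have cA: "card A > 0" using A finA by (metis card_gt_0_iff empty_iff subgroup.one_closed)
  let ?\<rho> = "ind_rep G \<psi> t n"
  show "representation G n ?\<rho>" by (rule representation_ind_rep[OF A psi tr])
  have "card (carrier G) > 0" using fin by (metis card_gt_0_iff empty_iff one_closed)
  thus "0 < n" using tr unfolding transversal_def by (metis gr0I mult_0 less_numeral_extra(3))
  fix W assume W: "invariant_subspace G n ?\<rho> W"
  have Wc: "w \<in> carrier_vec n" if "w \<in> W" for w using W that by (auto simp: invariant_subspace_def)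
  have W0: "0\<^sub>v n \<in> W" and Wadd: "\<And>v w. v \<in> W \<Longrightarrow> w \<in> W \<Longrightarrow> v + w \<in> W"
    and Wsc: "\<And>c v. v \<in> W \<Longrightarrow> c \<cdot>\<^sub>v v \<in> W" and Winv: "\<And>g v. g \<in> carrier G \<Longrightarrow> v \<in> W \<Longrightarrow> ?\<rho> g *\<^sub>v v \<in> W"
    using W by (auto simp: invariant_subspace_def)
  show "W = {0\<^sub>v n} \<or> W = carrier_vec n"
  proof (cases "W = {0\<^sub>v n}")
    case False
    then obtain w where w: "w \<in> W" "w \<noteq> 0\<^sub>v n" using W0 by auto
    then obtain l where l: "l < n" "w $ l \<noteq> 0" using Wc[OF w(1)] by (metis carrier_vecD eq_vecI index_zero_vec)
    have unit: "unit_vec n k \<in> W" if k: "k < n" for k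
    proof -
      \<comment> \<open>These coefficients extract the matrix unit at \<open>(k, l)\<close>, so the
        combination of the images of \<open>w\<close> is a multiple of the \<open>k\<close>-th unit
        vector, nonzero because \<open>w $ l\<close> is.\<close>
      define c where "c g = \<psi> (inv (t k \<otimes> g \<otimes> inv (t l)))" for g
      define F where "F S = vec n (\<lambda>i. \<Sum>g\<in>S. c g * (?\<rho> g *\<^sub>v w) $ i)" for S
      have "F S \<in> W" if "finite S" "S \<subseteq> carrier G" for S
        using that
      proof (induction S rule: finite_induct)
        case empty
        have "F {} = 0\<^sub>v n" by (auto simp: F_def)
        thus ?case using W0 by simp
      next
        case (insert g S)
        have "F (insert g S) = c g \<cdot>\<^sub>v (?\<rho> g *\<^sub>v w) + F S"
          using insert by (auto simp: F_def ind_rep_def intro!: eq_vecI)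
        thus ?case using insert Wadd Wsc Winv w(1) by simp
      qed
      hence FW: "F (carrier G) \<in> W" using fin by simp
      have "F (carrier G) = (of_nat (card A) * w $ l) \<cdot>\<^sub>v unit_vec n k"
      proof (rule eq_vecI)
        fix i assume "i < dim_vec ((of_nat (card A) * w $ l) \<cdot>\<^sub>v unit_vec n k)"
        hence i: "i < n" by simp
        have "F (carrier G) $ i = (\<Sum>g\<in>carrier G. c g * (\<Sum>j<n. \<psi> (t i \<otimes> g \<otimes> inv (t j)) * w $ j))"
          using i Wc[OF w(1)] by (simp add: F_def ind_rep_def scalar_prod_def atLeast0LessThan)
        also have "\<dots> = (\<Sum>j<n. (\<Sum>g\<in>carrier G. c g * \<psi> (t i \<otimes> g \<otimes> inv (t j))) * w $ j)"
          unfolding sum_distrib_left sum_distrib_right by (subst sum.swap) (simp add: mult.assoc)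
        also have "\<dots> = (\<Sum>j<n. (if i = k \<and> j = l then of_nat (card A) else 0) * w $ j)"
          unfolding c_def using ind_rep_matrix_units[OF fin M tr i _ k l(1)] by (intro sum.cong) auto
        also have "\<dots> = (\<Sum>j<n. if j = l then (if i = k then of_nat (card A) * w $ l else 0) else 0)"
          by (intro sum.cong) auto
        also have "\<dots> = ((of_nat (card A) * w $ l) \<cdot>\<^sub>v unit_vec n k) $ i" using i l k by (auto simp: unit_vec_def)
        finally show "F (carrier G) $ i = ((of_nat (card A) * w $ l) \<cdot>\<^sub>v unit_vec n k) $ i" .
      qed (simp add: F_def)
      hence "inverse (of_nat (card A) * w $ l) \<cdot>\<^sub>v F (carrier G) = unit_vec n k"
        using l(2) cA by (auto intro!: eq_vecI simp: field_simps)
      thus ?thesis using Wsc[OF FW] by metis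
    qed
    have "v \<in> W" if v: "v \<in> carrier_vec n" for v
    proof -
      define F where "F S = vec n (\<lambda>i. if i \<in> S then v $ i else 0)" for S
      have "F S \<in> W" if "finite S" "S \<subseteq> {..<n}" for S
        using that
      proof (induction S rule: finite_induct)
        case empty
        have "F {} = 0\<^sub>v n" by (auto simp: F_def)
        thus ?case using W0 by simp
      next
        case (insert k S)
        have "F (insert k S) = v $ k \<cdot>\<^sub>v unit_vec n k + F S"
          using insert by (auto simp: F_def unit_vec_def intro!: eq_vecI)
        thus ?case using insert Wadd Wsc unit by simp
      qed
      hence "F {..<n} \<in> W" by simp
      moreover have "F {..<n} = v" using v by (auto simp: F_def)
      ultimately show ?thesis by simp
    qed
    thus ?thesis using Wc by blast
  qed simp
qed

lemma det_ind_rep_derived: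
  assumes A: "subgroup A G" and psi: "\<psi> \<in> lin G A D" and tr: "transversal G A t n"
    and x: "x \<in> derived G (carrier G)"
  shows "det (ind_rep G \<psi> t n x) = 1"
proof -
  let ?d = "\<lambda>g. det (ind_rep G \<psi> t n g)"
  have mult: "?d (g \<otimes> h) = ?d g * ?d h" if "g \<in> carrier G" "h \<in> carrier G" for g h
    using ind_rep_mult[OF A psi tr that] det_mult[of "ind_rep G \<psi> t n g" n "ind_rep G \<psi> t n h"]
    by (simp add: ind_rep_def)
  have one: "?d \<one> = 1" using ind_rep_one[OF A psi tr] by simp
  have inv: "?d (inv g) * ?d g = 1" if "g \<in> carrier G" for g
    using mult[of "inv g" g] that one by simp
  have cm: "?d (a \<otimes> b \<otimes> inv a \<otimes> inv b) = 1" if "a \<in> carrier G" "b \<in> carrier G" for a b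
  proof -
    have "?d (a \<otimes> b \<otimes> inv a \<otimes> inv b) = (?d (inv a) * ?d a) * (?d (inv b) * ?d b)"
      using mult that by simp
    thus ?thesis using inv that by simp
  qed
  have sc: "derived_set G (carrier G) \<subseteq> carrier G" by auto
  have "x \<in> generate G (derived_set G (carrier G))" using x by (simp add: derived_def)
  thus ?thesis
  proof (induction rule: generate.induct)
    case one thus ?case using ind_rep_one[OF A psi tr] by simp
  next
    case (incl h)
    thus ?case using cm by auto
  next
    case (inv h)
    then obtain a b where ab: "a \<in> carrier G" "b \<in> carrier G" "h = a \<otimes> b \<otimes> inv a \<otimes> inv b" by auto
    hence "inv h = b \<otimes> a \<otimes> inv b \<otimes> inv a" by (simp add: grp_simps)
    thus ?case using cm ab by simp
  next
    case (eng a b)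
    thus ?case using mult generate_in_carrier[OF sc] by simp
  qed
qed

text \<open>A substitute for the transfer homomorphism: take the determinant of the representation induced from a
  linear character of a central section.\<close>
lemma lin_power_index_trivial:
  assumes fin: "finite (carrier G)" and C: "subgroup C G" and psi: "\<psi> \<in> lin G C D"
    and inv: "\<And>g c. g \<in> carrier G \<Longrightarrow> c \<in> C \<Longrightarrow> gconj G g c \<in> C \<and> \<psi> (gconj G g c) = \<psi> c"
    and c: "c \<in> C" "c \<in> derived G (carrier G)" and idx: "m * card C = card (carrier G)"
  shows "\<psi> c ^ m = 1"
proof -
  obtain n t where tr: "transversal G C t n" using transversal_exists[OF fin C] .
  have "card C > 0" using C fin by (metis card_gt_0_iff empty_iff finite_subset subgroup.one_closed subgroup.subset)
  hence "n = m" using tr idx unfolding transversal_def by (metis mult_right_cancel less_numeral_extra(3))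
  moreover have "det (\<psi> c \<cdot>\<^sub>m (1\<^sub>m n :: complex mat)) = 1"
    using det_ind_rep_derived[OF C psi tr c(2)] ind_rep_scalar[OF C psi tr c(1)] inv c(1) by simp
  ultimately show ?thesis by (simp add: det_smult)
qed

end

section \<open>Galois automorphisms acting on roots of unity\<close>

lemma subfield_complex_cyclotomic: "subfield_complex (cyclotomic_field n)"
  unfolding cyclotomic_field_def subfield_complex_def by auto

lemma zeta_in_cyclotomic: "cis (2 * pi / real n) \<in> cyclotomic_field n"
  by (simp add: cyclotomic_field_def)

lemma cyclotomic_power: "z \<in> cyclotomic_field n \<Longrightarrow> z ^ k \<in> cyclotomic_field n"
  using subfield_complex_cyclotomic[of n] by (induction k) (auto simp: subfield_complex_def)

lemma root_of_unity_power:
  assumes "n > 0" "z ^ n = (1::complex)" obtains k where "k < n" "z = cis (2 * pi / real n) ^ k"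
proof -
  have "z \<in> (\<lambda>k. cis (2 * pi * real k / real n)) ` {..<n}"
    using bij_betw_roots_unity[OF assms(1)] assms(2) by (auto simp: bij_betw_def)
  then obtain k where "k < n" "z = cis (2 * pi * real k / real n)" by auto
  moreover have "cis (2 * pi / real n) ^ k = cis (2 * pi * real k / real n)"
    by (simp add: DeMoivre mult_ac)
  ultimately show ?thesis using that by metis
qed

lemma zeta_power_eq_1:
  assumes "n > 0" "cis (2 * pi / real n) ^ k = 1" shows "n dvd k"
proof (rule ccontr)
  assume nd: "\<not> n dvd k"
  let ?z = "cis (2 * pi / real n)"
  have zn: "?z ^ n = 1" using assms(1) by (simp add: DeMoivre)
  have "?z ^ k = ?z ^ (n * (k div n) + k mod n)" by simp
  also have "\<dots> = ?z ^ (k mod n)" unfolding power_add power_mult zn by simp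
  finally have e: "?z ^ (k mod n) = 1" using assms(2) by simp
  have "inj_on (\<lambda>k. cis (2 * pi * real k / real n)) {..<n}"
    using bij_betw_roots_unity[OF assms(1)] by (auto simp: bij_betw_def)
  moreover have "cis (2 * pi * real (k mod n) / real n) = cis (2 * pi * real 0 / real n)"
    using e by (simp add: DeMoivre mult_ac)
  ultimately have "k mod n = 0" using assms(1) by (elim inj_onD) auto
  thus False using nd by auto
qed

text \<open>The primitive root \<open>cis (2 * pi / real n)\<close> is sent to a power of itself,
  and injectivity makes the exponent coprime to \<open>n\<close>. All other roots of unity follow as
  powers.\<close>

lemma galois_aut_root_of_unity:
  assumes g: "galois_aut n \<alpha>" and n: "n > 0"
  obtains j where "coprime j n" "j > 0" "\<alpha> 0 = 0" "\<And>z. z ^ n = 1 \<Longrightarrow> z \<in> cyclotomic_field n \<and> \<alpha> z = z ^ j"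
proof -
  let ?F = "cyclotomic_field n" and ?z = "cis (2 * pi / real n)"
  have F: "0 \<in> ?F" "1 \<in> ?F" using subfield_complex_cyclotomic[of n] by (auto simp: subfield_complex_def)
  have inj: "inj_on \<alpha> ?F" using g by (auto simp: galois_aut_def bij_betw_def)
  have add: "\<And>x y. x \<in> ?F \<Longrightarrow> y \<in> ?F \<Longrightarrow> \<alpha> (x + y) = \<alpha> x + \<alpha> y"
    and mult: "\<And>x y. x \<in> ?F \<Longrightarrow> y \<in> ?F \<Longrightarrow> \<alpha> (x * y) = \<alpha> x * \<alpha> y"
    using g by (auto simp: galois_aut_def)
  have a0: "\<alpha> 0 = 0" using add[OF F(1) F(1)] by simp
  have "\<alpha> 1 \<noteq> 0" using inj F a0 by (metis inj_onD zero_neq_one)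
  hence a1: "\<alpha> 1 = 1" using mult[OF F(2) F(2)] by simp
  have pw: "\<alpha> (x ^ k) = \<alpha> x ^ k" if "x \<in> ?F" for x k
    using that by (induction k) (simp_all add: a1 mult cyclotomic_power)
  have zn: "?z ^ n = 1" using n by (simp add: DeMoivre)
  have "\<alpha> ?z ^ n = 1" using pw[OF zeta_in_cyclotomic, of n] zn a1 by simp
  then obtain j0 where j0: "\<alpha> ?z = ?z ^ j0" using root_of_unity_power[OF n] by metis
  \<comment> \<open>Adding \<open>n\<close> makes the exponent positive, so that
    \<open>0 ^ j = 0\<close> and \<open>j\<close>-th powers of characters still vanish outside their
    subgroup.\<close>
  define j where "j = j0 + n"
  have az: "\<alpha> ?z = ?z ^ j" using j0 zn by (simp add: j_def power_add)
  have "coprime j n"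
  proof (rule ccontr)
    assume "\<not> coprime j n"
    define d where "d = gcd j n"
    have d: "d > 1" "d dvd j" "d dvd n" using \<open>\<not> coprime j n\<close> n
      unfolding d_def by (auto simp: coprime_iff_gcd_eq_1 nat_neq_iff)
    then obtain j' n' where jn: "j = d * j'" "n = d * n'" by (auto elim!: dvdE)
    \<comment> \<open>With \<open>d\<close> a common divisor of \<open>j\<close> and
      \<open>n\<close>, the root \<open>?z ^ (n div d)\<close>, which is not 1, would be sent to
      1.\<close>
    have "\<alpha> (?z ^ n') = ?z ^ (j * n')" using pw[OF zeta_in_cyclotomic] az by (simp add: power_mult)
    also have "j * n' = n * j'" using jn by simp
    also have "?z ^ (n * j') = \<alpha> 1" unfolding power_mult zn by (simp add: a1)
    finally have "?z ^ n' = 1" using inj F cyclotomic_power[OF zeta_in_cyclotomic] by (metis inj_onD)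
    hence "n dvd n'" by (rule zeta_power_eq_1[OF n])
    hence "n \<le> n'" using n jn by (intro dvd_imp_le) auto
    thus False using jn d n by (metis mult_le_cancel2 mult_1 not_le gr0I mult_0_right)
  qed
  moreover have "z \<in> ?F \<and> \<alpha> z = z ^ j" if z: "z ^ n = 1" for z
  proof -
    from root_of_unity_power[OF n z] obtain k where k: "z = ?z ^ k" by metis
    have "z \<in> ?F" unfolding k by (rule cyclotomic_power[OF zeta_in_cyclotomic])
    moreover have "\<alpha> z = z ^ j" unfolding k pw[OF zeta_in_cyclotomic] az by (simp add: power_mult[symmetric] mult.commute)
    ultimately show ?thesis by simp
  qed
  ultimately show ?thesis using that a0 n by (simp add: j_def)
qed

context group
begin

text \<open>Equal orders of the subgroups give equal degrees, and
  \<open>A \<noteq> carrier G\<close> makes the degree, the index of \<open>A\<close>, different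
  from 1. The values of \<open>\<psi>\<close> are roots of unity or 0, so the Galois automorphism
  raises them to the \<open>j\<close>-th power.\<close>

lemma GC_star_induced:
  assumes fin: "finite (carrier G)" and gc: "GC_star G"
    and M: "mackey G A \<psi>" and M': "mackey G A' \<psi>'" and c: "card A = card A'" and ne: "A \<noteq> carrier G"
  shows "\<exists>j>0. coprime j (card (carrier G)) \<and> (\<forall>g\<in>carrier G. induced G \<psi>' g = induced G (\<lambda>x. \<psi> x ^ j) g)"
proof -
  have A: "subgroup A G" and psi: "\<psi> \<in> lin G A {}" using M by (auto simp: mackey_def)
  have A': "subgroup A' G" and psi': "\<psi>' \<in> lin G A' {}" using M' by (auto simp: mackey_def)
  obtain n t where tr: "transversal G A t n" using transversal_exists[OF fin A] .
  obtain n' t' where tr': "transversal G A' t' n'" using transversal_exists[OF fin A'] .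
  have cA: "card A > 0" using A fin by (metis card_gt_0_iff empty_iff finite_subset subgroup.one_closed subgroup.subset)
  have "n * card A = n' * card A" using tr tr' c by (simp add: transversal_def)
  hence nn: "n' = n" using cA by simp
  define \<chi> where "\<chi> g = (if g \<in> carrier G then mat_trace (ind_rep G \<psi> t n g) else 0)" for g
  define \<chi>' where "\<chi>' g = (if g \<in> carrier G then mat_trace (ind_rep G \<psi>' t' n' g) else 0)" for g
  have irr: "irr_char G \<chi>" "irr_char G \<chi>'"
    using irreducible_ind_rep[OF fin M tr] irreducible_ind_rep[OF fin M' tr']
    unfolding irr_char_def \<chi>_def \<chi>'_def by blast+
  have chi: "\<chi> g = (\<Sum>i<n. \<psi> (gconj G (t i) g))" if "g \<in> carrier G" for g
    using that by (simp add: \<chi>_def mat_trace_def ind_rep_def gconj_def)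
  have chi': "\<chi>' g = (\<Sum>i<n'. \<psi>' (gconj G (t' i) g))" if "g \<in> carrier G" for g
    using that by (simp add: \<chi>'_def mat_trace_def ind_rep_def gconj_def)
  have tc: "t k \<in> carrier G" if "k < n" for k using tr that by (simp add: transversal_def)
  have tc': "t' k \<in> carrier G" if "k < n'" for k using tr' that by (simp add: transversal_def)
  have d1: "\<chi> \<one> = of_nat n" using chi[of \<one>] lin_one[OF A psi] tc by simp
  have d2: "\<chi>' \<one> = of_nat n" using chi'[of \<one>] lin_one[OF A' psi'] tc' nn by simp
  have "n \<noteq> 1"
  proof
    assume "n = 1"
    hence "card A = card (carrier G)" using tr by (simp add: transversal_def)
    thus False using ne fin A by (metis card_subset_eq subgroup.subset)
  qed
  hence "galois_conjugate G \<chi> \<chi>'" using gc irr d1 d2 unfolding GC_star_def by simp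
  then obtain N \<alpha> where N: "N > 0" "card (carrier G) dvd N" "galois_aut N \<alpha>"
    and al: "\<And>g. g \<in> carrier G \<Longrightarrow> \<chi>' g = \<alpha> (\<chi> g)" unfolding galois_conjugate_def by blast
  obtain j where j: "coprime j N" "j > 0" "\<alpha> 0 = 0"
    and aj: "\<And>z. z ^ N = 1 \<Longrightarrow> z \<in> cyclotomic_field N \<and> \<alpha> z = z ^ j"
    using galois_aut_root_of_unity[OF N(3,1)] by metis
  have zF: "0 \<in> cyclotomic_field N" using subfield_complex_cyclotomic[of N] by (auto simp: subfield_complex_def)
  have val: "\<psi> x \<in> cyclotomic_field N \<and> \<alpha> (\<psi> x) = \<psi> x ^ j" for x
  proof (cases "x \<in> A")
    case True
    have "x \<in> carrier G" using True A by (simp add: subgroup.mem_carrier)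
    hence "x [^] card (carrier G) = \<one>" using pow_order_eq_1 by (simp add: Coset.order_def)
    hence "\<psi> x ^ card (carrier G) = 1" using lin_pow[OF A psi True] lin_one[OF A psi] by metis
    hence "\<psi> x ^ N = 1" using N(2) by (metis dvdE power_mult power_one)
    thus ?thesis by (rule aj)
  next
    case False
    thus ?thesis using lin_outside[OF psi False] zF j by simp
  qed
  have asum: "sum f S \<in> cyclotomic_field N \<and> \<alpha> (sum f S) = (\<Sum>i\<in>S. \<alpha> (f i))"
    if "finite S" "\<And>i. i \<in> S \<Longrightarrow> f i \<in> cyclotomic_field N" for f :: "nat \<Rightarrow> complex" and S
    using that
  proof (induction S rule: finite_induct)
    case empty thus ?case using zF j by simp
  next
    case (insert i S)
    thus ?case using N(3) subfield_complex_cyclotomic[of N] unfolding galois_aut_def subfield_complex_def by auto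
  qed
  have pj: "(\<lambda>x. \<psi> x ^ j) \<in> lin G A {}" by (rule lin_power[OF psi j(2)])
  have "induced G \<psi>' g = induced G (\<lambda>x. \<psi> x ^ j) g" if g: "g \<in> carrier G" for g
  proof -
    have "\<chi>' g = \<alpha> (\<Sum>i<n. \<psi> (gconj G (t i) g))" using al[OF g] chi[OF g] by simp
    also have "\<dots> = (\<Sum>i<n. \<psi> (gconj G (t i) g) ^ j)" using asum[of "{..<n}" "\<lambda>i. \<psi> (gconj G (t i) g)"] val by simp
    finally show ?thesis
      using induced_eq_trace[OF fin A' psi' tr' g] induced_eq_trace[OF fin A pj tr g] chi'[OF g] c by simp
  qed
  moreover have "coprime j (card (carrier G))" using j(1) N(2) by (meson coprime_divisors dvd_refl)
  ultimately show ?thesis using j(2) by blast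
qed

end

subsection \<open>Frobenius groups\<close>

lemma (in group) gconj_pow: "g \<in> carrier G \<Longrightarrow> x \<in> carrier G \<Longrightarrow> gconj G g (x [^] (n::nat)) = gconj G g x [^] n"
  by (induction n) (auto simp: gconj_mult)

lemma (in group) gconj_inv: "g \<in> carrier G \<Longrightarrow> x \<in> carrier G \<Longrightarrow> gconj G g (inv x) = inv (gconj G g x)"
  by (simp add: gconj_def grp_simps)

section \<open>Orthogonality and independence of linear characters\<close>

lemma (in group) lin_sum_zero:
  assumes N: "subgroup N G" and psi: "\<psi> \<in> lin G N D" and x: "x \<in> N" "\<psi> x \<noteq> 1"
  shows "(\<Sum>y\<in>N. \<psi> y) = 0"
proof -
  have NG: "y \<in> carrier G" if "y \<in> N" for y using N that by (simp add: subgroup.mem_carrier)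
  have bij: "bij_betw (\<lambda>a. x \<otimes> a) N N"
  proof (rule bij_betwI[where g="\<lambda>a. inv x \<otimes> a"])
    show "(\<lambda>a. x \<otimes> a) \<in> N \<rightarrow> N" "(\<lambda>a. inv x \<otimes> a) \<in> N \<rightarrow> N"
      using x N by (auto simp: subgroup.m_closed subgroup.m_inv_closed)
  qed (use NG x in \<open>auto simp: inv_cancel_left cancel_inv_left\<close>)
  have "(\<Sum>y\<in>N. \<psi> y) = (\<Sum>y\<in>N. \<psi> (x \<otimes> y))" by (rule sum.reindex_bij_betw[OF bij, symmetric])
  also have "\<dots> = \<psi> x * (\<Sum>y\<in>N. \<psi> y)" using lin_mult[OF psi x(1)] by (simp add: sum_distrib_left)
  finally show ?thesis using x(2) by simp
qed

lemma (in group) lin_orthogonality: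
  assumes N: "subgroup N G" and f: "f \<in> lin G N {}" and g: "g \<in> lin G N {}"
  shows "(\<Sum>x\<in>N. f x * inverse (g x)) = (if f = g then of_nat (card N) else 0)"
proof (cases "f = g")
  case True
  thus ?thesis using lin_nonzero[OF g] by simp
next
  case False
  then obtain x where x: "x \<in> N" "f x \<noteq> g x" using lin_eqI[OF f g] by blast
  have h: "(\<lambda>x. f x * inverse (g x)) \<in> lin G N {}" using f g by (auto simp: lin_def)
  have "f x * inverse (g x) \<noteq> 1" using x lin_nonzero[OF g x(1)] by (simp add: field_simps)
  thus ?thesis using lin_sum_zero[OF N h x(1)] False by simp
qed

text \<open>Dedekind's independence of characters.\<close>
lemma (in group) lin_sums_match:
  assumes N: "subgroup N G" "finite N" and I: "finite I" "finite J"
    and f: "\<And>i. i \<in> I \<Longrightarrow> f i \<in> lin G N {}" and g: "\<And>j. j \<in> J \<Longrightarrow> g j \<in> lin G N {}"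
    and eq: "\<And>x. x \<in> N \<Longrightarrow> (\<Sum>i\<in>I. f i x) = (\<Sum>j\<in>J. g j x)" and j: "j0 \<in> J"
  shows "\<exists>i\<in>I. f i = g j0"
proof (rule ccontr)
  assume no: "\<not> ?thesis"
  have cN: "card N > 0" using N by (metis card_gt_0_iff empty_iff subgroup.one_closed)
  have "(\<Sum>x\<in>N. (\<Sum>i\<in>I. f i x) * inverse (g j0 x)) = (\<Sum>i\<in>I. \<Sum>x\<in>N. f i x * inverse (g j0 x))"
    unfolding sum_distrib_right by (rule sum.swap)
  also have "\<dots> = 0" using lin_orthogonality[OF N(1) f g[OF j]] no by (intro sum.neutral) auto
  finally have "0 = (\<Sum>x\<in>N. (\<Sum>i\<in>J. g i x) * inverse (g j0 x))" using eq by simp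
  also have "\<dots> = (\<Sum>i\<in>J. \<Sum>x\<in>N. g i x * inverse (g j0 x))"
    unfolding sum_distrib_right by (rule sum.swap)
  also have "\<dots> = (\<Sum>i\<in>J. if g i = g j0 then of_nat (card N) else 0)"
    using lin_orthogonality[OF N(1) g g[OF j]] by (intro sum.cong) auto
  also have "\<dots> = of_nat (card {i\<in>J. g i = g j0} * card N)"
    using I by (simp add: sum.If_cases Int_def)
  finally have "card {i\<in>J. g i = g j0} * card N = 0" by (metis of_nat_eq_0_iff)
  hence "{i\<in>J. g i = g j0} = {}" using cN I by simp
  thus False using j by blast
qed

text \<open>Adjoining one element at a time multiplies the order by the order of that element modulo
  the subgroup, which divides a power of \<open>q\<close>. The trivial character merely feeds
  \<open>lin_extend_step\<close>.\<close>

lemma (in group) section_prime_power: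
  assumes fin: "finite (carrier G)" and sec: "abelian_section G N D" and q: "Factorial_Ring.prime (q::nat)"
    and e: "\<And>x. x \<in> N \<Longrightarrow> \<exists>e. x [^] (q ^ e) \<in> D"
  shows "\<exists>n. card N = q ^ n * card D"
proof -
  have N: "subgroup N G" "subgroup D G" "D \<subseteq> N" using sec by (auto simp: abelian_section_def)
  have finN: "finite N" using N fin finite_subset subgroup.subset by blast
  have "\<exists>n. card N = q ^ n * card H" if "subgroup H G" "D \<subseteq> H" "H \<subseteq> N" for H
    using that
  proof (induction "card N - card H" arbitrary: H rule: less_induct)
    case less
    show ?case
    proof (cases "H = N")
      case True thus ?thesis by (intro exI[of _ 0]) simp
    next
      case False
      then obtain x where x: "x \<in> N" "x \<notin> H" using less.prems by auto
      obtain H1 m where H1: "subgroup H1 G" "H \<subset> H1" "H1 \<subseteq> N" "card H1 = m * card H"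
        and md: "\<And>k::nat. x [^] k \<in> H \<Longrightarrow> m dvd k"
        using lin_extend_step[OF fin sec less.prems trivial_lin[OF less.prems(1,2)] x] by blast
      obtain e where "x [^] (q ^ e) \<in> H" using e[OF x(1)] less.prems(2) by auto
      hence "m dvd q ^ e" by (rule md)
      then obtain i where i: "m = q ^ i" using divides_primepow_nat[OF q] by auto
      have finH1: "finite H1" using H1 finN finite_subset by blast
      have "card N - card H1 < card N - card H"
        using psubset_card_mono[OF finH1 H1(2)] card_mono[OF finN H1(3)] by linarith
      moreover have "D \<subseteq> H1" using less.prems H1 by auto
      ultimately obtain n where "card N = q ^ n * card H1" using less.hyps H1 by blast
      thus ?thesis using H1(4) i by (intro exI[of _ "n + i"]) (simp add: power_add)
    qed
  qed
  thus ?thesis using N by blast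
qed

text \<open>The working form of a Frobenius group: a nontrivial complement acting without fixed
  points on a nontrivial normal subgroup. \<open>frobenius_group_of_complement\<close> derives it
  from the definition by conjugates.\<close>

locale frobenius_group = group G for G (structure) +
  fixes K L :: "'a set"
  assumes finG: "finite (carrier G)"
    and K_normal: "K \<lhd> G"
    and L_sub: "subgroup L G"
    and KL: "carrier G = K <#> L"
    and KL_trivial: "K \<inter> L = {\<one>}"
    and fixed_point_free: "\<And>k l. k \<in> K \<Longrightarrow> l \<in> L \<Longrightarrow> k \<otimes> l = l \<otimes> k \<Longrightarrow> k = \<one> \<or> l = \<one>"
    and L_nontrivial: "L \<noteq> {\<one>}"
    and K_nontrivial: "K \<noteq> {\<one>}"
begin

section \<open>Fixed-point-free action of the complement on sections of the kernel\<close>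

lemma K_sub: "subgroup K G" using K_normal by (rule normal_imp_subgroup)

lemma K_car [simp]: "x \<in> K \<Longrightarrow> x \<in> carrier G" using K_sub by (rule subgroup.mem_carrier)
lemma L_car [simp]: "x \<in> L \<Longrightarrow> x \<in> carrier G" using L_sub by (rule subgroup.mem_carrier)

lemma finite_sub: "subgroup N G \<Longrightarrow> finite N" using finG finite_subset subgroup.subset by blast

lemma card_sub_pos: "subgroup N G \<Longrightarrow> card N > 0"
  using finite_sub by (metis card_gt_0_iff empty_iff subgroup.one_closed)

lemma normal_gconj: "N \<lhd> G \<Longrightarrow> g \<in> carrier G \<Longrightarrow> x \<in> N \<Longrightarrow> gconj G g x \<in> N"
  unfolding gconj_def by (rule normal.inv_op_closed2)

lemma gconj_K [simp]: "g \<in> carrier G \<Longrightarrow> x \<in> K \<Longrightarrow> gconj G g x \<in> K"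
  using normal_gconj[OF K_normal] .

lemma normal_gconj_iff:
  assumes "N \<lhd> G" "g \<in> carrier G" "x \<in> carrier G"
  shows "gconj G g x \<in> N \<longleftrightarrow> x \<in> N"
proof
  assume "gconj G g x \<in> N"
  hence "gconj G (inv g) (gconj G g x) \<in> N" using assms normal_gconj by simp
  thus "x \<in> N" using assms by (simp add: gconj_gconj)
qed (use assms normal_gconj in simp)

lemma KL_E: "g \<in> carrier G \<Longrightarrow> \<exists>k\<in>K. \<exists>l\<in>L. g = k \<otimes> l"
  using KL by (auto simp: set_mult_def)

lemma KL_bij: "bij_betw (\<lambda>(l,k). k \<otimes> l) (L \<times> K) (carrier G)"
proof (rule bij_betw_imageI)
  show "inj_on (\<lambda>(l,k). k \<otimes> l) (L \<times> K)"
  proof (rule inj_onI, clarsimp)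
    fix l k l' k' assume a: "l \<in> L" "k \<in> K" "l' \<in> L" "k' \<in> K" "k \<otimes> l = k' \<otimes> l'"
    have "inv k' \<otimes> k = inv k' \<otimes> (k \<otimes> l) \<otimes> inv l" using a(1-4) by (simp add: grp_simps)
    also have "\<dots> = l' \<otimes> inv l" unfolding a(5) using a(1-4) by (simp add: grp_simps)
    finally have e: "inv k' \<otimes> k = l' \<otimes> inv l" .
    moreover have "inv k' \<otimes> k \<in> K" using a K_sub by (simp add: subgroup.m_closed subgroup.m_inv_closed)
    moreover have "l' \<otimes> inv l \<in> L" using a L_sub by (simp add: subgroup.m_closed subgroup.m_inv_closed)
    ultimately have "inv k' \<otimes> k = \<one>" using KL_trivial by auto
    hence "k = k'" using a by (metis K_car inv_equality inv_inv inv_closed)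
    thus "l = l' \<and> k = k'" using a by simp
  qed
  show "(\<lambda>(l,k). k \<otimes> l) ` (L \<times> K) = carrier G"
  proof (intro equalityI subsetI)
    fix g assume "g \<in> carrier G"
    then obtain k l where "k \<in> K" "l \<in> L" "g = k \<otimes> l" using KL_E by blast
    thus "g \<in> (\<lambda>(l,k). k \<otimes> l) ` (L \<times> K)" by (intro image_eqI[of _ _ "(l,k)"]) auto
  qed auto
qed

lemma card_G: "card (carrier G) = card L * card K"
  using bij_betw_same_card[OF KL_bij] by (simp add: card_cartesian_product)

lemma induced_KL:
  assumes "x \<in> carrier G"
  shows "induced G \<psi> x = (\<Sum>l\<in>L. \<Sum>k\<in>K. \<psi> (gconj G k (gconj G l x)))"
proof -
  have "induced G \<psi> x = (\<Sum>p\<in>L \<times> K. \<psi> (gconj G ((\<lambda>(l,k). k \<otimes> l) p) x))"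
    unfolding induced_def by (rule sum.reindex_bij_betw[OF KL_bij, symmetric])
  also have "\<dots> = (\<Sum>(l,k)\<in>L \<times> K. \<psi> (gconj G k (gconj G l x)))"
    using assms by (intro sum.cong) (auto simp: gconj_gconj)
  finally show ?thesis by (simp add: sum.cartesian_product)
qed

text \<open>Equal values at \<open>x\<close> and \<open>y\<close> make
  \<open>y \<otimes> inv x\<close> commute with \<open>l\<close>, so the map is injective, and
  finiteness makes it bijective.\<close>

lemma fpf_bij:
  assumes N: "subgroup N G" "N \<subseteq> K" and l: "l \<in> L" "l \<noteq> \<one>" and inv: "\<And>x. x \<in> N \<Longrightarrow> gconj G l x \<in> N"
  shows "bij_betw (\<lambda>x. inv x \<otimes> gconj G l x) N N"
proof -
  have NK: "x \<in> K" "x \<in> carrier G" if "x \<in> N" for x using that N by auto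
  have inj: "inj_on (\<lambda>x. inv x \<otimes> gconj G l x) N"
  proof (rule inj_onI)
    fix x y assume xy: "x \<in> N" "y \<in> N" and e: "inv x \<otimes> gconj G l x = inv y \<otimes> gconj G l y"
    have "y \<otimes> inv x \<otimes> gconj G l x = gconj G l y"
      using e xy NK l by (metis L_car cancel_inv_left gconj_closed inv_closed m_assoc)
    hence "y \<otimes> inv x = gconj G l y \<otimes> inv (gconj G l x)" using xy NK l
      by (metis L_car gconj_closed inv_closed inv_solve_right m_closed)
    also have "\<dots> = gconj G l (y \<otimes> inv x)" using xy NK l by (simp add: gconj_mult gconj_inv)
    finally have c: "(y \<otimes> inv x) \<otimes> l = l \<otimes> (y \<otimes> inv x)"
      using xy NK l by (metis L_car gconj_def inv_closed inv_solve_right m_closed)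
    have "y \<otimes> inv x \<in> K" using xy NK K_sub by (simp add: subgroup.m_closed subgroup.m_inv_closed)
    hence "y \<otimes> inv x = \<one>" using fixed_point_free[OF _ l(1) c] l(2) by simp
    thus "x = y" using xy NK by (metis inv_equality inv_inv inv_closed)
  qed
  moreover have "(\<lambda>x. inv x \<otimes> gconj G l x) ` N \<subseteq> N"
    using inv N by (auto simp: subgroup.m_closed subgroup.m_inv_closed)
  ultimately have "(\<lambda>x. inv x \<otimes> gconj G l x) ` N = N"
    using finite_sub[OF N(1)] by (metis card_image card_subset_eq)
  thus ?thesis using inj by (simp add: bij_betw_def)
qed

text \<open>The element \<open>inv x \<otimes> gconj G l x\<close> of \<open>D\<close> is also the
  value of the same map at some \<open>d\<close> in \<open>D\<close>; injectivity on all of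
  \<open>K\<close> gives \<open>x = d\<close>. Thus \<open>l\<close> has no nontrivial fixed coset
  in a section either.\<close>

lemma fpf_section:
  assumes N: "subgroup N G" "N \<subseteq> K" and D: "D \<lhd> G" "D \<subseteq> N"
    and l: "l \<in> L" "l \<noteq> \<one>" and x: "x \<in> N" "gconj G l x \<in> N" "inv x \<otimes> gconj G l x \<in> D"
  shows "x \<in> D"
proof -
  have Ds: "subgroup D G" using D by (simp add: normal_imp_subgroup)
  have b: "bij_betw (\<lambda>x. inv x \<otimes> gconj G l x) D D"
    by (rule fpf_bij[OF Ds _ l]) (use D N l normal_gconj in auto)
  then obtain d where d: "d \<in> D" "inv x \<otimes> gconj G l x = inv d \<otimes> gconj G l d"
    using x(3) by (metis (no_types, lifting) bij_betw_iff_bijections)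
  have "inj_on (\<lambda>x. inv x \<otimes> gconj G l x) K"
    using fpf_bij[OF K_sub _ l] l by (simp add: bij_betw_def)
  hence "x = d" using d x D N by (auto dest: inj_onD)
  thus ?thesis using d by simp
qed

text \<open>Every element of \<open>N\<close> has the form
  \<open>inv y \<otimes> gconj G l y\<close>, and an \<open>l\<close>-invariant character is trivial
  on such elements.\<close>

lemma lin_fpf:
  assumes N: "N \<lhd> G" "N \<subseteq> K" and lam: "\<nu> \<in> lin G N D" and l: "l \<in> L" "l \<noteq> \<one>"
    and inv: "\<And>x. x \<in> N \<Longrightarrow> \<nu> (gconj G l x) = \<nu> x" and x: "x \<in> N"
  shows "\<nu> x = 1"
proof -
  have Ns: "subgroup N G" using N by (simp add: normal_imp_subgroup)
  have b: "bij_betw (\<lambda>x. inv x \<otimes> gconj G l x) N N"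
    by (rule fpf_bij[OF Ns N(2) l]) (use N l normal_gconj in auto)
  then obtain y where y: "y \<in> N" "x = inv y \<otimes> gconj G l y"
    using x by (metis (no_types, lifting) bij_betw_iff_bijections)
  have "gconj G l y \<in> N" using y N l normal_gconj by auto
  hence "\<nu> x = \<nu> (inv y) * \<nu> (gconj G l y)" unfolding y(2)
    using lin_mult[OF lam] y(1) Ns by (simp add: subgroup.m_inv_closed)
  thus ?thesis using lin_inv[OF Ns lam y(1)] inv[OF y(1)] lin_nonzero[OF lam y(1)] by simp
qed

text \<open>\<open>L\<close> permutes the nontrivial cosets of \<open>D\<close> in \<open>N\<close>
  freely by \<open>fpf_section\<close>; an orbit, filled up to full cosets, therefore has
  \<open>card L * card D\<close> elements.\<close>

lemma L_orbit_inj: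
  assumes N: "N \<lhd> G" "N \<subseteq> K" and D: "D \<lhd> G" "D \<subseteq> N" and x: "x \<in> N" "x \<notin> D"
  shows "inj_on (\<lambda>(l,d). gconj G l x \<otimes> d) (L \<times> D)" "(\<lambda>(l,d). gconj G l x \<otimes> d) ` (L \<times> D) \<subseteq> N - D"
proof -
  have Ns: "subgroup N G" using N by (simp add: normal_imp_subgroup)
  have Ds: "subgroup D G" using D by (simp add: normal_imp_subgroup)
  have xc: "x \<in> carrier G" using x N by auto
  have dc: "d \<in> carrier G" if "d \<in> D" for d using that Ds by (simp add: subgroup.mem_carrier)
  show "inj_on (\<lambda>(l,d). gconj G l x \<otimes> d) (L \<times> D)"
  proof (rule inj_onI, clarsimp)
    fix l d l' d' assume a: "l \<in> L" "d \<in> D" "l' \<in> L" "d' \<in> D" "gconj G l x \<otimes> d = gconj G l' x \<otimes> d'"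
    define h where "h = inv l' \<otimes> l"
    have h: "h \<in> L" using a L_sub by (simp add: h_def subgroup.m_closed subgroup.m_inv_closed)
    have "gconj G l x = (gconj G l x \<otimes> d) \<otimes> inv d" using a(1-4) xc dc by (simp add: grp_simps)
    also have "\<dots> = gconj G l' x \<otimes> (d' \<otimes> inv d)" unfolding a(5) using a(1-4) xc dc by (simp add: grp_simps)
    finally have "gconj G (inv l') (gconj G l x) = gconj G (inv l') (gconj G l' x \<otimes> (d' \<otimes> inv d))" by simp
    hence "gconj G h x = x \<otimes> gconj G (inv l') (d' \<otimes> inv d)"
      using a(1-4) xc dc by (simp add: gconj_gconj h_def gconj_mult)
    hence "inv x \<otimes> gconj G h x = gconj G (inv l') (d' \<otimes> inv d)" using a xc dc by (simp add: inv_cancel_left)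
    moreover have "gconj G (inv l') (d' \<otimes> inv d) \<in> D"
      using a Ds D by (simp add: normal_gconj subgroup.m_closed subgroup.m_inv_closed)
    ultimately have "inv x \<otimes> gconj G h x \<in> D" by simp
    hence "h = \<one>" using fpf_section[OF Ns N(2) D h] x h normal_gconj[OF N(1)] by auto
    hence "l = l'" using a unfolding h_def by (metis L_car inv_equality inv_inv inv_closed)
    thus "l = l' \<and> d = d'" using a xc dc by simp
  qed
  show "(\<lambda>(l,d). gconj G l x \<otimes> d) ` (L \<times> D) \<subseteq> N - D"
  proof clarsimp
    fix l d assume a: "l \<in> L" "d \<in> D"
    have c1: "gconj G l x \<in> N" using a x normal_gconj[OF N(1)] by simp
    have c2: "gconj G l x \<notin> D" using a x normal_gconj_iff[OF D(1) _ xc] by simp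
    have "gconj G l x \<otimes> d \<in> N" using c1 a D Ns by (auto simp: subgroup.m_closed)
    moreover have "gconj G l x \<otimes> d \<notin> D"
    proof
      assume "gconj G l x \<otimes> d \<in> D"
      hence "(gconj G l x \<otimes> d) \<otimes> inv d \<in> D" using a Ds by (simp add: subgroup.m_closed subgroup.m_inv_closed)
      thus False using c2 a dc xc by (simp add: m_assoc)
    qed
    ultimately show "gconj G l x \<otimes> d \<in> N \<and> gconj G l x \<otimes> d \<notin> D" by simp
  qed
qed

lemma card_L_bound:
  assumes N: "N \<lhd> G" "N \<subseteq> K" and D: "D \<lhd> G" "D \<subset> N"
  shows "(card L + 1) * card D \<le> card N"
proof -
  obtain x where x: "x \<in> N" "x \<notin> D" using D by auto
  have f: "finite N" "finite D" using finite_sub N D by (auto simp: normal_imp_subgroup)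
  have "card L * card D \<le> card (N - D)"
    using card_inj_on_le[OF L_orbit_inj[OF N D(1) _ x]] f D by (auto simp: card_cartesian_product)
  also have "\<dots> = card N - card D" using f D by (simp add: card_Diff_subset psubset_imp_subset)
  finally show ?thesis using card_mono[OF f(1) psubset_imp_subset[OF D(2)]] by simp
qed

text \<open>In the extremal case of \<open>card_L_bound\<close> a single orbit of cosets fills
  \<open>N - D\<close>.\<close>

lemma L_orbit_surj:
  assumes N: "N \<lhd> G" "N \<subseteq> K" and D: "D \<lhd> G" "D \<subseteq> N" and x: "x \<in> N" "x \<notin> D"
    and c: "(card L + 1) * card D = card N" and y: "y \<in> N" "y \<notin> D"
  shows "\<exists>l\<in>L. \<exists>d\<in>D. y = gconj G l x \<otimes> d"
proof -
  have f: "finite N" "finite D" using finite_sub N D by (auto simp: normal_imp_subgroup)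
  have "card (N - D) = card L * card D" using f D c by (simp add: card_Diff_subset)
  hence "(\<lambda>(l,d). gconj G l x \<otimes> d) ` (L \<times> D) = N - D"
    using L_orbit_inj[OF N D x] f by (intro card_subset_eq) (auto simp: card_image card_cartesian_product)
  hence "y \<in> (\<lambda>(l,d). gconj G l x \<otimes> d) ` (L \<times> D)" using y by simp
  thus ?thesis by auto
qed

end

text \<open>The conjugate of a character, again extended by zero outside \<open>N\<close>.\<close>

definition twist :: "('a, 'b) monoid_scheme \<Rightarrow> 'a set \<Rightarrow> 'a \<Rightarrow> ('a \<Rightarrow> complex) \<Rightarrow> 'a \<Rightarrow> complex" where
  "twist G N g \<psi> x = (if x \<in> N then \<psi> (gconj G g x) else 0)"

section \<open>Products of conjugates and the averaging argument\<close>

lemma (in group) abelian_section_derived: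
  assumes "subgroup N G" shows "abelian_section G N (derived G N)"
  unfolding abelian_section_def
proof (intro conjI ballI)
  show "subgroup (derived G N) G" using derived_is_subgroup assms by (simp add: subgroup.subset)
  show "derived G N \<subseteq> N" using derived_incl[OF _ assms] by simp
  fix x y assume "x \<in> N" "y \<in> N"
  thus "gcomm G x y \<in> derived G N" unfolding gcomm_def derived_def by (intro generate.incl) auto
qed (rule assms)

text \<open>Characters separate the elements of an abelian section. Membership in \<open>D\<close>
  is tested in this way from here on, instead of calculating in a quotient.\<close>

lemma (in group) lin_section_mult:
  assumes fin: "finite (carrier G)" and sec: "abelian_section G N D" and x: "x \<in> N"
    and e: "\<And>\<psi>. \<psi> \<in> lin G N D \<Longrightarrow> \<psi> x = 1"
  shows "x \<in> D"
proof (rule ccontr)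
  assume "x \<notin> D"
  then obtain \<psi> where "\<psi> \<in> lin G N D" "\<psi> x \<noteq> 1"
    using lin_separates[OF fin sec _ order_refl _ x] sec unfolding abelian_section_def by metis
  thus False using e by simp
qed

lemma (in group) lin_gcomm_kernel:
  assumes N: "subgroup N G" and psi: "\<psi> \<in> lin G N D" and x: "x \<in> N" "y \<in> N"
  shows "\<psi> (gcomm G x y) = 1"
  unfolding gcomm_def using N x lin_mult[OF psi] lin_inv[OF N psi] lin_nonzero[OF psi x(1)] lin_nonzero[OF psi x(2)]
  by (simp add: subgroup.m_closed subgroup.m_inv_closed field_simps)

lemma (in group) lin_derived:
  assumes N: "subgroup N G" and psi: "\<psi> \<in> lin G N {}"
  shows "\<psi> \<in> lin G N (derived G N)"
proof -
  have Nc: "N \<subseteq> carrier G" using N by (rule subgroup.subset)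
  have "\<psi> x = 1" if "x \<in> generate G (derived_set G N)" for x
    using that
  proof (induction rule: generate.induct)
    case one thus ?case using lin_one[OF N psi] by simp
  next
    case (incl h)
    thus ?case using lin_gcomm_kernel[OF N psi] by (auto simp: gcomm_def)
  next
    case (inv h)
    then obtain a b where ab: "a \<in> N" "b \<in> N" "h = gcomm G a b" by (auto simp: gcomm_def)
    have "inv h = gcomm G b a" using gcomm_inv[of a b] ab Nc by auto
    thus ?case using lin_gcomm_kernel[OF N psi ab(2,1)] by simp
  next
    case (eng a b)
    have "generate G (derived_set G N) \<subseteq> N" using derived_incl[OF _ N, of N] by (simp add: derived_def)
    thus ?case using eng lin_mult[OF psi, of a b] by auto
  qed
  thus ?thesis using psi by (auto simp: lin_def derived_def)
qed

context frobenius_group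
begin

lemma lin_twist:
  assumes N: "N \<lhd> G" and psi: "\<psi> \<in> lin G N D" and g: "g \<in> carrier G"
    and D: "\<And>d. d \<in> D \<Longrightarrow> d \<in> N \<and> gconj G g d \<in> D"
  shows "twist G N g \<psi> \<in> lin G N D"
proof -
  have Ns: "subgroup N G" using N by (simp add: normal_imp_subgroup)
  have Nc: "x \<in> carrier G" if "x \<in> N" for x using that Ns by (simp add: subgroup.mem_carrier)
  show ?thesis using psi normal_gconj[OF N g] D
    unfolding lin_def twist_def by (auto simp: subgroup.m_closed[OF Ns] gconj_mult Nc g)
qed

text \<open>This replaces a product in the abelian section: the \<open>F i\<close> are multiplied in
  some order, which no linear character can see.\<close>

lemma finprod_lin:
  assumes N: "subgroup N G" and I: "finite I" and F: "\<And>i. i \<in> I \<Longrightarrow> F i \<in> N"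
  shows "\<exists>s\<in>N. \<forall>\<psi>\<in>lin G N D. \<psi> s = (\<Prod>i\<in>I. \<psi> (F i))"
  using I F
proof (induction I rule: finite_induct)
  case empty
  show ?case using lin_one[OF N] subgroup.one_closed[OF N] by (intro bexI[of _ \<one>]) auto
next
  case (insert i I)
  then obtain s where s: "s \<in> N" "\<forall>\<psi>\<in>lin G N D. \<psi> s = (\<Prod>i\<in>I. \<psi> (F i))" by auto
  show ?case using insert s lin_mult[of _ N D] subgroup.m_closed[OF N]
    by (intro bexI[of _ "F i \<otimes> s"]) auto
qed

lemma L_transitive_bij:
  assumes "h \<in> L" shows "bij_betw (\<lambda>l. h \<otimes> l) L L"
proof (rule bij_betwI[where g="\<lambda>a. inv h \<otimes> a"])
  show "(\<lambda>a. h \<otimes> a) \<in> L \<rightarrow> L" "(\<lambda>a. inv h \<otimes> a) \<in> L \<rightarrow> L"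
    using assms L_sub by (auto simp: subgroup.m_closed subgroup.m_inv_closed)
qed (use assms in \<open>auto simp: inv_cancel_left cancel_inv_left\<close>)

text \<open>The product over a conjugate of \<open>L\<close> is fixed by that conjugate, hence trivial in every section of \<open>K\<close>.\<close>
lemma prod_conj_L:
  assumes N: "N \<lhd> G" "N \<subseteq> K" and D: "D \<lhd> G" "D \<subseteq> N" and sec: "abelian_section G N D"
    and psi: "\<psi> \<in> lin G N D" and x: "x \<in> K" and v: "v \<in> N"
  shows "(\<Prod>l\<in>L. \<psi> (gconj G (gconj G x l) v)) = 1"
proof -
  have Ns: "subgroup N G" and Ds: "subgroup D G" using N D by (auto simp: normal_imp_subgroup)
  have Nc: "y \<in> carrier G" if "y \<in> N" for y using that Ns by (simp add: subgroup.mem_carrier)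
  have xc: "x \<in> carrier G" and vc: "v \<in> carrier G" using x v Nc by auto
  have clos: "gconj G g y \<in> N" if "g \<in> carrier G" "y \<in> N" for g y using that N normal_gconj by simp
  have Fc: "gconj G (gconj G x l) v \<in> N" if "l \<in> L" for l using that v xc clos by simp
  obtain s where s: "s \<in> N" and sp: "\<And>\<psi>. \<psi> \<in> lin G N D \<Longrightarrow> \<psi> s = (\<Prod>l\<in>L. \<psi> (gconj G (gconj G x l) v))"
    using finprod_lin[OF Ns finite_sub[OF L_sub], of "\<lambda>l. gconj G (gconj G x l) v"] Fc by blast
  have fixd: "\<phi> (gconj G (gconj G x h) s) = \<phi> s" if phi: "\<phi> \<in> lin G N D" and h: "h \<in> L" for \<phi> h
  proof -
    let ?h = "gconj G x h"
    have hc: "?h \<in> carrier G" using h xc by simp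
    have tw: "twist G N ?h \<phi> \<in> lin G N D"
      by (rule lin_twist[OF N(1) phi hc]) (use D normal_gconj[OF D(1) hc] in auto)
    have "\<phi> (gconj G ?h s) = twist G N ?h \<phi> s" using s by (simp add: twist_def)
    also have "\<dots> = (\<Prod>l\<in>L. \<phi> (gconj G ?h (gconj G (gconj G x l) v)))"
      using sp[OF tw] Fc by (simp add: twist_def)
    also have "\<dots> = (\<Prod>l\<in>L. \<phi> (gconj G (gconj G x (h \<otimes> l)) v))"
      using h xc vc by (intro prod.cong) (auto simp: gconj_gconj gconj_mult)
    also have "\<dots> = (\<Prod>l\<in>L. \<phi> (gconj G (gconj G x l) v))"
      by (rule prod.reindex_bij_betw[OF L_transitive_bij[OF h]])
    finally show ?thesis using sp[OF phi] by simp
  qed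
  obtain h where h: "h \<in> L" "h \<noteq> \<one>" using L_nontrivial L_sub subgroup.one_closed by blast
  \<comment> \<open>Undoing the conjugation by \<open>x\<close> turns a fixed coset of the conjugate
    of \<open>h\<close> into one of \<open>h\<close>, to which \<open>fpf_section\<close>
    applies.\<close>
  define y where "y = gconj G (inv x) s"
  have y: "y \<in> N" using clos xc s by (simp add: y_def)
  have sy: "s = gconj G x y" using xc s Nc by (simp add: y_def gconj_gconj)
  have "inv s \<otimes> gconj G (gconj G x h) s \<in> D"
  proof (rule lin_section_mult[OF finG sec])
    have c: "gconj G (gconj G x h) s \<in> N" using clos s h xc by simp
    thus "inv s \<otimes> gconj G (gconj G x h) s \<in> N" using s Ns by (simp add: subgroup.m_closed subgroup.m_inv_closed)
    fix \<phi> assume phi: "\<phi> \<in> lin G N D"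
    show "\<phi> (inv s \<otimes> gconj G (gconj G x h) s) = 1"
      using lin_mult[OF phi _ c, of "inv s"] lin_inv[OF Ns phi s] fixd[OF phi h(1)] lin_nonzero[OF phi s] Ns s
      by (simp add: subgroup.m_inv_closed)
  qed
  moreover have "inv s \<otimes> gconj G (gconj G x h) s = gconj G x (inv y \<otimes> gconj G h y)"
    unfolding sy using xc y h Nc by (simp add: gconj_def grp_simps)
  ultimately have "inv y \<otimes> gconj G h y \<in> D"
    using normal_gconj_iff[OF D(1) xc, of "inv y \<otimes> gconj G h y"] y h Nc by simp
  hence "y \<in> D" using fpf_section[OF Ns N(2) D h y clos[OF _ y]] h by simp
  hence "s \<in> D" unfolding sy using normal_gconj[OF D(1) xc] by simp
  thus ?thesis using sp[OF psi] lin_trivial_on[OF psi] by simp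
qed

text \<open>The averaging argument behind the nilpotency of Frobenius kernels: \<open>G/N\<close> is partitioned by \<open>K/N\<close> and the
  conjugates of \<open>L\<close>, and every conjugate of \<open>L\<close> has trivial fixed points on the section \<open>N/D\<close>.\<close>
lemma power_index_central:
  assumes N: "N \<lhd> G" "N \<subseteq> K" and D: "D \<lhd> G" "D \<subseteq> N" and sec: "abelian_section G N D"
    and m: "m * card N = card K" and v: "v \<in> N" and k: "k \<in> K"
  shows "gcomm G k (v [^] m) \<in> D"
proof -
  have Ns: "subgroup N G" and Ds: "subgroup D G" using N D by (auto simp: normal_imp_subgroup)
  have Nc: "y \<in> carrier G" if "y \<in> N" for y using that Ns by (simp add: subgroup.mem_carrier)
  have clos: "gconj G g y \<in> N" if "g \<in> carrier G" "y \<in> N" for g y using that N normal_gconj by simp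
  interpret KK: group "G\<lparr>carrier := K\<rparr>" using K_sub by (rule subgroup.subgroup_is_group) (rule is_group)
  have NK: "subgroup N (G\<lparr>carrier := K\<rparr>)" using Ns N(2) K_sub by (simp add: subgroup_incl)
  have "finite (carrier (G\<lparr>carrier := K\<rparr>))" using finite_sub[OF K_sub] by simp
  from KK.transversal_exists[OF this NK] obtain n t where tr0: "transversal (G\<lparr>carrier := K\<rparr>) N t n" .
  have "n * card N = card K" using tr0 by (simp add: transversal_def)
  hence nm: "n = m" using m card_sub_pos[OF Ns] by (metis less_numeral_extra(3) mult_right_cancel)
  have tK: "t i \<in> K" if "i < m" for i using tr0 that nm by (simp add: transversal_def)
  have tinv: "inv\<^bsub>G\<lparr>carrier := K\<rparr>\<^esub> (t i) = inv (t i)" if "i < m" for i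
    using m_inv_consistent[OF K_sub tK[OF that]] .
  have ex1: "\<exists>!i. i < m \<and> g \<otimes> inv (t i) \<in> N" if "g \<in> K" for g
  proof -
    have "\<exists>!i. i < m \<and> g \<otimes> inv\<^bsub>G\<lparr>carrier := K\<rparr>\<^esub> (t i) \<in> N" using tr0 that nm by (simp add: transversal_def)
    thus ?thesis using tinv by (metis (no_types, lifting))
  qed
  define ix where "ix g = (THE i. i < m \<and> g \<otimes> inv (t i) \<in> N)" for g
  have ix: "ix g < m" "g \<otimes> inv (t (ix g)) \<in> N" if "g \<in> K" for g
    using theI'[OF ex1[OF that]] by (auto simp: ix_def)
  have ixu: "i = j" if "t i \<otimes> inv (t j) \<in> N" "i < m" "j < m" for i j
  proof -
    have "t i \<otimes> inv (t i) \<in> N" using tK[OF that(2)] Ns by (simp add: subgroup.one_closed)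
    thus ?thesis using ex1[OF tK[OF that(2)]] that by blast
  qed
  have via: "\<psi> (gconj G g u) = \<psi> (gconj G (t (ix g)) u)" if psi: "\<psi> \<in> lin G N D" and "g \<in> K" "u \<in> N" for \<psi> g u
  proof -
    let ?a = "g \<otimes> inv (t (ix g))"
    have "gconj G g u = gconj G ?a (gconj G (t (ix g)) u)"
      using that ix[OF that(2)] tK Nc by (simp add: gconj_gconj m_assoc)
    thus ?thesis using lin_gconj[OF Ns psi ix(2)[OF that(2)]] tK ix[OF that(2)] Nc that by simp
  qed
  \<comment> \<open>The product over representatives of the cosets of \<open>N\<close> in
    \<open>K\<close> does not depend on the representatives, because conjugation by \<open>N\<close>
    does not affect characters of \<open>N\<close>.\<close>
  have perm: "(\<Prod>i<m. \<psi> (gconj G (f i) u)) = (\<Prod>i<m. \<psi> (gconj G (t i) u))"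
    if psi: "\<psi> \<in> lin G N D" and u: "u \<in> N" and fK: "\<And>i. i < m \<Longrightarrow> f i \<in> K"
      and finj: "\<And>i j. i < m \<Longrightarrow> j < m \<Longrightarrow> f i \<otimes> inv (f j) \<in> N \<Longrightarrow> i = j" for \<psi> u f
  proof -
    have inj: "inj_on (\<lambda>i. ix (f i)) {..<m}"
    proof (rule inj_onI)
      fix i j assume ij: "i \<in> {..<m}" "j \<in> {..<m}" "ix (f i) = ix (f j)"
      let ?t = "t (ix (f i))"
      have a: "f i \<otimes> inv ?t \<in> N" "f j \<otimes> inv ?t \<in> N" using ix fK ij by (metis lessThan_iff)+
      hence "(f i \<otimes> inv ?t) \<otimes> inv (f j \<otimes> inv ?t) \<in> N" using Ns by (simp add: subgroup.m_closed subgroup.m_inv_closed)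
      moreover have "(f i \<otimes> inv ?t) \<otimes> inv (f j \<otimes> inv ?t) = f i \<otimes> inv (f j)"
        using fK ij tK ix by (simp add: grp_simps)
      ultimately show "i = j" using finj ij by simp
    qed
    have img: "(\<lambda>i. ix (f i)) ` {..<m} = {..<m}"
    proof (rule card_subset_eq)
      show "(\<lambda>i. ix (f i)) ` {..<m} \<subseteq> {..<m}" using ix fK by auto
      show "card ((\<lambda>i. ix (f i)) ` {..<m}) = card {..<m}" using inj by (rule card_image)
    qed simp
    hence bij: "bij_betw (\<lambda>i. ix (f i)) {..<m} {..<m}" using inj by (simp add: bij_betw_def)
    have "(\<Prod>i<m. \<psi> (gconj G (f i) u)) = (\<Prod>i<m. \<psi> (gconj G (t (ix (f i))) u))"
      using via[OF psi] fK u by (intro prod.cong) auto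
    also have "\<dots> = (\<Prod>i<m. \<psi> (gconj G (t i) u))"
      by (rule prod.reindex_bij_betw[OF bij, of "\<lambda>i. \<psi> (gconj G (t i) u)"])
    finally show ?thesis .
  qed
  have finL: "finite L" using finite_sub[OF L_sub] .
  \<comment> \<open>The relations for all conjugates of \<open>L\<close> by the representatives are
    multiplied. The identity of \<open>L\<close> contributes \<open>\<psi> v ^ m\<close>, every
    other \<open>l\<close> a norm over \<open>K/N\<close>.\<close>
  have main: "\<psi> v ^ m * (\<Prod>l\<in>L - {\<one>}. \<Prod>i<m. \<psi> (gconj G (t i) (gconj G l v))) = 1"
    if psi: "\<psi> \<in> lin G N D" for \<psi>
  proof -
    have "1 = (\<Prod>i<m. \<Prod>l\<in>L. \<psi> (gconj G (gconj G (t i) l) v))"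
      using prod_conj_L[OF N D sec psi tK v] by simp
    also have "\<dots> = (\<Prod>l\<in>L. \<Prod>i<m. \<psi> (gconj G (gconj G (t i) l) v))" by (rule prod.swap)
    also have "\<dots> = (\<Prod>i<m. \<psi> (gconj G (gconj G (t i) \<one>) v)) *
        (\<Prod>l\<in>L - {\<one>}. \<Prod>i<m. \<psi> (gconj G (gconj G (t i) l) v))"
      using finL L_sub by (intro prod.remove) (auto simp: subgroup.one_closed)
    also have "(\<Prod>i<m. \<psi> (gconj G (gconj G (t i) \<one>) v)) = \<psi> v ^ m" using tK v Nc by simp
    also have "(\<Prod>l\<in>L - {\<one>}. \<Prod>i<m. \<psi> (gconj G (gconj G (t i) l) v)) =
        (\<Prod>l\<in>L - {\<one>}. \<Prod>i<m. \<psi> (gconj G (t i) (gconj G l v)))"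
    proof (rule prod.cong[OF refl])
      fix l assume l: "l \<in> L - {\<one>}"
      hence lc: "l \<in> L" "l \<noteq> \<one>" "l \<in> carrier G" by auto
      \<comment> \<open>The \<open>f i\<close> represent the cosets of \<open>N\<close> in
        \<open>K\<close> once more, because \<open>l\<close> fixes no nontrivial coset.\<close>
      define f where "f i = gconj G (t i) l \<otimes> inv l" for i
      have fe: "f i = t i \<otimes> gconj G l (inv (t i))" if "i < m" for i
        using tK[OF that] lc by (simp add: f_def gconj_def grp_simps)
      have fK: "f i \<in> K" if "i < m" for i
        using tK[OF that] lc K_sub unfolding fe[OF that] by (simp add: subgroup.m_closed subgroup.m_inv_closed)
      have "(\<Prod>i<m. \<psi> (gconj G (gconj G (t i) l) v)) = (\<Prod>i<m. \<psi> (gconj G (f i) (gconj G l v)))"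
        using tK lc v Nc by (intro prod.cong) (auto simp: f_def gconj_gconj m_assoc)
      also have "\<dots> = (\<Prod>i<m. \<psi> (gconj G (t i) (gconj G l v)))"
      proof (rule perm[OF psi _ fK])
        show "gconj G l v \<in> N" using clos lc v by simp
        fix i j assume ij: "i < m" "j < m" "f i \<otimes> inv (f j) \<in> N"
        have ti: "t i \<in> carrier G" "t j \<in> carrier G" "t i \<in> K" "t j \<in> K" using tK ij by auto
        define w where "w = inv (t i) \<otimes> t j"
        have w: "w \<in> K" using ti K_sub by (simp add: w_def subgroup.m_closed subgroup.m_inv_closed)
        have "gconj G (inv (t j)) (f i \<otimes> inv (f j)) \<in> N" using clos ij ti by simp
        moreover have "gconj G (inv (t j)) (f i \<otimes> inv (f j)) = inv w \<otimes> gconj G l w"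
          unfolding f_def w_def using ti lc by (simp add: gconj_def grp_simps)
        ultimately have "inv w \<otimes> gconj G l w \<in> N" by simp
        hence "w \<in> N" using fpf_section[OF K_sub order_refl N lc(1,2) w] w lc by simp
        hence "gconj G (t i) (inv w) \<in> N" using clos ti Ns by (simp add: subgroup.m_inv_closed)
        moreover have "gconj G (t i) (inv w) = t i \<otimes> inv (t j)" unfolding w_def using ti
          by (simp add: gconj_def grp_simps)
        ultimately have "t i \<otimes> inv (t j) \<in> N" by simp
        thus "i = j" using ixu ij by simp
      qed
      finally show "(\<Prod>i<m. \<psi> (gconj G (gconj G (t i) l) v)) = (\<Prod>i<m. \<psi> (gconj G (t i) (gconj G l v)))" .
    qed
    finally show ?thesis by simp
  qed
  have kc: "k \<in> carrier G" using k by simp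
  \<comment> \<open>Twisting by \<open>k\<close> only changes the representatives, so the norm
    factors are the same for both characters and cancel in the two instances of
    \<open>main\<close>.\<close>
  have key: "\<psi> (gconj G k v) ^ m = \<psi> v ^ m" if psi: "\<psi> \<in> lin G N D" for \<psi>
  proof -
    have tw: "twist G N k \<psi> \<in> lin G N D"
      by (rule lin_twist[OF N(1) psi kc]) (use D normal_gconj[OF D(1) kc] in auto)
    have e: "(\<Prod>i<m. twist G N k \<psi> (gconj G (t i) u)) = (\<Prod>i<m. \<psi> (gconj G (t i) u))" if u: "u \<in> N" for u
    proof -
      have "(\<Prod>i<m. twist G N k \<psi> (gconj G (t i) u)) = (\<Prod>i<m. \<psi> (gconj G (k \<otimes> t i) u))"
        using tK kc u clos Nc by (intro prod.cong) (auto simp: twist_def gconj_gconj)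
      also have "\<dots> = (\<Prod>i<m. \<psi> (gconj G (t i) u))"
      proof (rule perm[OF psi u])
        fix i assume "i < m" thus "k \<otimes> t i \<in> K" using k tK K_sub by (simp add: subgroup.m_closed)
      next
        fix i j assume ij: "i < m" "j < m" "k \<otimes> t i \<otimes> inv (k \<otimes> t j) \<in> N"
        have ti: "t i \<in> carrier G" "t j \<in> carrier G" using tK ij by auto
        have "gconj G (inv k) (k \<otimes> t i \<otimes> inv (k \<otimes> t j)) \<in> N" using clos kc ij by simp
        moreover have "gconj G (inv k) (k \<otimes> t i \<otimes> inv (k \<otimes> t j)) = t i \<otimes> inv (t j)"
          using kc ti by (simp add: gconj_def grp_simps)
        ultimately show "i = j" using ixu ij by simp
      qed
      finally show ?thesis .
    qed
    let ?P = "\<Prod>l\<in>L - {\<one>}. \<Prod>i<m. \<psi> (gconj G (t i) (gconj G l v))"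
    have "(\<Prod>l\<in>L - {\<one>}. \<Prod>i<m. twist G N k \<psi> (gconj G (t i) (gconj G l v))) = ?P"
      by (rule prod.cong[OF refl], rule e) (use clos v in auto)
    hence "\<psi> (gconj G k v) ^ m * ?P = 1" using main[OF tw] v by (simp add: twist_def)
    moreover have p1: "\<psi> v ^ m * ?P = 1" using main[OF psi] .
    moreover have "?P \<noteq> 0" using p1 by (metis mult_zero_right zero_neq_one)
    ultimately show ?thesis by (metis mult_right_cancel)
  qed
  have vm: "v [^] m \<in> N" using subgroup_nat_pow[OF Ns v] .
  have cm: "gcomm G k (v [^] m) = gconj G k (v [^] m) \<otimes> inv (v [^] m)" using kc v Nc by (simp add: gcomm_def gconj_def)
  show ?thesis
  proof (rule lin_section_mult[OF finG sec])
    show "gcomm G k (v [^] m) \<in> N" unfolding cm using clos kc vm Ns by (simp add: subgroup.m_closed subgroup.m_inv_closed)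
    fix \<psi> assume psi: "\<psi> \<in> lin G N D"
    have "\<psi> (gconj G k (v [^] m)) = \<psi> (v [^] m)"
      using key[OF psi] lin_pow[OF Ns psi] v clos kc Nc by (simp add: gconj_pow)
    thus "\<psi> (gcomm G k (v [^] m)) = 1" unfolding cm
      using lin_mult[OF psi] lin_inv[OF Ns psi vm] lin_nonzero[OF psi vm] clos kc vm Ns
      by (simp add: subgroup.m_inv_closed)
  qed
qed

end

subsection \<open>The kernel is a prime power group\<close>

locale frobenius_GC = frobenius_group +
  assumes gc: "GC_star G" and solv: "solvable G"
begin

lemma K_neq_G: "N \<subseteq> K \<Longrightarrow> N \<noteq> carrier G"
proof
  assume "N \<subseteq> K" "N = carrier G"
  hence "L \<subseteq> K" by auto
  hence "L = {\<one>}" using KL_trivial by auto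
  thus False using L_nontrivial by simp
qed

lemma derived_psubset:
  assumes N: "subgroup N G" "N \<noteq> {\<one>}"
  shows "derived G N \<subset> N"
proof -
  have sub: "derived G N \<subseteq> N" using derived_incl[OF _ N(1)] by simp
  have "derived G N \<noteq> N"
  proof
    assume e: "derived G N = N"
    obtain n where n: "(derived G ^^ n) (carrier G) = {\<one>}" using solv solvable_iff_trivial_derived_seq by blast
    have "(derived G ^^ n) N = N" by (induction n) (auto simp: e)
    hence "N \<subseteq> {\<one>}" using mono_exp_of_derived[OF subgroup.subset[OF N(1)], of n] n by simp
    thus False using N subgroup.one_closed[OF N(1)] by auto
  qed
  thus ?thesis using sub by auto
qed

text \<open>Up to a factor in \<open>K\<close>, an element outside \<open>K\<close> conjugates
  characters of \<open>K\<close> like some \<open>l \<noteq> \<one>\<close>, and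
  \<open>lin_fpf\<close> excludes invariant nontrivial characters.\<close>

lemma mackey_K:
  assumes lam: "\<nu> \<in> lin G K {}" and x: "x \<in> K" "\<nu> x \<noteq> 1"
  shows "mackey G K \<nu>"
  unfolding mackey_def
proof (intro conjI ballI)
  fix g assume g: "g \<in> carrier G - K"
  then obtain k l where kl: "k \<in> K" "l \<in> L" "g = k \<otimes> l" using KL_E by blast
  have "l \<noteq> \<one>" using g kl by auto
  hence "\<not> (\<forall>h\<in>K. \<nu> (gconj G l h) = \<nu> h)" using lin_fpf[OF K_normal order_refl lam kl(2)] x by blast
  then obtain h where h: "h \<in> K" "\<nu> (gconj G l h) \<noteq> \<nu> h" by blast
  have "\<nu> (gconj G g h) = \<nu> (gconj G l h)"
    using lin_gconj[OF K_sub lam kl(1), of "gconj G l h"] kl h by (simp add: gconj_gconj)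
  thus "\<exists>h\<in>K. gconj G g h \<in> K \<and> \<nu> (gconj G g h) \<noteq> \<nu> h"
    using h g by (intro bexI[of _ h]) auto
qed (use K_sub lam in auto)

lemma induced_K:
  assumes psi: "\<psi> \<in> lin G K {}" and x: "x \<in> K"
  shows "induced G \<psi> x = of_nat (card K) * (\<Sum>l\<in>L. \<psi> (gconj G l x))"
proof -
  have "induced G \<psi> x = (\<Sum>l\<in>L. \<Sum>k\<in>K. \<psi> (gconj G l x))"
    unfolding induced_KL[OF K_car[OF x]] using lin_gconj[OF K_sub psi] x by (intro sum.cong) auto
  thus ?thesis by (simp add: sum_distrib_left)
qed

text \<open>On \<open>K\<close> both induced characters are sums of \<open>L\<close>-conjugates of
  linear characters; independence finds in one sum a term equal to \<open>\<mu>\<close> from the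
  other.\<close>

lemma lin_K_conjugate:
  assumes lam: "\<nu> \<in> lin G K {}" and x: "x \<in> K" "\<nu> x \<noteq> 1"
    and mu: "\<mu> \<in> lin G K {}" and y: "y \<in> K" "\<mu> y \<noteq> 1"
  shows "\<exists>j>0. coprime j (card (carrier G)) \<and> (\<exists>l\<in>L. \<forall>x\<in>K. \<mu> x = \<nu> (gconj G l x) ^ j)"
proof -
  obtain j where j: "j > 0" "coprime j (card (carrier G))"
    and e: "\<And>g. g \<in> carrier G \<Longrightarrow> induced G \<mu> g = induced G (\<lambda>x. \<nu> x ^ j) g"
    using GC_star_induced[OF finG gc mackey_K[OF lam x] mackey_K[OF mu y] refl K_neq_G[OF order_refl]] by blast
  have pj: "(\<lambda>x. \<nu> x ^ j) \<in> lin G K {}" by (rule lin_power[OF lam j(1)])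
  have cK: "card K \<noteq> 0" using card_sub_pos[OF K_sub] by simp
  have "\<exists>l\<in>L. twist G K l (\<lambda>x. \<nu> x ^ j) = twist G K \<one> \<mu>"
  proof (rule lin_sums_match[OF K_sub finite_sub[OF K_sub] finite_sub[OF L_sub] finite_sub[OF L_sub]])
    fix l assume "l \<in> L"
    thus "twist G K l (\<lambda>x. \<nu> x ^ j) \<in> lin G K {}" "twist G K l \<mu> \<in> lin G K {}"
      using lin_twist[OF K_normal pj] lin_twist[OF K_normal mu] by auto
  next
    fix x assume x: "x \<in> K"
    show "(\<Sum>l\<in>L. twist G K l (\<lambda>x. \<nu> x ^ j) x) = (\<Sum>l\<in>L. twist G K l \<mu> x)"
      using e[OF K_car[OF x]] x cK unfolding induced_K[OF mu x] induced_K[OF pj x] by (simp add: twist_def)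
  qed (rule subgroup.one_closed[OF L_sub])
  then obtain l where l: "l \<in> L" "twist G K l (\<lambda>x. \<nu> x ^ j) = twist G K \<one> \<mu>" by blast
  have "\<mu> x = \<nu> (gconj G l x) ^ j" if "x \<in> K" for x
    using fun_cong[OF l(2), of x] that by (simp add: twist_def)
  thus ?thesis using j l(1) by blast
qed

lemma derived_K_normal: "derived G K \<lhd> G" using derived_is_normal[OF K_normal] .

lemma sec_K: "abelian_section G K (derived G K)" by (rule abelian_section_derived[OF K_sub])

text \<open>Some power of a nontrivial character \<open>\<phi>\<close> of \<open>K/K'\<close> has
  prime order \<open>q\<close>. By \<open>lin_K_conjugate\<close> every other nontrivial character
  is conjugate to a power of it, so it has order \<open>q\<close> as well.\<close>

lemma exponent_prime: "\<exists>q. Factorial_Ring.prime (q::nat) \<and> (\<forall>x\<in>K. x [^] q \<in> derived G K)"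
proof -
  obtain x where x: "x \<in> K" "x \<notin> derived G K" using derived_psubset[OF K_sub K_nontrivial] by blast
  obtain \<phi> where phi: "\<phi> \<in> lin G K (derived G K)" "\<phi> x \<noteq> 1"
    using lin_separates[OF finG sec_K _ order_refl _ x] sec_K unfolding abelian_section_def by metis
  define P where "P r \<longleftrightarrow> r > 0 \<and> (\<forall>y\<in>K. \<phi> y ^ r = 1)" for r :: nat
  have "P (card K)" using lin_pow_card[OF K_sub phi(1)] card_sub_pos[OF K_sub] by (simp add: P_def)
  define r where "r = (LEAST r. P r)"
  have r: "P r" unfolding r_def by (rule LeastI[of P]) fact
  have rmin: "r \<le> s" if "P s" for s unfolding r_def using that by (rule Least_le)
  have "r \<noteq> 1" using r phi(2) x(1) by (auto simp: P_def)
  then obtain q where q: "Factorial_Ring.prime q" "q dvd r" using prime_factor_nat by blast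
  then obtain s where s: "r = q * s" by (auto elim: dvdE)
  have s0: "s > 0" using r s by (auto simp: P_def intro: gr0I)
  have "s < r" using s s0 prime_gt_1_nat[OF q(1)] by simp
  hence "\<not> P s" using rmin not_less by blast
  then obtain z where z: "z \<in> K" "\<phi> z ^ s \<noteq> 1" using s0 by (auto simp: P_def)
  have lam: "(\<lambda>x. \<phi> x ^ s) \<in> lin G K {}" using lin_mono[OF lin_power[OF phi(1) s0]] by simp
  have "y [^] q \<in> derived G K" if y: "y \<in> K" for y
  proof (rule lin_section_mult[OF finG sec_K])
    show "y [^] q \<in> K" using y by (rule subgroup_nat_pow[OF K_sub])
    fix \<mu> assume mu: "\<mu> \<in> lin G K (derived G K)"
    have mu': "\<mu> \<in> lin G K {}" using lin_mono[OF mu] by simp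
    have "\<mu> y ^ q = 1"
    proof (cases "\<mu> y = 1")
      case False
      from lin_K_conjugate[OF lam z mu' y False] obtain j l where l: "l \<in> L"
        "\<mu> y = (\<phi> (gconj G l y) ^ s) ^ j" using y by blast
      have "\<phi> (gconj G l y) ^ r = 1" using r l y by (simp add: P_def)
      hence "(\<phi> (gconj G l y) ^ s) ^ q = 1" unfolding s by (simp add: power_mult[symmetric] mult.commute)
      thus ?thesis using l(2) by (metis power_commutes power_mult mult.commute power_one)
    qed simp
    thus "\<mu> (y [^] q) = 1" using lin_pow[OF K_sub mu y] by simp
  qed
  thus ?thesis using q by blast
qed

end

locale frobenius_GC_prime = frobenius_GC +
  fixes q :: nat
  assumes q_prime: "Factorial_Ring.prime q" and pow_q: "\<And>x. x \<in> K \<Longrightarrow> x [^] q \<in> derived G K"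
begin

lemma index_derived: "\<exists>n. card K = q ^ n * card (derived G K)"
proof (rule section_prime_power[OF finG sec_K q_prime])
  fix x assume "x \<in> K"
  thus "\<exists>e. x [^] q ^ e \<in> derived G K" using pow_q by (intro exI[of _ 1]) simp
qed

text \<open>\<open>C\<close> consists of the elements of \<open>N\<close> that \<open>K\<close>
  centralizes modulo \<open>N'\<close>. The averaging lemma gives \<open>N/C\<close> exponent
  dividing \<open>q ^ s\<close>. Characters of \<open>C/N'\<close> are \<open>K\<close>-invariant
  and \<open>C\<close> lies in \<open>K'\<close>, so the determinant argument, carried out inside
  \<open>K\<close>, makes their orders divide the index of \<open>C\<close> in \<open>K\<close>, a
  power of \<open>q\<close>.\<close>

lemma lin_derived_q:
  assumes N: "N \<lhd> G" "N \<subseteq> derived G K" and idx: "card K = q ^ s * card N"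
  shows "\<exists>u. card N = q ^ u * card (derived G N)"
proof -
  have Ns: "subgroup N G" using N by (simp add: normal_imp_subgroup)
  have Nc: "x \<in> carrier G" if "x \<in> N" for x using that Ns by (simp add: subgroup.mem_carrier)
  have dK: "derived G K \<subseteq> K" using derived_incl[OF _ K_sub] by simp
  have NK: "N \<subseteq> K" using N dK by auto
  let ?D = "derived G N"
  have D: "?D \<lhd> G" using derived_is_normal[OF N(1)] .
  have sec: "abelian_section G N ?D" by (rule abelian_section_derived[OF Ns])
  have Ds: "subgroup ?D G" "?D \<subseteq> N" using sec by (auto simp: abelian_section_def)
  define C where "C = {c\<in>N. \<forall>k\<in>K. gcomm G k c \<in> ?D}"
  have Cc: "c \<in> carrier G" if "c \<in> C" for c using that Nc by (simp add: C_def)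
  have Csub: "subgroup C G"
  proof (rule finite_submonoid_imp_subgroup[OF finG])
    show "\<one> \<in> C" using subgroup.one_closed[OF Ns] subgroup.one_closed[OF Ds(1)] by (simp add: C_def gcomm_def)
    fix a b assume ab: "a \<in> C" "b \<in> C"
    have "gcomm G k (a \<otimes> b) \<in> ?D" if "k \<in> K" for k
      using that ab Cc Ds(1) normal_gconj[OF D] by (simp add: gcomm_mult_right C_def subgroup.m_closed Nc)
    thus "a \<otimes> b \<in> C" using ab Ns by (simp add: C_def subgroup.m_closed)
  qed (use Cc in auto)
  have DC: "?D \<subseteq> C"
  proof
    fix d assume d: "d \<in> ?D"
    have "gcomm G k d \<in> ?D" if "k \<in> K" for k
    proof -
      have dc: "d \<in> carrier G" using d Ds(1) by (simp add: subgroup.mem_carrier)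
      have "gcomm G k d = gconj G k d \<otimes> inv d" by (simp add: gcomm_def gconj_def)
      thus ?thesis using d that normal_gconj[OF D] Ds(1) by (simp add: subgroup.m_closed subgroup.m_inv_closed)
    qed
    thus "d \<in> C" using d Ds by (auto simp: C_def)
  qed
  have CN: "C \<subseteq> N" by (auto simp: C_def)
  have secNC: "abelian_section G N C" using sec DC CN Csub by (auto simp: abelian_section_def)
  have secC: "abelian_section G C ?D" using sec DC CN Csub unfolding abelian_section_def by blast
  have vC: "v [^] (q ^ s) \<in> C" if v: "v \<in> N" for v
    using power_index_central[OF N(1) NK D Ds(2) sec _ v, of "q ^ s"] idx subgroup_nat_pow[OF Ns v]
    by (simp add: C_def)
  obtain t where t: "card N = q ^ t * card C"
    using section_prime_power[OF finG secNC q_prime] vC by blast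
  have cv: "c [^] (q ^ (s + t)) \<in> ?D" if c: "c \<in> C" for c
  proof (rule lin_section_mult[OF finG secC])
    show "c [^] (q ^ (s + t)) \<in> C" by (rule subgroup_nat_pow[OF Csub c])
    fix \<psi> assume psi: "\<psi> \<in> lin G C ?D"
    let ?K = "G\<lparr>carrier := K\<rparr>"
    interpret KK: group ?K using K_sub by (rule subgroup.subgroup_is_group) (rule is_group)
    have "\<psi> c ^ (q ^ (s + t)) = 1"
    proof (rule KK.lin_power_index_trivial)
      show "finite (carrier ?K)" using finite_sub[OF K_sub] by simp
      show "subgroup C ?K" using Csub K_sub CN NK by (intro subgroup_incl) auto
      show "\<psi> \<in> lin ?K C ?D" using psi by (simp add: lin_def)
      show "c \<in> C" by (rule c)
      have "derived ?K K = derived G K" using derived_consistent[OF order_refl K_sub] by simp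
      thus "c \<in> derived ?K (carrier ?K)" using c CN N by auto
      show "q ^ (s + t) * card C = card (carrier ?K)" using t idx by (simp add: power_add)
      fix g a assume ga: "g \<in> carrier ?K" "a \<in> C"
      hence g: "g \<in> K" by simp
      have cj: "gconj ?K g a = gconj G g a" using m_inv_consistent[OF K_sub g] by (simp add: gconj_def)
      have cm: "gcomm G g a \<in> ?D" using ga g by (simp add: C_def)
      have "gconj G g a = gcomm G g a \<otimes> a" using g Cc ga by (simp add: gconj_gcomm)
      thus "gconj ?K g a \<in> C \<and> \<psi> (gconj ?K g a) = \<psi> a"
        unfolding cj using cm DC ga Csub lin_mult[OF psi, of "gcomm G g a" a] lin_trivial_on[OF psi cm]
        by (auto simp: subgroup.m_closed)
    qed
    thus "\<psi> (c [^] (q ^ (s + t))) = 1" using lin_pow[OF Csub psi c] by simp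
  qed
  have "\<exists>e. x [^] (q ^ e) \<in> ?D" if x: "x \<in> N" for x
    using cv[OF vC[OF x]] Nc[OF x] by (intro exI[of _ "s + (s + t)"]) (simp add: nat_pow_pow power_add)
  thus ?thesis using section_prime_power[OF finG sec q_prime] by blast
qed

text \<open>The induction descends the derived series of \<open>K\<close>, which ends at the
  identity by solvability. It starts at \<open>K'\<close> because \<open>lin_derived_q\<close>
  concerns subgroups of \<open>K'\<close>.\<close>

lemma K_q_group: "\<exists>s. card K = q ^ s"
proof -
  have sub: "(derived G ^^ Suc i) K \<lhd> G \<and> (derived G ^^ Suc i) K \<subseteq> derived G K \<and>
      (\<exists>s. card K = q ^ s * card ((derived G ^^ Suc i) K))" for i
  proof (induction i)
    case 0 show ?case using derived_K_normal index_derived by simp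
  next
    case (Suc i)
    let ?N = "(derived G ^^ Suc i) K"
    from Suc obtain s where N: "?N \<lhd> G" "?N \<subseteq> derived G K" and s: "card K = q ^ s * card ?N" by auto
    obtain u where u: "card ?N = q ^ u * card (derived G ?N)" using lin_derived_q[OF N s] by blast
    have "derived G ?N \<subseteq> ?N" using derived_incl[OF _ normal_imp_subgroup[OF N(1)]] by simp
    moreover have "card K = q ^ (s + u) * card (derived G ?N)" using s u by (simp add: power_add)
    moreover have "(derived G ^^ Suc (Suc i)) K = derived G ?N" by simp
    ultimately show ?case using derived_is_normal[OF N(1)] N(2) by (metis order_trans)
  qed
  obtain n where n: "(derived G ^^ n) (carrier G) = {\<one>}" using solv solvable_iff_trivial_derived_seq by blast
  have "(derived G ^^ n) K \<subseteq> {\<one>}" using mono_exp_of_derived[OF subgroup.subset[OF K_sub], of n] n by simp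
  moreover have "(derived G ^^ Suc n) K \<subseteq> (derived G ^^ n) K"
    using derived_incl[OF order_refl exp_of_derived_is_subgroup[OF K_sub]] by simp
  moreover have "\<one> \<in> (derived G ^^ Suc n) K"
    using exp_of_derived_is_subgroup[OF K_sub] subgroup.one_closed by blast
  ultimately have "(derived G ^^ Suc n) K = {\<one>}" by auto
  thus ?thesis using sub[of n] by auto
qed

text \<open>\<open>K/K'\<close> has \<open>q ^ n - 1\<close> nontrivial characters, all of them
  \<open>L\<close>-conjugates of powers of a fixed one. The exponent counts modulo \<open>q\<close>
  and is prime to \<open>q\<close>, which leaves \<open>q - 1\<close> values.\<close>

lemma card_L_lower:
  assumes n: "card K = q ^ n * card (derived G K)"
  shows "q ^ n - 1 \<le> (q - 1) * card L"
proof -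
  let ?E = "lin G K (derived G K)" and ?triv = "\<lambda>x. if x \<in> K then 1 else (0::complex)"
  have dpos: "card (derived G K) > 0" using card_sub_pos normal_imp_subgroup[OF derived_K_normal] by blast
  have cE: "card ?E = q ^ n" using card_lin[OF finG sec_K] n dpos by simp
  have fE: "finite ?E" using finite_lin[OF K_sub finite_sub[OF K_sub]] .
  have triv: "?triv \<in> ?E" using trivial_lin[OF K_sub] derived_incl[OF order_refl K_sub] by simp
  have cC: "card (?E - {?triv}) = q ^ n - 1" using cE fE triv by simp
  have nontriv: "\<exists>x\<in>K. \<mu> x \<noteq> 1" if "\<mu> \<in> ?E - {?triv}" for \<mu>
  proof (rule ccontr)
    assume "\<not> ?thesis"
    hence "\<mu> = ?triv" using that triv by (intro lin_eqI[of \<mu> K "derived G K" ?triv "derived G K"]) auto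
    thus False using that by simp
  qed
  show ?thesis
  proof (cases "?E - {?triv} = {}")
    case True
    have "q ^ n - 1 = 0" unfolding cC[symmetric] True by simp
    thus ?thesis by simp
  next
    case False
    then obtain \<nu> where nu: "\<nu> \<in> ?E - {?triv}" by blast
    obtain x where x: "x \<in> K" "\<nu> x \<noteq> 1" using nontriv[OF nu] by blast
    have nu': "\<nu> \<in> lin G K {}" using nu lin_mono by blast
    have nuq: "\<nu> y ^ q = 1" if "y \<in> K" for y
      using lin_pow[OF K_sub nu' that, of q] pow_q[OF that] nu lin_trivial_on by (metis DiffD1)
    have qG: "q dvd card (carrier G)"
    proof -
      have "\<not> q ^ n - 1 = 0" using cC False fE by (metis card_0_eq finite_Diff)
      hence "n \<noteq> 0" by (cases n) auto
      thus ?thesis using n card_G by (auto simp: dvd_mult)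
    qed
    have "?E - {?triv} \<subseteq> (\<lambda>(j,l). twist G K l (\<lambda>x. \<nu> x ^ j)) ` ({1..<q} \<times> L)"
    proof
      fix \<mu> assume mu: "\<mu> \<in> ?E - {?triv}"
      obtain y where y: "y \<in> K" "\<mu> y \<noteq> 1" using nontriv[OF mu] by blast
      have mu': "\<mu> \<in> lin G K {}" using mu lin_mono by blast
      obtain j l where j: "j > 0" "coprime j (card (carrier G))" and l: "l \<in> L"
        and e: "\<And>x. x \<in> K \<Longrightarrow> \<mu> x = \<nu> (gconj G l x) ^ j"
        using lin_K_conjugate[OF nu' x mu' y] by blast
      have "coprime j q" using j(2) qG by (meson coprime_divisors dvd_refl)
      hence "\<not> q dvd j" using q_prime by (metis coprime_absorb_right not_prime_unit)
      hence jm: "j mod q \<in> {1..<q}" using prime_gt_0_nat[OF q_prime] by (auto simp: Suc_le_eq mod_greater_zero_iff_not_dvd)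
      have "\<mu> = twist G K l (\<lambda>x. \<nu> x ^ (j mod q))"
      proof
        fix z show "\<mu> z = twist G K l (\<lambda>x. \<nu> x ^ (j mod q)) z"
        proof (cases "z \<in> K")
          case True
          let ?w = "\<nu> (gconj G l z)"
          have "?w ^ q = 1" using nuq l True by simp
          have "?w ^ j = ?w ^ (q * (j div q) + j mod q)" by simp
          also have "\<dots> = ?w ^ (j mod q)" unfolding power_add power_mult \<open>?w ^ q = 1\<close> by simp
          finally show ?thesis using e[OF True] True by (simp add: twist_def)
        qed (use lin_outside[OF mu'] in \<open>simp add: twist_def\<close>)
      qed
      thus "\<mu> \<in> (\<lambda>(j,l). twist G K l (\<lambda>x. \<nu> x ^ j)) ` ({1..<q} \<times> L)"
        using jm l by (intro image_eqI[of _ _ "(j mod q, l)"]) auto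
    qed
    hence "card (?E - {?triv}) \<le> card ({1..<q} \<times> L)"
      using finite_sub[OF L_sub] by (meson finite_SigmaI finite_atLeastLessThan surj_card_le)
    thus ?thesis using cC by (simp add: card_cartesian_product)
  qed
qed

end

text \<open>Orbits with more than one point have length divisible by \<open>q\<close>, so the number
  of fixed points is divisible by \<open>q\<close>. The action is restricted to \<open>E\<close>
  because permutations in \<open>BijGroup\<close> are extensional.\<close>

lemma (in group) prime_power_group_fixed_point:
  assumes fin: "finite (carrier G)" and card: "card (carrier G) = q ^ s" and q: "Factorial_Ring.prime (q::nat)"
    and E: "finite E" and cl: "\<And>g x. g \<in> carrier G \<Longrightarrow> x \<in> E \<Longrightarrow> act g x \<in> E"
    and one: "\<And>x. x \<in> E \<Longrightarrow> act \<one> x = x"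
    and mult: "\<And>g h x. g \<in> carrier G \<Longrightarrow> h \<in> carrier G \<Longrightarrow> x \<in> E \<Longrightarrow> act (g \<otimes> h) x = act g (act h x)"
    and dv: "q dvd card E" and x0: "x0 \<in> E" "\<And>g. g \<in> carrier G \<Longrightarrow> act g x0 = x0"
  shows "\<exists>x\<in>E. x \<noteq> x0 \<and> (\<forall>g\<in>carrier G. act g x = x)"
proof (rule ccontr)
  assume no: "\<not> ?thesis"
  define \<phi> where "\<phi> g = restrict (act g) E" for g
  have bij: "bij_betw (act g) E E" if g: "g \<in> carrier G" for g
  proof (rule bij_betwI[where g="act (inv g)"])
    fix x assume x: "x \<in> E"
    show "act (inv g) (act g x) = x" using mult[of "inv g" g x] g x one by simp
    show "act g (act (inv g) x) = x" using mult[of g "inv g" x] g x one by simp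
  qed (use cl g in auto)
  have "group_hom G (BijGroup E) \<phi>"
  proof (intro group_hom.intro group_hom_axioms.intro group_BijGroup is_group homI)
    fix g assume g: "g \<in> carrier G"
    thus "\<phi> g \<in> carrier (BijGroup E)" using bij[OF g] by (auto simp: BijGroup_def Bij_def \<phi>_def bij_betw_def inj_on_def)
  next
    fix g h assume gh: "g \<in> carrier G" "h \<in> carrier G"
    have "\<phi> g \<in> Bij E" "\<phi> h \<in> Bij E" using bij[OF gh(1)] bij[OF gh(2)]
      by (auto simp: Bij_def \<phi>_def bij_betw_def inj_on_def)
    thus "\<phi> (g \<otimes> h) = \<phi> g \<otimes>\<^bsub>BijGroup E\<^esub> \<phi> h"
      using gh mult cl by (auto simp: BijGroup_def \<phi>_def compose_def fun_eq_iff)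
  qed
  then interpret A: group_action G E \<phi> by (simp add: group_action_def)
  have orb_card: "q dvd card (orbit G \<phi> x)" if x: "x \<in> E" "x \<noteq> x0" for x
  proof -
    have "card (orbit G \<phi> x) dvd q ^ s" using A.orbit_stabilizer_theorem[OF x(1)] card by (metis Coset.order_def dvd_triv_left)
    then obtain i where i: "card (orbit G \<phi> x) = q ^ i" using divides_primepow_nat[OF q] by auto
    have "i \<noteq> 0"
    proof
      assume "i = 0"
      then obtain y where y: "orbit G \<phi> x = {y}" using i by (auto simp: card_1_singleton_iff)
      have "act g x = x" if "g \<in> carrier G" for g
      proof -
        have "\<phi> g x \<in> orbit G \<phi> x" "\<phi> \<one> x \<in> orbit G \<phi> x" using that by (auto simp: orbit_def)
        thus ?thesis using y x one by (simp add: \<phi>_def)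
      qed
      thus False using no x by blast
    qed
    thus ?thesis using i by simp
  qed
  have "\<phi> \<one> x0 \<in> orbit G \<phi> x0" by (auto simp: orbit_def)
  hence o0: "orbit G \<phi> x0 = {x0}" using x0 by (auto simp: orbit_def \<phi>_def)
  have o0in: "{x0} \<in> orbits G E \<phi>" using o0 x0 by (auto simp: orbits_def)
  have finO: "finite (orbits G E \<phi>)" using E by (simp add: orbits_def)
  have "card E = (\<Sum>orb\<in>orbits G E \<phi>. card orb)" using A.disjoint_sum[OF E, of "\<lambda>_. 1::nat"] by simp
  also have "\<dots> = card {x0} + (\<Sum>orb\<in>orbits G E \<phi> - {{x0}}. card orb)"
    by (rule sum.remove[OF finO o0in])
  finally have "card E = 1 + (\<Sum>orb\<in>orbits G E \<phi> - {{x0}}. card orb)" by simp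
  moreover have "q dvd (\<Sum>orb\<in>orbits G E \<phi> - {{x0}}. card orb)"
  proof (rule dvd_sum)
    fix orb assume "orb \<in> orbits G E \<phi> - {{x0}}"
    then obtain x where "x \<in> E" "orb = orbit G \<phi> x" "orb \<noteq> {x0}" by (auto simp: orbits_def)
    thus "q dvd card orb" using orb_card o0 by auto
  qed
  ultimately have "q dvd 1" using dv by (metis dvd_add_left_iff)
  thus False using q by simp
qed

section \<open>Commutator subgroups with the kernel, and invariant characters\<close>

context frobenius_group
begin

text \<open>The subgroup \<open>[K, N]\<close>; iterated from \<open>K\<close> it yields the lower
  central series of \<open>K\<close>.\<close>

definition commK :: "'a set \<Rightarrow> 'a set" where
  "commK N = generate G {gcomm G k x | k x. k \<in> K \<and> x \<in> N}"

lemma derived_eq_commK: "derived G K = commK K"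
  unfolding derived_def commK_def by (rule arg_cong[where f="generate G"]) (auto simp: gcomm_def)

lemma commK_incl: "k \<in> K \<Longrightarrow> x \<in> N \<Longrightarrow> gcomm G k x \<in> commK N"
  unfolding commK_def by (intro generate.incl) auto

lemma commK_least:
  assumes "subgroup H G" "\<And>k x. k \<in> K \<Longrightarrow> x \<in> N \<Longrightarrow> gcomm G k x \<in> H"
  shows "commK N \<subseteq> H"
  unfolding commK_def by (rule generate_subgroup_incl[OF _ assms(1)]) (use assms(2) in auto)

lemma commK_normal:
  assumes N: "N \<lhd> G" shows "commK N \<lhd> G"
  unfolding commK_def
proof (rule normal_generateI)
  have Ns: "subgroup N G" using N by (simp add: normal_imp_subgroup)
  have Nc: "x \<in> carrier G" if "x \<in> N" for x using that Ns by (simp add: subgroup.mem_carrier)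
  show "{gcomm G k x |k x. k \<in> K \<and> x \<in> N} \<subseteq> carrier G" using Nc by auto
  fix h g assume "h \<in> {gcomm G k x |k x. k \<in> K \<and> x \<in> N}" and g: "g \<in> carrier G"
  then obtain k x where h: "h = gcomm G k x" "k \<in> K" "x \<in> N" by blast
  have "g \<otimes> h \<otimes> inv g = gcomm G (gconj G g k) (gconj G g x)"
    using h g Nc gconj_gcomm_distrib[of g k x] by (simp add: gconj_def)
  thus "g \<otimes> h \<otimes> inv g \<in> {gcomm G k x |k x. k \<in> K \<and> x \<in> N}"
    using gconj_K[OF g h(2)] normal_gconj[OF N g h(3)] by blast
qed

lemma commK_subset:
  assumes N: "N \<lhd> G" shows "commK N \<subseteq> N"
proof (rule commK_least)
  show Ns: "subgroup N G" using N by (simp add: normal_imp_subgroup)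
  fix k x assume "k \<in> K" "x \<in> N"
  moreover have "gcomm G k x = gconj G k x \<otimes> inv x" by (simp add: gcomm_def gconj_def)
  ultimately show "gcomm G k x \<in> N" using Ns normal_gconj[OF N] by (simp add: subgroup.m_closed subgroup.m_inv_closed)
qed

lemma commK_section:
  assumes N: "N \<lhd> G" "N \<subseteq> K" shows "abelian_section G N (commK N)"
  unfolding abelian_section_def
  using normal_imp_subgroup[OF N(1)] normal_imp_subgroup[OF commK_normal[OF N(1)]] commK_subset[OF N(1)] commK_incl N(2) by blast

lemma lin_commK_invariant:
  assumes N: "N \<lhd> G" "N \<subseteq> K" and lam: "\<nu> \<in> lin G N (commK N)" and k: "k \<in> K" and x: "x \<in> N"
  shows "\<nu> (gconj G k x) = \<nu> x"
proof -
  have "gconj G k x = gcomm G k x \<otimes> x" using N k x by (intro gconj_gcomm) auto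
  thus ?thesis using lin_mult[OF lam, of "gcomm G k x" x] commK_incl[OF k x] commK_subset[OF N(1)] x
      lin_trivial_on[OF lam commK_incl[OF k x]] by auto
qed

text \<open>An invariant character is trivial on \<open>gconj G k x \<otimes> inv x\<close>, that
  is, on the generators of \<open>[K, N]\<close>. With \<open>lin_commK_invariant\<close> this
  identifies characters of \<open>N/[K, N]\<close> with \<open>K\<close>-invariant characters of
  \<open>N\<close>.\<close>

lemma lin_invariant_commK:
  assumes N: "N \<lhd> G" "N \<subseteq> K" and lam: "\<nu> \<in> lin G N {}"
    and inv: "\<And>k x. k \<in> K \<Longrightarrow> x \<in> N \<Longrightarrow> \<nu> (gconj G k x) = \<nu> x"
  shows "\<nu> \<in> lin G N (commK N)"
proof -
  have Ns: "subgroup N G" using N by (simp add: normal_imp_subgroup)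
  have Nc: "x \<in> carrier G" if "x \<in> N" for x using that Ns by (simp add: subgroup.mem_carrier)
  have "commK N \<subseteq> {x\<in>N. \<nu> x = 1}"
  proof (rule commK_least)
    show "subgroup {x\<in>N. \<nu> x = 1} G"
      by (rule finite_submonoid_imp_subgroup[OF finG])
        (use Nc Ns lin_one[OF Ns lam] lin_mult[OF lam] in \<open>auto simp: subgroup.one_closed subgroup.m_closed\<close>)
    fix k x assume kx: "k \<in> K" "x \<in> N"
    have "gcomm G k x = gconj G k x \<otimes> inv x" by (simp add: gcomm_def gconj_def)
    moreover have "gconj G k x \<in> N" using normal_gconj[OF N(1)] kx by simp
    ultimately show "gcomm G k x \<in> {x\<in>N. \<nu> x = 1}"
      using kx inv Ns lin_mult[OF lam] lin_inv[OF Ns lam] lin_nonzero[OF lam]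
      by (simp add: subgroup.m_closed subgroup.m_inv_closed)
  qed
  thus ?thesis using lam by (auto simp: lin_def)
qed

text \<open>Expanding the commutator of \<open>x \<otimes> y\<close> with \<open>n\<close> produces
  a conjugate, which \<open>\<nu>\<close> does not notice because it is \<open>K\<close>-invariant.
  Being linear on \<open>K\<close>, the resulting character is trivial on \<open>K'\<close>
  automatically.\<close>

lemma pairing_left:
  assumes M: "M \<lhd> G" "M \<subseteq> K" and lam: "\<nu> \<in> lin G M (commK M)" and N: "N \<subseteq> K"
    and cm: "\<And>k n. k \<in> K \<Longrightarrow> n \<in> N \<Longrightarrow> gcomm G k n \<in> M" and n: "n \<in> N"
  shows "(\<lambda>k. if k \<in> K then \<nu> (gcomm G k n) else 0) \<in> lin G K (derived G K)"
proof -
  have "(\<lambda>k. if k \<in> K then \<nu> (gcomm G k n) else 0) \<in> lin G K {}"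
    unfolding lin_def
  proof (intro CollectI conjI ballI allI impI)
    fix x y assume xy: "x \<in> K" "y \<in> K"
    have "\<nu> (gcomm G (x \<otimes> y) n) = \<nu> (gconj G x (gcomm G y n)) * \<nu> (gcomm G x n)"
      using xy n N cm normal_gconj[OF M(1)] lin_mult[OF lam] by (subst gcomm_mult_left) auto
    thus "(if x \<otimes> y \<in> K then \<nu> (gcomm G (x \<otimes> y) n) else 0) =
        (if x \<in> K then \<nu> (gcomm G x n) else 0) * (if y \<in> K then \<nu> (gcomm G y n) else 0)"
      using xy lin_commK_invariant[OF M lam xy(1) cm[OF xy(2) n]] K_sub by (simp add: subgroup.m_closed)
  qed (use cm n lin_nonzero[OF lam] in auto)
  thus ?thesis by (rule lin_derived[OF K_sub])
qed

lemma pairing_right: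
  assumes M: "M \<lhd> G" "M \<subseteq> K" and lam: "\<nu> \<in> lin G M (commK M)" and N: "subgroup N G" "N \<subseteq> K"
    and cm: "\<And>k n. k \<in> K \<Longrightarrow> n \<in> N \<Longrightarrow> gcomm G k n \<in> M" and k: "k \<in> K"
  shows "(\<lambda>n. if n \<in> N then \<nu> (gcomm G k n) else 0) \<in> lin G N {}"
  unfolding lin_def
proof (intro CollectI conjI ballI allI impI)
  fix x y assume xy: "x \<in> N" "y \<in> N"
  hence xyK: "x \<in> K" "y \<in> K" using N by auto
  have "\<nu> (gcomm G k (x \<otimes> y)) = \<nu> (gcomm G k x) * \<nu> (gconj G x (gcomm G k y))"
    using xy xyK k cm normal_gconj[OF M(1)] lin_mult[OF lam] by (subst gcomm_mult_right) auto
  thus "(if x \<otimes> y \<in> N then \<nu> (gcomm G k (x \<otimes> y)) else 0) =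
      (if x \<in> N then \<nu> (gcomm G k x) else 0) * (if y \<in> N then \<nu> (gcomm G k y) else 0)"
    using xy lin_commK_invariant[OF M lam xyK(1) cm[OF k xy(2)]] N by (simp add: subgroup.m_closed)
qed (use cm k lin_nonzero[OF lam] in auto)

end

context frobenius_GC_prime
begin

text \<open>The \<open>q\<close>-group \<open>K\<close> permutes the characters of
  \<open>N/N'\<close>, whose number is a power of \<open>q\<close> greater than 1. It fixes the
  trivial one, hence another one too, and that one is trivial on \<open>[K, N]\<close>.\<close>

lemma commK_psubset:
  assumes N: "N \<lhd> G" "N \<subseteq> K" "N \<noteq> {\<one>}" shows "commK N \<subset> N"
proof -
  have Ns: "subgroup N G" using N by (simp add: normal_imp_subgroup)
  have Nc: "x \<in> carrier G" if "x \<in> N" for x using that Ns by (simp add: subgroup.mem_carrier)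
  let ?D = "derived G N" let ?E = "lin G N ?D" let ?K = "G\<lparr>carrier := K\<rparr>"
  let ?triv = "\<lambda>x. if x \<in> N then 1 else (0::complex)"
  have D: "?D \<lhd> G" using derived_is_normal[OF N(1)] .
  have sec: "abelian_section G N ?D" by (rule abelian_section_derived[OF Ns])
  have DN: "?D \<subset> N" by (rule derived_psubset[OF Ns N(3)])
  obtain s where s: "card K = q ^ s" using K_q_group by blast
  have "card N dvd q ^ s"
  proof -
    interpret KK: group ?K using K_sub by (rule subgroup.subgroup_is_group) (rule is_group)
    have "subgroup N ?K" using Ns N(2) K_sub by (simp add: subgroup_incl)
    thus ?thesis using KK.lagrange s by (metis Coset.order_def dvd_triv_right partial_object.select_convs(1) partial_object.update_convs(1) partial_object.surjective)
  qed
  moreover have cE: "card ?E * card ?D = card N" by (rule card_lin[OF finG sec])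
  ultimately have "card ?E dvd q ^ s" by (metis dvd_mult_left)
  then obtain i where i: "card ?E = q ^ i" using divides_primepow_nat[OF q_prime] by auto
  have "i \<noteq> 0" using cE i psubset_card_mono[OF finite_sub[OF Ns] DN] by (intro notI) simp
  hence qE: "q dvd card ?E" using i by simp
  interpret KK: group ?K using K_sub by (rule subgroup.subgroup_is_group) (rule is_group)
  have triv: "?triv \<in> ?E" using trivial_lin[OF Ns] DN by auto
  \<comment> \<open>The inverse turns twisting into a left action.\<close>
  have "\<exists>\<nu>\<in>?E. \<nu> \<noteq> ?triv \<and> (\<forall>g\<in>carrier ?K. twist G N (inv g) \<nu> = \<nu>)"
  proof (rule KK.prime_power_group_fixed_point[where s=s and q=q])
    show "finite (carrier ?K)" "card (carrier ?K) = q ^ s" using finite_sub[OF K_sub] s by auto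
    show "finite ?E" by (rule finite_lin[OF Ns finite_sub[OF Ns]])
    fix g \<psi> assume g: "g \<in> carrier ?K" and psi: "\<psi> \<in> ?E"
    have gc: "inv g \<in> carrier G" using g by simp
    show "twist G N (inv g) \<psi> \<in> ?E"
      by (rule lin_twist[OF N(1) psi gc]) (use DN normal_gconj[OF D gc] in auto)
  next
    fix \<psi> assume psi: "\<psi> \<in> ?E"
    show "twist G N (inv \<one>\<^bsub>?K\<^esub>) \<psi> = \<psi>" using psi Nc by (auto simp: twist_def lin_outside)
  next
    fix g h \<psi> assume gh: "g \<in> carrier ?K" "h \<in> carrier ?K" and psi: "\<psi> \<in> ?E"
    show "twist G N (inv (g \<otimes>\<^bsub>?K\<^esub> h)) \<psi> = twist G N (inv g) (twist G N (inv h) \<psi>)"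
      using gh Nc normal_gconj[OF N(1)] by (auto simp: twist_def gconj_gconj inv_mult_group)
  next
    fix g assume "g \<in> carrier ?K"
    thus "twist G N (inv g) ?triv = ?triv" using normal_gconj[OF N(1)] by (auto simp: twist_def)
  qed (use q_prime qE triv in auto)
  then obtain \<nu> where nu: "\<nu> \<in> ?E" "\<nu> \<noteq> ?triv" and inv: "\<And>g. g \<in> K \<Longrightarrow> twist G N (inv g) \<nu> = \<nu>" by auto
  have nu': "\<nu> \<in> lin G N {}" using lin_mono[OF nu(1)] by simp
  have "\<nu> \<in> lin G N (commK N)"
  proof (rule lin_invariant_commK[OF N(1,2) nu'])
    fix k x assume kx: "k \<in> K" "x \<in> N"
    have "inv k \<in> K" using kx K_sub by (simp add: subgroup.m_inv_closed)
    from fun_cong[OF inv[OF this], of x] show "\<nu> (gconj G k x) = \<nu> x" using kx by (simp add: twist_def)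
  qed
  moreover obtain x where "x \<in> N" "\<nu> x \<noteq> 1" using lin_eqI[OF nu(1) triv] nu(2) by auto
  ultimately show ?thesis using commK_subset[OF N(1)] lin_trivial_on by blast
qed

text \<open>For fixed \<open>n\<close> the value of \<open>\<nu>\<close> at
  \<open>gcomm G k n\<close> is a character of \<open>K/K'\<close> in \<open>k\<close>. That group
  has exponent \<open>q\<close>, so the generators of \<open>[K, N]\<close> have values of order
  dividing \<open>q\<close>.\<close>

lemma commK_exponent:
  assumes N: "N \<lhd> G" "N \<subseteq> K" and x: "x \<in> commK N"
  shows "x [^] q \<in> commK (commK N)"
proof -
  let ?M = "commK N"
  have M: "?M \<lhd> G" "?M \<subseteq> K" using commK_normal[OF N(1)] commK_subset[OF N(1)] N by auto
  have Ms: "subgroup ?M G" using M by (simp add: normal_imp_subgroup)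
  show ?thesis
  proof (rule lin_section_mult[OF finG commK_section[OF M]])
    show "x [^] q \<in> ?M" by (rule subgroup_nat_pow[OF Ms x])
    fix \<nu> assume nu: "\<nu> \<in> lin G ?M (commK ?M)"
    have "?M \<subseteq> {y\<in>?M. \<nu> y ^ q = 1}"
    proof (rule commK_least)
      show "subgroup {y\<in>?M. \<nu> y ^ q = 1} G"
        by (rule finite_submonoid_imp_subgroup[OF finG])
          (use M Ms lin_one[OF Ms nu] lin_mult[OF nu] in \<open>auto simp: subgroup.one_closed subgroup.m_closed power_mult_distrib\<close>)
      fix k n assume kn: "k \<in> K" "n \<in> N"
      let ?f = "\<lambda>k. if k \<in> K then \<nu> (gcomm G k n) else 0"
      have f: "?f \<in> lin G K (derived G K)"
        by (rule pairing_left[OF M nu N(2) _ kn(2)]) (rule commK_incl)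
      have "?f k ^ q = ?f (k [^] q)" using lin_pow[OF K_sub f kn(1)] by simp
      also have "\<dots> = 1" using lin_trivial_on[OF f pow_q[OF kn(1)]] .
      finally show "gcomm G k n \<in> {y\<in>?M. \<nu> y ^ q = 1}" using kn commK_incl by simp
    qed
    hence "\<nu> x ^ q = 1" using x by auto
    thus "\<nu> (x [^] q) = 1" using lin_pow[OF Ms nu x] by simp
  qed
qed

lemma commK_index:
  assumes N: "N \<lhd> G" "N \<subseteq> K"
  shows "\<exists>m. card (commK N) = q ^ m * card (commK (commK N))"
proof (rule section_prime_power[OF finG _ q_prime])
  have M: "commK N \<lhd> G" "commK N \<subseteq> K" using commK_normal[OF N(1)] commK_subset[OF N(1)] N by auto
  show "abelian_section G (commK N) (commK (commK N))" by (rule commK_section[OF M])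
  fix x assume "x \<in> commK N"
  thus "\<exists>e. x [^] q ^ e \<in> commK (commK N)" using commK_exponent[OF N] by (intro exI[of _ 1]) simp
qed

end

subsection \<open>Bilinear pairings of elementary abelian groups\<close>

lemma prime_root_of_unity_power:
  assumes q: "Factorial_Ring.prime (q::nat)" and w: "w ^ q = (1::complex)" "w \<noteq> 1" and a: "a ^ q = 1"
  obtains j where "a = w ^ j"
proof -
  let ?z = "cis (2 * pi / real q)"
  have q0: "q > 0" using prime_gt_0_nat[OF q] .
  obtain k where k: "k < q" "w = ?z ^ k" using root_of_unity_power[OF q0 w(1)] .
  obtain l where l: "l < q" "a = ?z ^ l" using root_of_unity_power[OF q0 a] .
  have "k > 0" using k w(2) by (cases k) auto
  hence "coprime k q" using k q by (metis coprime_commute dvd_imp_le not_le prime_imp_coprime)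
  then obtain x where x: "[k * x = 1] (mod q)" using cong_solve_coprime_nat[of k q] by auto
  have zq: "?z ^ q = 1" using q0 by (simp add: DeMoivre)
  have red: "?z ^ m = ?z ^ (m mod q)" for m
  proof -
    have "?z ^ m = ?z ^ (q * (m div q) + m mod q)" by simp
    also have "\<dots> = ?z ^ (m mod q)" unfolding power_add power_mult zq by simp
    finally show ?thesis .
  qed
  have "(k * (x * l)) mod q = l mod q" using x
    by (metis cong_def cong_scalar_right mult.assoc mult_1)
  hence "?z ^ (k * (x * l)) = ?z ^ l" using red by metis
  hence "a = w ^ (x * l)" using k l by (simp add: power_mult)
  thus ?thesis by (rule that)
qed

lemma (in group_hom) card_image_kernel:
  assumes "finite (carrier G)"
  shows "card (h ` carrier G) * card (kernel G H h) = card (carrier G)"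
proof -
  let ?H = "H\<lparr>carrier := h ` carrier G\<rparr>"
  interpret I: group_hom G ?H h
  proof (intro group_hom.intro group_hom_axioms.intro G.is_group)
    show "group ?H" using img_is_subgroup H.subgroup_imp_group by blast
  qed (auto simp: hom_def)
  have "kernel G ?H h = kernel G H h" by (simp add: kernel_def)
  hence "(\<lambda>N. the_elem (h ` N)) \<in> iso (G Mod kernel G H h) ?H" using I.FactGroup_iso_set by simp
  hence "card (rcosets kernel G H h) = card (h ` carrier G)"
    using bij_betw_same_card by (fastforce simp: iso_def FactGroup_def)
  thus ?thesis using G.lagrange[OF subgroup_kernel] by (simp add: Coset.order_def)
qed

lemma (in group) card_subgroup_dvd:
  assumes "subgroup H G" "subgroup T G" "T \<subseteq> H" shows "card T dvd card H"
proof -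
  interpret HH: group "G\<lparr>carrier := H\<rparr>" using assms(1) by (rule subgroup.subgroup_is_group) (rule is_group)
  have "subgroup T (G\<lparr>carrier := H\<rparr>)" using assms by (simp add: subgroup_incl)
  from HH.lagrange[OF this] have "card (rcosets\<^bsub>G\<lparr>carrier := H\<rparr>\<^esub> T) * card T = card H" by (simp add: Coset.order_def)
  thus ?thesis by (metis dvd_triv_right)
qed

lemma (in group) prime_dvd_card_subgroup:
  assumes fin: "finite (carrier G)" and "card (carrier G) = q ^ n" and q: "Factorial_Ring.prime (q::nat)"
    and T: "subgroup T G" and x: "x \<in> T" "x \<noteq> \<one>"
  shows "q dvd card T"
proof -
  have "card T dvd q ^ n" using card_subgroup_dvd[OF subgroup_self T] T assms(2) by (simp add: subgroup.subset)
  then obtain i where i: "card T = q ^ i" using divides_primepow_nat[OF q] by auto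
  have "{\<one>, x} \<subseteq> T" using x T by (simp add: subgroup.one_closed)
  hence "card {\<one>, x} \<le> card T" using fin T by (meson card_mono finite_subset subgroup.subset)
  hence "i \<noteq> 0" using i x by (intro notI) auto
  thus ?thesis using i by simp
qed

text \<open>A dual basis modulo \<open>p\<close>: \<open>P\<close> is a largest set of points with
  functions \<open>h i\<close> in \<open>S\<close> that are 1 at \<open>i\<close> and 0 at the other
  points. If interpolation failed at \<open>x\<close>, the error of \<open>f\<close> would vanish on
  \<open>P\<close> but not at \<open>x\<close>; rescaled, it would enlarge the family by
  \<open>x\<close>.\<close>

lemma interpolation_basis:
  fixes S :: "('x \<Rightarrow> int) set"
  assumes Y: "finite Y" and p: "Factorial_Ring.prime (p::int)"
    and zero: "(\<lambda>_. 0) \<in> S" and lc: "\<And>f g a b. f \<in> S \<Longrightarrow> g \<in> S \<Longrightarrow> (\<lambda>x. a * f x + b * g x) \<in> S"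
  shows "\<exists>P h. P \<subseteq> Y \<and> (\<forall>i\<in>P. h i \<in> S) \<and> (\<forall>f\<in>S. \<forall>x\<in>Y. [f x = (\<Sum>i\<in>P. f i * h i x)] (mod p))"
proof -
  define good where "good P \<longleftrightarrow> P \<subseteq> Y \<and> (\<exists>h. (\<forall>i\<in>P. h i \<in> S) \<and>
     (\<forall>i\<in>P. \<forall>k\<in>P. [h i k = (if i = k then 1 else 0)] (mod p)))" for P
  have "good {}" by (simp add: good_def)
  moreover have "card P \<le> card Y" if "good P" for P using that Y by (auto simp: good_def intro: card_mono)
  ultimately obtain P where P: "good P" and max: "\<And>P'. good P' \<Longrightarrow> card P' \<le> card P"
    using ex_has_greatest_nat[of good "{}" card "Suc (card Y)"] by (metis le_imp_less_Suc)
  from P obtain h where PY: "P \<subseteq> Y" and h: "\<And>i. i \<in> P \<Longrightarrow> h i \<in> S"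
    and d: "\<And>i k. i \<in> P \<Longrightarrow> k \<in> P \<Longrightarrow> [h i k = (if i = k then 1 else 0)] (mod p)" unfolding good_def by blast
  have finP: "finite P" using PY Y finite_subset by blast
  have sumS: "(\<lambda>x. \<Sum>i\<in>Q. c i * h i x) \<in> S" if "finite Q" "Q \<subseteq> P" for Q c
    using that
  proof (induction Q rule: finite_induct)
    case empty thus ?case using zero by simp
  next
    case (insert i Q)
    have "(\<lambda>x. c i * h i x + 1 * (\<Sum>i\<in>Q. c i * h i x)) \<in> S" using insert h by (intro lc) auto
    thus ?case using insert by simp
  qed
  have "[f x = (\<Sum>i\<in>P. f i * h i x)] (mod p)" if f: "f \<in> S" and x: "x \<in> Y" for f x
  proof (rule ccontr)
    assume nc: "\<not> [f x = (\<Sum>i\<in>P. f i * h i x)] (mod p)"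
    define g where "g y = 1 * f y + (-1) * (\<Sum>i\<in>P. f i * h i y)" for y
    have gS: "g \<in> S" unfolding g_def[abs_def] by (rule lc[OF f sumS[OF finP order_refl]])
    have gP: "[g k = 0] (mod p)" if k: "k \<in> P" for k
    proof -
      have "[(\<Sum>i\<in>P. f i * h i k) = (\<Sum>i\<in>P. f i * (if i = k then 1 else 0))] (mod p)"
        using d k by (intro cong_sum cong_scalar_left) auto
      also have "(\<Sum>i\<in>P. f i * (if i = k then 1 else 0)) = f k" using finP k by (simp add: if_distrib cong: if_cong)
      finally have "[f k - (\<Sum>i\<in>P. f i * h i k) = f k - f k] (mod p)" by (intro cong_diff cong_refl)
      thus ?thesis by (simp add: g_def)
    qed
    have gx: "\<not> p dvd g x" using nc by (simp add: g_def cong_iff_dvd_diff)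
    have xP: "x \<notin> P" using gP[of x] gx by (auto simp: cong_0_iff)
    have "coprime (g x) p" using gx p by (metis coprime_commute prime_imp_coprime)
    then obtain c where c: "[g x * c = 1] (mod p)" using cong_solve_coprime_int[of "g x" p] by auto
    define g' where "g' y = c * g y + 0 * g y" for y
    have g'S: "g' \<in> S" unfolding g'_def[abs_def] by (rule lc[OF gS gS])
    have g'x: "[g' x = 1] (mod p)" using c by (simp add: g'_def mult.commute)
    have g'P: "[g' k = 0] (mod p)" if "k \<in> P" for k using gP[OF that] by (simp add: g'_def cong_0_iff)
    define h' where "h' i = (if i = x then g' else (\<lambda>y. 1 * h i y + (- h i x) * g' y))" for i
    have "good (insert x P)"
      unfolding good_def
    proof (intro conjI exI[of _ h'] ballI)
      show "insert x P \<subseteq> Y" using PY x by simp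
      fix i assume i: "i \<in> insert x P"
      show "h' i \<in> S"
      proof (cases "i = x")
        case False
        thus ?thesis using i lc[OF h g'S, of i 1 "- h i x"] by (simp add: h'_def)
      qed (use g'S in \<open>simp add: h'_def\<close>)
      fix k assume k: "k \<in> insert x P"
      show "[h' i k = (if i = k then 1 else 0)] (mod p)"
      proof (cases "i = x")
        case True
        thus ?thesis using g'x g'P k xP by (auto simp: h'_def)
      next
        case False
        hence iP: "i \<in> P" using i by simp
        show ?thesis
        proof (cases "k = x")
          case True
          have "[1 * h i x + (- h i x) * g' x = 1 * h i x + (- h i x) * 1] (mod p)"
            by (intro cong_add cong_scalar_left g'x cong_refl)
          thus ?thesis using True False by (simp add: h'_def)
        next
          case kx: False
          hence kP: "k \<in> P" using k by simp
          have "[1 * h i k + (- h i x) * g' k = 1 * (if i = k then 1 else 0) + (- h i x) * 0] (mod p)"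
            by (intro cong_add cong_scalar_left g'P[OF kP] d[OF iP kP])
          thus ?thesis using False by (simp add: h'_def)
        qed
      qed
    qed
    hence "card (insert x P) \<le> card P" by (rule max)
    thus False using xP finP by simp
  qed
  thus ?thesis using PY h by blast
qed

text \<open>The commutator pairing between factors of the central series in abstract form.
  \<open>radical_bound\<close> is what the count of extensions delivers: for nontrivial
  \<open>\<nu>\<close> the form \<open>\<nu> (B x y)\<close> has a radical of order at most
  \<open>q\<close> in \<open>V\<close>.\<close>

locale bilinear_pairing = V: comm_group V + U: comm_group U + W: comm_group W
  for V :: "('v, 'vm) monoid_scheme" and U :: "('u, 'um) monoid_scheme" and W :: "('w, 'wm) monoid_scheme" +
  fixes B :: "'v \<Rightarrow> 'u \<Rightarrow> 'w" and q n m :: nat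
  assumes q: "Factorial_Ring.prime q" and n2: "n \<ge> 2" and nm: "n \<le> m"
    and finV: "finite (carrier V)" and finU: "finite (carrier U)" and finW: "finite (carrier W)"
    and cardV: "card (carrier V) = q ^ n" and cardU: "card (carrier U) = q ^ n" and cardW: "card (carrier W) = q ^ m"
    and B_closed: "\<And>x y. x \<in> carrier V \<Longrightarrow> y \<in> carrier U \<Longrightarrow> B x y \<in> carrier W"
    and B_left: "\<And>x x' y. x \<in> carrier V \<Longrightarrow> x' \<in> carrier V \<Longrightarrow> y \<in> carrier U \<Longrightarrow>
       B (x \<otimes>\<^bsub>V\<^esub> x') y = B x y \<otimes>\<^bsub>W\<^esub> B x' y"
    and B_right: "\<And>x y y'. x \<in> carrier V \<Longrightarrow> y \<in> carrier U \<Longrightarrow> y' \<in> carrier U \<Longrightarrow>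
       B x (y \<otimes>\<^bsub>U\<^esub> y') = B x y \<otimes>\<^bsub>W\<^esub> B x y'"
    and left_kernel: "\<And>x. x \<in> carrier V \<Longrightarrow> x \<noteq> \<one>\<^bsub>V\<^esub> \<Longrightarrow> \<exists>y\<in>carrier U. y \<noteq> \<one>\<^bsub>U\<^esub> \<and> B x y = \<one>\<^bsub>W\<^esub>"
    and radical_bound: "\<And>\<nu> w. \<nu> \<in> lin W (carrier W) {} \<Longrightarrow> w \<in> carrier W \<Longrightarrow> \<nu> w \<noteq> 1 \<Longrightarrow>
       card {x \<in> carrier V. \<forall>y\<in>carrier U. \<nu> (B x y) = 1} \<le> q"
begin

lemma hom_right: "x \<in> carrier V \<Longrightarrow> group_hom U W (B x)"
  by (intro group_hom.intro group_hom_axioms.intro U.is_group W.is_group homI) (auto simp: B_closed B_right)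

lemma hom_left: "y \<in> carrier U \<Longrightarrow> group_hom V W (\<lambda>x. B x y)"
  by (intro group_hom.intro group_hom_axioms.intro V.is_group W.is_group homI) (auto simp: B_closed B_left)

definition ker where "ker x = {y \<in> carrier U. B x y = \<one>\<^bsub>W\<^esub>}"
definition img where "img x = B x ` carrier U"

lemma ker_subgroup: "x \<in> carrier V \<Longrightarrow> subgroup (ker x) U"
  using group_hom.subgroup_kernel[OF hom_right] unfolding ker_def kernel_def by simp

lemma img_subgroup: "x \<in> carrier V \<Longrightarrow> subgroup (img x) W"
  using group_hom.img_is_subgroup[OF hom_right] by (simp add: img_def)

lemma card_img_ker: "x \<in> carrier V \<Longrightarrow> card (img x) * card (ker x) = q ^ n"
  using group_hom.card_image_kernel[OF hom_right finU] cardU unfolding img_def ker_def kernel_def by simp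

lemma ker_ge: assumes "x \<in> carrier V" "x \<noteq> \<one>\<^bsub>V\<^esub>" shows "card (ker x) \<ge> q"
proof -
  obtain y where "y \<in> ker x" "y \<noteq> \<one>\<^bsub>U\<^esub>" using left_kernel[OF assms] by (auto simp: ker_def)
  hence "q dvd card (ker x)" using U.prime_dvd_card_subgroup[OF finU cardU q ker_subgroup[OF assms(1)]] by blast
  moreover have "card (ker x) > 0" using card_img_ker[OF assms(1)] prime_gt_0_nat[OF q] by (intro gr0I) simp
  ultimately show ?thesis by (rule dvd_imp_le)
qed

lemma section_W: "subgroup H W \<Longrightarrow> abelian_section W (carrier W) H"
  unfolding abelian_section_def
  using W.subgroup_self W.gcomm_one_iff W.m_comm by (auto simp: subgroup.subset subgroup.one_closed)

abbreviation trivW :: "'w \<Rightarrow> complex" where "trivW \<equiv> \<lambda>x. if x \<in> carrier W then 1 else 0"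

lemma card_lin_img:
  assumes x: "x \<in> carrier V" shows "card (lin W (carrier W) (img x)) = q ^ (m - n) * card (ker x)"
proof -
  have "card (lin W (carrier W) (img x)) * card (img x) = q ^ m"
    using W.card_lin[OF finW section_W[OF img_subgroup[OF x]]] cardW by simp
  also have "\<dots> = q ^ (m - n) * (card (img x) * card (ker x))"
    unfolding card_img_ker[OF x] using nm by (simp add: power_add[symmetric])
  finally have "card (lin W (carrier W) (img x)) * card (img x) = (q ^ (m - n) * card (ker x)) * card (img x)"
    by (simp only: mult_ac)
  moreover have "card (img x) \<noteq> 0" using card_img_ker[OF x] prime_gt_0_nat[OF q] by (intro notI) simp
  ultimately show ?thesis by auto
qed

text \<open>Count pairs of a nontrivial \<open>x\<close> and a nontrivial \<open>\<nu>\<close>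
  trivial on \<open>img x\<close>. Each \<open>x\<close> occurs in
  \<open>q ^ (m - n) * card (ker x) - 1\<close> pairs, where \<open>card (ker x) \<ge> q\<close>,
  and each \<open>\<nu>\<close> in at most \<open>q - 1\<close>. The totals are compatible only if
  equality holds everywhere.\<close>

lemma rank_count: "m = n \<and> (\<forall>x\<in>carrier V - {\<one>\<^bsub>V\<^esub>}. card (ker x) = q)"
proof -
  let ?V = "carrier V - {\<one>\<^bsub>V\<^esub>}" and ?L = "lin W (carrier W) {} - {trivW}"
  have finL: "finite (lin W (carrier W) {})" by (rule W.finite_lin[OF W.subgroup_self finW])
  have trivI: "trivW \<in> lin W (carrier W) H" if "H \<subseteq> carrier W" for H by (rule W.trivial_lin[OF W.subgroup_self that])
  have q1: "q > 1" using prime_gt_1_nat[OF q] .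
  have "lin W (carrier W) {} = lin W (carrier W) {\<one>\<^bsub>W\<^esub>}"
    using W.lin_one[OF W.subgroup_self] by (auto simp: lin_def)
  hence cL0: "card (lin W (carrier W) {}) = q ^ m"
    using W.card_lin[OF finW section_W[OF W.triv_subgroup]] cardW by simp
  have cL: "card ?L = q ^ m - 1" using cL0 trivI[of "{}"] finL by simp
  have cV: "card ?V = q ^ n - 1" using cardV finV by simp
  have left: "card {\<nu>\<in>?L. \<forall>y\<in>carrier U. \<nu> (B x y) = 1} = q ^ (m - n) * card (ker x) - 1" if x: "x \<in> ?V" for x
  proof -
    have "{\<nu>\<in>?L. \<forall>y\<in>carrier U. \<nu> (B x y) = 1} = lin W (carrier W) (img x) - {trivW}"
      by (auto simp: lin_def img_def)
    moreover have "trivW \<in> lin W (carrier W) (img x)" using img_subgroup x by (intro trivI) (auto dest: subgroup.subset)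
    ultimately show ?thesis using card_lin_img[of x] x W.finite_lin[OF W.subgroup_self finW] by simp
  qed
  have right: "card {x\<in>?V. \<forall>y\<in>carrier U. \<nu> (B x y) = 1} \<le> q - 1" if nu: "\<nu> \<in> ?L" for \<nu>
  proof -
    obtain w where w: "w \<in> carrier W" "\<nu> w \<noteq> 1" using W.lin_eqI[of \<nu> "carrier W" "{}" trivW "{}"] nu trivI[of "{}"] by auto
    let ?X = "{x \<in> carrier V. \<forall>y\<in>carrier U. \<nu> (B x y) = 1}"
    have "B \<one>\<^bsub>V\<^esub> y = \<one>\<^bsub>W\<^esub>" if "y \<in> carrier U" for y using group_hom.hom_one[OF hom_left[OF that]] .
    hence "\<one>\<^bsub>V\<^esub> \<in> ?X" using nu W.lin_one[OF W.subgroup_self] by auto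
    hence "card (?X - {\<one>\<^bsub>V\<^esub>}) = card ?X - 1" using finV by simp
    moreover have "{x\<in>?V. \<forall>y\<in>carrier U. \<nu> (B x y) = 1} = ?X - {\<one>\<^bsub>V\<^esub>}" by auto
    ultimately show ?thesis using radical_bound[of \<nu> w] w nu by (simp add: diff_le_mono)
  qed
  have "(\<Sum>x\<in>?V. q ^ (m - n) * card (ker x) - 1) = (\<Sum>x\<in>?V. card {\<nu>\<in>?L. \<forall>y\<in>carrier U. \<nu> (B x y) = 1})"
    using left by simp
  also have "\<dots> = (\<Sum>\<nu>\<in>?L. card {x\<in>?V. \<forall>y\<in>carrier U. \<nu> (B x y) = 1})"
    using sum_multicount_gen[of ?V ?L "\<lambda>x \<nu>. \<forall>y\<in>carrier U. \<nu> (B x y) = 1" "\<lambda>\<nu>. card {x\<in>?V. \<forall>y\<in>carrier U. \<nu> (B x y) = 1}"]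
      finV finL by simp
  also have "\<dots> \<le> (q ^ m - 1) * (q - 1)" using sum_bounded_above[of ?L _ "q - 1"] right cL by simp
  finally have main: "(\<Sum>x\<in>?V. q ^ (m - n) * card (ker x) - 1) \<le> (q ^ m - 1) * (q - 1)" .
  \<comment> \<open>With \<open>a = q ^ n\<close> and \<open>b = q ^ (m - n)\<close> the lower bound
    of the count exceeds the upper one by \<open>(a - q) * (b - 1)\<close>, which is positive for
    \<open>b > 1\<close>.\<close>
  have mn: "m = n"
  proof (rule ccontr)
    assume "m \<noteq> n"
    define b where "b = q ^ (m - n)"
    define a where "a = q ^ n"
    have b: "b > 1" unfolding b_def by (rule one_less_power[OF q1]) (use \<open>m \<noteq> n\<close> nm in simp)
    have a: "a > q" using n2 q1 power_strict_increasing[of 1 n q] by (simp add: a_def)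
    have ab: "q ^ m = a * b" using nm by (simp add: a_def b_def power_add[symmetric])
    have "(a - 1) * (b * q - 1) = (\<Sum>x\<in>?V. b * q - 1)" using cV by (simp add: a_def)
    also have "\<dots> \<le> (\<Sum>x\<in>?V. b * card (ker x) - 1)"
      by (intro sum_mono diff_le_mono mult_le_mono2) (use ker_ge in auto)
    also have "\<dots> \<le> (a * b - 1) * (q - 1)" using main ab by (simp add: b_def)
    finally have "(a - 1) * (b * q - 1) \<le> (a * b - 1) * (q - 1)" .
    moreover have "int ((a - 1) * (b * q - 1)) - int ((a * b - 1) * (q - 1)) = (int a - int q) * (int b - 1)"
    proof -
      have "1 \<le> a" "1 \<le> b * q" "1 \<le> a * b" "1 \<le> q" using a b q1 by (auto simp: Suc_le_eq)
      hence "int ((a - 1) * (b * q - 1)) = (int a - 1) * (int b * int q - 1)"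
        "int ((a * b - 1) * (q - 1)) = (int a * int b - 1) * (int q - 1)" by (simp_all only: of_nat_mult of_nat_diff of_nat_1)
      thus ?thesis by (simp add: algebra_simps)
    qed
    moreover have "(int a - int q) * (int b - 1) > 0" using a b by simp
    ultimately show False by linarith
  qed
  have "card (ker x) = q" if x: "x \<in> ?V" for x
  proof (rule ccontr)
    assume "card (ker x) \<noteq> q"
    hence gt: "card (ker x) > q" using ker_ge[of x] x by auto
    have "(q ^ n - 1) * (q - 1) = (\<Sum>x\<in>?V. q - 1)" using cV by simp
    also have "\<dots> < (\<Sum>x\<in>?V. card (ker x) - 1)"
    proof (rule sum_strict_mono_ex1)
      show "\<forall>x\<in>?V. q - 1 \<le> card (ker x) - 1" using ker_ge by (auto intro: diff_le_mono)
      show "\<exists>x\<in>?V. q - 1 < card (ker x) - 1" using gt x q1 by (intro bexI[of _ x]) auto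
    qed (use finV in simp)
    finally show False using main mn by simp
  qed
  thus ?thesis using mn by blast
qed

text \<open>An analogue of the Chevalley--Warning theorem: for fixed \<open>z\<close> and \<open>\<nu>\<close> the subgroups \<open>Ker x\<close> below are
  counted modulo \<open>q\<close> in two ways, and the generating set of functions \<open>z \<mapsto> [\<nu> z \<noteq> 1]\<close> is interpolated.\<close>
lemma no_pairing:
  assumes iota: "\<iota> \<in> hom U W" and inj: "\<And>u. u \<in> carrier U \<Longrightarrow> u \<noteq> \<one>\<^bsub>U\<^esub> \<Longrightarrow> \<iota> u \<noteq> \<one>\<^bsub>W\<^esub>"
    and expU: "\<And>u. u \<in> carrier U \<Longrightarrow> u [^]\<^bsub>U\<^esub> q = \<one>\<^bsub>U\<^esub>"
    and kap: "\<And>x. x \<in> carrier V \<Longrightarrow> x \<noteq> \<one>\<^bsub>V\<^esub> \<Longrightarrow> \<kappa> x \<in> carrier U \<and> B x (\<kappa> x) = \<one>\<^bsub>W\<^esub> \<and> \<iota> (\<kappa> x) \<notin> img x"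
    and rk: "\<And>y. y \<in> carrier U \<Longrightarrow> \<exists>x\<in>carrier V. x \<noteq> \<one>\<^bsub>V\<^esub> \<and> B x y = \<one>\<^bsub>W\<^esub>"
  shows False
proof -
  have mn: "m = n" and kerq: "\<And>x. x \<in> carrier V \<Longrightarrow> x \<noteq> \<one>\<^bsub>V\<^esub> \<Longrightarrow> card (ker x) = q" using rank_count by auto
  let ?V = "carrier V - {\<one>\<^bsub>V\<^esub>}" and ?L = "lin U (carrier U) {}"
  have q1: "q > 1" using prime_gt_1_nat[OF q] .
  have iW: "\<iota> u \<in> carrier W" if "u \<in> carrier U" for u using iota that by (auto simp: hom_def)
  interpret I: group_hom U W \<iota> by (intro group_hom.intro group_hom_axioms.intro U.is_group W.is_group iota)
  have finL: "finite ?L" by (rule U.finite_lin[OF U.subgroup_self finU])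
  have kap1: "\<kappa> x \<noteq> \<one>\<^bsub>U\<^esub>" if "x \<in> ?V" for x
    using kap[of x] that I.hom_one subgroup.one_closed[OF img_subgroup[of x]] by auto
  have linq: "\<nu> u ^ q = 1" if "\<nu> \<in> ?L" "u \<in> carrier U" for \<nu> u
    using U.lin_pow[OF U.subgroup_self that, of q] expU[OF that(2)] U.lin_one[OF U.subgroup_self that(1)] by simp
  \<comment> \<open>The indicator of \<open>x \<in> F z \<nu>\<close> is a product of a factor
    depending on \<open>z\<close> and one depending on \<open>\<nu>\<close>; such products appear
    when the interpolation formula is evaluated.\<close>
  define F where "F z \<nu> = {x\<in>?V. \<iota> z \<notin> img x \<and> \<nu> (\<kappa> x) \<noteq> 1}" for z and \<nu> :: "'u \<Rightarrow> complex"
  have Fdvd: "q dvd card (F z \<nu>)" if z: "z \<in> carrier U" and nu: "\<nu> \<in> ?L" for z \<nu>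
  proof (cases "z = \<one>\<^bsub>U\<^esub> \<or> (\<forall>u\<in>carrier U. \<nu> u = 1)")
    case True
    hence "F z \<nu> = {}" using kap subgroup.one_closed[OF img_subgroup] by (auto simp: F_def)
    thus ?thesis by simp
  next
    case False
    hence z1: "z \<noteq> \<one>\<^bsub>U\<^esub>" by simp
    define Z where "Z = {\<iota> z [^]\<^bsub>W\<^esub> i | i::nat. True}"
    have zW: "\<iota> z \<in> carrier W" using iW z by simp
    have Zs: "subgroup Z W"
    proof (rule W.finite_submonoid_imp_subgroup[OF finW])
      show "\<one>\<^bsub>W\<^esub> \<in> Z" unfolding Z_def using W.nat_pow_0 by (metis (mono_tags, lifting) mem_Collect_eq)
      fix a b assume "a \<in> Z" "b \<in> Z"
      thus "a \<otimes>\<^bsub>W\<^esub> b \<in> Z" unfolding Z_def using W.nat_pow_mult[OF zW] by auto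
    qed (use zW in \<open>auto simp: Z_def\<close>)
    have zZ: "\<iota> z \<in> Z" unfolding Z_def using W.nat_pow_eone[OF zW] by (metis (mono_tags, lifting) mem_Collect_eq)
    have Zone: "\<one>\<^bsub>W\<^esub> \<in> Z" by (rule subgroup.one_closed[OF Zs])
    have Zmul: "a \<otimes>\<^bsub>W\<^esub> b \<in> Z" if "a \<in> Z" "b \<in> Z" for a b using subgroup.m_closed[OF Zs that] .
    have zq: "\<iota> z [^]\<^bsub>W\<^esub> q = \<one>\<^bsub>W\<^esub>" using I.hom_nat_pow[OF z, of q] expU[OF z] by simp
    define Ker where "Ker x = {y\<in>carrier U. \<nu> y = 1 \<and> B x y \<in> Z}" for x
    have Kers: "subgroup (Ker x) U" if x: "x \<in> carrier V" for x
    proof (rule U.finite_submonoid_imp_subgroup[OF finU])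
      show "\<one>\<^bsub>U\<^esub> \<in> Ker x" using group_hom.hom_one[OF hom_right[OF x]] U.lin_one[OF U.subgroup_self nu] Zone by (simp add: Ker_def)
      fix a b assume "a \<in> Ker x" "b \<in> Ker x"
      thus "a \<otimes>\<^bsub>U\<^esub> b \<in> Ker x" using B_right[OF x] Zmul U.lin_mult[OF nu] by (auto simp: Ker_def)
    qed (auto simp: Ker_def)
    \<comment> \<open>\<open>ker x\<close> has order \<open>q\<close>, so \<open>\<kappa> x\<close>
      generates it. If \<open>\<nu>\<close> kills \<open>\<kappa> x\<close>, then
      \<open>\<kappa> x\<close> lies in \<open>Ker x\<close>; if it does not and
      \<open>\<iota> z\<close> has a preimage, a power of \<open>\<kappa> x\<close> corrects that
      preimage into the kernel of \<open>\<nu>\<close>. If neither happens, \<open>Ker x\<close> is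
      a proper subgroup of \<open>ker x\<close>.\<close>
    have tri: "Ker x = {\<one>\<^bsub>U\<^esub>} \<longleftrightarrow> x \<in> F z \<nu>" if x: "x \<in> ?V" for x
    proof
      have xV: "x \<in> carrier V" and k: "\<kappa> x \<in> carrier U" "B x (\<kappa> x) = \<one>\<^bsub>W\<^esub>" using x kap by auto
      assume triv: "Ker x = {\<one>\<^bsub>U\<^esub>}"
      have n1: "\<nu> (\<kappa> x) \<noteq> 1"
      proof
        assume "\<nu> (\<kappa> x) = 1"
        hence "\<kappa> x \<in> Ker x" using k Zone by (simp add: Ker_def)
        thus False using triv kap1[OF x] by simp
      qed
      have "\<iota> z \<notin> img x"
      proof
        assume "\<iota> z \<in> img x"
        then obtain y where y: "y \<in> carrier U" "\<iota> z = B x y" by (auto simp: img_def)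
        have "inverse (\<nu> y) ^ q = 1" using linq[OF nu y(1)] by (simp add: power_inverse)
        then obtain j where j: "inverse (\<nu> y) = \<nu> (\<kappa> x) ^ j"
          using prime_root_of_unity_power[OF q linq[OF nu k(1)] n1] by metis
        let ?y = "y \<otimes>\<^bsub>U\<^esub> \<kappa> x [^]\<^bsub>U\<^esub> j"
        have Bp: "B x (\<kappa> x [^]\<^bsub>U\<^esub> j) = \<one>\<^bsub>W\<^esub>"
          using group_hom.hom_nat_pow[OF hom_right[OF xV] k(1), of j] k(2) by simp
        have "\<nu> ?y = \<nu> y * inverse (\<nu> y)"
          using U.lin_mult[OF nu y(1)] U.lin_pow[OF U.subgroup_self nu k(1), of j] k j by simp
        hence "\<nu> ?y = 1" using U.lin_nonzero[OF nu y(1)] by simp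
        moreover have By: "B x ?y = \<iota> z" using B_right[OF xV y(1)] Bp y k B_closed[OF xV] by simp
        ultimately have "?y \<in> Ker x" using zZ y k by (simp add: Ker_def)
        hence "?y = \<one>\<^bsub>U\<^esub>" using triv by simp
        hence "\<iota> z = \<one>\<^bsub>W\<^esub>" using By group_hom.hom_one[OF hom_right[OF xV]] by simp
        thus False using inj[OF z z1] by simp
      qed
      thus "x \<in> F z \<nu>" using x n1 by (simp add: F_def)
    next
      have xV: "x \<in> carrier V" and k: "\<kappa> x \<in> carrier U" "B x (\<kappa> x) = \<one>\<^bsub>W\<^esub>" using x kap by auto
      assume xF: "x \<in> F z \<nu>"
      have sub: "Ker x \<subseteq> ker x"
      proof
        fix y assume y: "y \<in> Ker x"
        then obtain i :: nat where i: "B x y = \<iota> z [^]\<^bsub>W\<^esub> i" and yU: "y \<in> carrier U" by (auto simp: Ker_def Z_def)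
        have "q dvd i"
        proof (rule ccontr)
          assume "\<not> q dvd i"
          hence "coprime i q" using q by (metis coprime_commute prime_imp_coprime)
          then obtain t where t: "[i * t = 1] (mod q)" using cong_solve_coprime_nat[of i q] by auto
          have "\<iota> z [^]\<^bsub>W\<^esub> (i * t) = \<iota> z [^]\<^bsub>W\<^esub> (q * ((i * t) div q) + (i * t) mod q)" by simp
          also have "\<dots> = (\<iota> z [^]\<^bsub>W\<^esub> q) [^]\<^bsub>W\<^esub> ((i * t) div q) \<otimes>\<^bsub>W\<^esub> \<iota> z [^]\<^bsub>W\<^esub> ((i * t) mod q)"
            using zW by (simp only: W.nat_pow_mult[symmetric] W.nat_pow_pow)
          also have "\<dots> = \<iota> z" using t q1 zW zq by (simp add: cong_def)
          finally have "\<iota> z = B x (y [^]\<^bsub>U\<^esub> t)"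
            using group_hom.hom_nat_pow[OF hom_right[OF xV] yU, of t] i zW by (simp add: W.nat_pow_pow)
          hence "\<iota> z \<in> img x" using yU by (auto simp: img_def)
          thus False using xF by (simp add: F_def)
        qed
        then obtain t where "i = q * t" by (auto elim: dvdE)
        hence "B x y = \<one>\<^bsub>W\<^esub>" using i zq zW by (metis W.nat_pow_one W.nat_pow_pow)
        thus "y \<in> ker x" using yU by (simp add: ker_def)
      qed
      have "\<kappa> x \<in> ker x" "\<kappa> x \<notin> Ker x" using k xF by (auto simp: ker_def F_def Ker_def)
      hence ps: "Ker x \<subset> ker x" using sub by blast
      have finker: "finite (ker x)" using finU by (simp add: ker_def)
      have "card (Ker x) dvd q" using U.card_subgroup_dvd[OF ker_subgroup[OF xV] Kers[OF xV] sub] kerq[OF xV] x by simp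
      moreover have "card (Ker x) < q" using psubset_card_mono[OF finker ps] kerq[OF xV] x by simp
      ultimately have "card (Ker x) = 1" using q by (metis less_irrefl prime_nat_iff)
      then obtain a where "Ker x = {a}" by (auto simp: card_1_singleton_iff)
      thus "Ker x = {\<one>\<^bsub>U\<^esub>}" using subgroup.one_closed[OF Kers[OF xV]] by auto
    qed
    have Kdvd: "q dvd card (Ker x)" if "x \<in> carrier V" "Ker x \<noteq> {\<one>\<^bsub>U\<^esub>}" for x
    proof -
      have "\<one>\<^bsub>U\<^esub> \<in> Ker x" by (rule subgroup.one_closed[OF Kers[OF that(1)]])
      hence "\<exists>y\<in>Ker x. y \<noteq> \<one>\<^bsub>U\<^esub>" using that(2) by auto
      thus ?thesis using U.prime_dvd_card_subgroup[OF finU cardU q Kers[OF that(1)]] by blast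
    qed
    \<comment> \<open>\<open>Ker\<close> at the identity is the whole kernel of
      \<open>\<nu>\<close>. It is nontrivial since \<open>\<nu>\<close> has at most \<open>q\<close>
      values on \<open>q ^ n > q\<close> elements.\<close>
    have K1: "Ker \<one>\<^bsub>V\<^esub> \<noteq> {\<one>\<^bsub>U\<^esub>}"
    proof
      assume t: "Ker \<one>\<^bsub>V\<^esub> = {\<one>\<^bsub>U\<^esub>}"
      have "inj_on \<nu> (carrier U)"
      proof (rule inj_onI)
        fix a b assume ab: "a \<in> carrier U" "b \<in> carrier U" "\<nu> a = \<nu> b"
        have "\<nu> (a \<otimes>\<^bsub>U\<^esub> inv\<^bsub>U\<^esub> b) = 1" using ab U.lin_mult[OF nu] U.lin_inv[OF U.subgroup_self nu] U.lin_nonzero[OF nu] by simp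
        moreover have "B \<one>\<^bsub>V\<^esub> (a \<otimes>\<^bsub>U\<^esub> inv\<^bsub>U\<^esub> b) = \<one>\<^bsub>W\<^esub>" using group_hom.hom_one[OF hom_left] ab by simp
        ultimately have "a \<otimes>\<^bsub>U\<^esub> inv\<^bsub>U\<^esub> b \<in> Ker \<one>\<^bsub>V\<^esub>" using ab Zone by (simp add: Ker_def)
        hence "a \<otimes>\<^bsub>U\<^esub> inv\<^bsub>U\<^esub> b = \<one>\<^bsub>U\<^esub>" using t by simp
        thus "a = b" using ab by (metis U.inv_closed U.inv_equality U.inv_inv)
      qed
      hence "card (carrier U) \<le> card {c::complex. c ^ q = 1}"
        using linq[OF nu] finite_roots_unity[of q] q1 by (intro card_inj_on_le[of \<nu>]) auto
      also have "\<dots> = q" using card_roots_unity_eq[of q] q1 by simp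
      finally show False using cardU n2 q1 power_strict_increasing[of 1 n q] by simp
    qed
    have "(\<Sum>x\<in>carrier V. card (Ker x)) = (\<Sum>y\<in>{y\<in>carrier U. \<nu> y = 1}. card {x\<in>carrier V. B x y \<in> Z})"
    proof -
      have "card (Ker x) = card {y\<in>{y\<in>carrier U. \<nu> y = 1}. B x y \<in> Z}" for x
        unfolding Ker_def by (rule arg_cong[where f=card]) auto
      thus ?thesis
        using sum_multicount_gen[of "carrier V" "{y\<in>carrier U. \<nu> y = 1}" "\<lambda>x y. B x y \<in> Z" "\<lambda>y. card {x\<in>carrier V. B x y \<in> Z}"]
          finV finU by simp
    qed
    \<comment> \<open>Counted by \<open>y\<close>, every summand is the order of a subgroup of
      \<open>V\<close> that is nontrivial by \<open>rk\<close>.\<close>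
    moreover have "q dvd (\<Sum>y\<in>{y\<in>carrier U. \<nu> y = 1}. card {x\<in>carrier V. B x y \<in> Z})"
    proof (rule dvd_sum)
      fix y assume "y \<in> {y\<in>carrier U. \<nu> y = 1}"
      hence y: "y \<in> carrier U" by simp
      have s: "subgroup {x\<in>carrier V. B x y \<in> Z} V"
      proof (rule V.finite_submonoid_imp_subgroup[OF finV])
        show "\<one>\<^bsub>V\<^esub> \<in> {x\<in>carrier V. B x y \<in> Z}" using group_hom.hom_one[OF hom_left[OF y]] Zone by simp
      qed (use B_left[OF _ _ y] Zmul in auto)
      obtain x where "x \<in> carrier V" "x \<noteq> \<one>\<^bsub>V\<^esub>" "B x y = \<one>\<^bsub>W\<^esub>" using rk[OF y] by blast
      thus "q dvd card {x\<in>carrier V. B x y \<in> Z}" using V.prime_dvd_card_subgroup[OF finV cardV q s, of x] Zone by simp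
    qed
    ultimately have tot: "q dvd (\<Sum>x\<in>carrier V. card (Ker x))" by simp
    have FV: "F z \<nu> \<subseteq> carrier V" by (auto simp: F_def)
    have "(\<Sum>x\<in>carrier V. card (Ker x)) = (\<Sum>x\<in>carrier V - F z \<nu>. card (Ker x)) + (\<Sum>x\<in>F z \<nu>. card (Ker x))"
      by (rule sum.subset_diff[OF FV finV])
    moreover have "(\<Sum>x\<in>F z \<nu>. card (Ker x)) = card (F z \<nu>)"
    proof -
      have "card (Ker x) = 1" if "x \<in> F z \<nu>" for x
      proof -
        have "x \<in> ?V" using that by (simp add: F_def)
        hence "Ker x = {\<one>\<^bsub>U\<^esub>}" using tri that by simp
        thus ?thesis by simp
      qed
      thus ?thesis by simp
    qed
    moreover have "q dvd (\<Sum>x\<in>carrier V - F z \<nu>. card (Ker x))"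
      by (rule dvd_sum, rule Kdvd) (use tri K1 in auto)
    ultimately show ?thesis using tot by (metis dvd_add_right_iff)
  qed
  define M where "M \<nu> z = (if \<nu> z \<noteq> 1 then 1 else (0::int))" for \<nu> :: "'u \<Rightarrow> complex" and z
  define S where "S = {f. \<exists>w. f = (\<lambda>z. \<Sum>\<nu>\<in>?L. w \<nu> * M \<nu> z)}"
  have qp: "Factorial_Ring.prime (int q)" using q by simp
  have "\<exists>P h. P \<subseteq> carrier U \<and> (\<forall>i\<in>P. h i \<in> S) \<and> (\<forall>f\<in>S. \<forall>x\<in>carrier U. [f x = (\<Sum>i\<in>P. f i * h i x)] (mod int q))"
  proof (rule interpolation_basis[OF finU qp])
    show "(\<lambda>_. 0) \<in> S" unfolding S_def by (intro CollectI exI[of _ "\<lambda>_. 0"]) simp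
    fix f g a b assume "f \<in> S" "g \<in> S"
    then obtain w w' where fg: "f = (\<lambda>z. \<Sum>\<nu>\<in>?L. w \<nu> * M \<nu> z)" "g = (\<lambda>z. \<Sum>\<nu>\<in>?L. w' \<nu> * M \<nu> z)"
      unfolding S_def by blast
    have "a * f z + b * g z = (\<Sum>\<nu>\<in>?L. (a * w \<nu> + b * w' \<nu>) * M \<nu> z)" for z
      unfolding fg sum_distrib_left sum.distrib[symmetric] by (rule sum.cong) (simp_all add: distrib_right mult.assoc)
    thus "(\<lambda>x. a * f x + b * g x) \<in> S" unfolding S_def
      by (intro CollectI exI[of _ "\<lambda>\<nu>. a * w \<nu> + b * w' \<nu>"] ext)
  qed
  then obtain P h where P: "P \<subseteq> carrier U" and hS: "\<And>i. i \<in> P \<Longrightarrow> h i \<in> S"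
    and ip: "\<And>f x. f \<in> S \<Longrightarrow> x \<in> carrier U \<Longrightarrow> [f x = (\<Sum>i\<in>P. f i * h i x)] (mod int q)" by blast
  have "\<forall>i\<in>P. \<exists>w. h i = (\<lambda>z. \<Sum>\<nu>\<in>?L. w \<nu> * M \<nu> z)" using hS by (auto simp: S_def)
  then obtain w where w: "\<And>i. i \<in> P \<Longrightarrow> h i = (\<lambda>z. \<Sum>\<nu>\<in>?L. w i \<nu> * M \<nu> z)" by metis
  have MS: "M \<nu> \<in> S" if "\<nu> \<in> ?L" for \<nu>
  proof -
    have "M \<nu> z = (\<Sum>\<mu>\<in>?L. (if \<mu> = \<nu> then 1 else 0) * M \<mu> z)" for z
    proof -
      have "(\<Sum>\<mu>\<in>?L. (if \<mu> = \<nu> then 1 else 0) * M \<mu> z) = (\<Sum>\<mu>\<in>?L. if \<mu> = \<nu> then M \<nu> z else 0)"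
        by (rule sum.cong) auto
      thus ?thesis using finL that by simp
    qed
    thus ?thesis unfolding S_def by (intro CollectI exI[of _ "\<lambda>\<mu>. if \<mu> = \<nu> then 1 else 0"] ext)
  qed
  \<comment> \<open>\<open>img x\<close> has prime index \<open>q\<close> in \<open>W\<close>, so it
    is the full kernel of a character, which is pulled back along \<open>\<iota>\<close>.\<close>
  have alpha: "\<exists>\<nu>\<in>?L. \<forall>z\<in>carrier U. \<nu> z \<noteq> 1 \<longleftrightarrow> \<iota> z \<notin> img x" if x: "x \<in> ?V" for x
  proof -
    have xV: "x \<in> carrier V" using x by simp
    have cl: "card (lin W (carrier W) (img x)) = q" using card_lin_img[OF xV] mn kerq[OF xV] x by simp
    have "lin W (carrier W) (img x) \<noteq> {trivW}" using cl q1 by auto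
    moreover have "trivW \<in> lin W (carrier W) (img x)"
      using W.trivial_lin[OF W.subgroup_self] img_subgroup[OF xV] by (simp add: subgroup.subset)
    ultimately obtain \<nu> where nu: "\<nu> \<in> lin W (carrier W) (img x)" "\<nu> \<noteq> trivW" by auto
    then obtain w0 where w0: "w0 \<in> carrier W" "\<nu> w0 \<noteq> 1"
      using W.lin_eqI[OF nu(1) \<open>trivW \<in> lin W (carrier W) (img x)\<close>] by auto
    define T where "T = {a\<in>carrier W. \<nu> a = 1}"
    have T: "subgroup T W"
      by (rule W.finite_submonoid_imp_subgroup[OF finW])
        (use W.lin_one[OF W.subgroup_self nu(1)] W.lin_mult[OF nu(1)] in \<open>auto simp: T_def\<close>)
    have iT: "img x \<subseteq> T" using W.lin_trivial_on[OF nu(1)] subgroup.subset[OF img_subgroup[OF xV]] by (auto simp: T_def)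
    have finT: "finite T" using finW by (simp add: T_def)
    have cw: "card (img x) * q = q ^ n" using card_img_ker[OF xV] kerq[OF xV] x by simp
    have ci: "card (img x) > 0" using cw q1 by (intro gr0I) simp
    obtain s where s: "card T = card (img x) * s"
      using W.card_subgroup_dvd[OF T img_subgroup[OF xV] iT] by (auto elim: dvdE)
    have "card T dvd card (carrier W)" using W.card_subgroup_dvd[OF W.subgroup_self T] by (simp add: T_def)
    hence "card (img x) * s dvd card (img x) * q" using s cw cardW mn by simp
    hence "s dvd q" using ci by simp
    moreover have "s \<noteq> q"
    proof
      assume "s = q"
      hence "card T = card (carrier W)" using s cw cardW mn by simp
      hence "T = carrier W" using finW by (intro card_subset_eq) (auto simp: T_def)
      thus False using w0 by (auto simp: T_def)
    qed
    ultimately have "s = 1" using q by (metis prime_nat_iff)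
    hence "T = img x" using s iT finT by (metis card_subset_eq mult.right_neutral)
    hence Ti: "\<nu> a = 1 \<longleftrightarrow> a \<in> img x" if "a \<in> carrier W" for a using that by (auto simp: T_def)
    have "(\<lambda>u. if u \<in> carrier U then \<nu> (\<iota> u) else 0) \<in> ?L"
      using nu(1) iW iota unfolding lin_def hom_def by auto
    thus ?thesis using Ti iW by (intro bexI) auto
  qed
  \<comment> \<open>\<open>M \<alpha>\<close> equals 1 at \<open>\<kappa> x\<close>. Interpolating
    it there writes 1 as a combination of the indicators of \<open>x \<in> F i \<nu>\<close> with
    coefficients independent of \<open>x\<close>.\<close>
  have one: "[1 = (\<Sum>i\<in>P. \<Sum>\<nu>\<in>?L. w i \<nu> * (if x \<in> F i \<nu> then 1 else 0))] (mod int q)" if x: "x \<in> ?V" for x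
  proof -
    obtain \<alpha> where al: "\<alpha> \<in> ?L" "\<And>z. z \<in> carrier U \<Longrightarrow> \<alpha> z \<noteq> 1 \<longleftrightarrow> \<iota> z \<notin> img x" using alpha[OF x] by blast
    have kx: "\<kappa> x \<in> carrier U" "\<iota> (\<kappa> x) \<notin> img x" using kap x by auto
    have "M \<alpha> (\<kappa> x) = 1" using al(2)[OF kx(1)] kx by (simp add: M_def)
    moreover have "M \<alpha> i * h i (\<kappa> x) = (\<Sum>\<nu>\<in>?L. w i \<nu> * (if x \<in> F i \<nu> then 1 else 0))" if i: "i \<in> P" for i
    proof -
      have iU: "i \<in> carrier U" using i P by auto
      have "M \<alpha> i * (w i \<nu> * M \<nu> (\<kappa> x)) = w i \<nu> * (if x \<in> F i \<nu> then 1 else 0)" for \<nu>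
        using al(2)[OF iU] x by (simp add: M_def F_def)
      thus ?thesis unfolding w[OF i] sum_distrib_left by (rule sum.cong[OF refl])
    qed
    ultimately show ?thesis using ip[OF MS[OF al(1)] kx(1)] by simp
  qed
  \<comment> \<open>Summation over \<open>x\<close> expresses \<open>q ^ n - 1\<close> modulo
    \<open>q\<close> through the orders of the sets \<open>F i \<nu>\<close>, all divisible by
    \<open>q\<close>.\<close>
  have "[(\<Sum>x\<in>?V. 1) = (\<Sum>x\<in>?V. \<Sum>i\<in>P. \<Sum>\<nu>\<in>?L. w i \<nu> * (if x \<in> F i \<nu> then 1 else 0))] (mod int q)"
    by (rule cong_sum) (rule one)
  also have "(\<Sum>x\<in>?V. \<Sum>i\<in>P. \<Sum>\<nu>\<in>?L. w i \<nu> * (if x \<in> F i \<nu> then 1 else 0)) =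
      (\<Sum>i\<in>P. \<Sum>x\<in>?V. \<Sum>\<nu>\<in>?L. w i \<nu> * (if x \<in> F i \<nu> then 1 else 0))"
    by (rule sum.swap)
  also have "\<dots> = (\<Sum>i\<in>P. \<Sum>\<nu>\<in>?L. \<Sum>x\<in>?V. w i \<nu> * (if x \<in> F i \<nu> then 1 else 0))"
    by (rule sum.cong[OF refl], rule sum.swap)
  also have "\<dots> = (\<Sum>i\<in>P. \<Sum>\<nu>\<in>?L. w i \<nu> * int (card (F i \<nu>)))"
  proof (intro sum.cong refl)
    fix i \<nu>
    have "{x\<in>?V. x \<in> F i \<nu>} = F i \<nu>" by (auto simp: F_def)
    thus "(\<Sum>x\<in>?V. w i \<nu> * (if x \<in> F i \<nu> then 1 else 0)) = w i \<nu> * int (card (F i \<nu>))"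
      using finV by (simp add: sum_distrib_left[symmetric] sum.If_cases Int_def del: Diff_iff)
  qed
  finally have "[int (card ?V) = (\<Sum>i\<in>P. \<Sum>\<nu>\<in>?L. w i \<nu> * int (card (F i \<nu>)))] (mod int q)" by simp
  moreover have "int q dvd (\<Sum>i\<in>P. \<Sum>\<nu>\<in>?L. w i \<nu> * int (card (F i \<nu>)))"
    using Fdvd P by (intro dvd_sum dvd_mult) auto
  ultimately have "int q dvd int (card ?V)" using cong_dvd_iff by blast
  hence "q dvd card ?V" by simp
  hence "q dvd q ^ n - 1" using cardV finV by simp
  moreover have "q dvd q ^ n" using n2 by (simp add: dvd_power)
  ultimately have "q dvd 1" using q1
    by (metis dvd_diffD1 one_le_power less_imp_le)
  thus False using q1 by simp
qed

end

subsection \<open>Isotropic subgroups and the characters they induce\<close>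

lemma card_le_totient:
  assumes e: "e > 1" and co: "\<And>x. x \<in> E \<Longrightarrow> coprime (J x) e"
    and inj: "\<And>x y. x \<in> E \<Longrightarrow> y \<in> E \<Longrightarrow> J x mod e = J y mod e \<Longrightarrow> x = y"
  shows "card E \<le> totient e"
proof -
  have "inj_on (\<lambda>x. J x mod e) E" using inj by (auto simp: inj_on_def)
  moreover have "(\<lambda>x. J x mod e) ` E \<subseteq> totatives e"
  proof (rule image_subsetI)
    fix x assume x: "x \<in> E"
    have c: "coprime (J x mod e) e" using co[OF x] e by (simp add: coprime_mod_left_iff)
    have "J x mod e \<noteq> 0" using c e by (intro notI) simp
    thus "J x mod e \<in> totatives e" using c e by (simp add: in_totatives_iff less_imp_le)
  qed
  ultimately show ?thesis unfolding totient_def by (rule card_inj_on_le) simp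
qed

lemma coprime_powers_eq_1:
  assumes "z ^ a = (1::complex)" "z ^ b = 1" "coprime a b" "a > 0" shows "z = 1"
proof -
  obtain x y where xy: "a * x = b * y + 1" using bezout_nat[of a b] assms(3,4) by auto
  have "z ^ (a * x) = z ^ (b * y + 1)" using xy by simp
  thus ?thesis unfolding power_add power_mult using assms by simp
qed

section \<open>Inertia groups, maximal isotropic subgroups and irreducible induction\<close>

context frobenius_GC_prime
begin

abbreviation K2 :: "'a set" where "K2 \<equiv> derived G K"

lemma K2_normal: "K2 \<lhd> G" by (rule derived_K_normal)
lemma K2_sub: "subgroup K2 G" using K2_normal by (rule normal_imp_subgroup)
lemma K2_K: "K2 \<subseteq> K" using derived_incl[OF order_refl K_sub] .
lemma K2_KD [simp]: "x \<in> K2 \<Longrightarrow> x \<in> K" using K2_K by auto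

lemma gcomm_K2 [simp]: "x \<in> K \<Longrightarrow> y \<in> K \<Longrightarrow> gcomm G x y \<in> K2"
  unfolding derived_eq_commK by (rule commK_incl)

text \<open>The inertia subgroup in \<open>K\<close> of a character of \<open>K2\<close>.\<close>

definition stabK :: "('a \<Rightarrow> complex) \<Rightarrow> 'a set" where
  "stabK \<mu> = {x\<in>K. \<forall>n\<in>K2. \<mu> (gconj G x n) = \<mu> n}"

text \<open>A maximal isotropic subgroup for the form \<open>\<mu> (gcomm G a b)\<close> on the
  inertia group; maximality is expressed by saying that \<open>A\<close> contains everything
  orthogonal to it.\<close>

definition isotropic :: "('a \<Rightarrow> complex) \<Rightarrow> 'a set \<Rightarrow> bool" where
  "isotropic \<mu> A \<longleftrightarrow> subgroup A G \<and> K2 \<subseteq> A \<and> A \<subseteq> stabK \<mu> \<and> (\<forall>a\<in>A. \<forall>b\<in>A. \<mu> (gcomm G a b) = 1) \<and>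
     (\<forall>g\<in>stabK \<mu>. (\<forall>a\<in>A. \<mu> (gcomm G a g) = 1) \<longrightarrow> g \<in> A)"

lemma stabK_subset: "stabK \<mu> \<subseteq> K" by (auto simp: stabK_def)

lemma gconj_K2: "g \<in> carrier G \<Longrightarrow> x \<in> K2 \<Longrightarrow> gconj G g x \<in> K2" using normal_gconj[OF K2_normal] .

lemma stabK_subgroup:
  assumes mu: "\<mu> \<in> lin G K2 {}" shows "subgroup (stabK \<mu>) G"
proof (rule finite_submonoid_imp_subgroup[OF finG])
  show "stabK \<mu> \<subseteq> carrier G" using subset_trans[OF stabK_subset subgroup.subset[OF K_sub]] .
  show "\<one> \<in> stabK \<mu>" using K_sub by (simp add: stabK_def subgroup.one_closed)
  fix x y assume xy: "x \<in> stabK \<mu>" "y \<in> stabK \<mu>"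
  have "\<mu> (gconj G (x \<otimes> y) n) = \<mu> n" if n: "n \<in> K2" for n
    using xy n gconj_K2[of y n] by (simp add: stabK_def gconj_gconj[symmetric])
  thus "x \<otimes> y \<in> stabK \<mu>" using xy K_sub by (simp add: stabK_def subgroup.m_closed)
qed

lemma K2_stabK: assumes mu: "\<mu> \<in> lin G K2 {}" shows "K2 \<subseteq> stabK \<mu>"
  using lin_gconj[OF K2_sub mu] by (auto simp: stabK_def)

text \<open>Only conjugation by \<open>x\<close> enters the commutator identity, so membership of
  \<open>x\<close> in the inertia group is what makes the form multiplicative.\<close>

lemma form_left:
  assumes mu: "\<mu> \<in> lin G K2 {}" and x: "x \<in> stabK \<mu>" "y \<in> K" "w \<in> K"
  shows "\<mu> (gcomm G (x \<otimes> y) w) = \<mu> (gcomm G x w) * \<mu> (gcomm G y w)"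
proof -
  have xK: "x \<in> K" using x stabK_subset by auto
  have "\<mu> (gcomm G (x \<otimes> y) w) = \<mu> (gconj G x (gcomm G y w)) * \<mu> (gcomm G x w)"
    using xK x gconj_K2 lin_mult[OF mu] by (simp add: gcomm_mult_left)
  thus ?thesis using x xK by (simp add: stabK_def)
qed

lemma form_inv:
  assumes mu: "\<mu> \<in> lin G K2 {}" and x: "x \<in> K" "y \<in> K"
  shows "\<mu> (gcomm G y x) = inverse (\<mu> (gcomm G x y))"
  using lin_inv[OF K2_sub mu gcomm_K2[OF x]] x by (simp add: gcomm_inv)

lemma form_sym:
  assumes mu: "\<mu> \<in> lin G K2 {}" and x: "x \<in> K" "y \<in> K"
  shows "\<mu> (gcomm G y x) = 1 \<longleftrightarrow> \<mu> (gcomm G x y) = 1"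
  using form_inv[OF mu x] by simp

text \<open>The maximum is taken over sets rather than subgroups, so that a single orthogonal
  element can be inserted. Multiplicativity of the form then shows that a maximal set is closed
  under products.\<close>

lemma isotropic_exists:
  assumes mu: "\<mu> \<in> lin G K2 {}" shows "\<exists>A. isotropic \<mu> A"
proof -
  define ok where "ok A \<longleftrightarrow> K2 \<subseteq> A \<and> A \<subseteq> stabK \<mu> \<and> (\<forall>a\<in>A. \<forall>b\<in>A. \<mu> (gcomm G a b) = 1)" for A
  have finK: "finite K" by (rule finite_sub[OF K_sub])
  have ok0: "ok K2" unfolding ok_def using K2_stabK[OF mu] lin_gcomm_kernel[OF K2_sub mu] by auto
  have bnd: "card A \<le> card K" if "ok A" for A
    using that stabK_subset finK by (intro card_mono) (auto simp: ok_def)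
  obtain A where A: "ok A" and max: "\<And>B. ok B \<Longrightarrow> card B \<le> card A"
    using ex_has_greatest_nat[of ok K2 card "Suc (card K)"] ok0 bnd by (metis le_imp_less_Suc)
  have AK: "a \<in> K" if "a \<in> A" for a using that A stabK_subset by (auto simp: ok_def)
  have finA: "finite A" by (rule finite_subset[OF subsetI finK]) (rule AK)
  have mx: "g \<in> A" if g: "g \<in> stabK \<mu>" "\<And>a. a \<in> A \<Longrightarrow> \<mu> (gcomm G a g) = 1" for g
  proof (rule ccontr)
    assume "g \<notin> A"
    have gK: "g \<in> K" using g stabK_subset by auto
    have "ok (insert g A)" unfolding ok_def
      using A g form_sym[OF mu gK] AK lin_one[OF K2_sub mu] gK by (auto simp: ok_def)
    from max[OF this] show False using \<open>g \<notin> A\<close> finA by simp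
  qed
  have "subgroup A G"
  proof (rule finite_submonoid_imp_subgroup[OF finG])
    show "A \<subseteq> carrier G" using AK by auto
    show "\<one> \<in> A" using A subgroup.one_closed[OF K2_sub] by (auto simp: ok_def)
    fix a b assume ab: "a \<in> A" "b \<in> A"
    have st: "a \<in> stabK \<mu>" "b \<in> stabK \<mu>" using ab A by (auto simp: ok_def)
    show "a \<otimes> b \<in> A"
    proof (rule mx)
      show "a \<otimes> b \<in> stabK \<mu>" using st stabK_subgroup[OF mu] by (simp add: subgroup.m_closed)
      fix c assume c: "c \<in> A"
      have "\<mu> (gcomm G (a \<otimes> b) c) = 1" using form_left[OF mu st(1) AK[OF ab(2)] AK[OF c]] A ab c by (simp add: ok_def)
      thus "\<mu> (gcomm G c (a \<otimes> b)) = 1"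
        using form_sym[OF mu AK[OF c], of "a \<otimes> b"] AK ab K_sub by (simp add: subgroup.m_closed)
    qed
  qed
  thus ?thesis using A mx unfolding isotropic_def ok_def by blast
qed

text \<open>Modulo the kernel \<open>D\<close> of \<open>\<mu>\<close> in \<open>K2\<close> the
  subgroup \<open>B\<close> becomes abelian, which reduces the count to
  \<open>card_lin_extensions\<close>.\<close>

lemma extensions_card:
  assumes mu: "\<mu> \<in> lin G K2 {}" and B: "subgroup B G" "B \<subseteq> K" "\<And>a b. a \<in> B \<Longrightarrow> b \<in> B \<Longrightarrow> \<mu> (gcomm G a b) = 1"
    and H: "subgroup H G" "K2 \<subseteq> H" "H \<subseteq> B" and phi: "\<phi> \<in> lin G H {}" "\<And>n. n \<in> K2 \<Longrightarrow> \<phi> n = \<mu> n"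
  shows "card {\<psi>\<in>lin G B {}. \<forall>h\<in>H. \<psi> h = \<phi> h} * card H = card B"
proof -
  define D where "D = {n\<in>K2. \<mu> n = 1}"
  have D: "subgroup D G"
    by (rule finite_submonoid_imp_subgroup[OF finG])
      (use lin_one[OF K2_sub mu] lin_mult[OF mu] K2_sub in \<open>auto simp: D_def subgroup.one_closed subgroup.m_closed\<close>)
  have sec: "abelian_section G B D" unfolding abelian_section_def
    using B D H gcomm_K2 by (auto simp: D_def subset_iff)
  have phiD: "\<phi> \<in> lin G H D" using phi by (auto simp: lin_def D_def)
  have "{\<psi>\<in>lin G B {}. \<forall>h\<in>H. \<psi> h = \<phi> h} = {\<psi>\<in>lin G B D. \<forall>h\<in>H. \<psi> h = \<phi> h}"
    using phi(2) H(2) by (auto simp: lin_def D_def)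
  thus ?thesis using card_lin_extensions[OF finG sec H(1) _ H(3) phiD] H(2) by (auto simp: D_def)
qed

lemma extension_exists:
  assumes mu: "\<mu> \<in> lin G K2 {}" and B: "subgroup B G" "B \<subseteq> K" "\<And>a b. a \<in> B \<Longrightarrow> b \<in> B \<Longrightarrow> \<mu> (gcomm G a b) = 1"
    and H: "subgroup H G" "K2 \<subseteq> H" "H \<subseteq> B" and phi: "\<phi> \<in> lin G H {}" "\<And>n. n \<in> K2 \<Longrightarrow> \<phi> n = \<mu> n"
  shows "\<exists>\<psi>\<in>lin G B {}. \<forall>h\<in>H. \<psi> h = \<phi> h"
proof -
  have "card B > 0" by (rule card_sub_pos[OF B(1)])
  hence "card {\<psi>\<in>lin G B {}. \<forall>h\<in>H. \<psi> h = \<phi> h} \<noteq> 0" using extensions_card[OF assms] by (intro notI) simp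
  hence "{\<psi>\<in>lin G B {}. \<forall>h\<in>H. \<psi> h = \<phi> h} \<noteq> {}" by force
  thus ?thesis by blast
qed

text \<open>Write \<open>g = k \<otimes> l\<close>. If \<open>l \<noteq> \<one>\<close>, it moves
  the nontrivial \<open>K\<close>-invariant character on \<open>M\<close>. If \<open>g\<close> is in
  \<open>K\<close> but outside the inertia group, it moves \<open>\<mu>\<close> on
  \<open>K2\<close>. If it is inside the inertia group, maximality gives \<open>a\<close> in
  \<open>A\<close> not orthogonal to \<open>g\<close>, and conjugation by \<open>g\<close>
  multiplies \<open>\<psi> a\<close> by \<open>\<mu> (gcomm G g a) \<noteq> 1\<close>.\<close>

lemma mackey_isotropic:
  assumes mu: "\<mu> \<in> lin G K2 {}" and iso: "isotropic \<mu> A" and psi: "\<psi> \<in> lin G A {}" "\<And>n. n \<in> K2 \<Longrightarrow> \<psi> n = \<mu> n"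
    and M: "M \<lhd> G" "M \<subseteq> K2" "\<And>k m. k \<in> K \<Longrightarrow> m \<in> M \<Longrightarrow> \<mu> (gconj G k m) = \<mu> m" and nt: "m0 \<in> M" "\<mu> m0 \<noteq> 1"
  shows "mackey G A \<psi>"
  unfolding mackey_def
proof (intro conjI ballI)
  show A: "subgroup A G" using iso by (simp add: isotropic_def)
  have K2A: "K2 \<subseteq> A" using iso by (simp add: isotropic_def)
  fix g assume g: "g \<in> carrier G - A"
  then obtain k l where kl: "k \<in> K" "l \<in> L" "g = k \<otimes> l" using KL_E by blast
  show "\<exists>h\<in>A. gconj G g h \<in> A \<and> \<psi> (gconj G g h) \<noteq> \<psi> h"
  proof (cases "l = \<one>")
    case False
    have Ms: "subgroup M G" using M by (simp add: normal_imp_subgroup)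
    have r: "(\<lambda>x. if x \<in> M then \<mu> x else 0) \<in> lin G M {}" by (rule lin_restrict[OF mu Ms M(2)]) simp
    have "\<not> (\<forall>h\<in>M. \<mu> (gconj G l h) = \<mu> h)"
    proof
      assume a: "\<forall>h\<in>M. \<mu> (gconj G l h) = \<mu> h"
      have "(if m0 \<in> M then \<mu> m0 else 0) = 1"
        by (rule lin_fpf[OF M(1) _ r kl(2) False]) (use a M K2_K nt normal_gconj[OF M(1)] kl in auto)
      thus False using nt by simp
    qed
    then obtain h where h: "h \<in> M" "\<mu> (gconj G l h) \<noteq> \<mu> h" by blast
    have hc: "h \<in> carrier G" using h M(2) by auto
    have "gconj G l h \<in> M" using normal_gconj[OF M(1)] kl h by simp
    hence "\<mu> (gconj G g h) = \<mu> (gconj G l h)" using M(3)[OF kl(1), of "gconj G l h"] kl hc by (simp add: gconj_gconj)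
    moreover have "gconj G g h \<in> K2" "h \<in> K2" using h M(2) g gconj_K2 by auto
    ultimately show ?thesis using h psi(2) K2A by (intro bexI[of _ h]) auto
  next
    case True
    hence gK: "g \<in> K" "g \<in> carrier G" using kl by auto
    show ?thesis
    proof (cases "g \<in> stabK \<mu>")
      case False
      then obtain n where "n \<in> K2" "\<mu> (gconj G g n) \<noteq> \<mu> n" using gK by (auto simp: stabK_def)
      thus ?thesis using psi(2) K2A gconj_K2[OF gK(2)] by (intro bexI[of _ n]) auto
    next
      case True
      then obtain a where a: "a \<in> A" "\<mu> (gcomm G a g) \<noteq> 1" using iso g unfolding isotropic_def by blast
      have aK: "a \<in> K" using a iso stabK_subset by (auto simp: isotropic_def)
      have cA: "gcomm G g a \<in> A" using gK aK K2A by auto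
      have e: "gconj G g a = gcomm G g a \<otimes> a" using gK aK by (simp add: gconj_gcomm)
      have "\<psi> (gconj G g a) = \<mu> (gcomm G g a) * \<psi> a" unfolding e using lin_mult[OF psi(1) cA a(1)] psi(2) gK aK by simp
      moreover have "\<mu> (gcomm G g a) \<noteq> 1" using form_sym[OF mu aK gK(1)] a by simp
      ultimately have "\<psi> (gconj G g a) \<noteq> \<psi> a" using lin_nonzero[OF psi(1) a(1)] by simp
      moreover have "gconj G g a \<in> A" unfolding e using cA a A by (simp add: subgroup.m_closed)
      ultimately show ?thesis using a by blast
    qed
  qed
qed (use psi in auto)

text \<open>On \<open>K\<close> this is a multiple of the character of \<open>K\<close> induced from
  \<open>\<psi>\<close>; it is the inner sum of \<open>induced_KL\<close>.\<close>

definition thetaK :: "('a \<Rightarrow> complex) \<Rightarrow> 'a \<Rightarrow> complex" where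
  "thetaK \<psi> y = (\<Sum>k\<in>K. \<psi> (gconj G k y))"

lemma induced_thetaK: "x \<in> carrier G \<Longrightarrow> induced G \<psi> x = (\<Sum>l\<in>L. thetaK \<psi> (gconj G l x))"
  by (simp add: induced_KL thetaK_def)

text \<open>Fourier inversion on \<open>M\<close>: translation by \<open>s\<close> multiplies the
  term of \<open>l\<close> by the \<open>l\<close>-conjugate of \<open>\<nu>\<close>, which differs
  from \<open>\<nu>\<close> for \<open>l \<noteq> \<one>\<close>. Only the term of the identity
  survives, so equality of characters of \<open>G\<close> lying over the same \<open>\<nu>\<close>
  descends to their parts on \<open>K\<close>.\<close>

lemma thetaK_isolate:
  assumes psi: "\<psi> \<in> lin G A {}" and A: "subgroup A G" "M \<subseteq> A" and M: "M \<lhd> G" "M \<subseteq> K"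
    and lam: "\<nu> \<in> lin G M {}" "\<And>k m. k \<in> K \<Longrightarrow> m \<in> M \<Longrightarrow> \<nu> (gconj G k m) = \<nu> m" "m0 \<in> M" "\<nu> m0 \<noteq> 1"
    and res: "\<And>m. m \<in> M \<Longrightarrow> \<psi> m = \<nu> m" and y: "y \<in> carrier G"
  shows "(\<Sum>s\<in>M. inverse (\<nu> s) * induced G \<psi> (y \<otimes> s)) = of_nat (card M) * thetaK \<psi> y"
proof -
  have Ms: "subgroup M G" using M by (simp add: normal_imp_subgroup)
  have Mc: "s \<in> carrier G" if "s \<in> M" for s using that Ms by (simp add: subgroup.mem_carrier)
  have cj: "gconj G g s \<in> M" if "g \<in> carrier G" "s \<in> M" for g s using normal_gconj[OF M(1)] that by simp
  have th: "thetaK \<psi> (gconj G l (y \<otimes> s)) = thetaK \<psi> (gconj G l y) * \<nu> (gconj G l s)" if l: "l \<in> L" and s: "s \<in> M" for l s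
  proof -
    have "\<psi> (gconj G k (gconj G l (y \<otimes> s))) = \<psi> (gconj G k (gconj G l y)) * \<nu> (gconj G l s)" if k: "k \<in> K" for k
    proof -
      have "gconj G k (gconj G l (y \<otimes> s)) = gconj G k (gconj G l y) \<otimes> gconj G k (gconj G l s)"
        using l s k y Mc by (simp add: gconj_mult)
      moreover have m: "gconj G k (gconj G l s) \<in> M" using cj l s k by simp
      ultimately show ?thesis using lin_mult_right[OF A(1) psi, of "gconj G k (gconj G l s)" "gconj G k (gconj G l y)"]
          A(2) res[OF m] lam(2)[OF k cj[OF _ s], of l] l k y by auto
    qed
    thus ?thesis unfolding thetaK_def sum_distrib_right by (rule sum.cong[OF refl])
  qed
  have orth: "(\<Sum>s\<in>M. \<nu> (gconj G l s) * inverse (\<nu> s)) = (if l = \<one> then of_nat (card M) else 0)" if l: "l \<in> L" for l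
  proof -
    have tw: "twist G M l \<nu> \<in> lin G M {}" by (rule lin_twist[OF M(1) lam(1)]) (use l in auto)
    have "twist G M l \<nu> = \<nu> \<longleftrightarrow> l = \<one>"
    proof
      assume e: "twist G M l \<nu> = \<nu>"
      show "l = \<one>"
      proof (rule ccontr)
        assume "l \<noteq> \<one>"
        have "\<nu> m0 = 1"
          by (rule lin_fpf[OF M lam(1) l \<open>l \<noteq> \<one>\<close> _ lam(3)]) (use fun_cong[OF e] in \<open>simp add: twist_def\<close>, metis)
        thus False using lam(4) by simp
      qed
    next
      assume "l = \<one>"
      thus "twist G M l \<nu> = \<nu>" using Mc lin_outside[OF lam(1)] by (auto simp: twist_def)
    qed
    moreover have "(\<Sum>s\<in>M. \<nu> (gconj G l s) * inverse (\<nu> s)) = (\<Sum>s\<in>M. twist G M l \<nu> s * inverse (\<nu> s))"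
      by (rule sum.cong) (auto simp: twist_def)
    ultimately show ?thesis using lin_orthogonality[OF Ms tw lam(1)] by simp
  qed
  have "(\<Sum>s\<in>M. inverse (\<nu> s) * induced G \<psi> (y \<otimes> s)) =
      (\<Sum>s\<in>M. \<Sum>l\<in>L. thetaK \<psi> (gconj G l y) * (\<nu> (gconj G l s) * inverse (\<nu> s)))"
    using y Mc by (intro sum.cong refl) (simp add: induced_thetaK th sum_distrib_left mult_ac)
  also have "\<dots> = (\<Sum>l\<in>L. thetaK \<psi> (gconj G l y) * (\<Sum>s\<in>M. \<nu> (gconj G l s) * inverse (\<nu> s)))"
    unfolding sum_distrib_left by (rule sum.swap)
  also have "\<dots> = (\<Sum>l\<in>L. if l = \<one> then thetaK \<psi> y * of_nat (card M) else 0)"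
    using orth y by (intro sum.cong refl) auto
  also have "\<dots> = of_nat (card M) * thetaK \<psi> y"
    using finite_sub[OF L_sub] subgroup.one_closed[OF L_sub] by simp
  finally show ?thesis .
qed

lemma thetaK_eq:
  assumes psi: "\<psi> \<in> lin G A {}" "subgroup A G" "M \<subseteq> A" and psi': "\<psi>' \<in> lin G A' {}" "subgroup A' G" "M \<subseteq> A'"
    and M: "M \<lhd> G" "M \<subseteq> K"
    and lam: "\<nu> \<in> lin G M {}" "\<And>k m. k \<in> K \<Longrightarrow> m \<in> M \<Longrightarrow> \<nu> (gconj G k m) = \<nu> m" "m0 \<in> M" "\<nu> m0 \<noteq> 1"
    and res: "\<And>m. m \<in> M \<Longrightarrow> \<psi> m = \<nu> m" "\<And>m. m \<in> M \<Longrightarrow> \<psi>' m = \<nu> m" and y: "y \<in> carrier G"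
    and eq: "\<And>g. g \<in> carrier G \<Longrightarrow> induced G \<psi> g = induced G \<psi>' g"
  shows "thetaK \<psi> y = thetaK \<psi>' y"
proof -
  have Ms: "subgroup M G" using M by (simp add: normal_imp_subgroup)
  have "(\<Sum>s\<in>M. inverse (\<nu> s) * induced G \<psi> (y \<otimes> s)) = (\<Sum>s\<in>M. inverse (\<nu> s) * induced G \<psi>' (y \<otimes> s))"
    using eq y Ms by (intro sum.cong refl) (simp add: subgroup.mem_carrier)
  hence "of_nat (card M) * thetaK \<psi> y = of_nat (card M) * thetaK \<psi>' y"
    using thetaK_isolate[OF psi M lam res(1) y] thetaK_isolate[OF psi' M lam res(2) y] by simp
  thus ?thesis using card_sub_pos[OF Ms] by simp
qed

lemma coprime_q:
  assumes "coprime j (card (carrier G))" shows "coprime j q"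
proof -
  have "card K \<noteq> 1" using K_nontrivial subgroup.one_closed[OF K_sub] by (auto simp: card_1_singleton_iff)
  then obtain s where "card K = q ^ s" "s \<noteq> 0" using K_q_group by (metis power_0)
  hence "q dvd card (carrier G)" using card_G by simp
  thus ?thesis using assms by (meson coprime_divisors dvd_refl)
qed

end

section \<open>Abelian sections as quotient groups, the form required by the pairing locale\<close>

abbreviation quot :: "('a, 'b) monoid_scheme \<Rightarrow> 'a set \<Rightarrow> 'a set \<Rightarrow> 'a set monoid" where
  "quot G N D \<equiv> (G\<lparr>carrier := N\<rparr>) Mod D"

context group
begin

lemma rcos_eq_iff:
  assumes "subgroup D G" "x \<in> carrier G" "y \<in> carrier G"
  shows "D #> x = D #> y \<longleftrightarrow> x \<otimes> inv y \<in> D"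
  using repr_independence[OF _ _ assms(1), of x y] subgroup.rcos_module[OF assms(1) is_group assms(3,2)]
    rcos_self[OF assms(2,1)] assms by metis

lemma rcos_eq_self_iff:
  assumes "subgroup D G" "x \<in> carrier G"
  shows "D #> x = D \<longleftrightarrow> x \<in> D"
  using rcos_eq_iff[OF assms one_closed] assms by (simp add: coset_mult_one subgroup.subset)

lemma quot_carrier: "carrier (quot G N D) = (\<lambda>x. D #> x) ` N"
  by (auto simp: FactGroup_def RCOSETS_def r_coset_def)

lemma quot_one: "\<one>\<^bsub>quot G N D\<^esub> = D"
  by (simp add: FactGroup_def)

lemma quot_mult:
  assumes "D \<lhd> G" "x \<in> carrier G" "y \<in> carrier G"
  shows "(D #> x) \<otimes>\<^bsub>quot G N D\<^esub> (D #> y) = D #> (x \<otimes> y)"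
  using normal.rcos_sum[OF assms] by (simp add: FactGroup_def set_mult_def)

lemma quot_normal:
  assumes D: "D \<lhd> G" "D \<subseteq> N" and N: "subgroup N G"
  shows "D \<lhd> G\<lparr>carrier := N\<rparr>"
proof -
  interpret NN: group "G\<lparr>carrier := N\<rparr>" using N by (rule subgroup.subgroup_is_group) (rule is_group)
  have Ds: "subgroup D G" using D(1) by (rule normal_imp_subgroup)
  show ?thesis
    unfolding NN.normal_inv_iff
  proof (intro conjI ballI)
    show "subgroup D (G\<lparr>carrier := N\<rparr>)" using subgroup_incl[OF Ds N D(2)] .
    fix x h assume "x \<in> carrier (G\<lparr>carrier := N\<rparr>)" "h \<in> D"
    thus "x \<otimes>\<^bsub>G\<lparr>carrier := N\<rparr>\<^esub> h \<otimes>\<^bsub>G\<lparr>carrier := N\<rparr>\<^esub> inv\<^bsub>G\<lparr>carrier := N\<rparr>\<^esub> x \<in> D"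
      using normal.inv_op_closed2[OF D(1), of x h] N m_inv_consistent[OF N] by (simp add: subgroup.mem_carrier)
  qed
qed

lemma quot_comm_group:
  assumes D: "D \<lhd> G" and sec: "abelian_section G N D"
  shows "comm_group (quot G N D)"
proof -
  have N: "subgroup N G" "subgroup D G" "D \<subseteq> N" using sec by (auto simp: abelian_section_def)
  have Nc: "x \<in> carrier G" if "x \<in> N" for x using that N by (simp add: subgroup.mem_carrier)
  have "group (quot G N D)" using normal.factorgroup_is_group[OF quot_normal[OF D N(3,1)]] .
  moreover have "a \<otimes>\<^bsub>quot G N D\<^esub> b = b \<otimes>\<^bsub>quot G N D\<^esub> a"
    if "a \<in> carrier (quot G N D)" "b \<in> carrier (quot G N D)" for a b
  proof -
    from that obtain x y where xy: "x \<in> N" "y \<in> N" "a = D #> x" "b = D #> y" unfolding quot_carrier by blast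
    have "x \<otimes> y \<otimes> inv (y \<otimes> x) = gcomm G x y" using xy Nc by (simp add: gcomm_def grp_simps)
    moreover have "gcomm G x y \<in> D" using sec xy by (simp add: abelian_section_def)
    ultimately show ?thesis using xy Nc N by (simp add: normal.rcos_sum[OF D] rcos_eq_iff)
  qed
  ultimately show ?thesis by (simp add: group.group_comm_groupI)
qed

lemma quot_pow:
  assumes "D \<lhd> G" "x \<in> carrier G"
  shows "(D #> x) [^]\<^bsub>quot G N D\<^esub> (k::nat) = D #> (x [^] k)"
proof (induction k)
  case 0
  show ?case using quot_one normal_imp_subgroup[OF assms(1)] by (simp add: coset_mult_one subgroup.subset nat_pow_def quot_one)
next
  case (Suc k)
  thus ?case using quot_mult[OF assms(1) nat_pow_closed[OF assms(2), of k] assms(2), of N] by (simp add: nat_pow_def)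
qed

lemma quot_card:
  assumes D: "D \<lhd> G" and sec: "abelian_section G N D"
  shows "card (carrier (quot G N D)) * card D = card N"
proof -
  have N: "subgroup N G" "subgroup D G" "D \<subseteq> N" using sec by (auto simp: abelian_section_def)
  interpret NN: group "G\<lparr>carrier := N\<rparr>" using N(1) by (rule subgroup.subgroup_is_group) (rule is_group)
  show ?thesis using NN.lagrange[OF subgroup_incl[OF N(2,1,3)]] by (simp add: FactGroup_def Coset.order_def)
qed

lemma quot_lin:
  assumes D: "D \<lhd> G" and sec: "abelian_section G N D" and nu: "\<nu> \<in> lin (quot G N D) (carrier (quot G N D)) {}"
  shows "(\<lambda>x. if x \<in> N then \<nu> (D #> x) else 0) \<in> lin G N D"
proof -
  have N: "subgroup N G" "subgroup D G" "D \<subseteq> N" using sec by (auto simp: abelian_section_def)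
  have Nc: "x \<in> carrier G" if "x \<in> N" for x using that N by (simp add: subgroup.mem_carrier)
  interpret Q: comm_group "quot G N D" by (rule quot_comm_group[OF D sec])
  have cr: "D #> x \<in> carrier (quot G N D)" if "x \<in> N" for x using that unfolding quot_carrier by blast
  have one: "\<nu> D = 1" using Q.lin_one[OF Q.subgroup_self nu] by (simp add: quot_one)
  show ?thesis unfolding lin_def
  proof (intro CollectI conjI allI ballI impI)
    fix x assume "x \<in> N" thus "(if x \<in> N then \<nu> (D #> x) else 0) \<noteq> 0" using Q.lin_nonzero[OF nu cr] by simp
  next
    fix x y assume xy: "x \<in> N" "y \<in> N"
    show "(if x \<otimes> y \<in> N then \<nu> (D #> (x \<otimes> y)) else 0) = (if x \<in> N then \<nu> (D #> x) else 0) * (if y \<in> N then \<nu> (D #> y) else 0)"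
      using xy N Q.lin_mult[OF nu cr[OF xy(1)] cr[OF xy(2)]] quot_mult[OF D Nc[OF xy(1)] Nc[OF xy(2)]]
      by (simp add: subgroup.m_closed)
  next
    fix d assume d: "d \<in> D"
    have "D #> d = D" using rcos_eq_self_iff[OF N(2)] d N Nc by auto
    thus "(if d \<in> N then \<nu> (D #> d) else 0) = 1" using d N one by auto
  qed simp
qed

lemma section_eqI:
  assumes fin: "finite (carrier G)" and sec: "abelian_section G N D" and xy: "x \<in> N" "y \<in> N"
    and e: "\<And>\<psi>. \<psi> \<in> lin G N D \<Longrightarrow> \<psi> x = \<psi> y"
  shows "D #> x = D #> y"
proof -
  have N: "subgroup N G" "subgroup D G" using sec by (auto simp: abelian_section_def)
  have "x \<otimes> inv y \<in> D"
  proof (rule lin_section_mult[OF fin sec])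
    show "x \<otimes> inv y \<in> N" using xy N by (simp add: subgroup.m_closed subgroup.m_inv_closed)
    fix \<psi> assume psi: "\<psi> \<in> lin G N D"
    show "\<psi> (x \<otimes> inv y) = 1"
      using lin_mult[OF psi xy(1), of "inv y"] lin_inv[OF N(1) psi xy(2)] e[OF psi] lin_nonzero[OF psi xy(2)] xy N
      by (simp add: subgroup.m_inv_closed)
  qed
  thus ?thesis using rcos_eq_iff[OF N(2)] xy N by (simp add: subgroup.mem_carrier)
qed

end

section \<open>The commutator pairing between factors of the central series\<close>

context frobenius_GC_prime
begin

definition rep :: "'a set \<Rightarrow> 'a" where "rep A = (SOME x. x \<in> A)"

text \<open>Defined by arbitrary representatives of the two cosets; \<open>comm_pairing_eq\<close>
  shows that they do not matter.\<close>

definition comm_pairing :: "'a set \<Rightarrow> 'a set \<Rightarrow> 'a set \<Rightarrow> 'a set" where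
  "comm_pairing D v u = D #> gcomm G (rep v) (rep u)"

lemma rep_coset:
  assumes "subgroup D G" "x \<in> carrier G"
  shows "\<exists>d\<in>D. rep (D #> x) = d \<otimes> x"
proof -
  have "rep (D #> x) \<in> D #> x" unfolding rep_def using rcos_self[OF assms(2,1)] by (rule someI)
  thus ?thesis by (auto simp: r_coset_def)
qed

context
  fixes N M D
  assumes N: "N \<lhd> G" "N \<subseteq> K" and M_def: "M = commK N" and D_def: "D = commK M"
begin

lemma NMD: "subgroup N G" "M \<lhd> G" "subgroup M G" "M \<subseteq> N" "M \<subseteq> K" "D \<lhd> G" "subgroup D G" "D \<subseteq> M"
  "abelian_section G N M" "abelian_section G M D"
  using N commK_normal[OF N(1)] commK_normal[OF commK_normal[OF N(1)]] commK_subset[OF N(1)]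
    commK_subset[OF commK_normal[OF N(1)]] commK_section[OF N] commK_section[OF commK_normal[OF N(1)]]
  by (auto simp: M_def D_def normal_imp_subgroup)

lemma gcomm_M: "k \<in> K \<Longrightarrow> n \<in> N \<Longrightarrow> gcomm G k n \<in> M"
  unfolding M_def by (rule commK_incl)

lemma pair_left:
  assumes nu: "\<nu> \<in> lin G M D" and n: "n \<in> N"
  shows "(\<lambda>k. if k \<in> K then \<nu> (gcomm G k n) else 0) \<in> lin G K K2"
  using pairing_left[OF NMD(2,5) nu[unfolded D_def] N(2) gcomm_M n] by blast

lemma pair_right:
  assumes nu: "\<nu> \<in> lin G M D" and k: "k \<in> K"
  shows "(\<lambda>n. if n \<in> N then \<nu> (gcomm G k n) else 0) \<in> lin G N M"
proof -
  have "(\<lambda>n. if n \<in> N then \<nu> (gcomm G k n) else 0) \<in> lin G N {}"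
    using pairing_right[OF NMD(2,5) nu[unfolded D_def] NMD(1) N(2) gcomm_M k] by blast
  moreover have "\<nu> (gcomm G k n) = 1" if "n \<in> M" for n
    using lin_trivial_on[OF nu] commK_incl[OF k that] by (simp add: D_def)
  ultimately show ?thesis using NMD(4) by (auto simp: lin_def)
qed

text \<open>Seen through a character of \<open>M/D\<close>, the commutator is multiplicative in each
  argument and trivial for arguments in \<open>K2\<close> and in \<open>M\<close>.\<close>

lemma comm_pairing_eq:
  assumes x: "x \<in> K" and y: "y \<in> N"
  shows "comm_pairing D (K2 #> x) (M #> y) = D #> gcomm G x y"
proof -
  have xc: "x \<in> carrier G" and yc: "y \<in> carrier G" using x y N by auto
  obtain n where n: "n \<in> K2" "rep (K2 #> x) = n \<otimes> x" using rep_coset[OF K2_sub xc] by blast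
  obtain m where m: "m \<in> M" "rep (M #> y) = m \<otimes> y" using rep_coset[OF NMD(3) yc] by blast
  have nK: "n \<in> K" "n \<otimes> x \<in> K" using n x K_sub by (auto simp: subgroup.m_closed)
  have mN: "m \<in> N" "m \<otimes> y \<in> N" using m y NMD by (auto simp: subgroup.m_closed)
  show ?thesis unfolding comm_pairing_def n(2) m(2)
  proof (rule section_eqI[OF finG NMD(10) gcomm_M[OF nK(2) mN(2)] gcomm_M[OF x y]])
    fix \<nu> assume nu: "\<nu> \<in> lin G M D"
    have "\<nu> (gcomm G (n \<otimes> x) (m \<otimes> y)) = \<nu> (gcomm G x (m \<otimes> y))"
      using lin_mult[OF pair_left[OF nu mN(2)] nK(1) x] lin_trivial_on[OF pair_left[OF nu mN(2)] n(1)] nK x by simp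
    also have "\<dots> = \<nu> (gcomm G x y)"
      using lin_mult[OF pair_right[OF nu x] mN(1) y] lin_trivial_on[OF pair_right[OF nu x] m(1)] mN y by simp
    finally show "\<nu> (gcomm G (n \<otimes> x) (m \<otimes> y)) = \<nu> (gcomm G x y)" .
  qed
qed

text \<open>All identities are tested by characters of \<open>M/D\<close>. The bound
  \<open>rad\<close> counts elements of \<open>K\<close>; since the radical \<open>R\<close> is a
  subgroup containing \<open>K2\<close>, it passes to \<open>K/K2\<close> on division by
  \<open>card K2\<close>.\<close>

lemma commutator_pairing:
  assumes n: "n \<ge> 2" "n \<le> m" and cK: "card K = q ^ n * card K2" and cN: "card N = q ^ n * card M"
    and cM: "card M = q ^ m * card D"
    and ker: "\<And>x. x \<in> K \<Longrightarrow> x \<notin> K2 \<Longrightarrow> \<exists>y\<in>N. y \<notin> M \<and> gcomm G x y \<in> D"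
    and rad: "\<And>\<nu> w. \<nu> \<in> lin G M D \<Longrightarrow> w \<in> M \<Longrightarrow> \<nu> w \<noteq> 1 \<Longrightarrow>
       card {x\<in>K. \<forall>y\<in>N. \<nu> (gcomm G x y) = 1} \<le> q * card K2"
  shows "bilinear_pairing (quot G K K2) (quot G N M) (quot G M D) (comm_pairing D) q n m"
proof -
  have pos: "card K2 > 0" "card M > 0" "card D > 0" using card_sub_pos K2_sub NMD by auto
  have carV: "\<exists>x\<in>K. v = K2 #> x" if "v \<in> carrier (quot G K K2)" for v using that unfolding quot_carrier by blast
  have carU: "\<exists>x\<in>N. v = M #> x" if "v \<in> carrier (quot G N M)" for v using that unfolding quot_carrier by blast
  have Nc: "x \<in> carrier G" if "x \<in> N" for x using that N by auto
  have fin: "finite (carrier (quot G K K2))" "finite (carrier (quot G N M))" "finite (carrier (quot G M D))"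
    unfolding quot_carrier using finite_sub K_sub NMD by auto
  have oneV: "K2 #> x = \<one>\<^bsub>quot G K K2\<^esub> \<longleftrightarrow> x \<in> K2" if "x \<in> K" for x
    using rcos_eq_self_iff[OF K2_sub] that by (simp add: quot_one)
  have oneU: "M #> x = \<one>\<^bsub>quot G N M\<^esub> \<longleftrightarrow> x \<in> M" if "x \<in> N" for x
    using rcos_eq_self_iff[OF NMD(3)] Nc[OF that] by (simp add: quot_one)
  show ?thesis
  proof (intro bilinear_pairing.intro bilinear_pairing_axioms.intro)
    show "comm_group (quot G K K2)" by (rule quot_comm_group[OF K2_normal sec_K])
    show "comm_group (quot G N M)" by (rule quot_comm_group[OF NMD(2,9)])
    show "comm_group (quot G M D)" by (rule quot_comm_group[OF NMD(6,10)])
    show "card (carrier (quot G K K2)) = q ^ n" using quot_card[OF K2_normal sec_K] cK pos by simp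
    show "card (carrier (quot G N M)) = q ^ n" using quot_card[OF NMD(2,9)] cN pos by simp
    show "card (carrier (quot G M D)) = q ^ m" using quot_card[OF NMD(6,10)] cM pos by simp
  next
    fix v u assume "v \<in> carrier (quot G K K2)" "u \<in> carrier (quot G N M)"
    then obtain x y where xy: "x \<in> K" "v = K2 #> x" "y \<in> N" "u = M #> y" using carV carU by metis
    thus "comm_pairing D v u \<in> carrier (quot G M D)" using comm_pairing_eq[of x y] gcomm_M[of x y] by (simp add: quot_carrier)
  next
    fix v v' u assume "v \<in> carrier (quot G K K2)" "v' \<in> carrier (quot G K K2)" "u \<in> carrier (quot G N M)"
    then obtain x x' y where xy: "x \<in> K" "v = K2 #> x" "x' \<in> K" "v' = K2 #> x'" "y \<in> N" "u = M #> y" using carV carU by metis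
    have c: "gcomm G x y \<in> M" "gcomm G x' y \<in> M" "x \<otimes> x' \<in> K" "gcomm G (x \<otimes> x') y \<in> M"
      using xy gcomm_M K_sub by (auto simp: subgroup.m_closed)
    have "D #> gcomm G (x \<otimes> x') y = D #> (gcomm G x y \<otimes> gcomm G x' y)"
    proof (rule section_eqI[OF finG NMD(10) c(4)])
      show "gcomm G x y \<otimes> gcomm G x' y \<in> M" using c NMD by (simp add: subgroup.m_closed)
      fix \<nu> assume nu: "\<nu> \<in> lin G M D"
      show "\<nu> (gcomm G (x \<otimes> x') y) = \<nu> (gcomm G x y \<otimes> gcomm G x' y)"
        using lin_mult[OF pair_left[OF nu xy(5)] xy(1,3)] lin_mult[OF nu c(1,2)] xy c by simp
    qed
    thus "comm_pairing D (v \<otimes>\<^bsub>quot G K K2\<^esub> v') u = comm_pairing D v u \<otimes>\<^bsub>quot G M D\<^esub> comm_pairing D v' u"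
      using xy c comm_pairing_eq NMD by (simp add: normal.rcos_sum[OF K2_normal] normal.rcos_sum[OF NMD(6)] subgroup.mem_carrier[OF NMD(3)])
  next
    fix v u u' assume "v \<in> carrier (quot G K K2)" "u \<in> carrier (quot G N M)" "u' \<in> carrier (quot G N M)"
    then obtain x y y' where xy: "x \<in> K" "v = K2 #> x" "y \<in> N" "u = M #> y" "y' \<in> N" "u' = M #> y'" using carV carU by metis
    have c: "gcomm G x y \<in> M" "gcomm G x y' \<in> M" "y \<otimes> y' \<in> N" "gcomm G x (y \<otimes> y') \<in> M"
      using xy gcomm_M NMD(1) by (auto simp: subgroup.m_closed)
    have "D #> gcomm G x (y \<otimes> y') = D #> (gcomm G x y \<otimes> gcomm G x y')"
    proof (rule section_eqI[OF finG NMD(10) c(4)])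
      show "gcomm G x y \<otimes> gcomm G x y' \<in> M" using c NMD by (simp add: subgroup.m_closed)
      fix \<nu> assume nu: "\<nu> \<in> lin G M D"
      show "\<nu> (gcomm G x (y \<otimes> y')) = \<nu> (gcomm G x y \<otimes> gcomm G x y')"
        using lin_mult[OF pair_right[OF nu xy(1)] xy(3,5)] lin_mult[OF nu c(1,2)] xy c by simp
    qed
    thus "comm_pairing D v (u \<otimes>\<^bsub>quot G N M\<^esub> u') = comm_pairing D v u \<otimes>\<^bsub>quot G M D\<^esub> comm_pairing D v u'"
      using xy c comm_pairing_eq Nc by (simp add: normal.rcos_sum[OF NMD(2)] normal.rcos_sum[OF NMD(6)] subgroup.mem_carrier[OF NMD(3)])
  next
    fix v assume v: "v \<in> carrier (quot G K K2)" "v \<noteq> \<one>\<^bsub>quot G K K2\<^esub>"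
    then obtain x where x: "x \<in> K" "v = K2 #> x" using carV by blast
    have "x \<notin> K2" using v x oneV by blast
    then obtain y where y: "y \<in> N" "y \<notin> M" "gcomm G x y \<in> D" using ker x by blast
    have "D #> gcomm G x y = D" using rcos_eq_self_iff[OF NMD(7)] y(3) subgroup.mem_carrier[OF NMD(7)] by blast
    thus "\<exists>u\<in>carrier (quot G N M). u \<noteq> \<one>\<^bsub>quot G N M\<^esub> \<and> comm_pairing D v u = \<one>\<^bsub>quot G M D\<^esub>"
      using y x oneU[OF y(1)] comm_pairing_eq[OF x(1) y(1)] quot_carrier[of N M]
      by (intro bexI[of _ "M #> y"]) (auto simp: quot_one)
  next
    fix \<nu> w assume nu: "\<nu> \<in> lin (quot G M D) (carrier (quot G M D)) {}" and w: "w \<in> carrier (quot G M D)" "\<nu> w \<noteq> 1"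
    let ?n = "\<lambda>x. if x \<in> M then \<nu> (D #> x) else 0"
    have n: "?n \<in> lin G M D" by (rule quot_lin[OF NMD(6,10) nu])
    obtain w0 where w0: "w0 \<in> M" "w = D #> w0" using w unfolding quot_carrier by blast
    define R where "R = {x\<in>K. \<forall>y\<in>N. ?n (gcomm G x y) = 1}"
    have cR: "card R \<le> q * card K2" unfolding R_def by (rule rad[OF n w0(1)]) (use w w0 in simp)
    have Rs: "subgroup R G"
    proof (rule finite_submonoid_imp_subgroup[OF finG])
      show "\<one> \<in> R" using K_sub Nc lin_one[OF NMD(3) n] subgroup.one_closed[OF NMD(3)] by (auto simp: R_def gcomm_def subgroup.one_closed)
      fix a b assume ab: "a \<in> R" "b \<in> R"
      have "?n (gcomm G (a \<otimes> b) y) = 1" if y: "y \<in> N" for y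
        using lin_mult[OF pair_left[OF n y], of a b] ab y K_sub by (simp add: R_def subgroup.m_closed)
      thus "a \<otimes> b \<in> R" using ab K_sub by (simp add: R_def subgroup.m_closed)
    qed (auto simp: R_def)
    have K2R: "K2 \<subseteq> R"
    proof
      fix x assume x: "x \<in> K2"
      have "?n (gcomm G x y) = 1" if y: "y \<in> N" for y
        using lin_trivial_on[OF pair_left[OF n y] x] x by simp
      thus "x \<in> R" using x by (simp add: R_def)
    qed
    have RK: "R \<subseteq> K" by (auto simp: R_def)
    have sR: "abelian_section G R K2" unfolding abelian_section_def using Rs K2_sub K2R gcomm_K2 RK by blast
    have "{v \<in> carrier (quot G K K2). \<forall>u\<in>carrier (quot G N M). \<nu> (comm_pairing D v u) = 1} \<subseteq> carrier (quot G R K2)"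
    proof
      fix v assume v: "v \<in> {v \<in> carrier (quot G K K2). \<forall>u\<in>carrier (quot G N M). \<nu> (comm_pairing D v u) = 1}"
      then obtain x where x: "x \<in> K" "v = K2 #> x" using carV by blast
      have "?n (gcomm G x y) = 1" if y: "y \<in> N" for y
      proof -
        have "M #> y \<in> carrier (quot G N M)" using y unfolding quot_carrier by blast
        hence "\<nu> (comm_pairing D v (M #> y)) = 1" using v by blast
        thus ?thesis using comm_pairing_eq[OF x(1) y] x gcomm_M[OF x(1) y] by simp
      qed
      hence "x \<in> R" using x by (simp add: R_def)
      thus "v \<in> carrier (quot G R K2)" using x unfolding quot_carrier by blast
    qed
    moreover have "finite (carrier (quot G R K2))" unfolding quot_carrier using finite_sub[OF Rs] by simp
    ultimately have "card {v \<in> carrier (quot G K K2). \<forall>u\<in>carrier (quot G N M). \<nu> (comm_pairing D v u) = 1} \<le> card (carrier (quot G R K2))"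
      by (rule card_mono[rotated])
    also have "card (carrier (quot G R K2)) \<le> q"
      using quot_card[OF K2_normal sR] cR pos(1) by (metis mult_le_cancel2)
    finally show "card {v \<in> carrier (quot G K K2). \<forall>u\<in>carrier (quot G N M). \<nu> (comm_pairing D v u) = 1} \<le> q" .
  qed (use fin n q_prime in auto)
qed

lemma commutator_rank:
  assumes "n \<ge> 2" "n \<le> m" "card K = q ^ n * card K2" "card N = q ^ n * card M" "card M = q ^ m * card D"
    and "\<And>x. x \<in> K \<Longrightarrow> x \<notin> K2 \<Longrightarrow> \<exists>y\<in>N. y \<notin> M \<and> gcomm G x y \<in> D"
    and "\<And>\<nu> w. \<nu> \<in> lin G M D \<Longrightarrow> w \<in> M \<Longrightarrow> \<nu> w \<noteq> 1 \<Longrightarrow>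
       card {x\<in>K. \<forall>y\<in>N. \<nu> (gcomm G x y) = 1} \<le> q * card K2"
  shows "m = n"
proof -
  interpret P: bilinear_pairing "quot G K K2" "quot G N M" "quot G M D" "comm_pairing D" q n m
    by (rule commutator_pairing[OF assms(1-5)]) (use assms(6,7) in blast)+
  show ?thesis using P.rank_count by blast
qed

text \<open>The kernel belonging to \<open>x\<close> has order at least \<open>q\<close>, so the
  commutators of \<open>x\<close> with \<open>N\<close> have a proper image in \<open>M/D\<close>,
  and some nontrivial character kills it.\<close>

lemma commutator_annihilator:
  assumes "n \<ge> 2" "n \<le> m" "card K = q ^ n * card K2" "card N = q ^ n * card M" "card M = q ^ m * card D"
    and "\<And>x. x \<in> K \<Longrightarrow> x \<notin> K2 \<Longrightarrow> \<exists>y\<in>N. y \<notin> M \<and> gcomm G x y \<in> D"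
    and "\<And>\<nu> w. \<nu> \<in> lin G M D \<Longrightarrow> w \<in> M \<Longrightarrow> \<nu> w \<noteq> 1 \<Longrightarrow>
       card {x\<in>K. \<forall>y\<in>N. \<nu> (gcomm G x y) = 1} \<le> q * card K2"
    and x: "x \<in> K" "x \<notin> K2"
  shows "\<exists>\<nu>\<in>lin G M D. (\<exists>w\<in>M. \<nu> w \<noteq> 1) \<and> (\<forall>y\<in>N. \<nu> (gcomm G x y) = 1)"
proof -
  let ?W = "quot G M D"
  interpret P: bilinear_pairing "quot G K K2" "quot G N M" ?W "comm_pairing D" q n m
    by (rule commutator_pairing[OF assms(1-5)]) (use assms(6,7) in blast)+
  let ?v = "K2 #> x"
  have v: "?v \<in> carrier (quot G K K2)" "?v \<noteq> \<one>\<^bsub>quot G K K2\<^esub>"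
    using x rcos_eq_self_iff[OF K2_sub] by (auto simp: quot_carrier quot_one)
  let ?L = "lin ?W (carrier ?W) (P.img ?v)"
  have "card ?L \<ge> 1 * q" unfolding P.card_lin_img[OF v(1)]
    using P.ker_ge[OF v] prime_gt_0_nat[OF q_prime] by (intro mult_le_mono) (auto simp: Suc_le_eq)
  hence "card ?L > 1" using prime_gt_1_nat[OF q_prime] by simp
  hence "?L \<noteq> {P.trivW}" by auto
  moreover have tr: "P.trivW \<in> ?L" using P.W.trivial_lin[OF P.W.subgroup_self] P.img_subgroup[OF v(1)] by (simp add: subgroup.subset)
  ultimately obtain \<nu> where nu: "\<nu> \<in> ?L" "\<nu> \<noteq> P.trivW" by blast
  then obtain w where w: "w \<in> carrier ?W" "\<nu> w \<noteq> 1" using P.W.lin_eqI[OF nu(1) tr] by auto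
  then obtain w0 where w0: "w0 \<in> M" "w = D #> w0" unfolding quot_carrier by blast
  let ?n = "\<lambda>x. if x \<in> M then \<nu> (D #> x) else 0"
  have n: "?n \<in> lin G M D" by (rule quot_lin[OF NMD(6,10)]) (use nu P.W.lin_mono in blast)
  have "?n (gcomm G x y) = 1" if y: "y \<in> N" for y
  proof -
    have "M #> y \<in> carrier (quot G N M)" using y unfolding quot_carrier by blast
    hence "comm_pairing D ?v (M #> y) \<in> P.img ?v" by (simp add: P.img_def)
    hence "\<nu> (comm_pairing D ?v (M #> y)) = 1" using P.W.lin_trivial_on[OF nu(1)] by blast
    thus ?thesis using comm_pairing_eq[OF x(1) y] gcomm_M[OF x(1) y] by simp
  qed
  moreover have "?n w0 \<noteq> 1" using w w0 by simp
  ultimately show ?thesis using n w0(1) by (intro bexI[of _ ?n] conjI bexI[of _ w0] ballI)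
qed

text \<open>\<open>no_pairing\<close> is applied with \<open>\<iota>\<close> the \<open>q\<close>-th
  power map from \<open>N/M\<close> to \<open>M/D\<close> and \<open>\<kappa>\<close> induced by
  \<open>k\<close>. The power map is well defined on cosets because \<open>q\<close>-th powers of
  \<open>M\<close> lie in \<open>D\<close>.\<close>

lemma no_commutator_pairing:
  assumes n: "n \<ge> 2" "n \<le> m" and cK: "card K = q ^ n * card K2" and cN: "card N = q ^ n * card M"
    and cM: "card M = q ^ m * card D"
    and rad: "\<And>\<nu> w. \<nu> \<in> lin G M D \<Longrightarrow> w \<in> M \<Longrightarrow> \<nu> w \<noteq> 1 \<Longrightarrow>
       card {x\<in>K. \<forall>y\<in>N. \<nu> (gcomm G x y) = 1} \<le> q * card K2"
    and expN: "\<And>y. y \<in> N \<Longrightarrow> y [^] q \<in> M"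
    and pow: "\<And>y z. y \<in> N \<Longrightarrow> z \<in> N \<Longrightarrow> D #> ((y \<otimes> z) [^] q) = D #> (y [^] q \<otimes> z [^] q)"
    and inj: "\<And>y. y \<in> N \<Longrightarrow> y \<notin> M \<Longrightarrow> y [^] q \<notin> D"
    and kap: "\<And>x. x \<in> K \<Longrightarrow> x \<notin> K2 \<Longrightarrow> k x \<in> N \<and> k x \<notin> M \<and> gcomm G x (k x) \<in> D \<and>
       (\<forall>y\<in>N. D #> (k x [^] q) \<noteq> D #> gcomm G x y)"
    and rk: "\<And>y. y \<in> N \<Longrightarrow> \<exists>x\<in>K. x \<notin> K2 \<and> gcomm G x y \<in> D"
  shows False
proof -
  have carV: "\<exists>x\<in>K. v = K2 #> x" if "v \<in> carrier (quot G K K2)" for v using that unfolding quot_carrier by blast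
  have carU: "\<exists>x\<in>N. v = M #> x" if "v \<in> carrier (quot G N M)" for v using that unfolding quot_carrier by blast
  have Nc: "x \<in> carrier G" if "x \<in> N" for x using that N by auto
  have oneV: "K2 #> x = \<one>\<^bsub>quot G K K2\<^esub> \<longleftrightarrow> x \<in> K2" if "x \<in> K" for x
    using rcos_eq_self_iff[OF K2_sub] that by (simp add: quot_one)
  have oneU: "M #> x = \<one>\<^bsub>quot G N M\<^esub> \<longleftrightarrow> x \<in> M" if "x \<in> N" for x
    using rcos_eq_self_iff[OF NMD(3)] Nc[OF that] by (simp add: quot_one)
  have oneW: "D #> x = \<one>\<^bsub>quot G M D\<^esub> \<longleftrightarrow> x \<in> D" if "x \<in> M" for x
    using rcos_eq_self_iff[OF NMD(7)] subgroup.mem_carrier[OF NMD(3) that] by (simp add: quot_one)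
  define io where "io u = D #> (rep u [^] q)" for u
  have io: "io (M #> y) = D #> (y [^] q)" if y: "y \<in> N" for y
  proof -
    obtain m where m: "m \<in> M" "rep (M #> y) = m \<otimes> y" using rep_coset[OF NMD(3) Nc[OF y]] by blast
    have mN: "m \<in> N" using m NMD(4) by auto
    have mq: "m [^] q \<in> D" using commK_exponent[OF N] m(1) by (simp add: M_def D_def)
    have "D #> ((m \<otimes> y) [^] q) = D #> (m [^] q \<otimes> y [^] q)" by (rule pow[OF mN y])
    also have "\<dots> = D #> (y [^] q)"
      using rcos_eq_iff[OF NMD(7)] mq Nc[OF mN] Nc[OF y] by (simp add: m_assoc)
    finally show ?thesis by (simp add: io_def m)
  qed
  interpret P: bilinear_pairing "quot G K K2" "quot G N M" "quot G M D" "comm_pairing D" q n m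
    by (rule commutator_pairing[OF n cK cN cM _ rad]) (use kap in blast)+
  show False
  proof (rule P.no_pairing[where \<iota>=io and \<kappa>="\<lambda>v. M #> k (rep v)"])
    show "io \<in> hom (quot G N M) (quot G M D)"
    proof (rule homI)
      fix u assume "u \<in> carrier (quot G N M)"
      then obtain y where y: "y \<in> N" "u = M #> y" using carU by blast
      thus "io u \<in> carrier (quot G M D)" using io expN by (simp add: quot_carrier)
    next
      fix u u' assume "u \<in> carrier (quot G N M)" "u' \<in> carrier (quot G N M)"
      then obtain y z where y: "y \<in> N" "u = M #> y" "z \<in> N" "u' = M #> z" using carU by metis
      have "y \<otimes> z \<in> N" using y NMD(1) by (simp add: subgroup.m_closed)
      thus "io (u \<otimes>\<^bsub>quot G N M\<^esub> u') = io u \<otimes>\<^bsub>quot G M D\<^esub> io u'"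
        using y io pow Nc by (simp add: normal.rcos_sum[OF NMD(2)] normal.rcos_sum[OF NMD(6)])
    qed
  next
    fix u assume u: "u \<in> carrier (quot G N M)"
    then obtain y where y: "y \<in> N" "u = M #> y" using carU by blast
    show "u [^]\<^bsub>quot G N M\<^esub> q = \<one>\<^bsub>quot G N M\<^esub>"
      using y quot_pow[OF NMD(2) Nc[OF y(1)], of N q] oneU[of "y [^] q"] expN[OF y(1)] NMD(4) by auto
    show "io u \<noteq> \<one>\<^bsub>quot G M D\<^esub>" if "u \<noteq> \<one>\<^bsub>quot G N M\<^esub>"
      using that y oneU[OF y(1)] io[OF y(1)] inj[OF y(1)] oneW[OF expN[OF y(1)]] by simp
    obtain x where x: "x \<in> K" "x \<notin> K2" "gcomm G x y \<in> D" using rk[OF y(1)] by blast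
    show "\<exists>v\<in>carrier (quot G K K2). v \<noteq> \<one>\<^bsub>quot G K K2\<^esub> \<and> comm_pairing D v u = \<one>\<^bsub>quot G M D\<^esub>"
      using x y oneV[OF x(1)] comm_pairing_eq[OF x(1) y(1)] oneW[OF gcomm_M[OF x(1) y(1)]] quot_carrier[of K K2]
      by (intro bexI[of _ "K2 #> x"]) auto
  next
    fix v assume v: "v \<in> carrier (quot G K K2)" "v \<noteq> \<one>\<^bsub>quot G K K2\<^esub>"
    then obtain x0 where x0: "x0 \<in> K" "v = K2 #> x0" using carV by blast
    obtain d where d: "d \<in> K2" "rep v = d \<otimes> x0" using rep_coset[OF K2_sub K_car[OF x0(1)]] x0 by blast
    let ?x = "rep v"
    have x: "?x \<in> K" using d x0 K_sub by (simp add: subgroup.m_closed)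
    have vx: "v = K2 #> ?x" unfolding x0(2) using d x0 rcos_eq_iff[OF K2_sub, of x0 "d \<otimes> x0"] K2_sub
      by (simp add: grp_simps subgroup.m_inv_closed)
    have xn: "?x \<notin> K2" using v vx oneV[OF x] by blast
    note k = kap[OF x xn]
    have "io (M #> k ?x) \<notin> P.img v"
    proof
      assume "io (M #> k ?x) \<in> P.img v"
      then obtain u where u: "u \<in> carrier (quot G N M)" "io (M #> k ?x) = comm_pairing D v u" by (auto simp: P.img_def)
      then obtain y where y: "y \<in> N" "u = M #> y" using carU by blast
      have "comm_pairing D v u = D #> gcomm G ?x y" using comm_pairing_eq[OF x y(1)] y vx by simp
      thus False using u(2) io[of "k ?x"] k y by auto
    qed
    moreover have "comm_pairing D v (M #> k ?x) = \<one>\<^bsub>quot G M D\<^esub>"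
      using comm_pairing_eq[OF x, of "k ?x"] vx oneW[OF gcomm_M[OF x, of "k ?x"]] k by simp
    ultimately show "M #> k (rep v) \<in> carrier (quot G N M) \<and> comm_pairing D v (M #> k (rep v)) = \<one>\<^bsub>quot G M D\<^esub> \<and>
        io (M #> k (rep v)) \<notin> P.img v" using k quot_carrier[of N M] by blast
  qed
qed

end

end

text \<open>Moving each \<open>v\<close> past the factors \<open>u\<close> to its right costs one
  \<open>c\<close> each time, which happens \<open>m * (m - 1) div 2\<close> times.\<close>

lemma (in group) pow_mult_central:
  assumes "u \<in> carrier G" "v \<in> carrier G" "c \<in> carrier G" and vu: "v \<otimes> u = c \<otimes> (u \<otimes> v)"
    and cu: "c \<otimes> u = u \<otimes> c" and cv: "c \<otimes> v = v \<otimes> c"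
  shows "(u \<otimes> v) [^] (m::nat) = c [^] (m * (m - 1) div 2) \<otimes> (u [^] m \<otimes> v [^] m)"
proof -
  have cvp: "c \<otimes> v [^] k = v [^] k \<otimes> c" for k :: nat
    using group_commutes_pow[OF cv[symmetric] assms(2,3), of k] by simp
  have cup: "c [^] k \<otimes> u [^] j = u [^] j \<otimes> c [^] k" for k j :: nat
    using group_commutes_pow[OF cu assms(3,1), of k] group_commutes_pow[of u "c [^] k" j] assms by simp
  have vpu: "v [^] k \<otimes> u = c [^] k \<otimes> (u \<otimes> v [^] k)" for k :: nat
  proof (induction k)
    case (Suc k)
    have "v [^] Suc k \<otimes> u = v [^] k \<otimes> (v \<otimes> u)" using assms by (simp add: m_assoc)
    also have "\<dots> = v [^] k \<otimes> c \<otimes> (u \<otimes> v)" unfolding vu using assms by (simp add: m_assoc)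
    also have "\<dots> = c \<otimes> (v [^] k \<otimes> u) \<otimes> v" unfolding cvp[symmetric] using assms by (simp add: m_assoc)
    also have "\<dots> = c [^] Suc k \<otimes> (u \<otimes> v [^] Suc k)" unfolding Suc using assms
      by (simp add: m_assoc[symmetric] nat_pow_Suc2[symmetric])
    finally show ?case .
  qed (use assms in simp)
  show ?thesis
  proof (induction m)
    case (Suc m)
    have "(u \<otimes> v) [^] Suc m = c [^] (m * (m - 1) div 2) \<otimes> u [^] m \<otimes> (v [^] m \<otimes> u) \<otimes> v"
      unfolding nat_pow_Suc Suc using assms by (simp add: m_assoc)
    also have "\<dots> = c [^] (m * (m - 1) div 2) \<otimes> (u [^] m \<otimes> c [^] m) \<otimes> (u \<otimes> v [^] m) \<otimes> v"
      unfolding vpu using assms by (simp add: m_assoc)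
    also have "\<dots> = (c [^] (m * (m - 1) div 2) \<otimes> c [^] m) \<otimes> (u [^] Suc m \<otimes> v [^] Suc m)"
      unfolding cup[symmetric] using assms by (simp add: m_assoc)
    also have "c [^] (m * (m - 1) div 2) \<otimes> c [^] m = c [^] (Suc m * (Suc m - 1) div 2)"
    proof -
      have "Suc m * (Suc m - 1) = m * (m - 1) + m * 2" by (cases m) auto
      hence "Suc m * (Suc m - 1) div 2 = m * (m - 1) div 2 + m" by simp
      thus ?thesis using assms(3) by (simp only: nat_pow_mult)
    qed
    finally show ?case .
  qed simp
qed

section \<open>Power maps, and the radical of the form of an invariant character\<close>

context frobenius_GC_prime
begin

lemma pow_coset:
  assumes D: "D \<lhd> G" "D \<subseteq> K" and yz: "y \<in> K" "z \<in> K"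
    and c: "\<And>k. k \<in> K \<Longrightarrow> gcomm G (gcomm G z y) k \<in> D"
    and e: "gcomm G z y [^] (p * (p - 1) div 2 :: nat) \<in> D"
  shows "D #> ((y \<otimes> z) [^] p) = D #> (y [^] p \<otimes> z [^] p)"
proof -
  let ?Q = "quot G K D"
  have Ds: "subgroup D G" using D(1) by (rule normal_imp_subgroup)
  interpret Q: group ?Q using normal.factorgroup_is_group[OF quot_normal[OF D K_sub]] .
  have car: "D #> x \<in> carrier ?Q" if "x \<in> K" for x using that unfolding quot_carrier by blast
  have ml: "(D #> x) \<otimes>\<^bsub>?Q\<^esub> (D #> w) = D #> (x \<otimes> w)" if "x \<in> K" "w \<in> K" for x w
    using quot_mult[OF D(1), of x w K] that by simp
  let ?c = "gcomm G z y"
  have cK: "?c \<in> K" using yz K2_K by simp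
  have Kcl: "a \<otimes> b \<in> K" if "a \<in> K" "b \<in> K" for a b using that K_sub by (simp add: subgroup.m_closed)
  have cc: "(D #> ?c) \<otimes>\<^bsub>?Q\<^esub> (D #> k) = (D #> k) \<otimes>\<^bsub>?Q\<^esub> (D #> ?c)" if k: "k \<in> K" for k
  proof -
    have "?c \<otimes> k \<otimes> inv (k \<otimes> ?c) = gcomm G ?c k" using cK k by (simp add: gcomm_def[of G "gcomm G z y" k] grp_simps)
    hence "D #> (?c \<otimes> k) = D #> (k \<otimes> ?c)" using c[OF k] rcos_eq_iff[OF Ds] cK k by simp
    thus ?thesis using ml cK k by simp
  qed
  have "D #> (z \<otimes> y) = D #> (?c \<otimes> (y \<otimes> z))" using yz by (simp add: gcomm_def grp_simps)
  hence "(D #> z) \<otimes>\<^bsub>?Q\<^esub> (D #> y) = (D #> ?c) \<otimes>\<^bsub>?Q\<^esub> ((D #> y) \<otimes>\<^bsub>?Q\<^esub> (D #> z))"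
    using ml[OF yz(2,1)] ml[OF yz] ml[OF cK Kcl[OF yz]] by simp
  from Q.pow_mult_central[OF car[OF yz(1)] car[OF yz(2)] car[OF cK] this cc[OF yz(1)] cc[OF yz(2)], of p]
  have "D #> ((y \<otimes> z) [^] p) = (D #> (?c [^] (p * (p - 1) div 2))) \<otimes>\<^bsub>?Q\<^esub> ((D #> y [^] p) \<otimes>\<^bsub>?Q\<^esub> (D #> z [^] p))"
    unfolding ml[OF yz] using quot_pow[OF D(1), of _ K] yz cK Kcl by simp
  also have "D #> (?c [^] (p * (p - 1) div 2)) = \<one>\<^bsub>?Q\<^esub>"
    using rcos_eq_self_iff[OF Ds] e cK by (simp add: quot_one)
  also have "\<one>\<^bsub>?Q\<^esub> \<otimes>\<^bsub>?Q\<^esub> ((D #> y [^] p) \<otimes>\<^bsub>?Q\<^esub> (D #> z [^] p)) = D #> (y [^] p \<otimes> z [^] p)"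
    using ml[OF subgroup_nat_pow[OF K_sub yz(1)] subgroup_nat_pow[OF K_sub yz(2)]]
      car[OF subgroup_nat_pow[OF K_sub yz(1)]] car[OF subgroup_nat_pow[OF K_sub yz(2)]] by (metis Q.l_one Q.m_closed)
  finally show ?thesis .
qed

definition rad :: "('a \<Rightarrow> complex) \<Rightarrow> 'a set" where
  "rad \<nu> = {x\<in>K. \<forall>y\<in>K. \<nu> (gcomm G x y) = 1}"

lemma rad_K: "rad \<nu> \<subseteq> K" by (auto simp: rad_def)

lemma stabK_commK: "\<nu> \<in> lin G K2 (commK K2) \<Longrightarrow> stabK \<nu> = K"
  using lin_commK_invariant[OF K2_normal K2_K] by (auto simp: stabK_def)

lemma rad_subgroup:
  assumes nu: "\<nu> \<in> lin G K2 (commK K2)" shows "subgroup (rad \<nu>) G" "K2 \<subseteq> rad \<nu>"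
proof -
  have nu0: "\<nu> \<in> lin G K2 {}" using lin_mono[OF nu] by simp
  show "subgroup (rad \<nu>) G"
  proof (rule finite_submonoid_imp_subgroup[OF finG])
    show "rad \<nu> \<subseteq> carrier G" using subset_trans[OF rad_K subgroup.subset[OF K_sub]] .
    show "\<one> \<in> rad \<nu>" using K_sub lin_one[OF K2_sub nu] by (auto simp: rad_def gcomm_def subgroup.one_closed)
    fix a b assume ab: "a \<in> rad \<nu>" "b \<in> rad \<nu>"
    thus "a \<otimes> b \<in> rad \<nu>" using form_left[OF nu0, of a b] stabK_commK[OF nu] K_sub by (simp add: rad_def subgroup.m_closed)
  qed
  show "K2 \<subseteq> rad \<nu>"
  proof
    fix x assume x: "x \<in> K2"
    have "\<nu> (gcomm G x y) = 1" if y: "y \<in> K" for y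
      using form_sym[OF nu0 y, of x] x lin_trivial_on[OF nu commK_incl[OF y x]] by simp
    thus "x \<in> rad \<nu>" using x by (simp add: rad_def)
  qed
qed

lemma intermediate_index:
  assumes "subgroup R G" "K2 \<subseteq> R" "R \<subseteq> K" shows "\<exists>r. card R = q ^ r * card K2"
proof (rule section_prime_power[OF finG _ q_prime])
  show "abelian_section G R K2" unfolding abelian_section_def using assms K2_sub gcomm_K2 by blast
  fix x assume "x \<in> R"
  thus "\<exists>e. x [^] q ^ e \<in> K2" using pow_q assms(3) by (intro exI[of _ 1]) auto
qed

text \<open>The \<open>|R : K2|\<close> extensions of \<open>\<nu>\<close> to \<open>R\<close> are
  extended further to one maximal isotropic \<open>A\<close>. The induced characters are irreducible
  of the same degree, hence Galois conjugate to a fixed one through exponents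
  \<open>J \<phi>\<close>. The \<open>K\<close>-part of such a character vanishes outside
  \<open>R\<close> and is a multiple of \<open>\<phi>\<close> on \<open>R\<close>, so
  \<open>J \<phi>\<close> modulo \<open>e\<close> determines \<open>\<phi>\<close>.\<close>

lemma rad_bound:
  assumes nu: "\<nu> \<in> lin G K2 (commK K2)" and w: "w \<in> K2" "\<nu> w \<noteq> 1" and e: "e = q ^ i" "i > 0"
    and R_def: "R = rad \<nu>"
    and ex: "\<And>\<phi> x. \<phi> \<in> lin G R {} \<Longrightarrow> (\<And>n. n \<in> K2 \<Longrightarrow> \<phi> n = \<nu> n) \<Longrightarrow> x \<in> R \<Longrightarrow> \<phi> x ^ e = 1"
  shows "card R \<le> totient e * card K2"
proof -
  have nu0: "\<nu> \<in> lin G K2 {}" using lin_mono[OF nu] by simp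
  have inv: "\<nu> (gconj G k n) = \<nu> n" if "k \<in> K" "n \<in> K2" for k n
    using lin_commK_invariant[OF K2_normal K2_K nu that] .
  have st: "stabK \<nu> = K" by (rule stabK_commK[OF nu])
  have RK: "R \<subseteq> K" and Rs: "subgroup R G" and K2R: "K2 \<subseteq> R" unfolding R_def by (rule rad_K rad_subgroup[OF nu])+
  obtain A where A: "isotropic \<nu> A" using isotropic_exists[OF nu0] by blast
  have As: "subgroup A G" and K2A: "K2 \<subseteq> A" and AK: "A \<subseteq> K" and Ai: "\<And>a b. a \<in> A \<Longrightarrow> b \<in> A \<Longrightarrow> \<nu> (gcomm G a b) = 1"
    and Amax: "\<And>g. g \<in> K \<Longrightarrow> (\<And>a. a \<in> A \<Longrightarrow> \<nu> (gcomm G a g) = 1) \<Longrightarrow> g \<in> A"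
    using A st unfolding isotropic_def by blast+
  have RA: "R \<subseteq> A"
  proof
    fix x assume x: "x \<in> R"
    show "x \<in> A" by (rule Amax) (use x AK form_sym[OF nu0] in \<open>auto simp: R_def rad_def\<close>)
  qed
  define E where "E = {\<phi>\<in>lin G R {}. \<forall>n\<in>K2. \<phi> n = \<nu> n}"
  have Riso: "\<nu> (gcomm G a b) = 1" if "a \<in> R" "b \<in> R" for a b using that RK by (auto simp: R_def rad_def)
  have cE: "card E * card K2 = card R" unfolding E_def
    by (rule extensions_card[OF nu0 Rs RK Riso K2_sub order_refl K2R nu0]) auto
  have "\<exists>\<psi>\<in>lin G A {}. \<forall>h\<in>R. \<psi> h = \<phi> h" if "\<phi> \<in> E" for \<phi>
    by (rule extension_exists[OF nu0 As AK Ai Rs K2R RA]) (use that in \<open>auto simp: E_def\<close>)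
  then obtain \<Psi> where Psi: "\<And>\<phi>. \<phi> \<in> E \<Longrightarrow> \<Psi> \<phi> \<in> lin G A {}" "\<And>\<phi> h. \<phi> \<in> E \<Longrightarrow> h \<in> R \<Longrightarrow> \<Psi> \<phi> h = \<phi> h" by metis
  have PsiK2: "\<Psi> \<phi> n = \<nu> n" if "\<phi> \<in> E" "n \<in> K2" for \<phi> n using Psi(2)[OF that(1)] that K2R by (auto simp: E_def)
  have mk: "mackey G A (\<Psi> \<phi>)" if "\<phi> \<in> E" for \<phi>
    by (rule mackey_isotropic[OF nu0 A Psi(1)[OF that] PsiK2[OF that] K2_normal order_refl inv w])
  \<comment> \<open>For \<open>y\<close> in \<open>A\<close> outside \<open>R\<close> the sum is
    over the \<open>j\<close>-th power of the character
    \<open>k \<mapsto> \<nu> (gcomm G k y)\<close>, still nontrivial because \<open>j\<close> is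
    prime to its order \<open>q\<close>.\<close>
  have theta: "thetaK (\<lambda>x. \<Psi> \<phi> x ^ j) y = (if y \<in> R then of_nat (card K) * \<phi> y ^ j else 0)"
    if phi: "\<phi> \<in> E" and j: "coprime j q" "j > 0" and y: "y \<in> K" for \<phi> j y
  proof -
    have cj: "gconj G k y = gcomm G k y \<otimes> y" if "k \<in> K" for k using that y by (simp add: gconj_gcomm)
    show ?thesis
    proof (cases "y \<in> A")
      case False
      have "gconj G k y \<notin> A" if k: "k \<in> K" for k
      proof
        assume "gconj G k y \<in> A"
        moreover have "gcomm G k y \<in> A" using k y K2A by auto
        ultimately have "inv (gcomm G k y) \<otimes> gconj G k y \<in> A" using As by (simp add: subgroup.m_closed subgroup.m_inv_closed)
        thus False using False cj[OF k] k y by (simp add: inv_cancel_left)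
      qed
      hence "thetaK (\<lambda>x. \<Psi> \<phi> x ^ j) y = 0" using lin_outside[OF Psi(1)[OF phi]] j(2) by (simp add: thetaK_def)
      thus ?thesis using False RA by auto
    next
      case True
      have v: "\<Psi> \<phi> (gconj G k y) = \<nu> (gcomm G k y) * \<Psi> \<phi> y" if k: "k \<in> K" for k
      proof -
        have "gcomm G k y \<in> A" using k y K2A by auto
        thus ?thesis unfolding cj[OF k] using lin_mult[OF Psi(1)[OF phi] _ True] PsiK2[OF phi gcomm_K2[OF k y]] by simp
      qed
      let ?f = "\<lambda>k. if k \<in> K then \<nu> (gcomm G k y) else 0"
      have f: "?f \<in> lin G K K2" by (rule pairing_left[OF K2_normal K2_K nu order_refl _ y]) simp
      have fj: "(\<lambda>k. ?f k ^ j) \<in> lin G K K2" by (rule lin_power[OF f j(2)])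
      have th: "thetaK (\<lambda>x. \<Psi> \<phi> x ^ j) y = (\<Sum>k\<in>K. ?f k ^ j) * \<Psi> \<phi> y ^ j"
        unfolding thetaK_def sum_distrib_right using v by (intro sum.cong refl) (simp add: power_mult_distrib)
      show ?thesis
      proof (cases "y \<in> R")
        case True
        have "\<nu> (gcomm G k y) = 1" if "k \<in> K" for k using True form_sym[OF nu0 y that] that by (auto simp: R_def rad_def)
        thus ?thesis using th Psi(2)[OF phi True] True by simp
      next
        case False
        then obtain k where k: "k \<in> K" "\<nu> (gcomm G y k) \<noteq> 1" using y by (auto simp: R_def rad_def)
        hence k1: "?f k \<noteq> 1" using form_sym[OF nu0 y k(1)] by simp
        have "?f k ^ q = 1" using lin_pow[OF K_sub f k(1), of q] lin_trivial_on[OF f pow_q[OF k(1)]] by simp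
        hence "?f k ^ j \<noteq> 1" using coprime_powers_eq_1[of "?f k" j q] j k1 by blast
        hence "(\<Sum>k\<in>K. ?f k ^ j) = 0" using lin_sum_zero[OF K_sub fj k(1)] by simp
        thus ?thesis using th False by simp
      qed
    qed
  qed
  show "card R \<le> totient e * card K2"
  proof (cases "E = {}")
    case True thus ?thesis using cE by simp
  next
    case False
    then obtain \<phi>0 where p0: "\<phi>0 \<in> E" by blast
    have "\<exists>j>0. coprime j (card (carrier G)) \<and> (\<forall>g\<in>carrier G. induced G (\<Psi> \<phi>) g = induced G (\<lambda>x. \<Psi> \<phi>0 x ^ j) g)"
      if "\<phi> \<in> E" for \<phi>
      by (rule GC_star_induced[OF finG gc mk[OF p0] mk[OF that] refl K_neq_G[OF AK]])
    then obtain J where J: "\<And>\<phi>. \<phi> \<in> E \<Longrightarrow> J \<phi> > 0" "\<And>\<phi>. \<phi> \<in> E \<Longrightarrow> coprime (J \<phi>) (card (carrier G))"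
      "\<And>\<phi> g. \<phi> \<in> E \<Longrightarrow> g \<in> carrier G \<Longrightarrow> induced G (\<Psi> \<phi>) g = induced G (\<lambda>x. \<Psi> \<phi>0 x ^ J \<phi>) g" by metis
    have "card E \<le> totient e"
    proof (rule card_le_totient)
      show "e > 1" unfolding e by (rule one_less_power[OF prime_gt_1_nat[OF q_prime] e(2)])
      fix \<phi> assume "\<phi> \<in> E"
      thus "coprime (J \<phi>) e" using coprime_q[OF J(2)] e by simp
    next
      fix \<phi> \<phi>' assume pp: "\<phi> \<in> E" "\<phi>' \<in> E" and jj: "J \<phi> mod e = J \<phi>' mod e"
      have "\<phi>0 y ^ J \<phi> = \<phi>0 y ^ J \<phi>'" if y: "y \<in> R" for y
      proof -
        have ye: "\<phi>0 y ^ e = 1" using ex[of \<phi>0 y] p0 y by (auto simp: E_def)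
        have "\<phi>0 y ^ k = \<phi>0 y ^ (k mod e)" for k
        proof -
          have "\<phi>0 y ^ k = \<phi>0 y ^ (e * (k div e) + k mod e)" by simp
          also have "\<dots> = \<phi>0 y ^ (k mod e)" unfolding power_add power_mult ye by simp
          finally show ?thesis .
        qed
        thus ?thesis using jj by metis
      qed
      hence th: "thetaK (\<lambda>x. \<Psi> \<phi>0 x ^ J \<phi>) y = thetaK (\<lambda>x. \<Psi> \<phi>0 x ^ J \<phi>') y" if "y \<in> K" for y
        using theta[OF p0 coprime_q[OF J(2)[OF pp(1)]] J(1)[OF pp(1)] that]
          theta[OF p0 coprime_q[OF J(2)[OF pp(2)]] J(1)[OF pp(2)] that] by auto
      have out: "thetaK (\<lambda>x. \<Psi> \<phi>0 x ^ k) y = 0" if "y \<in> carrier G" "y \<notin> K" "k > 0" for y k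
      proof -
        have "gconj G a y \<notin> A" if "a \<in> K" for a
          using normal_gconj_iff[OF K_normal, of a y] that \<open>y \<in> carrier G\<close> \<open>y \<notin> K\<close> AK by auto
        thus ?thesis using lin_outside[OF Psi(1)[OF p0]] that(3) by (simp add: thetaK_def)
      qed
      have "thetaK (\<lambda>x. \<Psi> \<phi>0 x ^ J \<phi>) y = thetaK (\<lambda>x. \<Psi> \<phi>0 x ^ J \<phi>') y" if "y \<in> carrier G" for y
        using th[of y] out[OF that _ J(1)[OF pp(1)]] out[OF that _ J(1)[OF pp(2)]] by (cases "y \<in> K") auto
      hence "induced G (\<Psi> \<phi>) g = induced G (\<Psi> \<phi>') g" if "g \<in> carrier G" for g
        using J(3)[OF pp(1) that] J(3)[OF pp(2) that] that by (simp add: induced_thetaK)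
      hence te: "thetaK (\<Psi> \<phi>) y = thetaK (\<Psi> \<phi>') y" if "y \<in> carrier G" for y
        using thetaK_eq[OF Psi(1)[OF pp(1)] As K2A Psi(1)[OF pp(2)] As K2A K2_normal K2_K nu0 inv w
            PsiK2[OF pp(1)] PsiK2[OF pp(2)] that] by blast
      show "\<phi> = \<phi>'"
      proof (rule lin_eqI[of _ R "{}" _ "{}"])
        show "\<phi> \<in> lin G R {}" "\<phi>' \<in> lin G R {}" using pp by (auto simp: E_def)
        fix y assume y: "y \<in> R"
        hence yK: "y \<in> K" using RK by auto
        have "of_nat (card K) * \<phi> y = of_nat (card K) * \<phi>' y"
          using te[OF K_car[OF yK]] theta[OF pp(1) _ _ yK, of 1] theta[OF pp(2) _ _ yK, of 1] y by simp
        thus "\<phi> y = \<phi>' y" using card_sub_pos[OF K_sub] by simp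
      qed
    qed
    thus ?thesis using cE by (metis mult_le_mono1)
  qed
qed

lemma K2_lin_pow_q:
  assumes nu: "\<nu> \<in> lin G K2 (commK K2)" and n: "n \<in> K2" shows "\<nu> n ^ q = 1"
proof -
  have "n [^] q \<in> commK K2" using commK_exponent[OF K_normal order_refl, of n] n unfolding derived_eq_commK .
  thus ?thesis using lin_pow[OF K2_sub nu n, of q] lin_trivial_on[OF nu] by simp
qed

text \<open>Since \<open>x [^] q\<close> lies in \<open>K2\<close>, where \<open>\<nu>\<close> has
  order dividing \<open>q\<close>, the extensions have order dividing \<open>q ^ 2\<close>. The
  index is a power of \<open>q\<close> not exceeding \<open>totient (q ^ 2) < q ^ 2\<close>, hence
  at most \<open>q\<close>.\<close>

lemma rad_card:
  assumes nu: "\<nu> \<in> lin G K2 (commK K2)" and w: "w \<in> K2" "\<nu> w \<noteq> 1"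
  shows "card (rad \<nu>) \<le> q * card K2"
proof -
  note Rs = rad_subgroup[OF nu]
  have ex: "\<phi> x ^ (q ^ 2) = 1" if phi: "\<phi> \<in> lin G (rad \<nu>) {}" "\<And>n. n \<in> K2 \<Longrightarrow> \<phi> n = \<nu> n" and x: "x \<in> rad \<nu>" for \<phi> x
  proof -
    have xq: "x [^] q \<in> K2" using pow_q x rad_K by blast
    have "\<phi> x ^ q = \<nu> (x [^] q)" using lin_pow[OF Rs(1) phi(1) x, of q] phi(2)[OF xq] by simp
    thus ?thesis using K2_lin_pow_q[OF nu xq] by (simp add: power_mult power2_eq_square)
  qed
  have b: "card (rad \<nu>) \<le> totient (q ^ 2) * card K2"
  proof (rule rad_bound[OF nu w, where i=2])
    fix \<phi> x assume "\<phi> \<in> lin G (rad \<nu>) {}" "\<And>n. n \<in> K2 \<Longrightarrow> \<phi> n = \<nu> n" "x \<in> rad \<nu>"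
    thus "\<phi> x ^ q\<^sup>2 = 1" by (rule ex)
  qed auto
  obtain r where r: "card (rad \<nu>) = q ^ r * card K2" using intermediate_index[OF Rs rad_K] by blast
  have q1: "q > 1" using prime_gt_1_nat[OF q_prime] .
  have "q ^ r \<le> totient (q ^ 2)" using b r card_sub_pos[OF K2_sub] by simp
  also have "\<dots> < q ^ 2" by (rule totient_less) (use q1 one_less_power[of q 2] in simp)
  finally have "r < 2" by (rule power_less_imp_less_exp[OF q1])
  hence "q ^ r \<le> q ^ 1" using q1 by (intro power_increasing) auto
  thus ?thesis using r by simp
qed

text \<open>If \<open>\<nu> (x [^] q) = 1\<close>, the \<open>q\<close>-th power of an extension is
  trivial on \<open>K2\<close> and at \<open>x\<close>. By \<open>rad_card\<close> these generate
  the radical, so all extensions have order dividing \<open>q\<close>, and \<open>rad_bound\<close>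
  gives an index at most \<open>totient q < q\<close>, while \<open>x\<close> forces at least
  \<open>q\<close>.\<close>

lemma rad_pow:
  assumes nu: "\<nu> \<in> lin G K2 (commK K2)" and w: "w \<in> K2" "\<nu> w \<noteq> 1"
    and x: "x \<in> rad \<nu>" "x \<notin> K2"
  shows "\<nu> (x [^] q) \<noteq> 1"
proof
  assume a: "\<nu> (x [^] q) = 1"
  let ?R = "rad \<nu>"
  note Rs = rad_subgroup[OF nu]
  have xK: "x \<in> K" using x rad_K by auto
  have q1: "q > 1" using prime_gt_1_nat[OF q_prime] .
  have ge: "q * card K2 \<le> card T" if T: "subgroup T G" "K2 \<subseteq> T" "x \<in> T" "T \<subseteq> K" for T
  proof -
    obtain t where t: "card T = q ^ t * card K2" using intermediate_index[OF T(1,2,4)] by blast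
    have "card K2 < card T" using T x(2) finite_sub[OF T(1)] by (intro psubset_card_mono) auto
    hence "t \<noteq> 0" using t by (intro notI) simp
    hence "q \<le> q ^ t" using q1 by (simp add: self_le_power)
    thus ?thesis using t by simp
  qed
  have ex: "\<phi> y ^ (q ^ 1) = 1" if phi: "\<phi> \<in> lin G ?R {}" "\<And>n. n \<in> K2 \<Longrightarrow> \<phi> n = \<nu> n" and y: "y \<in> ?R" for \<phi> y
  proof -
    define T where "T = {y\<in>?R. \<phi> y ^ q = 1}"
    have Rc: "y \<in> carrier G" if "y \<in> ?R" for y using subsetD[OF rad_K that] by simp
    have T: "subgroup T G"
      by (rule finite_submonoid_imp_subgroup[OF finG])
        (use lin_one[OF Rs(1) phi(1)] lin_mult[OF phi(1)] Rs(1) Rc in \<open>auto simp: T_def subgroup.one_closed subgroup.m_closed power_mult_distrib\<close>)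
    have K2T: "K2 \<subseteq> T" using Rs(2) phi(2) K2_lin_pow_q[OF nu] by (auto simp: T_def)
    have xT: "x \<in> T" using x lin_pow[OF Rs(1) phi(1) x(1), of q] phi(2)[OF pow_q[OF xK]] a by (simp add: T_def)
    have TR: "T \<subseteq> ?R" by (auto simp: T_def)
    have "card ?R \<le> card T" using rad_card[OF nu w] ge[OF T K2T xT subset_trans[OF TR rad_K]] by (rule le_trans)
    hence "T = ?R" by (rule card_seteq[OF finite_sub[OF Rs(1)] TR])
    thus ?thesis using y by (auto simp: T_def)
  qed
  have "card ?R \<le> totient (q ^ 1) * card K2"
  proof (rule rad_bound[OF nu w, where i=1])
    fix \<phi> x assume "\<phi> \<in> lin G ?R {}" "\<And>n. n \<in> K2 \<Longrightarrow> \<phi> n = \<nu> n" "x \<in> ?R"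
    thus "\<phi> x ^ q ^ 1 = 1" by (rule ex)
  qed auto
  moreover have "totient (q ^ 1) < q" using totient_less[of q] q1 by simp
  hence "totient (q ^ 1) * card K2 < q * card K2" using card_sub_pos[OF K2_sub] by simp
  ultimately show False using ge[OF Rs x(1) rad_K] by linarith
qed

end

subsection \<open>The kernel is a 2-group\<close>

locale frobenius_GC_nonabelian = frobenius_GC_prime +
  assumes nonabelian: "derived G K \<noteq> {\<one>}"
begin

abbreviation K3 :: "'a set" where "K3 \<equiv> commK K2"

lemma K3_normal: "K3 \<lhd> G" by (rule commK_normal[OF K2_normal])
lemma K3_sub: "subgroup K3 G" using K3_normal by (rule normal_imp_subgroup)
lemma K3_psubset: "K3 \<subset> K2" by (rule commK_psubset[OF K2_normal K2_K nonabelian])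
lemma sec_K2: "abelian_section G K2 K3" by (rule commK_section[OF K2_normal K2_K])

definition rank :: nat where "rank = (SOME n. card K = q ^ n * card K2)"

lemma card_K: "card K = q ^ rank * card K2"
  unfolding rank_def using index_derived by (rule someI_ex)

text \<open>If \<open>K/K2\<close> had order at most \<open>q\<close>, any \<open>x\<close> outside
  \<open>K2\<close> would generate \<open>K\<close> together with \<open>K2\<close>. Since
  \<open>x\<close> is orthogonal to itself and to \<open>K2\<close>, the character
  \<open>\<nu>\<close> would be trivial on all commutators, hence on \<open>K2\<close>.\<close>

lemma rank_ge: "rank \<ge> 2"
proof (rule ccontr)
  assume "\<not> rank \<ge> 2"
  hence "q ^ rank \<le> q ^ 1" using prime_gt_0_nat[OF q_prime] by (intro power_increasing) auto
  hence cK: "card K \<le> q * card K2" using card_K by simp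
  obtain w where w: "w \<in> K2" "w \<notin> K3" using K3_psubset by blast
  obtain \<nu> where nu: "\<nu> \<in> lin G K2 K3" "\<nu> w \<noteq> 1"
    using lin_separates[OF finG sec_K2 K3_sub order_refl _ w] K3_psubset by blast
  have nu0: "\<nu> \<in> lin G K2 {}" using lin_mono[OF nu(1)] by simp
  have triv: "\<nu> (gcomm G x y) = 1" if x: "x \<in> K" and y: "y \<in> K" for x y
  proof (cases "x \<in> K2")
    case True
    thus ?thesis using form_sym[OF nu0 y x] lin_trivial_on[OF nu(1) commK_incl[OF y True]] by simp
  next
    case False
    let ?f = "\<lambda>y. if y \<in> K then \<nu> (gcomm G x y) else 0"
    have f: "?f \<in> lin G K {}" by (rule pairing_right[OF K2_normal K2_K nu(1) K_sub order_refl _ x]) simp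
    define T where "T = {y\<in>K. \<nu> (gcomm G x y) = 1}"
    have T: "subgroup T G"
      by (rule finite_submonoid_imp_subgroup[OF finG])
        (use lin_one[OF K_sub f] lin_mult[OF f] K_sub in \<open>auto simp: T_def subgroup.one_closed subgroup.m_closed\<close>)
    have K2T: "K2 \<subseteq> T"
    proof
      fix y assume y: "y \<in> K2"
      show "y \<in> T" using lin_trivial_on[OF lin_derived[OF K_sub f] y] y by (simp add: T_def)
    qed
    have xT: "x \<in> T" using x lin_one[OF K2_sub nu(1)] by (simp add: T_def)
    have TK: "T \<subseteq> K" by (auto simp: T_def)
    obtain t where t: "card T = q ^ t * card K2" using intermediate_index[OF T K2T TK] by blast
    have "card K2 < card T" using K2T xT False finite_sub[OF T] by (intro psubset_card_mono) auto
    hence "t \<noteq> 0" using t by (intro notI) simp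
    hence "q \<le> q ^ t" using prime_gt_1_nat[OF q_prime] by (simp add: self_le_power)
    hence "card K \<le> card T" using cK t by (metis le_trans mult_le_mono1)
    hence "T = K" by (rule card_seteq[OF finite_sub[OF K_sub] TK])
    thus ?thesis using y by (auto simp: T_def)
  qed
  have "commK K \<subseteq> {x\<in>K2. \<nu> x = 1}"
  proof (rule commK_least)
    show "subgroup {x\<in>K2. \<nu> x = 1} G"
      by (rule finite_submonoid_imp_subgroup[OF finG])
        (use lin_one[OF K2_sub nu(1)] lin_mult[OF nu(1)] K2_sub in \<open>auto simp: subgroup.one_closed subgroup.m_closed\<close>)
  qed (use triv in auto)
  thus False using w nu(2) unfolding derived_eq_commK by blast
qed

lemma L_bound_K2: "\<exists>m. card K2 = q ^ m * card K3 \<and> card L + 1 \<le> q ^ m"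
proof -
  obtain m where m: "card K2 = q ^ m * card K3"
    using commK_index[OF K_normal order_refl] unfolding derived_eq_commK[symmetric] by blast
  have "(card L + 1) * card K3 \<le> card K2" by (rule card_L_bound[OF K2_normal K2_K K3_normal K3_psubset])
  hence "(card L + 1) * card K3 \<le> q ^ m * card K3" unfolding m .
  hence "card L + 1 \<le> q ^ m" using card_sub_pos[OF K3_sub] by (simp only: mult_le_cancel2)
  thus ?thesis using m by blast
qed

text \<open>The lower and the upper bound on the order of \<open>L\<close> exclude
  \<open>m < rank\<close>, and \<open>rank_count\<close> then gives \<open>m = rank\<close>. For the
  last claim, a nontrivial \<open>\<nu>\<close> annihilating the commutators of \<open>x\<close> has
  \<open>x\<close> in its radical, and \<open>rad_pow\<close> makes it nontrivial at
  \<open>x [^] q\<close>.\<close>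

lemma card_K2: "card K2 = q ^ rank * card K3" and L_upper: "card L + 1 \<le> q ^ rank"
  and power_not_commutator: "\<And>x y. x \<in> K \<Longrightarrow> x \<notin> K2 \<Longrightarrow> y \<in> K \<Longrightarrow> K3 #> (x [^] q) \<noteq> K3 #> gcomm G x y"
proof -
  obtain m where m: "card K2 = q ^ m * card K3" and Lm: "card L + 1 \<le> q ^ m" using L_bound_K2 by blast
  have q1: "q > 1" using prime_gt_1_nat[OF q_prime] .
  have nm: "rank \<le> m"
  proof (rule ccontr)
    assume "\<not> rank \<le> m"
    \<comment> \<open>If \<open>m < rank\<close>, then \<open>card L \<le> Q - 1\<close>, and the
      lower bound on \<open>card L\<close> becomes \<open>q * Q - 1 \<le> (q - 1) * (Q - 1)\<close>,
      which is false.\<close>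
    define Q where "Q = q ^ (rank - 1)"
    have "q ^ m \<le> Q" unfolding Q_def using q1 \<open>\<not> rank \<le> m\<close> by (intro power_increasing) auto
    hence "card L \<le> Q - 1" using Lm by linarith
    moreover have qQ: "q ^ rank = q * Q" unfolding Q_def using rank_ge by (simp add: power_Suc[symmetric] del: power_Suc)
    ultimately have "q * Q - 1 \<le> (q - 1) * (Q - 1)" using card_L_lower[OF card_K] by (metis le_trans mult_le_mono2)
    moreover have "Q > 0" using q1 by (simp add: Q_def)
    moreover have "q = Suc (Suc (q - 2))" "Q = Suc (Q - 1)" using q1 \<open>Q > 0\<close> by auto
    then obtain a b where ab: "q = Suc (Suc a)" "Q = Suc b" by blast
    ultimately show False unfolding ab by simp
  qed
  \<comment> \<open>Every \<open>x\<close> commutes with itself and so serves as its own kernel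
    element.\<close>
  have ker: "\<exists>y\<in>K. y \<notin> K2 \<and> gcomm G x y \<in> K3" if "x \<in> K" "x \<notin> K2" for x
    using that K3_sub by (intro bexI[of _ x]) (auto simp: subgroup.one_closed)
  have rd: "card {x\<in>K. \<forall>y\<in>K. \<nu> (gcomm G x y) = 1} \<le> q * card K2"
    if "\<nu> \<in> lin G K2 K3" "w \<in> K2" "\<nu> w \<noteq> 1" for \<nu> w
    using rad_card[OF that] by (simp add: rad_def)
  have mn: "m = rank"
    by (rule commutator_rank[OF K_normal order_refl derived_eq_commK refl rank_ge nm card_K card_K m ker rd])
  thus "card K2 = q ^ rank * card K3" "card L + 1 \<le> q ^ rank" using m Lm by auto
  fix x y assume x: "x \<in> K" "x \<notin> K2" and y: "y \<in> K"
  have "\<exists>\<nu>\<in>lin G K2 K3. (\<exists>w\<in>K2. \<nu> w \<noteq> 1) \<and> (\<forall>y\<in>K. \<nu> (gcomm G x y) = 1)"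
    by (rule commutator_annihilator[OF K_normal order_refl derived_eq_commK refl rank_ge nm card_K card_K m ker rd x])
  then obtain \<nu> where n1: "\<nu> \<in> lin G K2 K3" "\<exists>w\<in>K2. \<nu> w \<noteq> 1" and n4: "\<And>y. y \<in> K \<Longrightarrow> \<nu> (gcomm G x y) = 1" by auto
  then obtain w where w: "w \<in> K2" "\<nu> w \<noteq> 1" by blast
  note nu = n1(1) w n4
  have ne: "\<nu> (x [^] q) \<noteq> 1" by (rule rad_pow[OF nu(1-3) _ x(2)]) (use x nu(4) in \<open>simp add: rad_def\<close>)
  show "K3 #> (x [^] q) \<noteq> K3 #> gcomm G x y"
  proof
    assume "K3 #> (x [^] q) = K3 #> gcomm G x y"
    hence d: "x [^] q \<otimes> inv (gcomm G x y) \<in> K3" using rcos_eq_iff[OF K3_sub] x y by simp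
    have xq: "x [^] q \<in> K2" "inv (gcomm G x y) \<in> K2" using pow_q x y K2_sub by (auto simp: subgroup.m_inv_closed)
    have "\<nu> (x [^] q \<otimes> inv (gcomm G x y)) = \<nu> (x [^] q)"
      using lin_mult[OF nu(1) xq] lin_inv[OF K2_sub nu(1) gcomm_K2[OF x(1) y]] nu(4)[OF y] by simp
    thus False using ne lin_trivial_on[OF nu(1) d] by simp
  qed
qed

lemma power_notin_K3: "x \<in> K \<Longrightarrow> x \<notin> K2 \<Longrightarrow> x [^] q \<notin> K3"
  using power_not_commutator[of x x] rcos_eq_iff[OF K3_sub, of "x [^] q" \<one>] by auto

text \<open>For odd \<open>q\<close> the exponent \<open>q * (q - 1) div 2\<close> is a multiple of
  \<open>q\<close> and kills commutators modulo \<open>K3\<close>. The \<open>q\<close>-th power map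
  is then multiplicative, and \<open>no_commutator_pairing\<close> applies with \<open>k\<close> the
  identity.\<close>

lemma q_eq_2: "q = 2"
proof (rule ccontr)
  assume "q \<noteq> 2"
  hence odd: "odd q" using q_prime prime_odd_nat[of q] prime_ge_2_nat[OF q_prime] by simp
  have rd: "card {x\<in>K. \<forall>y\<in>K. \<nu> (gcomm G x y) = 1} \<le> q * card K2"
    if "\<nu> \<in> lin G K2 K3" "w \<in> K2" "\<nu> w \<noteq> 1" for \<nu> w
    using rad_card[OF that] by (simp add: rad_def)
  obtain x0 where x0: "x0 \<in> K" "x0 \<notin> K2" using derived_psubset[OF K_sub K_nontrivial] by blast
  show False
  proof (rule no_commutator_pairing[OF K_normal order_refl derived_eq_commK refl rank_ge order_refl card_K card_K card_K2 rd,
        where k="\<lambda>x. x"])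
    fix y assume y: "y \<in> K"
    show "y [^] q \<in> K2" by (rule pow_q[OF y])
    show "\<exists>x\<in>K. x \<notin> K2 \<and> gcomm G x y \<in> K3"
    proof (cases "y \<in> K2")
      case True thus ?thesis using x0 commK_incl by blast
    next
      case False thus ?thesis using y K3_sub by (intro bexI[of _ y]) (auto simp: subgroup.one_closed)
    qed
    fix z assume z: "z \<in> K"
    show "K3 #> ((y \<otimes> z) [^] q) = K3 #> (y [^] q \<otimes> z [^] q)"
    proof (rule pow_coset[OF K3_normal _ y z])
      show "K3 \<subseteq> K" using K3_psubset K2_K by blast
      fix k assume k: "k \<in> K"
      have "gcomm G k (gcomm G z y) \<in> K3" using commK_incl[OF k gcomm_K2[OF z y]] .
      hence "inv (gcomm G k (gcomm G z y)) \<in> K3" using K3_sub by (simp add: subgroup.m_inv_closed)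
      thus "gcomm G (gcomm G z y) k \<in> K3" using k y z by (simp add: gcomm_inv)
    next
      obtain t where "q = 2 * t + 1" using odd by (rule oddE)
      hence "q * (q - 1) div 2 = q * t" by simp
      moreover have "gcomm G z y [^] q \<in> K3"
        using commK_exponent[OF K_normal order_refl, of "gcomm G z y"] gcomm_K2[OF z y] unfolding derived_eq_commK by blast
      ultimately show "gcomm G z y [^] (q * (q - 1) div 2) \<in> K3"
        using subgroup_nat_pow[OF K3_sub, of "gcomm G z y [^] q" t] y z by (simp add: nat_pow_pow)
    qed
  next
    fix x assume x: "x \<in> K" "x \<notin> K2"
    show "x [^] q \<notin> K3" by (rule power_notin_K3[OF x])
    show "x \<in> K \<and> x \<notin> K2 \<and> gcomm G x x \<in> K3 \<and> (\<forall>y\<in>K. K3 #> (x [^] q) \<noteq> K3 #> gcomm G x y)"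
      using x K3_sub power_not_commutator[OF x] by (auto simp: subgroup.one_closed)
  qed
qed

text \<open>For \<open>q = 2\<close> the lower and upper bounds on the order of \<open>L\<close>
  coincide.\<close>

lemma card_L: "card L + 1 = 2 ^ rank"
  using L_upper card_L_lower[OF card_K] unfolding q_eq_2 by simp

end

subsection \<open>The kernel has class 2\<close>

lemma card_fibers_le:
  assumes "finite A" "\<And>b. b \<in> f ` A \<Longrightarrow> card {a\<in>A. f a = b} \<le> c"
  shows "card A \<le> c * card (f ` A)"
proof -
  have "card A = (\<Sum>b\<in>f ` A. card {a\<in>A. f a = b})"
    using sum.image_gen[OF assms(1), of "\<lambda>_. 1::nat" f] by simp
  also have "\<dots> \<le> (\<Sum>b\<in>f ` A. c)" by (rule sum_mono) (rule assms(2))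
  finally show ?thesis by (simp add: mult.commute)
qed

lemma power_mod_eq:
  assumes "(z::complex) ^ e = 1" "j mod e = k mod e" shows "z ^ j = z ^ k"
proof -
  have "z ^ i = z ^ (i mod e)" for i
  proof -
    have "z ^ i = z ^ (e * (i div e) + i mod e)" by simp
    also have "\<dots> = z ^ (i mod e)" unfolding power_add power_mult assms(1) by simp
    finally show ?thesis .
  qed
  thus ?thesis using assms(2) by metis
qed

section \<open>Characters over a nontrivial character of the third factor\<close>

context frobenius_GC_nonabelian
begin

abbreviation K4 :: "'a set" where "K4 \<equiv> commK K3"

lemma K3_K: "K3 \<subseteq> K" using K3_psubset K2_K by blast
lemma K4_normal: "K4 \<lhd> G" by (rule commK_normal[OF K3_normal])
lemma K4_sub: "subgroup K4 G" using K4_normal by (rule normal_imp_subgroup)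
lemma K4_K3: "K4 \<subseteq> K3" by (rule commK_subset[OF K3_normal])
lemma sec_K3: "abelian_section G K3 K4" by (rule commK_section[OF K3_normal K3_K])
lemma K3_K2D: "x \<in> K3 \<Longrightarrow> x \<in> K2" using K3_psubset by auto
lemma gcomm_K3: "k \<in> K \<Longrightarrow> z \<in> K2 \<Longrightarrow> gcomm G k z \<in> K3" by (rule commK_incl)

lemma square_K2: "z \<in> K2 \<Longrightarrow> z [^] (2::nat) \<in> K3"
  using commK_exponent[OF K_normal order_refl, of z] unfolding derived_eq_commK[symmetric] q_eq_2 .

lemma square_K3: "z \<in> K3 \<Longrightarrow> z [^] (2::nat) \<in> K4"
  using commK_exponent[OF K2_normal K2_K, of z] unfolding q_eq_2 .

lemma square_K: "x \<in> K \<Longrightarrow> x [^] (2::nat) \<in> K2"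
  using pow_q unfolding q_eq_2 .

lemmas pair3_left = pair_left[OF K2_normal K2_K refl refl]
lemmas pair3_right = pair_right[OF K2_normal K2_K refl refl]

text \<open>For fixed \<open>z'\<close> the values of \<open>\<nu>\<close> at the commutators with
  \<open>z'\<close> form a linear character of \<open>K\<close>, which is trivial on
  \<open>K2\<close>; an instance of the three subgroups lemma.\<close>

lemma gcomm_K4:
  assumes z: "z \<in> K2" "z' \<in> K2" shows "gcomm G z z' \<in> K4"
proof (rule lin_section_mult[OF finG sec_K3])
  show "gcomm G z z' \<in> K3" using gcomm_K3 z by simp
  fix \<nu> assume nu: "\<nu> \<in> lin G K3 K4"
  show "\<nu> (gcomm G z z') = 1" using lin_trivial_on[OF pair3_left[OF nu z(2)] z(1)] z by simp
qed

lemma sec_K2_K4: "abelian_section G K2 K4"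
  unfolding abelian_section_def using K2_sub K4_sub K4_K3 K3_psubset gcomm_K4 by blast

context
  fixes \<nu> :: "'a \<Rightarrow> complex" and w :: 'a
  assumes nu: "\<nu> \<in> lin G K3 K4" and w: "w \<in> K3" "\<nu> w \<noteq> 1"
begin

text \<open>The two radicals of the pairing \<open>\<nu> (gcomm G x z)\<close> between
  \<open>K\<close> and \<open>K2\<close>.\<close>

definition left_rad :: "'a set" where "left_rad = {x\<in>K. \<forall>z\<in>K2. \<nu> (gcomm G x z) = 1}"
definition right_rad :: "'a set" where "right_rad = {z\<in>K2. \<forall>x\<in>K. \<nu> (gcomm G x z) = 1}"
text \<open>The extensions of \<open>\<nu>\<close> to \<open>right_rad\<close>, the part of
  \<open>K2\<close> on which they remain \<open>K\<close>-invariant.\<close>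

definition central_ext :: "('a \<Rightarrow> complex) set" where
  "central_ext = {\<phi>\<in>lin G right_rad K4. \<forall>s\<in>K3. \<phi> s = \<nu> s}"
text \<open>A chosen extension of \<open>\<phi>\<close> to all of \<open>K2\<close>; outside
  \<open>right_rad\<close> its values change under conjugation by suitable elements of
  \<open>K\<close>.\<close>

definition mu :: "('a \<Rightarrow> complex) \<Rightarrow> 'a \<Rightarrow> complex" where
  "mu \<phi> = (SOME \<mu>. \<mu> \<in> lin G K2 K4 \<and> (\<forall>y\<in>right_rad. \<mu> y = \<phi> y))"
definition isot :: "('a \<Rightarrow> complex) \<Rightarrow> 'a set" where
  "isot \<phi> = (SOME A. isotropic (mu \<phi>) A)"

lemma left_rad_K: "left_rad \<subseteq> K" by (auto simp: left_rad_def)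

lemma left_rad_sub: "subgroup left_rad G" and K2_left_rad: "K2 \<subseteq> left_rad"
proof -
  show "subgroup left_rad G"
  proof (rule finite_submonoid_imp_subgroup[OF finG])
    show "left_rad \<subseteq> carrier G" using subset_trans[OF left_rad_K subgroup.subset[OF K_sub]] .
    show "\<one> \<in> left_rad" using K_sub lin_one[OF K3_sub nu] by (auto simp: left_rad_def gcomm_def subgroup.one_closed)
    fix a b assume ab: "a \<in> left_rad" "b \<in> left_rad"
    have "\<nu> (gcomm G (a \<otimes> b) z) = 1" if z: "z \<in> K2" for z
      using lin_mult[OF pair3_left[OF nu z], of a b] ab z K_sub by (simp add: left_rad_def subgroup.m_closed)
    thus "a \<otimes> b \<in> left_rad" using ab K_sub by (simp add: left_rad_def subgroup.m_closed)
  qed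
  show "K2 \<subseteq> left_rad"
    using lin_trivial_on[OF nu gcomm_K4] by (auto simp: left_rad_def)
qed

lemma right_rad_sub: "subgroup right_rad G" and K3_right_rad: "K3 \<subseteq> right_rad" and right_rad_K2: "right_rad \<subseteq> K2"
proof -
  show "right_rad \<subseteq> K2" by (auto simp: right_rad_def)
  show "subgroup right_rad G"
  proof (rule finite_submonoid_imp_subgroup[OF finG])
    show "right_rad \<subseteq> carrier G" by (auto simp: right_rad_def)
    show "\<one> \<in> right_rad" using K2_sub lin_one[OF K3_sub nu] by (auto simp: right_rad_def gcomm_def subgroup.one_closed)
    fix a b assume ab: "a \<in> right_rad" "b \<in> right_rad"
    have "\<nu> (gcomm G x (a \<otimes> b)) = 1" if x: "x \<in> K" for x
      using lin_mult[OF pair3_right[OF nu x], of a b] ab x K2_sub by (simp add: right_rad_def subgroup.m_closed)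
    thus "a \<otimes> b \<in> right_rad" using ab K2_sub by (simp add: right_rad_def subgroup.m_closed)
  qed
  show "K3 \<subseteq> right_rad"
  proof
    fix z assume z: "z \<in> K3"
    have "\<nu> (gcomm G x z) = 1" if "x \<in> K" for x using lin_trivial_on[OF nu commK_incl[OF that z]] .
    thus "z \<in> right_rad" using K3_K2D[OF z] by (simp add: right_rad_def)
  qed
qed

lemma nu_square: "s \<in> K3 \<Longrightarrow> \<nu> s ^ 2 = 1"
  using lin_pow[OF K3_sub nu, of s 2] lin_trivial_on[OF nu square_K3] by simp

text \<open>Modulo \<open>right_rad\<close> the group \<open>K2\<close> embeds into the characters
  of \<open>K/left_rad\<close>. As \<open>K/K2\<close> and \<open>K2/K3\<close> have equal order,
  this says \<open>|left_rad : K2| \<le> |right_rad : K3|\<close>, and the right side is the number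
  of elements of \<open>central_ext\<close>.\<close>

lemma rad_duality: "card left_rad * card K3 \<le> card right_rad * card K2"
proof -
  let ?f = "\<lambda>z k. if k \<in> K then \<nu> (gcomm G k z) else 0"
  have sec: "abelian_section G K left_rad" unfolding abelian_section_def
    using K_sub left_rad_sub left_rad_K K2_left_rad gcomm_K2 by blast
  have f1: "card K2 \<le> card right_rad * card (?f ` K2)"
  proof (rule card_fibers_le[OF finite_sub[OF K2_sub]])
    fix b assume "b \<in> ?f ` K2"
    then obtain z where z: "z \<in> K2" "b = ?f z" by blast
    have "{a\<in>K2. ?f a = b} \<subseteq> (\<lambda>y. y \<otimes> z) ` right_rad"
    proof
      fix a assume "a \<in> {a\<in>K2. ?f a = b}"
      hence a: "a \<in> K2" "?f a = ?f z" using z by auto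
      have iz: "inv z \<in> K2" using z K2_sub by (simp add: subgroup.m_inv_closed)
      have "\<nu> (gcomm G x (a \<otimes> inv z)) = 1" if x: "x \<in> K" for x
      proof -
        let ?g = "\<lambda>n. if n \<in> K2 then \<nu> (gcomm G x n) else 0"
        note g = pair3_right[OF nu x]
        have "?g a = ?g z" using fun_cong[OF a(2), of x] x a z by simp
        hence "?g (a \<otimes> inv z) = 1"
          using lin_mult[OF g a(1) iz] lin_inv[OF K2_sub g z(1)] lin_nonzero[OF g z(1)] by simp
        thus ?thesis using a iz K2_sub by (simp add: subgroup.m_closed)
      qed
      hence "a \<otimes> inv z \<in> right_rad" using a iz K2_sub by (simp add: right_rad_def subgroup.m_closed)
      moreover have "a = (a \<otimes> inv z) \<otimes> z" using a z by (simp add: m_assoc)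
      ultimately show "a \<in> (\<lambda>y. y \<otimes> z) ` right_rad" by blast
    qed
    thus "card {a\<in>K2. ?f a = b} \<le> card right_rad" using finite_sub[OF right_rad_sub] surj_card_le by blast
  qed
  have f2: "card (?f ` K2) \<le> card (lin G K left_rad)"
  proof (rule card_mono[OF finite_lin[OF K_sub finite_sub[OF K_sub]]], rule image_subsetI)
    fix z assume z: "z \<in> K2"
    show "?f z \<in> lin G K left_rad"
      using pair3_left[OF nu z] z left_rad_K unfolding lin_def left_rad_def by auto
  qed
  have "card K2 \<le> card right_rad * card (lin G K left_rad)" by (rule order_trans[OF f1 mult_le_mono2[OF f2]])
  hence "card K2 * card left_rad \<le> card right_rad * (card (lin G K left_rad) * card left_rad)" by (simp add: mult.assoc[symmetric])
  also have "card (lin G K left_rad) * card left_rad = 2 ^ rank * card K2" using card_lin[OF finG sec] card_K q_eq_2 by simp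
  finally have "2 ^ rank * (card left_rad * card K3) \<le> 2 ^ rank * (card right_rad * card K2)"
    using card_K2 unfolding q_eq_2 by (simp add: mult_ac)
  thus ?thesis by simp
qed

lemma card_central_ext: "card central_ext * card K3 = card right_rad"
proof -
  have sec: "abelian_section G right_rad K4" unfolding abelian_section_def
  proof (intro conjI ballI)
    fix x y assume "x \<in> right_rad" "y \<in> right_rad"
    thus "gcomm G x y \<in> K4" using right_rad_K2 gcomm_K4 by (meson subsetD)
  qed (rule right_rad_sub K4_sub subset_trans[OF K4_K3 K3_right_rad])+
  show ?thesis unfolding central_ext_def by (rule card_lin_extensions[OF finG sec K3_sub K4_K3 K3_right_rad nu])
qed

lemma mu:
  assumes "\<phi> \<in> central_ext"
  shows "mu \<phi> \<in> lin G K2 K4" "\<And>y. y \<in> right_rad \<Longrightarrow> mu \<phi> y = \<phi> y" "\<And>s. s \<in> K3 \<Longrightarrow> mu \<phi> s = \<nu> s" "mu \<phi> \<in> lin G K2 {}"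
proof -
  have "\<phi> \<in> lin G right_rad K4" using assms by (simp add: central_ext_def)
  then obtain \<mu> where "\<mu> \<in> lin G K2 K4" "\<And>y. y \<in> right_rad \<Longrightarrow> \<mu> y = \<phi> y"
    using lin_extend[OF finG sec_K2_K4 right_rad_sub subset_trans[OF K4_K3 K3_right_rad] right_rad_K2] by blast
  hence "\<exists>\<mu>. \<mu> \<in> lin G K2 K4 \<and> (\<forall>y\<in>right_rad. \<mu> y = \<phi> y)" by blast
  hence m: "mu \<phi> \<in> lin G K2 K4 \<and> (\<forall>y\<in>right_rad. mu \<phi> y = \<phi> y)" unfolding mu_def by (rule someI_ex)
  thus "mu \<phi> \<in> lin G K2 K4" "\<And>y. y \<in> right_rad \<Longrightarrow> mu \<phi> y = \<phi> y" by auto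
  show "\<And>s. s \<in> K3 \<Longrightarrow> mu \<phi> s = \<nu> s" using m K3_right_rad assms by (auto simp: central_ext_def)
  show "mu \<phi> \<in> lin G K2 {}" using m lin_mono by blast
qed

lemma mu_pow4: assumes "\<phi> \<in> central_ext" "z \<in> K2" shows "mu \<phi> z ^ 4 = 1"
proof -
  have "mu \<phi> z ^ 2 = \<nu> (z [^] (2::nat))"
    using lin_pow[OF K2_sub mu(1)[OF assms(1)] assms(2), of 2] mu(3)[OF assms(1) square_K2[OF assms(2)]] by simp
  hence "(mu \<phi> z ^ 2) ^ 2 = 1" using nu_square[OF square_K2[OF assms(2)]] by simp
  thus ?thesis by (simp add: power_mult[symmetric])
qed

lemma mu_gconj:
  assumes "\<phi> \<in> central_ext" "x \<in> K" "z \<in> K2"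
  shows "mu \<phi> (gconj G x z) = \<nu> (gcomm G x z) * mu \<phi> z"
proof -
  have "gconj G x z = gcomm G x z \<otimes> z" using assms by (simp add: gconj_gcomm)
  thus ?thesis using lin_mult[OF mu(1)[OF assms(1)] K3_K2D[OF gcomm_K3[OF assms(2,3)]] assms(3)]
      mu(3)[OF assms(1) gcomm_K3[OF assms(2,3)]] by simp
qed

text \<open>Conjugation by \<open>x\<close> multiplies \<open>mu \<phi> z\<close> by
  \<open>\<nu> (gcomm G x z)\<close>, and this is 1 for all \<open>z\<close> exactly when
  \<open>x\<close> is in \<open>left_rad\<close>.\<close>

lemma stabK_mu: assumes "\<phi> \<in> central_ext" shows "stabK (mu \<phi>) = left_rad"
  using mu_gconj[OF assms] lin_nonzero[OF mu(1)[OF assms]] by (auto simp: stabK_def left_rad_def)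

lemma isot:
  assumes "\<phi> \<in> central_ext"
  shows "isotropic (mu \<phi>) (isot \<phi>)" "subgroup (isot \<phi>) G" "K2 \<subseteq> isot \<phi>" "isot \<phi> \<subseteq> left_rad" "isot \<phi> \<subseteq> K"
    "\<And>a b. a \<in> isot \<phi> \<Longrightarrow> b \<in> isot \<phi> \<Longrightarrow> mu \<phi> (gcomm G a b) = 1"
    "left_rad \<noteq> K2 \<Longrightarrow> isot \<phi> \<noteq> K2"
proof -
  show i: "isotropic (mu \<phi>) (isot \<phi>)" unfolding isot_def using isotropic_exists[OF mu(4)[OF assms]] by (rule someI_ex)
  show "subgroup (isot \<phi>) G" "K2 \<subseteq> isot \<phi>" "isot \<phi> \<subseteq> left_rad"
    "\<And>a b. a \<in> isot \<phi> \<Longrightarrow> b \<in> isot \<phi> \<Longrightarrow> mu \<phi> (gcomm G a b) = 1"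
    using i unfolding isotropic_def stabK_mu[OF assms] by auto
  thus "isot \<phi> \<subseteq> K" using left_rad_K by blast
  \<comment> \<open>An element of \<open>left_rad\<close> outside \<open>K2\<close> is orthogonal to
    \<open>K2\<close>, so \<open>K2\<close> cannot be maximal isotropic.\<close>
  assume "left_rad \<noteq> K2"
  then obtain x where x: "x \<in> left_rad" "x \<notin> K2" using K2_left_rad by blast
  have xK: "x \<in> K" using x left_rad_K by auto
  show "isot \<phi> \<noteq> K2"
  proof
    assume e: "isot \<phi> = K2"
    have "mu \<phi> (gcomm G a x) = 1" if a: "a \<in> K2" for a
      using form_sym[OF mu(4)[OF assms] xK, of a] a x mu(3)[OF assms gcomm_K3[OF xK a]] by (simp add: left_rad_def)
    hence "x \<in> isot \<phi>" using i x unfolding isotropic_def stabK_mu[OF assms] e by blast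
    thus False using e x by simp
  qed
qed

lemma nu_inv: "k \<in> K \<Longrightarrow> m \<in> K3 \<Longrightarrow> \<nu> (gconj G k m) = \<nu> m"
  by (rule lin_commK_invariant[OF K3_normal K3_K nu])

lemma mackey_ext:
  assumes "\<phi> \<in> central_ext" "\<psi> \<in> lin G (isot \<phi>) {}" "\<And>n. n \<in> K2 \<Longrightarrow> \<psi> n = mu \<phi> n"
  shows "mackey G (isot \<phi>) \<psi>"
proof (rule mackey_isotropic[OF mu(4)[OF assms(1)] isot(1)[OF assms(1)] assms(2,3) K3_normal])
  show "K3 \<subseteq> K2" using K3_psubset by auto
  fix k m assume km: "k \<in> K" "m \<in> K3"
  thus "mu \<phi> (gconj G k m) = mu \<phi> m"
    using nu_inv mu(3)[OF assms(1)] normal_gconj[OF K3_normal] by simp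
qed (use w mu(3)[OF assms(1)] in auto)

text \<open>On \<open>K3\<close> the values of \<open>\<nu>\<close> are 1 and -1, which odd powers
  do not change. A Galois conjugate therefore lies over the same \<open>\<nu>\<close>, as
  \<open>thetaK_eq\<close> requires.\<close>

lemma nu_odd: "s \<in> K3 \<Longrightarrow> coprime j (card (carrier G)) \<Longrightarrow> \<nu> s ^ j = \<nu> s"
proof -
  assume s: "s \<in> K3" and "coprime j (card (carrier G))"
  hence "coprime j 2" using coprime_q unfolding q_eq_2 by blast
  hence "odd j" by simp
  hence "j mod 2 = 1 mod 2" by (simp add: odd_iff_mod_2_eq_one)
  thus "\<nu> s ^ j = \<nu> s" using power_mod_eq[OF nu_square[OF s], of j 1] by simp
qed

lemma coprime_pow2: "coprime j (card (carrier G)) \<Longrightarrow> coprime j (2 ^ i)"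
  using coprime_q unfolding q_eq_2 by simp

lemma conjugate_exts:
  assumes p: "\<phi> \<in> central_ext" "\<psi> \<in> lin G (isot \<phi>) {}" "\<And>n. n \<in> K2 \<Longrightarrow> \<psi> n = mu \<phi> n"
    and p': "\<phi>' \<in> central_ext" "\<psi>' \<in> lin G (isot \<phi>') {}" "\<And>n. n \<in> K2 \<Longrightarrow> \<psi>' n = mu \<phi>' n"
    and c: "card (isot \<phi>) = card (isot \<phi>')"
  shows "\<exists>j>0. coprime j (card (carrier G)) \<and> (\<forall>y\<in>carrier G. thetaK \<psi>' y = thetaK (\<lambda>x. \<psi> x ^ j) y)"
proof -
  obtain j where j: "j > 0" "coprime j (card (carrier G))"
    and e: "\<And>g. g \<in> carrier G \<Longrightarrow> induced G \<psi>' g = induced G (\<lambda>x. \<psi> x ^ j) g"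
    using GC_star_induced[OF finG gc mackey_ext[OF p] mackey_ext[OF p'] c K_neq_G[OF isot(5)[OF p(1)]]] by blast
  have K3K2: "K3 \<subseteq> K2" using K3_psubset by auto
  have "thetaK \<psi>' y = thetaK (\<lambda>x. \<psi> x ^ j) y" if y: "y \<in> carrier G" for y
  proof (rule thetaK_eq[OF p'(2) isot(2)[OF p'(1)] _ lin_power[OF p(2) j(1)] isot(2)[OF p(1)] _ K3_normal K3_K
        lin_mono[OF nu] nu_inv w _ _ y e])
    show "K3 \<subseteq> isot \<phi>'" "K3 \<subseteq> isot \<phi>" using K3K2 isot(3)[OF p'(1)] isot(3)[OF p(1)] by auto
    fix m assume m: "m \<in> K3"
    show "\<psi>' m = \<nu> m" using p'(3)[OF K3_K2D[OF m]] mu(3)[OF p'(1) m] by simp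
    show "\<psi> m ^ j = \<nu> m" using p(3)[OF K3_K2D[OF m]] mu(3)[OF p(1) m] nu_odd[OF m j(2)] by simp
  qed auto
  thus ?thesis using j by blast
qed

lemma ext_exists: "\<phi> \<in> central_ext \<Longrightarrow> \<exists>\<psi>\<in>lin G (isot \<phi>) {}. \<forall>n\<in>K2. \<psi> n = mu \<phi> n"
  by (rule extension_exists[OF mu(4) isot(2) isot(5) isot(6) K2_sub order_refl isot(3) mu(4)]) auto

text \<open>On \<open>right_rad\<close> all \<open>K\<close>-conjugates of
  \<open>\<Psi> \<phi>\<close> have the value \<open>\<phi> y\<close>, so comparing
  \<open>K\<close>-parts gives \<open>\<phi> y = \<phi>0 y ^ J \<phi>\<close>. Since fourth powers
  of the values are 1, only \<open>totient 4 = 2\<close> characters are possible.\<close>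

lemma class_bound:
  assumes S: "S \<subseteq> central_ext" "\<And>\<phi> \<phi>'. \<phi> \<in> S \<Longrightarrow> \<phi>' \<in> S \<Longrightarrow> card (isot \<phi>) = card (isot \<phi>')"
  shows "card S \<le> 2"
proof (cases "S = {}")
  case False
  then obtain \<phi>0 where p0: "\<phi>0 \<in> S" by blast
  have Sc: "\<phi> \<in> central_ext" if "\<phi> \<in> S" for \<phi> using that S(1) by auto
  define \<Psi> where "\<Psi> \<phi> = (SOME \<psi>. \<psi> \<in> lin G (isot \<phi>) {} \<and> (\<forall>n\<in>K2. \<psi> n = mu \<phi> n))" for \<phi>
  have Psi: "\<Psi> \<phi> \<in> lin G (isot \<phi>) {} \<and> (\<forall>n\<in>K2. \<Psi> \<phi> n = mu \<phi> n)" if "\<phi> \<in> S" for \<phi>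
  proof -
    have "\<exists>\<psi>. \<psi> \<in> lin G (isot \<phi>) {} \<and> (\<forall>n\<in>K2. \<psi> n = mu \<phi> n)" using ext_exists[OF Sc[OF that]] by blast
    from someI_ex[OF this] show ?thesis unfolding \<Psi>_def .
  qed
  have "\<exists>j>0. coprime j (card (carrier G)) \<and> (\<forall>y\<in>carrier G. thetaK (\<Psi> \<phi>) y = thetaK (\<lambda>x. \<Psi> \<phi>0 x ^ j) y)" if "\<phi> \<in> S" for \<phi>
    by (rule conjugate_exts[OF Sc[OF p0] _ _ Sc[OF that] _ _ S(2)[OF p0 that]]) (use Psi p0 that in auto)
  then obtain J where J: "\<And>\<phi>. \<phi> \<in> S \<Longrightarrow> J \<phi> > 0" "\<And>\<phi>. \<phi> \<in> S \<Longrightarrow> coprime (J \<phi>) (card (carrier G))"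
    "\<And>\<phi> y. \<phi> \<in> S \<Longrightarrow> y \<in> carrier G \<Longrightarrow> thetaK (\<Psi> \<phi>) y = thetaK (\<lambda>x. \<Psi> \<phi>0 x ^ J \<phi>) y" by metis
  have cent: "\<Psi> \<phi> (gconj G k y) = \<phi> y" if phi: "\<phi> \<in> S" and y: "y \<in> right_rad" and k: "k \<in> K" for \<phi> k y
  proof -
    have yK: "y \<in> K2" using y right_rad_K2 by auto
    have "\<Psi> \<phi> (gconj G k y) = mu \<phi> (gconj G k y)" using Psi[OF phi] gconj_K2[OF K_car[OF k] yK] by simp
    thus ?thesis using mu_gconj[OF Sc[OF phi] k yK] mu(2)[OF Sc[OF phi] y] y k by (simp add: right_rad_def)
  qed
  have val: "\<phi> y = \<phi>0 y ^ J \<phi>" if phi: "\<phi> \<in> S" and y: "y \<in> right_rad" for \<phi> y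
  proof -
    have yc: "y \<in> carrier G" using y right_rad_K2 by auto
    have "thetaK (\<Psi> \<phi>) y = of_nat (card K) * \<phi> y" using cent[OF phi y] by (simp add: thetaK_def)
    moreover have "thetaK (\<lambda>x. \<Psi> \<phi>0 x ^ J \<phi>) y = of_nat (card K) * \<phi>0 y ^ J \<phi>" using cent[OF p0 y] by (simp add: thetaK_def)
    ultimately show ?thesis using J(3)[OF phi yc] card_sub_pos[OF K_sub] by simp
  qed
  have "card S \<le> totient (2 ^ 2)"
  proof (rule card_le_totient)
    fix \<phi> assume "\<phi> \<in> S" thus "coprime (J \<phi>) (2 ^ 2)" using coprime_pow2[OF J(2)] by blast
  next
    fix \<phi> \<phi>' assume pp: "\<phi> \<in> S" "\<phi>' \<in> S" and jj: "J \<phi> mod 2 ^ 2 = J \<phi>' mod 2 ^ 2"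
    show "\<phi> = \<phi>'"
    proof (rule lin_eqI[of _ right_rad K4 _ K4])
      show "\<phi> \<in> lin G right_rad K4" "\<phi>' \<in> lin G right_rad K4" using Sc pp by (auto simp: central_ext_def)
      fix y assume y: "y \<in> right_rad"
      have "\<phi>0 y ^ (2 ^ 2) = 1" using mu_pow4[OF Sc[OF p0], of y] mu(2)[OF Sc[OF p0] y] y right_rad_K2 by auto
      thus "\<phi> y = \<phi>' y" using val[OF pp(1) y] val[OF pp(2) y] power_mod_eq jj by metis
    qed
  qed simp
  also have "totient (2 ^ 2) = 2" using totient_prime_power_Suc[of 2 1] by simp
  finally show ?thesis .
qed simp

text \<open>If \<open>left_rad\<close> itself is isotropic, extensions to \<open>left_rad\<close>
  are distinguished as well. Each \<open>\<phi>\<close> in \<open>S\<close> has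
  \<open>|left_rad : K2|\<close> of them, and all of these for all \<open>\<phi>\<close> are
  determined by exponents modulo \<open>e\<close> relative to one \<open>\<psi>0\<close>.\<close>

lemma full_class_bound:
  assumes S: "S \<subseteq> central_ext" "\<And>\<phi>. \<phi> \<in> S \<Longrightarrow> isot \<phi> = left_rad" and e: "e = 2 ^ i" "i > 0"
    and ex: "\<And>\<phi> \<psi> x. \<phi> \<in> S \<Longrightarrow> \<psi> \<in> lin G left_rad {} \<Longrightarrow> (\<And>n. n \<in> K2 \<Longrightarrow> \<psi> n = mu \<phi> n) \<Longrightarrow> x \<in> left_rad \<Longrightarrow> \<psi> x ^ e = 1"
  shows "card S * card left_rad \<le> totient e * card K2"
proof (cases "S = {}")
  case False
  have Sc: "\<phi> \<in> central_ext" if "\<phi> \<in> S" for \<phi> using that S(1) by auto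
  define E where "E \<phi> = {\<psi>\<in>lin G left_rad {}. \<forall>n\<in>K2. \<psi> n = mu \<phi> n}" for \<phi>
  have cE: "card (E \<phi>) * card K2 = card left_rad" if "\<phi> \<in> S" for \<phi>
    unfolding E_def using extensions_card[OF mu(4)[OF Sc[OF that]] isot(2,5,6)[OF Sc[OF that]] K2_sub order_refl
        isot(3)[OF Sc[OF that]] mu(4)[OF Sc[OF that]] refl] S(2)[OF that] by simp
  let ?R = left_rad
  have finE: "finite (E \<phi>)" for \<phi> unfolding E_def using finite_lin[OF left_rad_sub finite_sub[OF left_rad_sub]] by simp
  have finS: "finite S"
  proof (rule finite_subset[OF S(1)])
    show "finite central_ext" unfolding central_ext_def using finite_lin[OF right_rad_sub finite_sub[OF right_rad_sub]] by simp
  qed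
  have EK2: "\<psi> n = mu \<phi> n" if "\<psi> \<in> E \<phi>" "n \<in> K2" for \<psi> \<phi> n using that by (simp add: E_def)
  have deter: "\<phi> = \<phi>'" if "\<phi> \<in> S" "\<phi>' \<in> S" "\<And>y. y \<in> right_rad \<Longrightarrow> mu \<phi> y = mu \<phi>' y" for \<phi> \<phi>'
  proof (rule lin_eqI[of _ right_rad K4 _ K4])
    show "\<phi> \<in> lin G right_rad K4" "\<phi>' \<in> lin G right_rad K4" using Sc that by (auto simp: central_ext_def)
    fix y assume "y \<in> right_rad"
    thus "\<phi> y = \<phi>' y" using that(3) mu(2)[OF Sc[OF that(1)]] mu(2)[OF Sc[OF that(2)]] by metis
  qed
  define F where "F = (\<Union>\<phi>\<in>S. E \<phi>)"
  have "card F = (\<Sum>\<phi>\<in>S. card (E \<phi>))" unfolding F_def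
  proof (rule card_UN_disjoint[OF finS])
    show "\<forall>\<phi>\<in>S. finite (E \<phi>)" using finE by blast
    show "\<forall>\<phi>\<in>S. \<forall>\<phi>'\<in>S. \<phi> \<noteq> \<phi>' \<longrightarrow> E \<phi> \<inter> E \<phi>' = {}"
    proof (intro ballI impI, rule ccontr)
      fix \<phi> \<phi>' assume pp: "\<phi> \<in> S" "\<phi>' \<in> S" "\<phi> \<noteq> \<phi>'" and "E \<phi> \<inter> E \<phi>' \<noteq> {}"
      then obtain \<psi> where "\<psi> \<in> E \<phi>" "\<psi> \<in> E \<phi>'" by blast
      hence "mu \<phi> y = mu \<phi>' y" if "y \<in> right_rad" for y using EK2 that right_rad_K2 by (metis subsetD)
      thus False using deter[OF pp(1,2)] pp(3) by blast
    qed
  qed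
  hence cF: "card F * card K2 = card S * card ?R" using cE by (simp add: sum_distrib_right)
  obtain \<phi>0 where p0: "\<phi>0 \<in> S" using False by blast
  have "card (E \<phi>0) \<noteq> 0" using cE[OF p0] card_sub_pos[OF left_rad_sub] by (intro notI) simp
  then obtain \<psi>0 where q0: "\<psi>0 \<in> E \<phi>0" by fastforce
  have "\<exists>j>0. coprime j (card (carrier G)) \<and> (\<forall>y\<in>carrier G. thetaK \<psi> y = thetaK (\<lambda>x. \<psi>0 x ^ j) y)" if psi: "\<psi> \<in> F" for \<psi>
  proof -
    obtain \<phi> where p: "\<phi> \<in> S" "\<psi> \<in> E \<phi>" using psi by (auto simp: F_def)
    show ?thesis
    proof (rule conjugate_exts[OF Sc[OF p0] _ _ Sc[OF p(1)]])
      show "\<psi>0 \<in> lin G (isot \<phi>0) {}" "\<psi> \<in> lin G (isot \<phi>) {}" "card (isot \<phi>0) = card (isot \<phi>)"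
        using q0 p S(2) p0 by (auto simp: E_def)
    qed (use EK2 q0 p in auto)
  qed
  then obtain J where J: "\<And>\<psi>. \<psi> \<in> F \<Longrightarrow> J \<psi> > 0" "\<And>\<psi>. \<psi> \<in> F \<Longrightarrow> coprime (J \<psi>) (card (carrier G))"
    "\<And>\<psi> y. \<psi> \<in> F \<Longrightarrow> y \<in> carrier G \<Longrightarrow> thetaK \<psi> y = thetaK (\<lambda>x. \<psi>0 x ^ J \<psi>) y" by metis
  have gR: "gconj G k y \<in> ?R" if "k \<in> K" "y \<in> ?R" for k y
  proof -
    have yK: "y \<in> K" using that left_rad_K by auto
    have "gconj G k y = gcomm G k y \<otimes> y" using that yK by (simp add: gconj_gcomm)
    moreover have "gcomm G k y \<in> ?R" using K2_left_rad gcomm_K2[OF that(1) yK] by blast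
    ultimately show ?thesis using that left_rad_sub by (simp add: subgroup.m_closed)
  qed
  have "card F \<le> totient e"
  proof (rule card_le_totient)
    show "e > 1" unfolding e by (rule one_less_power) (use e in auto)
    fix \<psi> assume "\<psi> \<in> F" thus "coprime (J \<psi>) e" unfolding e using coprime_pow2[OF J(2)] by blast
  next
    fix \<psi> \<psi>' assume pp: "\<psi> \<in> F" "\<psi>' \<in> F" and jj: "J \<psi> mod e = J \<psi>' mod e"
    obtain \<phi> \<phi>' where p: "\<phi> \<in> S" "\<psi> \<in> E \<phi>" "\<phi>' \<in> S" "\<psi>' \<in> E \<phi>'" using pp by (auto simp: F_def)
    have l: "\<psi> \<in> lin G ?R {}" "\<psi>' \<in> lin G ?R {}" "\<psi>0 \<in> lin G ?R {}" using p q0 by (auto simp: E_def)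
    have "\<psi>0 y ^ J \<psi> = \<psi>0 y ^ J \<psi>'" for y
    proof (cases "y \<in> ?R")
      case True
      thus ?thesis using power_mod_eq[OF ex[OF p0 l(3) EK2[OF q0] True] jj] by blast
    next
      case False
      thus ?thesis using lin_outside[OF l(3) False] J(1)[OF pp(1)] J(1)[OF pp(2)] by (simp add: zero_power)
    qed
    hence te: "thetaK \<psi> y = thetaK \<psi>' y" if "y \<in> carrier G" for y
      using J(3)[OF pp(1) that] J(3)[OF pp(2) that] by simp
    let ?t = "\<lambda>\<psi> k y. if y \<in> ?R then \<psi> (gconj G k y) else 0"
    have tl: "?t \<chi> k \<in> lin G ?R {}" if ch: "\<chi> \<in> lin G ?R {}" and k: "k \<in> K" for \<chi> k
      unfolding lin_def
    proof (intro CollectI conjI allI ballI impI)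
      fix x y assume xy: "x \<in> ?R" "y \<in> ?R"
      have "gconj G k (x \<otimes> y) = gconj G k x \<otimes> gconj G k y" using xy k left_rad_K by (intro gconj_mult) auto
      thus "?t \<chi> k (x \<otimes> y) = ?t \<chi> k x * ?t \<chi> k y"
        using xy lin_mult[OF ch gR[OF k xy(1)] gR[OF k xy(2)]] left_rad_sub by (simp add: subgroup.m_closed)
    qed (use gR[OF k] lin_nonzero[OF ch] in auto)
    \<comment> \<open>Equal \<open>K\<close>-parts make \<open>\<psi>'\<close> a conjugate of
      \<open>\<psi>\<close> by some \<open>k\<close> in \<open>K\<close>. On
      \<open>right_rad\<close> this conjugation is invisible, so \<open>\<phi> = \<phi>'\<close>.
      Hence \<open>k\<close> stabilizes \<open>mu \<phi>\<close>, lies in \<open>left_rad\<close>,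
      and does not change \<open>\<psi>\<close> at all.\<close>
    have "\<exists>k\<in>K. ?t \<psi> k = ?t \<psi>' \<one>"
    proof (rule lin_sums_match[OF left_rad_sub finite_sub[OF left_rad_sub] finite_sub[OF K_sub] finite_sub[OF K_sub]])
      fix y assume y: "y \<in> ?R"
      thus "(\<Sum>k\<in>K. ?t \<psi> k y) = (\<Sum>k\<in>K. ?t \<psi>' k y)"
        using te[of y] left_rad_K unfolding thetaK_def by auto
    qed (use tl l K_sub in \<open>auto simp: subgroup.one_closed\<close>)
    then obtain k where k: "k \<in> K" "?t \<psi> k = ?t \<psi>' \<one>" by blast
    have v: "\<psi> (gconj G k y) = \<psi>' y" if "y \<in> ?R" for y
      using fun_cong[OF k(2), of y] that left_rad_K by auto
    have K2v: "mu \<phi> (gconj G k n) = mu \<phi>' n" if n: "n \<in> K2" for n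
      using v[of n] n K2_left_rad EK2[OF p(2) gconj_K2[OF K_car[OF k(1)] n]] EK2[OF p(4) n] by auto
    have "\<phi> = \<phi>'"
    proof (rule deter[OF p(1,3)])
      fix y assume y: "y \<in> right_rad"
      hence yK: "y \<in> K2" using right_rad_K2 by auto
      show "mu \<phi> y = mu \<phi>' y" using K2v[OF yK] mu_gconj[OF Sc[OF p(1)] k(1) yK] y k by (simp add: right_rad_def)
    qed
    hence "k \<in> stabK (mu \<phi>)" using K2v k by (simp add: stabK_def)
    hence kR: "k \<in> ?R" using stabK_mu[OF Sc[OF p(1)]] by simp
    show "\<psi> = \<psi>'"
    proof (rule lin_eqI[OF l(1,2)])
      fix y assume y: "y \<in> ?R"
      show "\<psi> y = \<psi>' y" using v[OF y] lin_gconj[OF left_rad_sub l(1) kR, of y] y left_rad_K by auto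
    qed
  qed
  hence "card F * card K2 \<le> totient e * card K2" by simp
  thus ?thesis using cF by simp
qed simp

lemma left_rad_index: "\<exists>c. card left_rad = 2 ^ c * card K2"
  using intermediate_index[OF left_rad_sub K2_left_rad left_rad_K] unfolding q_eq_2 .

lemma central_ext_ge: assumes c: "card left_rad = 2 ^ c * card K2" shows "2 ^ c \<le> card central_ext"
proof -
  have "2 ^ c * (card K2 * card K3) \<le> card central_ext * (card K2 * card K3)"
    using rad_duality unfolding c card_central_ext[symmetric] by (simp add: mult_ac)
  moreover have "card K2 * card K3 > 0" using card_sub_pos[OF K2_sub] card_sub_pos[OF K3_sub] by simp
  ultimately show ?thesis by (meson mult_le_cancel2)
qed

lemma ext_pow8:
  assumes p: "\<phi> \<in> central_ext" "\<psi> \<in> lin G left_rad {}" "\<And>n. n \<in> K2 \<Longrightarrow> \<psi> n = mu \<phi> n" and x: "x \<in> left_rad"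
  shows "\<psi> x ^ (2 ^ 3) = 1"
proof -
  have x2: "x [^] (2::nat) \<in> K2" using square_K x left_rad_K by auto
  have "\<psi> x ^ 2 = mu \<phi> (x [^] (2::nat))" using lin_pow[OF left_rad_sub p(2) x, of 2] p(3)[OF x2] by simp
  hence "(\<psi> x ^ 2) ^ 4 = 1" using mu_pow4[OF p(1) x2] by simp
  thus ?thesis by (simp add: power_mult[symmetric])
qed

text \<open>Let the index be \<open>2 ^ c\<close> with \<open>c \<ge> 2\<close>; then
  \<open>central_ext\<close> has at least \<open>2 ^ c\<close> members. Sort them by
  \<open>|isot \<phi> : K2| = 2 ^ i\<close>, where \<open>1 \<le> i \<le> c\<close>. Each class has
  at most 2 members, and the top class at most 1 because \<open>totient 8 = 4 \<le> 2 ^ c\<close>.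
  So \<open>2 ^ c \<le> 2 * c - 1\<close>, which is impossible.\<close>

lemma left_rad_card: "card left_rad \<le> 2 * card K2"
proof (rule ccontr)
  assume big: "\<not> ?thesis"
  obtain c where c: "card left_rad = 2 ^ c * card K2" using left_rad_index by blast
  have "c \<noteq> 0" using big c by (intro notI) simp
  moreover have "c \<noteq> 1" using big c by (intro notI) simp
  ultimately have c2: "c \<ge> 2" by simp
  define S where "S i = {\<phi>\<in>central_ext. card (isot \<phi>) = 2 ^ i * card K2}" for i
  have fin: "finite central_ext" unfolding central_ext_def using finite_lin[OF right_rad_sub finite_sub[OF right_rad_sub]] by simp
  have K2p: "card K2 > 0" by (rule card_sub_pos[OF K2_sub])
  have ne: "left_rad \<noteq> K2" using big by auto
  have cov: "central_ext \<subseteq> (\<Union>i\<in>{1..c}. S i)"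
  proof
    fix \<phi> assume p: "\<phi> \<in> central_ext"
    obtain i where i: "card (isot \<phi>) = 2 ^ i * card K2"
      using intermediate_index[OF isot(2,3,5)[OF p]] unfolding q_eq_2 by blast
    have "i \<noteq> 0"
    proof
      assume "i = 0"
      hence "K2 = isot \<phi>" using i isot(3)[OF p] finite_sub[OF isot(2)[OF p]] by (intro card_subset_eq) auto
      thus False using isot(7)[OF p ne] by simp
    qed
    moreover have "2 ^ i * card K2 \<le> 2 ^ c * card K2"
      using card_mono[OF finite_sub[OF left_rad_sub] isot(4)[OF p]] i c by simp
    hence "i \<le> c" using K2p by simp
    ultimately show "\<phi> \<in> (\<Union>i\<in>{1..c}. S i)" using p i by (auto simp: S_def)
  qed
  have Sle: "card (S i) \<le> 2" for i by (rule class_bound) (auto simp: S_def)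
  have full: "isot \<phi> = left_rad" if "\<phi> \<in> S c" for \<phi>
    using that c isot(4)[of \<phi>] finite_sub[OF left_rad_sub] by (intro card_subset_eq) (auto simp: S_def)
  have "card (S c) * card left_rad \<le> totient (2 ^ 3) * card K2"
  proof (rule full_class_bound[OF _ full, where i=3])
    fix \<phi> \<psi> x assume "\<phi> \<in> S c" "\<psi> \<in> lin G left_rad {}" "\<And>n. n \<in> K2 \<Longrightarrow> \<psi> n = mu \<phi> n" "x \<in> left_rad"
    thus "\<psi> x ^ 2 ^ 3 = 1" using ext_pow8[of \<phi> \<psi> x] by (simp add: S_def)
  qed (auto simp: S_def)
  also have "totient (2 ^ 3) = 4" using totient_prime_power_Suc[of 2 2] by simp
  finally have "card (S c) * 2 ^ c \<le> 4" using K2p unfolding c by (simp add: mult.assoc[symmetric])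
  moreover have "(4::nat) \<le> 2 ^ c" using power_increasing[OF c2, of "2::nat"] by simp
  hence "card (S c) * 4 \<le> card (S c) * 2 ^ c" by simp
  ultimately have Sc: "card (S c) \<le> 1" by linarith
  have "card central_ext \<le> card (\<Union>i\<in>{1..c}. S i)" by (rule card_mono[OF _ cov]) (use fin in \<open>auto simp: S_def\<close>)
  also have "\<dots> \<le> (\<Sum>i\<in>{1..c}. card (S i))" by (rule card_UN_le) simp
  also have "\<dots> = card (S c) + (\<Sum>i\<in>{1..c} - {c}. card (S i))" using c2 by (intro sum.remove) auto
  also have "\<dots> \<le> 1 + (\<Sum>i\<in>{1..c} - {c}. 2)" using Sc Sle by (intro add_mono sum_mono)
  also have "\<dots> = 1 + 2 * (c - 1)" using c2 by simp
  finally have "2 ^ c \<le> 1 + 2 * (c - 1)" using central_ext_ge[OF c] by simp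
  moreover have "2 * k < 2 ^ k + (1::nat)" if "k \<ge> 1" for k :: nat using that by (induction k rule: dec_induct) auto
  from this[of c] have "1 + 2 * (c - 1) < 2 ^ c" using c2 by simp
  ultimately show False by simp
qed

text \<open>If the value were 1, the extensions to \<open>left_rad\<close>, which is generated by
  \<open>K2\<close> and \<open>x\<close>, would have order dividing 4 instead of 8. Every
  \<open>isot \<phi>\<close> equals \<open>left_rad\<close>, of index 2 over \<open>K2\<close>, so
  \<open>totient 4 = 2\<close> leaves room for one member of \<open>central_ext\<close>, which has
  at least two.\<close>

lemma left_rad_pow4:
  assumes x: "x \<in> left_rad" "x \<notin> K2" shows "\<nu> (x [^] (4::nat)) \<noteq> 1"
proof
  assume a: "\<nu> (x [^] (4::nat)) = 1"
  have xK: "x \<in> K" using x left_rad_K by auto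
  obtain c where c: "card left_rad = 2 ^ c * card K2" using left_rad_index by blast
  have K2p: "card K2 > 0" by (rule card_sub_pos[OF K2_sub])
  have ge: "card left_rad \<le> card T" if T: "subgroup T G" "K2 \<subseteq> T" "T \<noteq> K2" "T \<subseteq> K" for T
  proof -
    obtain t where t: "card T = 2 ^ t * card K2" using intermediate_index[OF T(1,2,4)] unfolding q_eq_2 by blast
    have "card K2 < card T" using T finite_sub[OF T(1)] by (intro psubset_card_mono) auto
    hence "t \<noteq> 0" using t by (intro notI) simp
    hence "(2::nat) \<le> 2 ^ t" by (simp add: self_le_power)
    hence "2 * card K2 \<le> card T" using t by simp
    thus ?thesis using left_rad_card by linarith
  qed
  have ne: "left_rad \<noteq> K2" using x by auto
  have "card K2 < card left_rad" using x K2_left_rad finite_sub[OF left_rad_sub] by (intro psubset_card_mono) auto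
  hence "c \<noteq> 0" using c by (intro notI) simp
  hence c1: "(2::nat) \<le> 2 ^ c" by (simp add: self_le_power)
  have full: "isot \<phi> = left_rad" if p: "\<phi> \<in> central_ext" for \<phi>
    by (rule card_seteq[OF finite_sub[OF left_rad_sub] isot(4)[OF p]])
      (rule ge[OF isot(2,3)[OF p] isot(7)[OF p ne] isot(5)[OF p]])
  have "card central_ext * card left_rad \<le> totient (2 ^ 2) * card K2"
  proof (rule full_class_bound[OF order_refl full, where i=2])
    fix \<phi> \<psi> y assume p: "\<phi> \<in> central_ext" "\<psi> \<in> lin G left_rad {}" "\<And>n. n \<in> K2 \<Longrightarrow> \<psi> n = mu \<phi> n" and y: "y \<in> left_rad"
    define T where "T = {y\<in>left_rad. \<psi> y ^ 4 = 1}"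
    have T: "subgroup T G"
    proof (rule finite_submonoid_imp_subgroup[OF finG])
      show "T \<subseteq> carrier G" using left_rad_K by (auto simp: T_def)
    qed (use lin_one[OF left_rad_sub p(2)] lin_mult[OF p(2)] left_rad_sub in
        \<open>auto simp: T_def subgroup.one_closed subgroup.m_closed power_mult_distrib\<close>)
    have K2T: "K2 \<subseteq> T" using K2_left_rad p(3) mu_pow4[OF p(1)] by (auto simp: T_def)
    have x2: "x [^] (2::nat) \<in> K2" by (rule square_K[OF xK])
    have x4: "x [^] (4::nat) \<in> K3" using square_K2[OF x2] xK by (simp add: nat_pow_pow)
    have "\<psi> x ^ 4 = 1" using lin_pow[OF left_rad_sub p(2) x(1), of 4] p(3)[OF K3_K2D[OF x4]] mu(3)[OF p(1) x4] a by simp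
    hence "T \<noteq> K2" using x by (auto simp: T_def)
    moreover have TR: "T \<subseteq> left_rad" by (auto simp: T_def)
    ultimately have "card left_rad \<le> card T" using ge[OF T K2T] left_rad_K by blast
    hence "T = left_rad" by (rule card_seteq[OF finite_sub[OF left_rad_sub] TR])
    thus "\<psi> y ^ 2 ^ 2 = 1" using y by (auto simp: T_def)
  qed auto
  also have "totient (2 ^ 2) = 2" using totient_prime_power_Suc[of 2 1] by simp
  finally have "card central_ext * 2 ^ c \<le> 2" using K2p unfolding c by (simp add: mult.assoc[symmetric])
  moreover have "2 * 2 \<le> card central_ext * 2 ^ c" using c1 central_ext_ge[OF c] by (intro mult_le_mono) auto
  ultimately show False by simp
qed

end

end

section \<open>Squaring maps and the triviality of the third term\<close>

context frobenius_GC_nonabelian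
begin

lemma gcomm_square_self: "x \<in> carrier G \<Longrightarrow> gcomm G x (x [^] (2::nat)) = \<one>"
  by (simp add: gcomm_one_iff numeral_2_eq_2 m_assoc)

text \<open>\<open>L\<close> is transitive on the nontrivial cosets of \<open>K3\<close> in
  \<open>K2\<close>, and one of them contains the square of an element outside \<open>K2\<close>;
  conjugates of that element reach the other cosets.\<close>

lemma orbit_square:
  assumes y: "y \<in> K2" "y \<notin> K3"
  shows "\<exists>x\<in>K. x \<notin> K2 \<and> (\<exists>d\<in>K3. y = x [^] (2::nat) \<otimes> d)"
proof -
  obtain x0 where x0: "x0 \<in> K" "x0 \<notin> K2" using derived_psubset[OF K_sub K_nontrivial] by blast
  have s: "x0 [^] (2::nat) \<in> K2" "x0 [^] (2::nat) \<notin> K3" using square_K[OF x0(1)] power_notin_K3[OF x0] by (auto simp: q_eq_2)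
  have "(card L + 1) * card K3 = card K2" using card_L card_K2 q_eq_2 by simp
  then obtain l d where ld: "l \<in> L" "d \<in> K3" "y = gconj G l (x0 [^] (2::nat)) \<otimes> d"
    using L_orbit_surj[OF K2_normal K2_K K3_normal psubset_imp_subset[OF K3_psubset] s _ y] by blast
  have "y = (gconj G l x0) [^] (2::nat) \<otimes> d" using ld x0 by (simp add: gconj_pow)
  moreover have "gconj G l x0 \<in> K" "gconj G l x0 \<notin> K2"
    using ld x0 normal_gconj_iff[OF K2_normal, of l x0] by auto
  ultimately show ?thesis using ld(2) by blast
qed

lemma K2_square_coset:
  assumes y: "y \<in> K2" and z: "z \<in> K2"
  shows "K4 #> ((y \<otimes> z) [^] (2::nat)) = K4 #> (y [^] (2::nat) \<otimes> z [^] (2::nat))"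
proof (rule pow_coset[OF K4_normal subset_trans[OF K4_K3 K3_K] K2_KD[OF y] K2_KD[OF z]])
  have c: "gcomm G z y \<in> K4" by (rule gcomm_K4[OF z y])
  hence cc: "gcomm G z y \<in> carrier G" using K4_sub by (simp add: subgroup.mem_carrier)
  fix k assume k: "k \<in> K"
  have "gcomm G (gcomm G z y) k = gcomm G z y \<otimes> gconj G k (inv (gcomm G z y))"
    using cc k by (simp add: gcomm_def[of G "gcomm G z y" k] gconj_def m_assoc)
  thus "gcomm G (gcomm G z y) k \<in> K4"
    using c k K4_sub normal_gconj[OF K4_normal] by (simp add: subgroup.m_closed subgroup.m_inv_closed)
next
  show "gcomm G z y [^] (2 * (2 - 1) div 2 :: nat) \<in> K4" using gcomm_K4[OF z y] y z by simp
qed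

text \<open>Here \<open>k\<close> is squaring from \<open>K\<close> to \<open>K2\<close>: every
  \<open>x\<close> commutes with its square, and \<open>left_rad_pow4\<close> keeps fourth powers
  away from commutators. Squaring on \<open>K2\<close> is multiplicative modulo \<open>K4\<close>
  because the commutators of \<open>K2\<close> lie there, so \<open>q = 2\<close> is no
  obstacle.\<close>

lemma K3_trivial: "K3 = {\<one>}"
proof (rule ccontr)
  assume "K3 \<noteq> {\<one>}"
  hence K43: "K4 \<subset> K3" by (rule commK_psubset[OF K3_normal K3_K])
  obtain m where m: "card K3 = q ^ m * card K4" using commK_index[OF K2_normal K2_K] by blast
  have "(card L + 1) * card K4 \<le> card K3" by (rule card_L_bound[OF K3_normal K3_K K4_normal K43])
  hence "2 ^ rank * card K4 \<le> 2 ^ m * card K4" unfolding card_L m q_eq_2 .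
  hence "(2::nat) ^ rank \<le> 2 ^ m" using card_sub_pos[OF K4_sub] by (simp only: mult_le_cancel2)
  hence nm: "rank \<le> m" by simp
  have K4one: "\<one> \<in> K4" by (rule subgroup.one_closed[OF K4_sub])
  have rd: "card {x\<in>K. \<forall>y\<in>K2. \<nu> (gcomm G x y) = 1} \<le> q * card K2"
    if "\<nu> \<in> lin G K3 K4" "w \<in> K3" "\<nu> w \<noteq> 1" for \<nu> w
    using left_rad_card[OF that] unfolding left_rad_def[OF that] q_eq_2 .
  have ker: "\<exists>y\<in>K2. y \<notin> K3 \<and> gcomm G x y \<in> K4" if x: "x \<in> K" "x \<notin> K2" for x
    using square_K[OF x(1)] power_notin_K3[OF x] gcomm_square_self[OF K_car[OF x(1)]] K4one unfolding q_eq_2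
    by (intro bexI[of _ "x [^] (2::nat)"]) auto
  \<comment> \<open>A character annihilating the commutators of \<open>x\<close> with
    \<open>K2\<close> has \<open>x\<close> in its left radical, so it separates
    \<open>x [^] 4\<close> from all of them.\<close>
  have fourth: "K4 #> (x [^] (4::nat)) \<noteq> K4 #> gcomm G x y" if x: "x \<in> K" "x \<notin> K2" and y: "y \<in> K2" for x y
  proof
    assume e: "K4 #> (x [^] (4::nat)) = K4 #> gcomm G x y"
    have "\<exists>\<nu>\<in>lin G K3 K4. (\<exists>w\<in>K3. \<nu> w \<noteq> 1) \<and> (\<forall>y\<in>K2. \<nu> (gcomm G x y) = 1)"
      by (rule commutator_annihilator[OF K2_normal K2_K refl refl rank_ge nm card_K card_K2 m ker rd x])
    then obtain \<nu> where n1: "\<nu> \<in> lin G K3 K4" "\<exists>w\<in>K3. \<nu> w \<noteq> 1" and n4: "\<And>y. y \<in> K2 \<Longrightarrow> \<nu> (gcomm G x y) = 1" by auto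
    then obtain w where w: "w \<in> K3" "\<nu> w \<noteq> 1" by blast
    have xr: "x \<in> left_rad \<nu>" using x n4 unfolding left_rad_def[OF n1(1) w] by blast
    have ne: "\<nu> (x [^] (4::nat)) \<noteq> 1" by (rule left_rad_pow4[OF n1(1) w xr x(2)])
    have x4: "x [^] (4::nat) \<in> K3" using square_K2[OF square_K[OF x(1)]] x(1) by (simp add: nat_pow_pow)
    have g: "gcomm G x y \<in> K3" by (rule gcomm_K3[OF x(1) y])
    have d: "x [^] (4::nat) \<otimes> inv (gcomm G x y) \<in> K4" using rcos_eq_iff[OF K4_sub] e x y by simp
    have "\<nu> (x [^] (4::nat) \<otimes> inv (gcomm G x y)) = \<nu> (x [^] (4::nat))"
      using lin_mult[OF n1(1) x4, of "inv (gcomm G x y)"] lin_inv[OF K3_sub n1(1) g] n4[OF y] g K3_sub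
      by (simp add: subgroup.m_inv_closed)
    thus False using ne lin_trivial_on[OF n1(1) d] by simp
  qed
  show False
  proof (rule no_commutator_pairing[OF K2_normal K2_K refl refl rank_ge nm card_K card_K2 m rd,
        where k="\<lambda>x. x [^] (2::nat)"])
    fix y assume y: "y \<in> K2"
    show "y [^] q \<in> K3" unfolding q_eq_2 by (rule square_K2[OF y])
    show "\<exists>x\<in>K. x \<notin> K2 \<and> gcomm G x y \<in> K4"
    proof (cases "y \<in> K3")
      case True
      obtain x0 where "x0 \<in> K" "x0 \<notin> K2" using derived_psubset[OF K_sub K_nontrivial] by blast
      thus ?thesis using commK_incl[OF _ True] by blast
    next
      case False
      obtain x d where x: "x \<in> K" "x \<notin> K2" "d \<in> K3" "y = x [^] (2::nat) \<otimes> d" using orbit_square[OF y False] by blast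
      have dc: "d \<in> carrier G" using x K3_sub by (simp add: subgroup.mem_carrier)
      \<comment> \<open>Since \<open>x\<close> commutes with its square, only the factor
        \<open>d\<close> in \<open>K3\<close> contributes, and its commutator lies in
        \<open>K4\<close>.\<close>
      have "gcomm G x y = gconj G (x [^] (2::nat)) (gcomm G x d)"
        unfolding x(4) using x dc gcomm_square_self[of x] by (simp add: gcomm_mult_right)
      thus ?thesis using x commK_incl[OF x(1,3)] normal_gconj[OF K4_normal, of "x [^] (2::nat)"] by (intro bexI[of _ x]) auto
    qed
    show "y [^] q \<notin> K4" if "y \<notin> K3"
    proof
      assume a: "y [^] q \<in> K4"
      obtain x d where x: "x \<in> K" "x \<notin> K2" "d \<in> K3" "y = x [^] (2::nat) \<otimes> d" using orbit_square[OF y \<open>y \<notin> K3\<close>] by blast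
      have dc: "d \<in> carrier G" using x K3_sub by (simp add: subgroup.mem_carrier)
      have d2: "d [^] (2::nat) \<in> K4" by (rule square_K3[OF x(3)])
      have "K4 #> (y [^] (2::nat)) = K4 #> ((x [^] (2::nat)) [^] (2::nat) \<otimes> d [^] (2::nat))"
        unfolding x(4) by (rule K2_square_coset[OF square_K[OF x(1)] K3_K2D[OF x(3)]])
      hence "K4 = K4 #> (x [^] (4::nat) \<otimes> d [^] (2::nat))"
        using rcos_eq_self_iff[OF K4_sub, of "y [^] (2::nat)"] a y x(1) unfolding q_eq_2 by (simp add: nat_pow_pow)
      hence "x [^] (4::nat) \<otimes> d [^] (2::nat) \<in> K4" using rcos_eq_self_iff[OF K4_sub, of "x [^] (4::nat) \<otimes> d [^] (2::nat)"] x dc by simp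
      hence "(x [^] (4::nat) \<otimes> d [^] (2::nat)) \<otimes> inv (d [^] (2::nat)) \<in> K4" using d2 K4_sub
        by (simp add: subgroup.m_closed subgroup.m_inv_closed)
      hence "x [^] (4::nat) \<in> K4" using x dc by (simp add: m_assoc)
      \<comment> \<open>Membership in \<open>K4\<close> would make \<open>x [^] 4\<close> congruent
        to the commutator of \<open>x\<close> with \<open>\<one>\<close>.\<close>
      hence "K4 #> (x [^] (4::nat)) = K4 #> gcomm G x \<one>"
        using rcos_eq_iff[OF K4_sub, of "x [^] (4::nat)" \<one>] x by (simp add: gcomm_def)
      thus False using fourth[OF x(1,2) subgroup.one_closed[OF K2_sub]] by simp
    qed
    fix z assume z: "z \<in> K2"
    show "K4 #> ((y \<otimes> z) [^] q) = K4 #> (y [^] q \<otimes> z [^] q)" unfolding q_eq_2 by (rule K2_square_coset[OF y z])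
  next
    fix x assume x: "x \<in> K" "x \<notin> K2"
    show "x [^] (2::nat) \<in> K2 \<and> x [^] (2::nat) \<notin> K3 \<and> gcomm G x (x [^] (2::nat)) \<in> K4 \<and>
        (\<forall>y\<in>K2. K4 #> ((x [^] (2::nat)) [^] q) \<noteq> K4 #> gcomm G x y)"
      using square_K[OF x(1)] power_notin_K3[OF x] gcomm_square_self[OF K_car[OF x(1)]] K4one fourth[OF x] x(1)
      unfolding q_eq_2 by (simp add: nat_pow_pow)
  qed
qed

end

subsection \<open>The complement is cyclic\<close>

context group
begin

lemma pow_mod_eq:
  assumes "x \<in> carrier G" "x [^] (p::nat) = \<one>" shows "x [^] j = x [^] (j mod p)"
proof -
  have "x [^] j = x [^] (p * (j div p)) \<otimes> x [^] (j mod p)" using assms(1) by (simp add: nat_pow_mult)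
  thus ?thesis using assms by (simp add: nat_pow_pow[symmetric])
qed

text \<open>Write \<open>d = p * d'\<close>. The \<open>p\<close>-th power map sends roots for
  \<open>d\<close> to roots for \<open>d'\<close>, and each fibre lies in a coset of the solutions
  of \<open>y [^] p = \<one>\<close>, of which there are at most \<open>p\<close> by
  \<open>uniq\<close>.\<close>

lemma card_roots_le:
  assumes fin: "finite (carrier G)" and comm: "\<And>x y. x \<in> carrier G \<Longrightarrow> y \<in> carrier G \<Longrightarrow> x \<otimes> y = y \<otimes> x"
    and uniq: "\<And>p x y. Factorial_Ring.prime (p::nat) \<Longrightarrow> x \<in> carrier G \<Longrightarrow> y \<in> carrier G \<Longrightarrow> x [^] p = \<one> \<Longrightarrow>
       y [^] p = \<one> \<Longrightarrow> x \<noteq> \<one> \<Longrightarrow> x \<otimes> y = y \<otimes> x \<Longrightarrow> \<exists>j::nat. y = x [^] j"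
  shows "d > 0 \<Longrightarrow> card {x\<in>carrier G. x [^] (d::nat) = \<one>} \<le> d"
proof (induction d rule: less_induct)
  case (less d)
  show ?case
  proof (cases "d = 1")
    case True
    have "{x\<in>carrier G. x [^] (1::nat) = \<one>} = {\<one>}" by auto
    thus ?thesis using True by simp
  next
    case False
    then obtain p where p: "Factorial_Ring.prime p" "p dvd d" using prime_factor_nat by blast
    then obtain d' where d: "d = p * d'" by (auto elim: dvdE)
    have p1: "p > 1" using prime_gt_1_nat[OF p(1)] .
    have d': "d' > 0" "d' < d" using less.prems d p1 by (auto intro: gr0I)
    let ?A = "{x\<in>carrier G. x [^] d = \<one>}" and ?f = "\<lambda>x. x [^] p"
    have roots: "card {y\<in>carrier G. y [^] p = \<one>} \<le> p"
    proof (cases "\<exists>x\<in>carrier G. x [^] p = \<one> \<and> x \<noteq> \<one>")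
      case False
      hence "{y\<in>carrier G. y [^] p = \<one>} \<subseteq> {\<one>}" by blast
      hence "card {y\<in>carrier G. y [^] p = \<one>} \<le> card {\<one>}" by (intro card_mono) auto
      thus ?thesis using p1 by simp
    next
      case True
      then obtain x where x: "x \<in> carrier G" "x [^] p = \<one>" "x \<noteq> \<one>" by blast
      have "{y\<in>carrier G. y [^] p = \<one>} \<subseteq> (\<lambda>j. x [^] j) ` {..<p}"
      proof
        fix y assume "y \<in> {y\<in>carrier G. y [^] p = \<one>}"
        then obtain j :: nat where "y = x [^] j" using uniq[OF p(1) x(1) _ x(2) _ x(3)] comm x(1) by blast
        hence "y = x [^] (j mod p)" using pow_mod_eq[OF x(1,2)] by simp
        thus "y \<in> (\<lambda>j. x [^] j) ` {..<p}" using p1 by (intro image_eqI[of _ _ "j mod p"]) auto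
      qed
      hence "card {y\<in>carrier G. y [^] p = \<one>} \<le> card {..<p}" by (meson finite_lessThan surj_card_le)
      thus ?thesis by simp
    qed
    have finA: "finite ?A" using fin by simp
    have "card ?A \<le> p * card (?f ` ?A)"
    proof (rule card_fibers_le[OF finA])
      fix b assume "b \<in> ?f ` ?A"
      then obtain x where x: "x \<in> carrier G" "b = x [^] p" by blast
      have "{a\<in>?A. a [^] p = b} \<subseteq> (\<lambda>y. x \<otimes> y) ` {y\<in>carrier G. y [^] p = \<one>}"
      proof
        fix a assume "a \<in> {a\<in>?A. a [^] p = b}"
        hence a: "a \<in> carrier G" "a [^] p = x [^] p" using x by auto
        have "(inv x \<otimes> a) [^] p = inv x [^] p \<otimes> a [^] p" using pow_mult_distrib[OF comm, of "inv x" a p] x a by simp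
        also have "\<dots> = \<one>" using a x by (simp add: nat_pow_inv)
        finally have "(inv x \<otimes> a) [^] p = \<one>" .
        moreover have "a = x \<otimes> (inv x \<otimes> a)" using a x by (simp add: cancel_inv_left)
        ultimately show "a \<in> (\<lambda>y. x \<otimes> y) ` {y\<in>carrier G. y [^] p = \<one>}" using a x by blast
      qed
      hence "card {a\<in>?A. a [^] p = b} \<le> card {y\<in>carrier G. y [^] p = \<one>}" using fin by (intro surj_card_le) auto
      thus "card {a\<in>?A. a [^] p = b} \<le> p" using roots by linarith
    qed
    also have "card (?f ` ?A) \<le> card {x\<in>carrier G. x [^] d' = \<one>}"
      using fin by (intro card_mono) (auto simp: d nat_pow_pow)
    also have "\<dots> \<le> d'" by (rule less.IH[OF d'(2,1)])
    finally show ?thesis using d by simp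
  qed
qed

text \<open>The counting argument of Gauss: an element of order \<open>d\<close> already supplies
  all solutions of \<open>x [^] d = \<one>\<close>, so at most \<open>phi' d\<close> elements have
  order \<open>d\<close>. These bounds add up to the group order, hence an element of full order
  must occur.\<close>

lemma cyclic_of_root_bound:
  assumes fin: "finite (carrier G)" and bnd: "\<And>d::nat. d > 0 \<Longrightarrow> card {x\<in>carrier G. x [^] d = \<one>} \<le> d"
  shows "cyclic_group G"
proof -
  let ?N = "Coset.order G"
  have Np: "?N > 0" using fin by (simp add: order_gt_0_iff_finite)
  have finD: "finite {d. d dvd ?N}" using Np by simp
  have le: "card {a\<in>carrier G. ord a = d} \<le> phi' d" if d: "d dvd ?N" for d
  proof (cases "\<exists>a\<in>carrier G. ord a = d")
    case False
    hence "{a\<in>carrier G. ord a = d} = {}" by blast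
    thus ?thesis by (metis card.empty le0)
  next
    case True
    then obtain a where a: "a \<in> carrier G" "ord a = d" by blast
    have dp: "d > 0" using d Np by (intro gr0I) auto
    have ad: "a [^] d = \<one>" using pow_ord_eq_1[OF a(1)] a(2) by simp
    have inj: "inj_on (\<lambda>n. a [^] n) {1..d}" using ord_inj'[OF a(1)] a(2) by simp
    have eq: "(\<lambda>n. a [^] n) ` {1..d} = {x\<in>carrier G. x [^] d = \<one>}"
    proof (rule card_seteq)
      show "(\<lambda>n. a [^] n) ` {1..d} \<subseteq> {x\<in>carrier G. x [^] d = \<one>}"
      proof (rule image_subsetI)
        fix n :: nat
        have "(a [^] n) [^] d = (a [^] d) [^] n" using a(1) by (simp add: nat_pow_pow mult.commute)
        thus "a [^] n \<in> {x\<in>carrier G. x [^] d = \<one>}" using ad a(1) by simp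
      qed
      show "card {x\<in>carrier G. x [^] d = \<one>} \<le> card ((\<lambda>n. a [^] n) ` {1..d})"
        unfolding card_image[OF inj] using bnd[OF dp] by simp
    qed (use fin in simp)
    have "{x\<in>carrier G. ord x = d} \<subseteq> (\<lambda>n. a [^] n) ` {k. 1 \<le> k \<and> k \<le> d \<and> coprime k d}"
    proof
      fix x assume "x \<in> {x\<in>carrier G. ord x = d}"
      hence x: "x \<in> carrier G" "ord x = d" by auto
      have "x \<in> {x\<in>carrier G. x [^] d = \<one>}" using pow_ord_eq_1[OF x(1)] x by simp
      hence "x \<in> (\<lambda>n. a [^] n) ` {1..d}" unfolding eq .
      then obtain k where k: "k \<in> {1..d}" "x = a [^] k" by blast
      have "coprime k d" using pow_ord_eq_ord_iff[OF fin a(1), of k] k x a by simp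
      thus "x \<in> (\<lambda>n. a [^] n) ` {k. 1 \<le> k \<and> k \<le> d \<and> coprime k d}" using k by auto
    qed
    moreover have "finite {k. 1 \<le> k \<and> k \<le> d \<and> coprime k d}" by (rule finite_subset[of _ "{..d}"]) auto
    ultimately show ?thesis unfolding phi'_def by (rule surj_card_le[rotated])
  qed
  have "card (carrier G) = (\<Sum>d | d dvd ?N. card {a\<in>carrier G. ord a = d})"
  proof -
    have "carrier G = (\<Union>d\<in>{d. d dvd ?N}. {a\<in>carrier G. ord a = d})" using ord_dvd_group_order by blast
    hence "card (carrier G) = card (\<Union>d\<in>{d. d dvd ?N}. {a\<in>carrier G. ord a = d})" by simp
    also have "\<dots> = (\<Sum>d | d dvd ?N. card {a\<in>carrier G. ord a = d})"
      using fin finD by (intro card_UN_disjoint) auto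
    finally show ?thesis .
  qed
  hence sumN: "(\<Sum>d | d dvd ?N. card {a\<in>carrier G. ord a = d}) = ?N" by (simp add: Coset.order_def)
  have "card {a\<in>carrier G. ord a = ?N} \<noteq> 0"
  proof
    assume z: "card {a\<in>carrier G. ord a = ?N} = 0"
    have "(\<Sum>d | d dvd ?N. card {a\<in>carrier G. ord a = d}) < (\<Sum>d | d dvd ?N. phi' d)"
    proof (rule sum_strict_mono_ex1[OF finD])
      show "\<exists>d\<in>{d. d dvd ?N}. card {a\<in>carrier G. ord a = d} < phi' d"
        using z phi'_nonzero[OF Np] by (intro bexI[of _ ?N]) auto
    qed (use le in blast)
    thus False using sumN sum_phi'_factors[OF Np] by simp
  qed
  then obtain a where a: "a \<in> carrier G" "ord a = ?N" by (metis (mono_tags, lifting) card.empty empty_Collect_eq)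
  have inj: "inj_on (\<lambda>n. a [^] n) {1..?N}" using ord_inj'[OF a(1)] a(2) by simp
  have "(\<lambda>n. a [^] n) ` {1..?N} = carrier G"
    by (rule card_seteq[OF fin]) (use a(1) card_image[OF inj] in \<open>auto simp: Coset.order_def\<close>)
  hence "carrier G \<subseteq> range (\<lambda>n::int. a [^] n)"
    by (metis image_subset_iff int_pow_int rangeI)
  hence "carrier G = range (\<lambda>n::int. a [^] n)" using a(1) by auto
  thus ?thesis using cyclic_group a(1) by blast
qed

lemma lower_central_subset: "lower_central G i \<subseteq> carrier G"
proof (induction i)
  case (Suc i)
  have "{x \<otimes> y \<otimes> inv x \<otimes> inv y |x y. x \<in> lower_central G i \<and> y \<in> carrier G} \<subseteq> carrier G" using Suc by auto
  thus ?case using generate_in_carrier by auto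
qed simp

text \<open>A non-commuting pair of \<open>p\<close>-elements \<open>x\<close>, \<open>y\<close> with central commutator of order \<open>p\<close> can be shortened: \<open>y\<close> times a
  suitable power of \<open>x\<close> has smaller order and the same commutator with \<open>x\<close>.\<close>
lemma nilpotent_odd_commutative:
  assumes fin: "finite (carrier G)" and odd: "odd (card (carrier G))" and nil: "lower_central G c = {\<one>}"
    and uniq: "\<And>p x y. Factorial_Ring.prime (p::nat) \<Longrightarrow> x \<in> carrier G \<Longrightarrow> y \<in> carrier G \<Longrightarrow> x [^] p = \<one> \<Longrightarrow>
       y [^] p = \<one> \<Longrightarrow> x \<noteq> \<one> \<Longrightarrow> x \<otimes> y = y \<otimes> x \<Longrightarrow> \<exists>j::nat. y = x [^] j"
    and ab: "x0 \<in> carrier G" "y0 \<in> carrier G"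
  shows "x0 \<otimes> y0 = y0 \<otimes> x0"
proof (rule ccontr)
  assume nc: "x0 \<otimes> y0 \<noteq> y0 \<otimes> x0"
  define cen where "cen z \<longleftrightarrow> z \<in> carrier G \<and> (\<forall>y\<in>carrier G. z \<otimes> y = y \<otimes> z)" for z
  \<comment> \<open>The term before the first central one contains a non-central element, and all
    its commutators are central.\<close>
  define i where "i = (LEAST i. \<forall>z\<in>lower_central G i. cen z)"
  have ic: "\<forall>z\<in>lower_central G i. cen z" unfolding i_def
    by (rule LeastI[of "\<lambda>i. \<forall>z\<in>lower_central G i. cen z" c]) (simp add: nil cen_def)
  have "i \<noteq> 0" using ic ab nc by (intro notI) (auto simp: cen_def)
  then obtain k where k: "i = Suc k" by (cases i) auto
  have "\<not> (\<forall>z\<in>lower_central G k. cen z)" using not_less_Least[of k "\<lambda>i. \<forall>z\<in>lower_central G i. cen z"] k by (simp add: i_def)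
  then obtain x where x: "x \<in> lower_central G k" "\<not> cen x" by blast
  have xc: "x \<in> carrier G" using x lower_central_subset by auto
  then obtain y where y: "y \<in> carrier G" "x \<otimes> y \<noteq> y \<otimes> x" using x by (auto simp: cen_def)
  have rel: "a \<otimes> b = gcomm G a b \<otimes> (b \<otimes> a)" if "a \<in> carrier G" "b \<in> carrier G" for a b
    using that by (simp add: gcomm_def grp_simps)
  define z where "z = gcomm G x y"
  have "z \<in> lower_central G i" unfolding k z_def using x y by (auto simp: gcomm_def intro!: generate.incl)
  hence z: "cen z" using ic by blast
  have z1: "z \<noteq> \<one>" using y xc gcomm_one_iff by (simp add: z_def)
  have zc: "z \<in> carrier G" using z by (simp add: cen_def)
  have zx: "x \<otimes> y = z \<otimes> (y \<otimes> x)" using rel[OF xc y(1)] unfolding z_def .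
  have cenp: "cen (z [^] j)" if "cen z" for j :: nat and z
    using that group_commutes_pow[of z _ j] by (auto simp: cen_def)
  have powl: "x [^] j \<otimes> y = z [^] j \<otimes> (y \<otimes> x [^] j)" if "x \<in> carrier G" "y \<in> carrier G" "cen z" "x \<otimes> y = z \<otimes> (y \<otimes> x)"
    for x y z and j :: nat
  proof (induction j)
    case (Suc j)
    have c: "z [^] j \<in> carrier G" "z \<in> carrier G" using that by (auto simp: cen_def)
    have zxj: "x [^] j \<otimes> z = z \<otimes> x [^] j" using that by (simp add: cen_def)
    have "x [^] Suc j \<otimes> y = x [^] j \<otimes> (x \<otimes> y)" using that by (simp add: m_assoc)
    also have "\<dots> = (x [^] j \<otimes> z) \<otimes> y \<otimes> x" unfolding that(4) using that c by (simp add: m_assoc)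
    also have "\<dots> = z \<otimes> (x [^] j \<otimes> y) \<otimes> x" unfolding zxj using that c by (simp add: m_assoc)
    also have "\<dots> = z [^] Suc j \<otimes> (y \<otimes> x [^] Suc j)" unfolding Suc using that c
      by (simp add: m_assoc[symmetric] nat_pow_Suc2[symmetric])
    finally show ?case .
  qed (use that in simp)
  have swap: "cen (inv z) \<and> y \<otimes> x = inv z \<otimes> (x \<otimes> y)" if "x \<in> carrier G" "y \<in> carrier G" "cen z" "x \<otimes> y = z \<otimes> (y \<otimes> x)" for x y z
  proof
    have c: "z \<in> carrier G" using that by (simp add: cen_def)
    show "y \<otimes> x = inv z \<otimes> (x \<otimes> y)" unfolding that(4) using that(1,2) c by (simp add: inv_cancel_left)
    show "cen (inv z)" unfolding cen_def
    proof (intro conjI ballI)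
      fix a assume a: "a \<in> carrier G"
      have "a \<otimes> inv z = inv z \<otimes> (z \<otimes> a) \<otimes> inv z" using a c by (simp add: grp_simps)
      also have "z \<otimes> a = a \<otimes> z" using that(3) a by (simp add: cen_def)
      also have "inv z \<otimes> (a \<otimes> z) \<otimes> inv z = inv z \<otimes> a" using a c by (simp add: grp_simps)
      finally show "inv z \<otimes> a = a \<otimes> inv z" by simp
    qed (use c in simp)
  qed
  \<comment> \<open>A non-commuting pair of \<open>p\<close>-elements with central commutator
    \<open>z\<close> of order \<open>p\<close>; the exponents \<open>a\<close> and \<open>b\<close>
    bound the orders, and their sum is to be minimized.\<close>
  define Q where "Q p a b x y z \<longleftrightarrow> x \<in> carrier G \<and> y \<in> carrier G \<and> cen z \<and> x \<otimes> y = z \<otimes> (y \<otimes> x) \<and> z \<noteq> \<one> \<and>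
     z [^] (p::nat) = \<one> \<and> x [^] (p ^ a) = \<one> \<and> y [^] (p ^ b) = \<one>" for p and a b :: nat and x y z
  have Qswap: "Q p b a y x (inv z)" if "Q p a b x y z" for p a b x y z
  proof -
    have c: "z \<in> carrier G" using that by (simp add: Q_def cen_def)
    have h: "x \<in> carrier G" "y \<in> carrier G" "cen z" "x \<otimes> y = z \<otimes> (y \<otimes> x)" "z \<noteq> \<one>" "z [^] p = \<one>"
      "x [^] (p ^ a) = \<one>" "y [^] (p ^ b) = \<one>" using that unfolding Q_def by blast+
    note sw = swap[OF h(1-4)]
    have "inv z \<noteq> \<one>" "inv z [^] p = \<one>" using c h(5,6) by (simp_all add: nat_pow_inv)
    thus ?thesis unfolding Q_def using sw h(1,2,7,8) by blast
  qed
  \<comment> \<open>Powers of \<open>x\<close> give powers of the commutator, so the exponent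
    \<open>ord z div p\<close> leaves a commutator of order \<open>p\<close>. The exponent
    \<open>m\<close>, prime to \<open>p\<close>, then turns both elements into
    \<open>p\<close>-elements without killing it.\<close>
  define o' where "o' = ord z"
  have "o' \<noteq> 1" using ord_eq_1[OF zc] z1 by (simp add: o'_def)
  then obtain p where p: "Factorial_Ring.prime p" "p dvd o'" using prime_factor_nat by blast
  then obtain r where r: "o' = p * r" by (auto elim: dvdE)
  have p1: "p > 1" using prime_gt_1_nat[OF p(1)] .
  have op: "o' > 0" unfolding o'_def using ord_ge_1[OF fin zc] by simp
  have pN: "p dvd card (carrier G)" using p(2) ord_dvd_group_order[OF zc] by (auto simp: o'_def Coset.order_def)
  have podd: "odd p" using odd pN by auto
  define z2 where "z2 = z [^] r"
  have z2p: "z2 [^] p = \<one>" using pow_ord_eq_1[OF zc] zc r by (simp add: z2_def nat_pow_pow o'_def[symmetric] mult.commute)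
  have "\<not> o' dvd r" using r op p1 by (intro nat_dvd_not_less) auto
  hence z21: "z2 \<noteq> \<one>" unfolding z2_def using pow_eq_id[OF zc, of r] by (simp add: o'_def)
  have zx2: "x [^] r \<otimes> y = z2 \<otimes> (y \<otimes> x [^] r)" unfolding z2_def by (rule powl[OF xc y(1) z zx])
  have z2: "cen z2" unfolding z2_def by (rule cenp[OF z])
  obtain s m where sm: "card (carrier G) = p ^ s * m" "\<not> p dvd m"
  proof -
    have "card (carrier G) \<noteq> 0" "\<not> p dvd 1" using odd p1 by (auto dest: odd_pos)
    from multiplicity_decompose'[OF this] that show ?thesis by blast
  qed
  have tor: "(a [^] m) [^] (p ^ s) = \<one>" if "a \<in> carrier G" for a
    using pow_order_eq_1[OF that] that sm by (simp add: nat_pow_pow Coset.order_def mult.commute)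
  have shift: "\<exists>z'. cen z' \<and> z' \<noteq> \<one> \<and> z' [^] p = \<one> \<and> u [^] m \<otimes> v = z' \<otimes> (v \<otimes> u [^] m)"
    if "u \<in> carrier G" "v \<in> carrier G" "cen z" "u \<otimes> v = z \<otimes> (v \<otimes> u)" "z [^] p = \<one>" "z \<noteq> \<one>" for u v z
  proof (intro exI conjI)
    have zc: "z \<in> carrier G" using that by (simp add: cen_def)
    show "cen (z [^] m)" by (rule cenp[OF that(3)])
    show "u [^] m \<otimes> v = z [^] m \<otimes> (v \<otimes> u [^] m)" by (rule powl[OF that(1-4)])
    have "(z [^] m) [^] p = (z [^] p) [^] m" using zc by (simp add: nat_pow_pow mult.commute)
    thus "(z [^] m) [^] p = \<one>" using that by simp
    have "ord z dvd p" using pow_eq_id[OF zc, of p] that(5) by simp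
    hence "ord z = p" using p(1) ord_eq_1[OF zc] that(6) by (auto simp: prime_nat_iff)
    thus "z [^] m \<noteq> \<one>" using pow_eq_id[OF zc, of m] sm(2) by simp
  qed
  have "\<exists>x y z. Q p s s x y z"
  proof -
    obtain z3 where z3: "cen z3" "z3 \<noteq> \<one>" "z3 [^] p = \<one>" "(x [^] r) [^] m \<otimes> y = z3 \<otimes> (y \<otimes> (x [^] r) [^] m)"
      using shift[OF nat_pow_closed[OF xc] y(1) z2 zx2 z2p z21] by blast
    let ?x = "(x [^] r) [^] m"
    have xc': "?x \<in> carrier G" using xc by simp
    have c3: "z3 \<in> carrier G" using z3 by (simp add: cen_def)
    note sw = swap[OF xc' y(1) z3(1,4)]
    have "inv z3 [^] p = \<one>" "inv z3 \<noteq> \<one>" using z3 c3 by (auto simp: nat_pow_inv)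
    then obtain z4 where z4: "cen z4" "z4 \<noteq> \<one>" "z4 [^] p = \<one>" "y [^] m \<otimes> ?x = z4 \<otimes> (?x \<otimes> y [^] m)"
      using shift[OF y(1) xc' conjunct1[OF sw] conjunct2[OF sw]] by blast
    have "Q p s s (y [^] m) ?x z4" unfolding Q_def
      using z4 nat_pow_closed[OF y(1), of m] xc' tor[OF y(1)] tor[OF nat_pow_closed[OF xc], of r] by blast
    thus ?thesis by blast
  qed
  hence ex: "\<exists>a b x y z. a + b = s + s \<and> Q p a b x y z" by blast
  define n where "n = (LEAST n. \<exists>a b x y z. a + b = n \<and> Q p a b x y z)"
  have "\<exists>a b x y z. a + b = n \<and> Q p a b x y z" unfolding n_def by (rule LeastI_ex) (use ex in blast)
  then obtain a0 b0 x1 y1 z1 where q0: "a0 + b0 = n" "Q p a0 b0 x1 y1 z1" by blast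
  have nmin: "\<not> Q p a b x y z" if "a + b < n" for a b x y z
    using that not_less_Least[of "a + b" "\<lambda>n. \<exists>a b x y z. a + b = n \<and> Q p a b x y z"] unfolding n_def by blast
  obtain a b x y z where q: "a + b = n" "Q p a b x y z" "b \<le> a"
  proof (cases "b0 \<le> a0")
    case True thus ?thesis using that q0 by blast
  next
    case False thus ?thesis using that[of b0 a0] Qswap[OF q0(2)] q0(1) by (simp add: add.commute)
  qed
  have x: "x \<in> carrier G" and y: "y \<in> carrier G" and z: "cen z" and xy: "x \<otimes> y = z \<otimes> (y \<otimes> x)" and zn: "z \<noteq> \<one>"
    and zp: "z [^] p = \<one>" and xa: "x [^] (p ^ a) = \<one>" and yb: "y [^] (p ^ b) = \<one>" using q(2) by (auto simp: Q_def)
  have zc: "z \<in> carrier G" using z by (simp add: cen_def)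
  have "y \<noteq> \<one>" using xy x zc zn by (intro notI) (simp add: r_cancel_one')
  hence b0: "b \<noteq> 0" using yb y by (intro notI) simp
  hence a0: "a \<noteq> 0" using q(3) by simp
  obtain a' b' where ab': "a = Suc a'" "b = Suc b'" using a0 b0 by (cases a; cases b) auto
  let ?u = "x [^] (p ^ a')" and ?v = "y [^] (p ^ b')"
  have uc: "?u \<in> carrier G" "?v \<in> carrier G" using x y by auto
  have u1: "?u \<noteq> \<one>" using nmin[of a' b x y z] q ab' by (auto simp: Q_def)
  have up: "?u [^] p = \<one>" "?v [^] p = \<one>" using xa yb x y by (simp_all add: ab' nat_pow_pow mult.commute)
  \<comment> \<open>\<open>z\<close> commutes with \<open>?u\<close> and \<open>?v\<close>, and all
    three have order dividing \<open>p\<close>; uniqueness makes \<open>z\<close> a power of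
    \<open>?u\<close>, and \<open>?v\<close> a power of \<open>z\<close>.\<close>
  obtain i1 :: nat where i1: "z = ?u [^] i1" using uniq[OF p(1) uc(1) zc up(1) zp u1] z[unfolded cen_def] uc by auto
  obtain i2 :: nat where i2: "?v = z [^] i2" using uniq[OF p(1) zc uc(2) zp up(2) zn] z[unfolded cen_def] uc by blast
  have b2: "b' \<noteq> 0"
  proof
    assume "b' = 0"
    hence "y = z [^] i2" using i2 y by simp
    hence "cen y" using cenp[OF z] by simp
    hence "x \<otimes> y = y \<otimes> x" using x y by (simp add: cen_def)
    hence "y \<otimes> x = z \<otimes> (y \<otimes> x)" using xy by simp
    thus False using zn zc x y r_cancel_one'[of "y \<otimes> x" z] by blast
  qed
  \<comment> \<open>Chosen so that \<open>x [^] t\<close> and \<open>y\<close> have the same power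
    with exponent \<open>p ^ b'\<close>; this is where \<open>b \<le> a\<close> enters.\<close>
  define t where "t = i1 * i2 * p ^ (a - b)"
  have xt: "x [^] (t * p ^ b') = ?v"
  proof -
    have "p ^ (a - b) * p ^ b' = p ^ a'" using q(3) ab' by (simp add: power_add[symmetric])
    hence "t * p ^ b' = p ^ a' * i1 * i2" unfolding t_def by (simp add: ac_simps)
    thus ?thesis using i1 i2 x by (simp add: nat_pow_pow)
  qed
  define xx where "xx = inv (x [^] t)"
  have xxc: "xx \<in> carrier G" using x by (simp add: xx_def)
  have yx: "y \<otimes> xx = z [^] t \<otimes> (xx \<otimes> y)"
  proof -
    have e: "x [^] t \<otimes> y = z [^] t \<otimes> (y \<otimes> x [^] t)" by (rule powl[OF x y z xy])
    have c: "z [^] t \<otimes> xx = xx \<otimes> z [^] t" using cenp[OF z, of t] xxc by (simp add: cen_def)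
    have "z [^] t \<otimes> (xx \<otimes> y) = xx \<otimes> (z [^] t \<otimes> (y \<otimes> x [^] t)) \<otimes> xx"
      unfolding m_assoc[OF nat_pow_closed[OF zc] xxc y, symmetric] c using x y zc by (simp add: xx_def m_assoc)
    also have "\<dots> = y \<otimes> xx" unfolding e[symmetric] using x y by (simp add: xx_def grp_simps)
    finally show ?thesis by simp
  qed
  define y' where "y' = xx \<otimes> y"
  have y'c: "y' \<in> carrier G" using xxc y by (simp add: y'_def)
  let ?M = "p ^ b'"
  have "y' [^] ?M = (z [^] t) [^] (?M * (?M - 1) div 2) \<otimes> (xx [^] ?M \<otimes> y [^] ?M)"
    unfolding y'_def by (rule pow_mult_central[OF xxc y _ yx]) (use zc cenp[OF z, of t] xxc y in \<open>auto simp: cen_def\<close>)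
  also have "xx [^] ?M = inv ?v" using xt x by (simp add: xx_def nat_pow_inv nat_pow_pow)
  \<comment> \<open>As \<open>p\<close> is odd and \<open>b' > 0\<close>, the binomial exponent is a
    multiple of \<open>p\<close>, so the correction is a power of \<open>z [^] p\<close>.\<close>
  also have "(z [^] t) [^] (?M * (?M - 1) div 2) = \<one>"
  proof -
    have "odd ?M" using podd by simp
    then obtain h where h: "?M = 2 * h + 1" by (rule oddE)
    hence "?M * (?M - 1) div 2 = ?M * h" by simp
    moreover obtain g where "?M = p * g" using b2 by (metis dvdE dvd_power gr0I)
    ultimately have "t * (?M * (?M - 1) div 2) = p * (g * h * t)" by simp
    hence "(z [^] t) [^] (?M * (?M - 1) div 2) = (z [^] p) [^] (g * h * t)" using zc by (simp only: nat_pow_pow)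
    thus ?thesis using zp by simp
  qed
  finally have y'M: "y' [^] ?M = \<one>" using uc by simp
  have "x \<otimes> y' = z \<otimes> (y' \<otimes> x)"
  proof -
    have c: "x \<otimes> xx = xx \<otimes> x"
    proof -
      have "x \<otimes> x [^] t = x [^] t \<otimes> x" using x by (simp add: nat_pow_Suc2[symmetric])
      hence "xx \<otimes> (x \<otimes> x [^] t) \<otimes> xx = xx \<otimes> (x [^] t \<otimes> x) \<otimes> xx" by simp
      thus ?thesis using x by (simp add: xx_def grp_simps)
    qed
    have cz: "xx \<otimes> z = z \<otimes> xx" using z xxc by (simp add: cen_def)
    have "x \<otimes> y' = xx \<otimes> (x \<otimes> y)" unfolding y'_def using c x y xxc by (metis m_assoc)
    also have "\<dots> = (xx \<otimes> z) \<otimes> (y \<otimes> x)" unfolding xy using x y xxc zc by (simp add: m_assoc)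
    also have "\<dots> = z \<otimes> (y' \<otimes> x)" unfolding cz y'_def using x y xxc zc by (simp add: m_assoc)
    finally show ?thesis .
  qed
  hence "Q p a b' x y' z" unfolding Q_def using x y'c z zn zp xa y'M by simp
  thus False using nmin[of a b' x y' z] q(1) ab' by simp
qed

end

section \<open>Burnside relations and the action of the complement by automorphisms\<close>

context frobenius_group
begin

text \<open>The argument of \<open>prod_conj_L\<close> for the cyclic group of \<open>h\<close>:
  applying \<open>h\<close> shifts the factors cyclically, so the product is fixed by
  \<open>h\<close> and trivial in the section.\<close>

lemma prod_conj_cyclic:
  assumes N: "N \<lhd> G" "N \<subseteq> K" and D: "D \<lhd> G" "D \<subseteq> N" and sec: "abelian_section G N D"
    and psi: "\<psi> \<in> lin G N D" and h: "h \<in> L" "h \<noteq> \<one>" "h [^] (p::nat) = \<one>" and v: "v \<in> N"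
  shows "(\<Prod>j<p. \<psi> (gconj G (h [^] j) v)) = 1"
proof -
  have Ns: "subgroup N G" using N by (simp add: normal_imp_subgroup)
  have Nc: "y \<in> carrier G" if "y \<in> N" for y using that Ns by (simp add: subgroup.mem_carrier)
  have hc: "h \<in> carrier G" using h by simp
  have vc: "v \<in> carrier G" using v Nc by simp
  have clos: "gconj G g y \<in> N" if "g \<in> carrier G" "y \<in> N" for g y using that N normal_gconj by simp
  have Fc: "gconj G (h [^] j) v \<in> N" for j :: nat using hc v clos by simp
  obtain s where s: "s \<in> N" and sp: "\<And>\<psi>. \<psi> \<in> lin G N D \<Longrightarrow> \<psi> s = (\<Prod>j<p. \<psi> (gconj G (h [^] j) v))"
    using finprod_lin[OF Ns finite_lessThan[of p], of "\<lambda>j. gconj G (h [^] j) v"] Fc by blast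
  have fixd: "\<phi> (gconj G h s) = \<phi> s" if phi: "\<phi> \<in> lin G N D" for \<phi>
  proof -
    let ?f = "\<lambda>j::nat. \<phi> (gconj G (h [^] j) v)"
    have tw: "twist G N h \<phi> \<in> lin G N D"
      by (rule lin_twist[OF N(1) phi hc]) (use D normal_gconj[OF D(1) hc] in auto)
    have "\<phi> (gconj G h s) = twist G N h \<phi> s" using s by (simp add: twist_def)
    also have "\<dots> = (\<Prod>j<p. \<phi> (gconj G h (gconj G (h [^] j) v)))"
      using sp[OF tw] Fc by (simp add: twist_def)
    also have "\<dots> = (\<Prod>j<p. ?f (Suc j))"
      using hc vc by (intro prod.cong refl) (simp add: gconj_gconj nat_pow_Suc2[symmetric])
    finally have e: "\<phi> (gconj G h s) = (\<Prod>j<p. ?f (Suc j))" .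
    have "?f 0 * (\<Prod>j<p. ?f (Suc j)) = (\<Prod>j<p. ?f j) * ?f p"
      using prod.lessThan_Suc_shift[of ?f p] prod.lessThan_Suc[of ?f p] by simp
    also have "?f p = ?f 0" using h by simp
    finally have "(\<Prod>j<p. ?f (Suc j)) = (\<Prod>j<p. ?f j)" using lin_nonzero[OF phi Fc[of 0]] by simp
    thus ?thesis using e sp[OF phi] by simp
  qed
  have c: "gconj G h s \<in> N" using clos s hc by simp
  have "inv s \<otimes> gconj G h s \<in> D"
  proof (rule lin_section_mult[OF finG sec])
    show "inv s \<otimes> gconj G h s \<in> N" using c s Ns by (simp add: subgroup.m_closed subgroup.m_inv_closed)
    fix \<phi> assume phi: "\<phi> \<in> lin G N D"
    show "\<phi> (inv s \<otimes> gconj G h s) = 1"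
      using lin_mult[OF phi _ c, of "inv s"] lin_inv[OF Ns phi s] fixd[OF phi] lin_nonzero[OF phi s] Ns s
      by (simp add: subgroup.m_inv_closed)
  qed
  hence "s \<in> D" by (rule fpf_section[OF Ns N(2) D h(1,2) s c])
  thus ?thesis using sp[OF psi] lin_trivial_on[OF psi] by simp
qed

text \<open>Burnside's argument against subgroups of type \<open>(p, p)\<close>: multiply the relations of
  \<open>prod_conj_cyclic\<close> for the \<open>p\<close> subgroups generated by the \<open>w z\<^sup>i\<close>.\<close>
lemma commuting_prime_order:
  assumes N: "N \<lhd> G" "N \<subseteq> K" and D: "D \<lhd> G" "D \<subseteq> N" and sec: "abelian_section G N D"
    and psi: "\<psi> \<in> lin G N D" and v: "v \<in> N" and p: "Factorial_Ring.prime (p::nat)"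
    and z: "z \<in> L" "z \<noteq> \<one>" "z [^] p = \<one>" and w: "w \<in> L" "w [^] p = \<one>" and zw: "z \<otimes> w = w \<otimes> z"
    and indep: "\<And>j::nat. w \<noteq> z [^] j"
  shows "\<psi> v ^ p = 1"
proof -
  have zc: "z \<in> carrier G" and wc: "w \<in> carrier G" using z w by auto
  have vc: "v \<in> carrier G" using v N(2) by auto
  have Lpow: "x [^] (i::nat) \<in> L" if "x \<in> L" for x i using subgroup_nat_pow[OF L_sub that] .
  have cp: "z [^] i \<otimes> w [^] j = w [^] j \<otimes> z [^] i" for i j :: nat
  proof -
    have "w \<otimes> z [^] i = z [^] i \<otimes> w" using group_commutes_pow[OF zw zc wc] by simp
    from group_commutes_pow[OF this wc] show ?thesis using zc by simp
  qed
  have ordz: "ord z = p"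
  proof -
    have "ord z dvd p" using pow_eq_id[OF zc, of p] z(3) by simp
    thus ?thesis using p ord_eq_1[OF zc] z(2) by (auto simp: prime_nat_iff)
  qed
  have pw: "(w \<otimes> z [^] i) [^] j = w [^] j \<otimes> z [^] (i * j)" for i j :: nat
  proof -
    have "w \<otimes> z [^] i = z [^] i \<otimes> w" using cp[of i 1] wc by simp
    from pow_mult_distrib[OF this wc nat_pow_closed[OF zc]] show ?thesis using zc by (simp add: nat_pow_pow)
  qed
  let ?F = "\<lambda>i j::nat. \<psi> (gconj G ((w \<otimes> z [^] (i::nat)) [^] j) v)"
  \<comment> \<open>A row is the relation for the element \<open>w \<otimes> z [^] i\<close>, which
    is nontrivial because \<open>w\<close> is no power of \<open>z\<close>.\<close>
  have row: "(\<Prod>j<p. ?F i j) = 1" if "i < p" for i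
  proof (rule prod_conj_cyclic[OF N D sec psi _ _ _ v])
    show "w \<otimes> z [^] i \<in> L" using Lpow z w L_sub by (simp add: subgroup.m_closed)
    have "(w \<otimes> z [^] i) [^] p = w [^] p \<otimes> (z [^] p) [^] i" using pw zc by (simp add: nat_pow_pow mult.commute)
    thus "(w \<otimes> z [^] i) [^] p = \<one>" using z w by simp
    show "w \<otimes> z [^] i \<noteq> \<one>"
    proof
      assume a: "w \<otimes> z [^] i = \<one>"
      have "w = w \<otimes> z [^] (i + (p - i))" using that z wc by simp
      also have "\<dots> = (w \<otimes> z [^] i) \<otimes> z [^] (p - i)"
        unfolding nat_pow_mult[OF zc, symmetric] using wc zc by (simp add: m_assoc)
      also have "\<dots> = z [^] (p - i)" unfolding a using zc by simp
      finally show False using indep by blast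
    qed
  qed
  \<comment> \<open>For \<open>j \<noteq> 0\<close> the column is the relation for
    \<open>z [^] j\<close> at a conjugate of \<open>v\<close>. So only column 0 remains, and it
    equals \<open>\<psi> v ^ p\<close>.\<close>
  have col: "(\<Prod>i<p. ?F i j) = 1" if j: "0 < j" "j < p" for j
  proof -
    have u: "gconj G (w [^] j) v \<in> N" using normal_gconj[OF N(1)] wc v by simp
    have "(\<Prod>i<p. ?F i j) = (\<Prod>i<p. \<psi> (gconj G ((z [^] j) [^] i) (gconj G (w [^] j) v)))"
      using zc wc vc cp by (intro prod.cong refl) (simp add: pw gconj_gconj nat_pow_pow mult.commute)
    also have "\<dots> = 1"
    proof (rule prod_conj_cyclic[OF N D sec psi _ _ _ u])
      show "z [^] j \<in> L" using Lpow z by simp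
      show "z [^] j \<noteq> \<one>" using pow_eq_id[OF zc, of j] ordz j by (auto dest: dvd_imp_le)
      have "(z [^] j) [^] p = (z [^] p) [^] j" using zc by (simp add: nat_pow_pow mult.commute)
      thus "(z [^] j) [^] p = \<one>" using z by simp
    qed
    finally show ?thesis .
  qed
  obtain p' where p': "p = Suc p'" using prime_gt_0_nat[OF p] by (cases p) auto
  have "1 = (\<Prod>i<p. \<Prod>j<p. ?F i j)" using row by simp
  also have "\<dots> = (\<Prod>j<p. \<Prod>i<p. ?F i j)" by (rule prod.swap)
  also have "\<dots> = (\<Prod>j<Suc p'. \<Prod>i<p. ?F i j)" by (simp only: p')
  also have "\<dots> = (\<Prod>i<p. ?F i 0) * (\<Prod>j<p'. \<Prod>i<p. ?F i (Suc j))" by (rule prod.lessThan_Suc_shift)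
  also have "(\<Prod>j<p'. \<Prod>i<p. ?F i (Suc j)) = 1" by (intro prod.neutral ballI col) (simp_all add: p')
  also have "(\<Prod>i<p. ?F i 0) = \<psi> v ^ p" using vc by simp
  finally show ?thesis by simp
qed

lemma solvable_L:
  assumes "solvable G" shows "solvable (G\<lparr>carrier := L\<rparr>)"
proof (rule group_hom.inj_hom_imp_solvable)
  show "group_hom (G\<lparr>carrier := L\<rparr>) G id"
    using L_sub subgroup.subgroup_is_group[OF L_sub is_group]
    by (intro group_hom.intro group_hom_axioms.intro is_group) (auto simp: hom_def)
qed (use assms in auto)

text \<open>Restricted to \<open>K\<close> because members of \<open>AutoGroup\<close> are
  extensional functions.\<close>

definition actK :: "'a \<Rightarrow> 'a \<Rightarrow> 'a" where "actK l = restrict (gconj G l) K"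

lemma actK_auto:
  assumes l: "l \<in> L" shows "actK l \<in> auto (G\<lparr>carrier := K\<rparr>)"
proof -
  have "bij_betw (actK l) K K"
    by (rule bij_betwI[where g = "gconj G (inv l)"]) (use l in \<open>auto simp: actK_def gconj_gconj\<close>)
  thus ?thesis using l K_sub unfolding auto_def Bij_def hom_def
    by (auto simp: actK_def gconj_mult subgroup.m_closed)
qed

lemma actK_mult:
  assumes "l \<in> L" "m \<in> L" shows "actK (l \<otimes> m) = compose K (actK l) (actK m)"
  using assms by (auto simp: actK_def compose_def gconj_gconj fun_eq_iff)

lemma actK_group:
  assumes "solvable G"
  shows "subgroup (actK ` L) (AutoGroup (G\<lparr>carrier := K\<rparr>))"
    and "solvable ((AutoGroup (G\<lparr>carrier := K\<rparr>))\<lparr>carrier := actK ` L\<rparr>)"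
proof -
  let ?A = "AutoGroup (G\<lparr>carrier := K\<rparr>)"
  have gK: "group (G\<lparr>carrier := K\<rparr>)" and gL: "group (G\<lparr>carrier := L\<rparr>)"
    using subgroup.subgroup_is_group[OF _ is_group] K_sub L_sub by auto
  have gA: "group ?A" by (rule group.AutoGroup[OF gK])
  have hA: "actK \<in> hom (G\<lparr>carrier := L\<rparr>) ?A"
    using actK_auto actK_mult
    by (auto simp: hom_def AutoGroup_def BijGroup_def auto_def)
  have gh: "group_hom (G\<lparr>carrier := L\<rparr>) ?A actK" using gL gA hA by (simp add: group_hom_def group_hom_axioms_def)
  show sub: "subgroup (actK ` L) ?A" using group_hom.img_is_subgroup[OF gh] by simp
  have "actK \<in> hom (G\<lparr>carrier := L\<rparr>) (?A\<lparr>carrier := actK ` L\<rparr>)" using hA by (auto simp: hom_def)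
  hence gh2: "group_hom (G\<lparr>carrier := L\<rparr>) (?A\<lparr>carrier := actK ` L\<rparr>) actK"
    using gL subgroup.subgroup_is_group[OF sub gA] by (simp add: group_hom_def group_hom_axioms_def)
  show "solvable (?A\<lparr>carrier := actK ` L\<rparr>)"
    by (rule group_hom.surj_hom_imp_solvable[OF gh2 _ solvable_L[OF assms]]) simp
qed

end

section \<open>The lower central series and its last term\<close>

context group
begin

lemma lower_central_normal: "lower_central G i \<lhd> G"
proof (induction i)
  case 0
  show ?case using normal_invI[OF subgroup_self] by simp
next
  case (Suc i)
  have "generate G {x \<otimes> y \<otimes> inv x \<otimes> inv y |x y. x \<in> lower_central G i \<and> y \<in> carrier G} \<lhd> G"
  proof (rule normal_generateI)
    show "{x \<otimes> y \<otimes> inv x \<otimes> inv y |x y. x \<in> lower_central G i \<and> y \<in> carrier G} \<subseteq> carrier G"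
      using lower_central_subset[of i] by auto
    fix h g assume "h \<in> {x \<otimes> y \<otimes> inv x \<otimes> inv y |x y. x \<in> lower_central G i \<and> y \<in> carrier G}" and g: "g \<in> carrier G"
    then obtain x y where xy: "h = gcomm G x y" "x \<in> lower_central G i" "y \<in> carrier G" by (auto simp: gcomm_def)
    have "gconj G g x \<in> lower_central G i" unfolding gconj_def by (rule normal.inv_op_closed2[OF Suc g xy(2)])
    moreover have "g \<otimes> h \<otimes> inv g = gcomm G (gconj G g x) (gconj G g y)"
      using gconj_gcomm_distrib[OF g, of x y] xy lower_central_subset[of i] by (auto simp: gconj_def)
    ultimately show "g \<otimes> h \<otimes> inv g \<in> {x \<otimes> y \<otimes> inv x \<otimes> inv y |x y. x \<in> lower_central G i \<and> y \<in> carrier G}"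
      unfolding gcomm_def using gconj_closed[OF g xy(3)] by blast
  qed
  thus ?case by simp
qed

lemma lower_central_Suc_subset: "lower_central G (Suc i) \<subseteq> lower_central G i"
proof -
  have s: "subgroup (lower_central G i) G" using lower_central_normal by (rule normal_imp_subgroup)
  have "{x \<otimes> y \<otimes> inv x \<otimes> inv y |x y. x \<in> lower_central G i \<and> y \<in> carrier G} \<subseteq> lower_central G i"
  proof clarify
    fix x y assume x: "x \<in> lower_central G i" and y: "y \<in> carrier G"
    have xc: "x \<in> carrier G" using x lower_central_subset by auto
    have "y \<otimes> inv x \<otimes> inv y \<in> lower_central G i"
      by (rule normal.inv_op_closed2[OF lower_central_normal y subgroup.m_inv_closed[OF s x]])
    hence "x \<otimes> (y \<otimes> inv x \<otimes> inv y) \<in> lower_central G i" by (rule subgroup.m_closed[OF s x])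
    thus "x \<otimes> y \<otimes> inv x \<otimes> inv y \<in> lower_central G i" using xc y by (simp add: m_assoc)
  qed
  thus ?thesis using generate_subgroup_incl[OF _ s] by simp
qed

text \<open>The series decreases, so by finiteness a term of least order is contained in all
  others.\<close>

lemma nilpotent_residual_eq:
  assumes fin: "finite (carrier G)"
  shows "\<exists>c. nilpotent_residual G = lower_central G c"
proof -
  obtain c where c: "\<And>i. card (lower_central G c) \<le> card (lower_central G i)"
    using ex_has_least_nat[of "\<lambda>_. True" 0 "\<lambda>i. card (lower_central G i)"] by blast
  have anti: "lower_central G j \<subseteq> lower_central G i" if "i \<le> j" for i j
    using lift_Suc_antimono_le[of "lower_central G", OF lower_central_Suc_subset that] .
  have "lower_central G c \<subseteq> lower_central G i" for i
  proof (cases "i \<le> c")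
    case True thus ?thesis by (rule anti)
  next
    case False
    have "lower_central G i = lower_central G c"
      by (rule card_seteq) (use False c[of i] anti[of c i] finite_subset[OF lower_central_subset fin] in auto)
    thus ?thesis by simp
  qed
  thus ?thesis unfolding nilpotent_residual_def by blast
qed

text \<open>Used for \<open>H = L\<close>: if \<open>K\<close> is a term of the series of
  \<open>G\<close>, the corresponding term for \<open>L\<close> lies in \<open>K \<inter> L\<close>,
  which makes \<open>L\<close> nilpotent.\<close>

lemma lower_central_subgroup:
  assumes H: "subgroup H G"
  shows "lower_central (G\<lparr>carrier := H\<rparr>) i \<subseteq> lower_central G i \<inter> H"
proof (induction i)
  case 0 show ?case using subgroup.subset[OF H] by simp
next
  case (Suc i)
  let ?S = "{x \<otimes> y \<otimes> inv x \<otimes> inv y |x y. x \<in> lower_central (G\<lparr>carrier := H\<rparr>) i \<and> y \<in> H}"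
  have SH: "?S \<subseteq> H" using Suc H by (auto simp: subgroup.m_closed subgroup.m_inv_closed)
  have "{x \<otimes>\<^bsub>G\<lparr>carrier := H\<rparr>\<^esub> y \<otimes>\<^bsub>G\<lparr>carrier := H\<rparr>\<^esub> inv\<^bsub>G\<lparr>carrier := H\<rparr>\<^esub> x \<otimes>\<^bsub>G\<lparr>carrier := H\<rparr>\<^esub> inv\<^bsub>G\<lparr>carrier := H\<rparr>\<^esub> y
      |x y. x \<in> lower_central (G\<lparr>carrier := H\<rparr>) i \<and> y \<in> carrier (G\<lparr>carrier := H\<rparr>)} = ?S"
    using Suc m_inv_consistent[OF H] by (intro Collect_cong ex_cong1) auto
  hence "lower_central (G\<lparr>carrier := H\<rparr>) (Suc i) = generate (G\<lparr>carrier := H\<rparr>) ?S" by simp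
  also have "\<dots> = generate G ?S" by (rule generate_consistent[OF SH H])
  finally have e: "lower_central (G\<lparr>carrier := H\<rparr>) (Suc i) = generate G ?S" .
  have "?S \<subseteq> {x \<otimes> y \<otimes> inv x \<otimes> inv y |x y. x \<in> lower_central G i \<and> y \<in> carrier G}"
    using Suc subgroup.subset[OF H] by blast
  hence "generate G ?S \<subseteq> lower_central G (Suc i)" using mono_generate by simp
  moreover have "generate G ?S \<subseteq> H" by (rule generate_subgroup_incl[OF SH H])
  ultimately show ?case unfolding e by simp
qed

end

section \<open>Cyclicity of the complement and the Suzuki structure of the kernel\<close>

context frobenius_GC_nonabelian
begin

lemma card_L_odd: "odd (card L)"
proof -
  have "even (card L + 1)" unfolding card_L using rank_ge by simp
  thus ?thesis by simp
qed

text \<open>Otherwise \<open>commuting_prime_order\<close> gives every character of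
  \<open>K2/K3\<close> order dividing \<open>p\<close>, while squares of \<open>K2\<close> lie in
  \<open>K3\<close>. As \<open>L\<close> has odd order, \<open>p\<close> is odd, so all these
  characters would be trivial.\<close>

lemma L_unique_prime_order:
  assumes p: "Factorial_Ring.prime (p::nat)" and z: "z \<in> L" "z [^] p = \<one>" "z \<noteq> \<one>" and w: "w \<in> L" "w [^] p = \<one>"
    and zw: "z \<otimes> w = w \<otimes> z"
  shows "\<exists>j::nat. w = z [^] j"
proof (rule ccontr)
  assume c: "\<not> ?thesis"
  have zc: "z \<in> carrier G" using z by simp
  have gL: "group (G\<lparr>carrier := L\<rparr>)" by (rule subgroup.subgroup_is_group[OF L_sub is_group])
  have "z [^] card L = \<one>"
    using group.pow_order_eq_1[OF gL, of z] z(1) by (simp add: Coset.order_def nat_pow_consistent[symmetric])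
  hence "ord z dvd card L" using pow_eq_id[OF zc] by simp
  moreover have "ord z = p"
  proof -
    have "ord z dvd p" using pow_eq_id[OF zc, of p] z(2) by simp
    thus ?thesis using p ord_eq_1[OF zc] z(3) by (auto simp: prime_nat_iff)
  qed
  ultimately have po: "odd p" using card_L_odd by auto
  have K32: "K3 \<subseteq> K2" using K3_psubset by blast
  have "v \<in> K3" if v: "v \<in> K2" for v
  proof (rule lin_section_mult[OF finG sec_K2 v])
    fix \<psi> assume psi: "\<psi> \<in> lin G K2 K3"
    have 1: "\<psi> v ^ p = 1"
      by (rule commuting_prime_order[OF K2_normal K2_K K3_normal K32 sec_K2 psi v p z(1,3,2) w zw]) (use c in blast)
    have 2: "\<psi> v ^ 2 = 1" using lin_pow[OF K2_sub psi v, of 2] lin_trivial_on[OF psi square_K2[OF v]] by simp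
    from po obtain k where "p = 2 * k + 1" by (rule oddE)
    thus "\<psi> v = 1" using 1 2 by (simp add: power_mult)
  qed
  thus False using K3_psubset by blast
qed

lemma L_cyclic:
  assumes res: "nilpotent_residual G = K"
  shows "cyclic_group (G\<lparr>carrier := L\<rparr>)"
proof -
  interpret L: group "G\<lparr>carrier := L\<rparr>" by (rule subgroup.subgroup_is_group[OF L_sub is_group])
  have fin: "finite (carrier (G\<lparr>carrier := L\<rparr>))" using finite_sub[OF L_sub] by simp
  have uniq: "\<exists>j::nat. y = x [^]\<^bsub>G\<lparr>carrier := L\<rparr>\<^esub> j"
    if "Factorial_Ring.prime (p::nat)" "x \<in> carrier (G\<lparr>carrier := L\<rparr>)" "y \<in> carrier (G\<lparr>carrier := L\<rparr>)"
      "x [^]\<^bsub>G\<lparr>carrier := L\<rparr>\<^esub> p = \<one>\<^bsub>G\<lparr>carrier := L\<rparr>\<^esub>" "y [^]\<^bsub>G\<lparr>carrier := L\<rparr>\<^esub> p = \<one>\<^bsub>G\<lparr>carrier := L\<rparr>\<^esub>"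
      "x \<noteq> \<one>\<^bsub>G\<lparr>carrier := L\<rparr>\<^esub>" "x \<otimes>\<^bsub>G\<lparr>carrier := L\<rparr>\<^esub> y = y \<otimes>\<^bsub>G\<lparr>carrier := L\<rparr>\<^esub> x" for p x y
    using L_unique_prime_order[of p x y] that by (simp add: nat_pow_consistent[symmetric])
  obtain c where c: "K = lower_central G c" using nilpotent_residual_eq[OF finG] res by auto
  have nil: "lower_central (G\<lparr>carrier := L\<rparr>) c = {\<one>\<^bsub>G\<lparr>carrier := L\<rparr>\<^esub>}"
    using lower_central_subgroup[OF L_sub, of c] KL_trivial c
      subgroup.one_closed[OF normal_imp_subgroup[OF L.lower_central_normal[of c]]] by auto
  have odd: "odd (card (carrier (G\<lparr>carrier := L\<rparr>)))" using card_L_odd by simp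
  note comm = L.nilpotent_odd_commutative[OF fin odd nil uniq]
  show ?thesis by (rule L.cyclic_of_root_bound[OF fin]) (rule L.card_roots_le[OF fin comm uniq])
qed

lemma card_K2': "card K2 = 2 ^ rank"
  using card_K2 K3_trivial q_eq_2 by simp

text \<open>Squares of elements of \<open>K2\<close> lie in \<open>K3 = {\<one>}\<close>, and
  elements outside \<open>K2\<close> have squares outside \<open>K3\<close>.\<close>

lemma involutions_K: "involutions (G\<lparr>carrier := K\<rparr>) = K2 - {\<one>}"
proof -
  have "x \<otimes> x = \<one> \<longleftrightarrow> x \<in> K2" if x: "x \<in> K" for x
  proof -
    have sq: "x [^] (2::nat) = x \<otimes> x" using x by (simp add: numeral_2_eq_2)
    show ?thesis
      using square_K2[of x] power_notin_K3[OF x] unfolding K3_trivial q_eq_2 sq by auto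
  qed
  thus ?thesis by (auto simp: involutions_def)
qed

text \<open>The solvable transitive group is \<open>L\<close> acting by conjugation:
  \<open>card L + 1 = card K2\<close> leaves a single orbit on the nontrivial elements of
  \<open>K2\<close>, which are the involutions.\<close>

lemma suzuki_K: "suzuki_2_group (G\<lparr>carrier := K\<rparr>)"
proof -
  have gK: "group (G\<lparr>carrier := K\<rparr>)" by (rule subgroup.subgroup_is_group[OF K_sub is_group])
  have "\<not> comm_group (G\<lparr>carrier := K\<rparr>)"
  proof
    assume c: "comm_group (G\<lparr>carrier := K\<rparr>)"
    have "gcomm G x y = \<one>" if "x \<in> K" "y \<in> K" for x y
    proof -
      have "x \<otimes> y = y \<otimes> x" using comm_monoid.m_comm[OF comm_group.axioms(1)[OF c], of x y] that by simp
      thus ?thesis using that gcomm_one_iff by simp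
    qed
    hence "{gcomm G k x |k x. k \<in> K \<and> x \<in> K} \<subseteq> {\<one>}" by blast
    hence "K2 \<subseteq> {\<one>}" unfolding derived_eq_commK commK_def by (rule generate_subgroup_incl[OF _ triv_subgroup])
    thus False using nonabelian subgroup.one_closed[OF K2_sub] by blast
  qed
  moreover have "card (involutions (G\<lparr>carrier := K\<rparr>)) > 1"
  proof -
    have "card (K2 - {\<one>}) = 2 ^ rank - 1"
      using subgroup.one_closed[OF K2_sub] card_K2' by (simp add: card_Diff_singleton)
    moreover have "(2::nat) ^ rank \<ge> 2 ^ 2" by (rule power_increasing[OF rank_ge]) simp
    ultimately show ?thesis unfolding involutions_K by simp
  qed
  moreover have "\<exists>k. card K = 2 ^ k" using K_q_group unfolding q_eq_2 .
  moreover have "\<exists>a\<in>actK ` L. a x = y" if x: "x \<in> K2 - {\<one>}" and y: "y \<in> K2 - {\<one>}" for x y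
  proof -
    have c: "(card L + 1) * card K3 = card K2" using card_L card_K2' K3_trivial by simp
    have "\<exists>l\<in>L. \<exists>d\<in>K3. y = gconj G l x \<otimes> d"
      using L_orbit_surj[OF K2_normal K2_K K3_normal _ _ _ c] K3_psubset x y K3_trivial by blast
    then obtain l where "l \<in> L" "y = gconj G l x" using K3_trivial x K2_K by auto
    thus ?thesis using x K2_K by (intro bexI[of _ "actK l"]) (auto simp: actK_def)
  qed
  ultimately show ?thesis unfolding suzuki_2_group_def involutions_K
    using gK finite_sub[OF K_sub] actK_group[OF solv] by (intro conjI exI[of _ "actK ` L"]) auto
qed

end

text \<open>If \<open>k\<close> commutes with \<open>l\<close>, then \<open>l\<close> lies in the
  conjugate of \<open>L\<close> by \<open>k\<close>. For \<open>k\<close> outside \<open>L\<close>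
  this forces \<open>l = \<one>\<close>, and a \<open>k\<close> in \<open>L\<close> is trivial
  because the kernel meets \<open>L\<close> only in the identity.\<close>

lemma frobenius_group_of_complement:
  assumes G: "group G" and fin: "finite (carrier G)" and fc: "frobenius_complement G L"
    and K: "K = frobenius_kernel G L" and KL: "carrier G = K <#>\<^bsub>G\<^esub> L" and N: "K \<lhd> G"
  shows "frobenius_group G K L"
proof -
  interpret group G by (rule G)
  have L: "subgroup L G" "L \<noteq> {\<one>\<^bsub>G\<^esub>}" "L \<noteq> carrier G"
    and tri: "\<And>g. g \<in> carrier G - L \<Longrightarrow> L \<inter> conjugate_set G g L = {\<one>\<^bsub>G\<^esub>}"
    using fc unfolding frobenius_complement_def by auto
  have Lc: "l \<in> carrier G" if "l \<in> L" for l using that L(1) by (rule subgroup.mem_carrier[rotated])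
  have Kc: "k \<in> carrier G" if "k \<in> K" for k using that normal_imp_subgroup[OF N] by (rule subgroup.mem_carrier[rotated])
  have L1: "l \<in> conjugate_set G \<one>\<^bsub>G\<^esub> L" if "l \<in> L" for l
    using that Lc unfolding conjugate_set_def by force
  have int: "k = \<one>\<^bsub>G\<^esub>" if "k \<in> K" "k \<in> L" for k
    using that L1[of k] one_closed unfolding K frobenius_kernel_def by blast
  show ?thesis
  proof (intro frobenius_group.intro frobenius_group_axioms.intro)
    show "group G" "finite (carrier G)" "K \<lhd> G" "subgroup L G" "carrier G = K <#>\<^bsub>G\<^esub> L" "L \<noteq> {\<one>\<^bsub>G\<^esub>}" by fact+
    show "K \<inter> L = {\<one>\<^bsub>G\<^esub>}"
      using int subgroup.one_closed[OF L(1)] subgroup.one_closed[OF normal_imp_subgroup[OF N]] by blast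
    show "k = \<one>\<^bsub>G\<^esub> \<or> l = \<one>\<^bsub>G\<^esub>" if k: "k \<in> K" and l: "l \<in> L" and kl: "k \<otimes>\<^bsub>G\<^esub> l = l \<otimes>\<^bsub>G\<^esub> k" for k l
    proof (cases "k \<in> L")
      case True thus ?thesis using int k by blast
    next
      case False
      have "l = k \<otimes>\<^bsub>G\<^esub> l \<otimes>\<^bsub>G\<^esub> inv\<^bsub>G\<^esub> k" unfolding kl using Kc[OF k] Lc[OF l] by (simp add: m_assoc)
      hence "l \<in> conjugate_set G k L" unfolding conjugate_set_def using l by blast
      thus ?thesis using tri[of k] False Kc[OF k] l by blast
    qed
    show "K \<noteq> {\<one>\<^bsub>G\<^esub>}"
    proof
      assume "K = {\<one>\<^bsub>G\<^esub>}"
      hence "carrier G = L" using KL Lc by (force simp: set_mult_def)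
      thus False using L(3) by simp
    qed
  qed
qed

theorem theorem3p6:
  fixes G :: "('a, 'b) monoid_scheme" and K L :: "'a set"
  assumes "group G" and "finite (carrier G)" and "solvable G"
    and "frobenius_complement G L"
    and "K = frobenius_kernel G L"
    and "carrier G = K <#>\<^bsub>G\<^esub> L"
    and "K = nilpotent_residual G"
    and "GC_star G"
  shows "(\<exists>q. elementary_abelian (G\<lparr>carrier := K\<rparr>) q) \<or>
         (suzuki_2_group (G\<lparr>carrier := K\<rparr>) \<and> card K = card (derived G K) ^ 2 \<and>
          cyclic_group (G\<lparr>carrier := L\<rparr>) \<and> card L = card (derived G K) - 1)"
proof -
  interpret group G by (rule assms(1))
  have "K \<lhd> G" using nilpotent_residual_eq[OF assms(2)] lower_central_normal assms(7) by auto
  then interpret frobenius_group G K L by (rule frobenius_group_of_complement[OF assms(1,2,4-6)])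
  interpret frobenius_GC G K L by unfold_locales (rule assms(8), rule assms(3))
  obtain q :: nat where q: "Factorial_Ring.prime q" "\<forall>x\<in>K. x [^]\<^bsub>G\<^esub> q \<in> derived G K" using exponent_prime by blast
  interpret frobenius_GC_prime G K L q by unfold_locales (use q in auto)
  show ?thesis
  proof (cases "derived G K = {\<one>\<^bsub>G\<^esub>}")
    case True
    have gK: "group (G\<lparr>carrier := K\<rparr>)" by (rule subgroup.subgroup_is_group[OF K_sub assms(1)])
    have "x \<otimes>\<^bsub>G\<^esub> y = y \<otimes>\<^bsub>G\<^esub> x" if "x \<in> K" "y \<in> K" for x y
      using gcomm_K2[OF that] True that by (simp add: gcomm_one_iff)
    hence "comm_group (G\<lparr>carrier := K\<rparr>)" by (intro group.group_comm_groupI[OF gK]) simp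
    moreover have "x [^]\<^bsub>G\<lparr>carrier := K\<rparr>\<^esub> q = \<one>\<^bsub>G\<^esub>" if "x \<in> K" for x
      using q(2) that True by (simp add: nat_pow_consistent[symmetric])
    ultimately have "elementary_abelian (G\<lparr>carrier := K\<rparr>) q"
      unfolding elementary_abelian_def using q(1) K_q_group finite_sub[OF K_sub] by simp
    thus ?thesis by blast
  next
    case False
    interpret frobenius_GC_nonabelian G K L q by unfold_locales (rule False)
    have "card K = card K2 ^ 2" using card_K card_K2' q_eq_2 by (simp add: power2_eq_square)
    moreover have "card L = card K2 - 1" using card_L card_K2' by simp
    ultimately show ?thesis using suzuki_K L_cyclic assms(7) by simp
  qed
qed

end
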